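(* Let $\lambda\in\mathfrak h^*$ with $\lambda(c_1)=k_1>0$ and $\lambda(c_2)=0$ be such that $\lambda(\alpha_i^\vee)$ $(i=0,1)$ are nonnegative integers. Then $W(\lambda)\cong L(\lambda)$ as $\mathfrak T$-modules.
   Context: All over $\mathbb C$. $\mathfrak{sl}_2$ has standard basis $e,f,\alpha^\vee$ with $[e,f]=\alpha^\vee$, $[\alpha^\vee,e]=2e$, $[\alpha^\vee,f]=-2f$ and invariant form with $(e|f)=1$, $(\alpha^\vee|\alpha^\vee)=2$. The toroidal Lie algebra is $\mathfrak T=\mathfrak{sl}_2\otimes\mathbb C[t_1^{\pm1},t_2^{\pm1}]\oplus\mathbb Cc_1\oplus\mathbb Cc_2\oplus\mathbb Cd_1\oplus\mathbb Cd_2$. Writing $x(m,n)=x\otimes t_1^mt_2^n$, the brackets are $[x(r_1,r_2),y(s_1,s_2)]=[x,y](r_1+s_1,r_2+s_2)+(x|y)\delta_{r_1,-s_1}\delta_{r_2,-s_2}(r_1c_1+r_2c_2)$, $c_1,c_2$ central, $[d_i,x(r_1,r_2)]=r_i\,x(r_1,r_2)$, $[d_1,d_2]=0$. Cartan subalgebra: $\mathfrak h=\mathbb C\alpha^\vee\oplus\mathbb Cc_1\oplus\mathbb Cc_2\oplus\mathbb Cd_1\oplus\mathbb Cd_2$ ($\alpha^\vee=\alpha^\vee(0,0)$). Coroots: $\alpha_1^\vee=\alpha^\vee$, $\alpha_0^\vee=c_1-\alpha^\vee$. Triangular decomposition $\mathfrak T=\mathfrak T_+\oplus\mathfrak h\oplus\mathfrak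 T_-$: $\mathfrak T_+$ is spanned by $e(m,0)$ $(m\ge 0)$, $f(m,0)$ and $\alpha^\vee(m,0)$ $(m\ge1)$, and all $x(m,n)$ with $x\in\mathfrak{sl}_2$, $m\in\mathbb Z$, $n\ge1$; $\mathfrak T_-$ is spanned by $f(-m,0)$ $(m\ge0)$, $e(-m,0)$ and $\alpha^\vee(-m,0)$ $(m\ge1)$, and all $x(m,-n)$ with $x\in\mathfrak{sl}_2$, $m\in\mathbb Z$, $n\ge1$. Verma module: $M(\lambda)=U(\mathfrak T)\otimes_{U(\mathfrak T_+\oplus\mathfrak h)}\mathbb C1_\lambda$, where $\mathfrak T_+$ acts by $0$ on $1_\lambda$ and $h\in\mathfrak h$ acts by $\lambda(h)$; $v_\lambda=1\otimes1_\lambda$. $L(\lambda)$ is the unique irreducible quotient of $M(\lambda)$. For $\lambda(\alpha_i^\vee)=n_i$ nonnegative integers, $W(\lambda)=M(\lambda)/\sum_{i=0}^1U(\mathfrak T_-)y_i^{n_i+1}v_\lambda$ with $y_1=f(0,0)$, $y_0=e(-1,0)$ (the subspace divided out is a submodule). *)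

theory Defs
  imports Complex_Main "HOL-Algebra.Algebra" "HOL-Algebra.Algebraic_Closure_Type"
begin

section \<open>The toroidal Lie algebra\<close>

text \<open>Complex vector spaces with a chosen basis of type \<open>'k\<close> are modelled as \<open>'k \<Rightarrow>\<^sub>0 complex\<close>.\<close>

definition scl :: "complex \<Rightarrow> ('k \<Rightarrow>\<^sub>0 complex) \<Rightarrow> ('k \<Rightarrow>\<^sub>0 complex)"
  where "scl c x = Poly_Mapping.map ((*) c) x"

lemma lookup_scl [simp]: "Poly_Mapping.lookup (scl c x) k = c * Poly_Mapping.lookup x k"
  by (simp add: scl_def Poly_Mapping.map.rep_eq when_def)

global_interpretation pm: vector_space scl
  by unfold_locales (auto intro!: poly_mapping_eqI simp: lookup_add algebra_simps)

datatype sl2_basis = BE | BF | BH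

type_synonym sl2 = "sl2_basis \<Rightarrow>\<^sub>0 complex"

abbreviation bas :: "'k \<Rightarrow> ('k \<Rightarrow>\<^sub>0 complex)"
  where "bas b \<equiv> Poly_Mapping.single b 1"

fun sl2_basis_bracket :: "sl2_basis \<Rightarrow> sl2_basis \<Rightarrow> sl2" where
  "sl2_basis_bracket BE BF = bas BH"
| "sl2_basis_bracket BF BE = - bas BH"
| "sl2_basis_bracket BH BE = scl 2 (bas BE)"
| "sl2_basis_bracket BE BH = - scl 2 (bas BE)"
| "sl2_basis_bracket BH BF = - scl 2 (bas BF)"
| "sl2_basis_bracket BF BH = scl 2 (bas BF)"
| "sl2_basis_bracket BE BE = 0"
| "sl2_basis_bracket BF BF = 0"
| "sl2_basis_bracket BH BH = 0"

fun sl2_basis_form :: "sl2_basis \<Rightarrow> sl2_basis \<Rightarrow> complex" where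
  "sl2_basis_form BE BF = 1"
| "sl2_basis_form BF BE = 1"
| "sl2_basis_form BH BH = 2"
| "sl2_basis_form BE BE = 0"
| "sl2_basis_form BE BH = 0"
| "sl2_basis_form BF BF = 0"
| "sl2_basis_form BF BH = 0"
| "sl2_basis_form BH BE = 0"
| "sl2_basis_form BH BF = 0"

text \<open>\<open>Loop b m n\<close> is the basis vector \<open>b \<otimes> t\<^sub>1\<^sup>m t\<^sub>2\<^sup>n\<close>.\<close>

datatype toroidal_basis = Loop sl2_basis int int | C1 | C2 | D1 | D2

type_synonym toroidal = "toroidal_basis \<Rightarrow>\<^sub>0 complex"

text \<open>\<open>loop x m n\<close> is \<open>x(m,n)\<close> for an arbitrary \<open>x\<close> in \<open>sl\<^sub>2\<close>.\<close>

definition loop :: "sl2 \<Rightarrow> int \<Rightarrow> int \<Rightarrow> toroidal" where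
  "loop x m n = (\<Sum>b\<in>Poly_Mapping.keys x. scl (Poly_Mapping.lookup x b) (bas (Loop b m n)))"

fun toroidal_basis_bracket :: "toroidal_basis \<Rightarrow> toroidal_basis \<Rightarrow> toroidal" where
  "toroidal_basis_bracket (Loop a r1 r2) (Loop b s1 s2) =
     loop (sl2_basis_bracket a b) (r1 + s1) (r2 + s2) +
     (if r1 = - s1 \<and> r2 = - s2
      then scl (sl2_basis_form a b) (scl (of_int r1) (bas C1) + scl (of_int r2) (bas C2)) else 0)"
| "toroidal_basis_bracket D1 (Loop b s1 s2) = scl (of_int s1) (bas (Loop b s1 s2))"
| "toroidal_basis_bracket D2 (Loop b s1 s2) = scl (of_int s2) (bas (Loop b s1 s2))"
| "toroidal_basis_bracket (Loop b s1 s2) D1 = - scl (of_int s1) (bas (Loop b s1 s2))"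
| "toroidal_basis_bracket (Loop b s1 s2) D2 = - scl (of_int s2) (bas (Loop b s1 s2))"
| "toroidal_basis_bracket _ _ = 0"

definition toroidal_bracket :: "toroidal \<Rightarrow> toroidal \<Rightarrow> toroidal" where
  "toroidal_bracket x y =
     (\<Sum>a\<in>Poly_Mapping.keys x. \<Sum>b\<in>Poly_Mapping.keys y.
        scl (Poly_Mapping.lookup x a * Poly_Mapping.lookup y b) (toroidal_basis_bracket a b))"

abbreviation e_loop :: "int \<Rightarrow> int \<Rightarrow> toroidal" where "e_loop m n \<equiv> loop (bas BE) m n"
abbreviation f_loop :: "int \<Rightarrow> int \<Rightarrow> toroidal" where "f_loop m n \<equiv> loop (bas BF) m n"
abbreviation h_loop :: "int \<Rightarrow> int \<Rightarrow> toroidal" where "h_loop m n \<equiv> loop (bas BH) m n"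

definition cartan :: "toroidal set" where
  "cartan = pm.span {h_loop 0 0, bas C1, bas C2, bas D1, bas D2}"

definition coroot1 :: toroidal where "coroot1 = h_loop 0 0"
definition coroot0 :: toroidal where "coroot0 = bas C1 - h_loop 0 0"

definition toroidal_pos :: "toroidal set" where
  "toroidal_pos = pm.span
     ({e_loop m 0 | m. m \<ge> 0} \<union> {f_loop m 0 | m. m \<ge> 1} \<union> {h_loop m 0 | m. m \<ge> 1}
      \<union> {loop x m n | x m n. n \<ge> 1})"

definition toroidal_neg :: "toroidal set" where
  "toroidal_neg = pm.span
     ({f_loop (- m) 0 | m. m \<ge> 0} \<union> {e_loop (- m) 0 | m. m \<ge> 1} \<union> {h_loop (- m) 0 | m. m \<ge> 1}
      \<union> {loop x m (- n) | x m n. n \<ge> 1})"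

definition borel :: "toroidal set" where
  "borel = {p + h | p h. p \<in> toroidal_pos \<and> h \<in> cartan}"

text \<open>Membership of \<open>\<lambda>\<close> in the dual of the Cartan subalgebra; the values of \<open>\<lambda>\<close> outside of the
  Cartan subalgebra are never used.\<close>

definition cartan_functional :: "(toroidal \<Rightarrow> complex) \<Rightarrow> bool" where
  "cartan_functional lam \<longleftrightarrow>
     (\<forall>x\<in>cartan. \<forall>y\<in>cartan. lam (x + y) = lam x + lam y) \<and>
     (\<forall>c. \<forall>x\<in>cartan. lam (scl c x) = c * lam x)"


section \<open>Universal enveloping algebras\<close>

text \<open>Words form the free monoid, written additively because the convolution product of
  \<^typ>\<open>'k \<Rightarrow>\<^sub>0 complex\<close> is based on the addition of \<^typ>\<open>'k\<close>. Hence
  \<open>'a word \<Rightarrow>\<^sub>0 complex\<close> is the free associative unital algebra on \<open>'a\<close>.\<close>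

datatype 'a word = Word (letters: "'a list")

instantiation word :: (type) monoid_add
begin

definition zero_word :: "'a word" where "zero_word = Word []"

definition plus_word :: "'a word \<Rightarrow> 'a word \<Rightarrow> 'a word"
  where "plus_word v w = Word (letters v @ letters w)"

instance
  by standard (auto simp: zero_word_def plus_word_def)

end

type_synonym free_alg = "toroidal word \<Rightarrow>\<^sub>0 complex"

definition gen :: "toroidal \<Rightarrow> free_alg" where "gen x = bas (Word [x])"

text \<open>The free algebra on the underlying set of a Lie subalgebra \<open>g\<close>. The tensor algebra of \<open>g\<close> is its
  quotient by the relations of linearity, which are imposed together with those of the bracket.\<close>

definition free_algebra :: "toroidal set \<Rightarrow> free_alg ring" where
  "free_algebra g =
     ring_of_type_algebra \<lparr>carrier := {p. \<forall>w\<in>Poly_Mapping.keys p. set (letters w) \<subseteq> g}\<rparr>"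

definition env_relations :: "toroidal set \<Rightarrow> free_alg set" where
  "env_relations g =
     {gen (x + y) - (gen x + gen y) | x y. x \<in> g \<and> y \<in> g} \<union>
     {gen (scl c x) - scl c (gen x) | c x. x \<in> g} \<union>
     {gen x * gen y - gen y * gen x - gen (toroidal_bracket x y) | x y. x \<in> g \<and> y \<in> g}"

definition env_ideal :: "toroidal set \<Rightarrow> free_alg set" where
  "env_ideal g = Idl\<^bsub>free_algebra g\<^esub> (env_relations g)"

definition env :: "toroidal set \<Rightarrow> free_alg set ring" where
  "env g = free_algebra g Quot env_ideal g"

text \<open>A module over the toroidal Lie algebra is a left module over its enveloping algebra \<open>UT\<close>.\<close>

abbreviation UT :: "free_alg set ring" where "UT \<equiv> env UNIV"

definition env_of :: "toroidal \<Rightarrow> free_alg set" where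
  "env_of x = env_ideal UNIV +>\<^bsub>free_algebra UNIV\<^esub> gen x"

text \<open>The homomorphism from the enveloping algebra of a Lie subalgebra to \<open>UT\<close> induced by the
  inclusion; the union is over representatives, which all give the same coset.\<close>

definition env_incl :: "free_alg set \<Rightarrow> free_alg set" where
  "env_incl A = (\<Union>p\<in>A. env_ideal UNIV +>\<^bsub>free_algebra UNIV\<^esub> p)"


section \<open>Left modules over a not necessarily commutative ring\<close>

text \<open>In the record \<^typ>\<open>('a, 'b) module\<close> the fields \<open>mult\<close> and \<open>one\<close> are irrelevant for modules.
  The locale \<^locale>\<open>submodule\<close> does not presuppose a commutative ring.\<close>

definition quot_module :: "('a, 'b) module \<Rightarrow> 'b set \<Rightarrow> ('a, 'b set) module" where
  "quot_module M N =
     \<lparr>carrier = a_rcosets\<^bsub>M\<^esub> N, monoid.mult = (\<lambda>_ _. undefined), one = undefined,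
      ring.zero = N, add = set_add M,
      module.smult = (\<lambda>r A. \<Union>a\<in>A. N +>\<^bsub>M\<^esub> (r \<odot>\<^bsub>M\<^esub> a))\<rparr>"

definition irreducible_module :: "('a, 'c) ring_scheme \<Rightarrow> ('a, 'b) module \<Rightarrow> bool" where
  "irreducible_module R M \<longleftrightarrow>
     carrier M \<noteq> {\<zero>\<^bsub>M\<^esub>} \<and>
     (\<forall>N. submodule N R M \<longrightarrow> N = {\<zero>\<^bsub>M\<^esub>} \<or> N = carrier M)"

definition module_isomorphic ::
  "('a, 'c) ring_scheme \<Rightarrow> ('a, 'b) module \<Rightarrow> ('a, 'd) module \<Rightarrow> bool" where
  "module_isomorphic R M N \<longleftrightarrow>
     (\<exists>\<phi>. \<phi> \<in> iso (add_monoid M) (add_monoid N) \<and>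
        (\<forall>r\<in>carrier R. \<forall>x\<in>carrier M. \<phi> (r \<odot>\<^bsub>M\<^esub> x) = r \<odot>\<^bsub>N\<^esub> \<phi> x))"

text \<open>For a ring homomorphism \<open>j\<close> from \<open>R\<close> to \<open>S\<close> and a left \<open>R\<close>-module \<open>N\<close>, the left \<open>S\<close>-module
  \<open>S \<otimes>\<^sub>R N\<close>, as a quotient of the free abelian group on \<open>S \<times> N\<close>.\<close>

definition tensor_relations ::
  "('r, 'x) ring_scheme \<Rightarrow> ('s, 'y) ring_scheme \<Rightarrow> ('r \<Rightarrow> 's) \<Rightarrow> ('r, 'n) module \<Rightarrow>
     ('s \<times> 'n \<Rightarrow>\<^sub>0 int) set" where
  "tensor_relations R S j N =
     {frag_of (s \<oplus>\<^bsub>S\<^esub> s', z) - (frag_of (s, z) + frag_of (s', z)) | s s' z.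
        s \<in> carrier S \<and> s' \<in> carrier S \<and> z \<in> carrier N} \<union>
     {frag_of (s, z \<oplus>\<^bsub>N\<^esub> z') - (frag_of (s, z) + frag_of (s, z')) | s z z'.
        s \<in> carrier S \<and> z \<in> carrier N \<and> z' \<in> carrier N} \<union>
     {frag_of (s \<otimes>\<^bsub>S\<^esub> j r, z) - frag_of (s, r \<odot>\<^bsub>N\<^esub> z) | s r z.
        s \<in> carrier S \<and> r \<in> carrier R \<and> z \<in> carrier N}"

definition tensor_subgroup ::
  "('r, 'x) ring_scheme \<Rightarrow> ('s, 'y) ring_scheme \<Rightarrow> ('r \<Rightarrow> 's) \<Rightarrow> ('r, 'n) module \<Rightarrow>
     ('s \<times> 'n \<Rightarrow>\<^sub>0 int) set" where
  "tensor_subgroup R S j N =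
     generate (free_Abelian_group (carrier S \<times> carrier N)) (tensor_relations R S j N)"

definition pure_tensor ::
  "('r, 'x) ring_scheme \<Rightarrow> ('s, 'y) ring_scheme \<Rightarrow> ('r \<Rightarrow> 's) \<Rightarrow> ('r, 'n) module \<Rightarrow>
     's \<Rightarrow> 'n \<Rightarrow> ('s \<times> 'n \<Rightarrow>\<^sub>0 int) set" where
  "pure_tensor R S j N s z =
     tensor_subgroup R S j N #>\<^bsub>free_Abelian_group (carrier S \<times> carrier N)\<^esub> frag_of (s, z)"

definition induced_module ::
  "('r, 'x) ring_scheme \<Rightarrow> ('s, 'y) ring_scheme \<Rightarrow> ('r \<Rightarrow> 's) \<Rightarrow> ('r, 'n) module \<Rightarrow>
     ('s, ('s \<times> 'n \<Rightarrow>\<^sub>0 int) set) module" where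
  "induced_module R S j N =
     (let G = free_Abelian_group (carrier S \<times> carrier N);
          K = tensor_subgroup R S j N
      in \<lparr>carrier = carrier (G Mod K), monoid.mult = (\<lambda>_ _. undefined), one = undefined,
          ring.zero = \<one>\<^bsub>G Mod K\<^esub>, add = (\<otimes>\<^bsub>G Mod K\<^esub>),
          module.smult = (\<lambda>s A. \<Union>p\<in>A. K #>\<^bsub>G\<^esub> frag_extend (\<lambda>(s', z). frag_of (s \<otimes>\<^bsub>S\<^esub> s', z)) p)\<rparr>)"


section \<open>Verma modules and their quotients\<close>

definition borel_character :: "(toroidal \<Rightarrow> complex) \<Rightarrow> toroidal \<Rightarrow> complex" where
  "borel_character lam x =
     (THE c. \<exists>p\<in>toroidal_pos. \<exists>h\<in>cartan. x = p + h \<and> c = lam h)"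

definition free_alg_eval :: "(toroidal \<Rightarrow> complex) \<Rightarrow> free_alg \<Rightarrow> complex" where
  "free_alg_eval \<chi> p =
     (\<Sum>w\<in>Poly_Mapping.keys p. Poly_Mapping.lookup p w * prod_list (map \<chi> (letters w)))"

text \<open>The module \<open>\<complex> 1\<^sub>\<lambda>\<close>: the evaluation is constant on each element of \<^term>\<open>env borel\<close>.\<close>

definition borel_module :: "(toroidal \<Rightarrow> complex) \<Rightarrow> (free_alg set, complex) module" where
  "borel_module lam =
     \<lparr>carrier = UNIV, monoid.mult = (*), one = 1, ring.zero = 0, add = (+),
      module.smult = (\<lambda>A z. the_elem (free_alg_eval (borel_character lam) ` A) * z)\<rparr>"

type_synonym verma_elem = "(free_alg set \<times> complex \<Rightarrow>\<^sub>0 int) set"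

definition verma :: "(toroidal \<Rightarrow> complex) \<Rightarrow> (free_alg set, verma_elem) module" where
  "verma lam = induced_module (env borel) UT env_incl (borel_module lam)"

definition verma_vec :: "(toroidal \<Rightarrow> complex) \<Rightarrow> verma_elem" where
  "verma_vec lam = pure_tensor (env borel) UT env_incl (borel_module lam) \<one>\<^bsub>UT\<^esub> 1"

text \<open>The submodule in question is the unique maximal one.\<close>

definition irreducible_quotient :: "(toroidal \<Rightarrow> complex) \<Rightarrow> (free_alg set, verma_elem set) module" where
  "irreducible_quotient lam =
     quot_module (verma lam)
       (THE N. submodule N UT (verma lam) \<and> irreducible_module UT (quot_module (verma lam) N))"

definition y1 :: toroidal where "y1 = f_loop 0 0"
definition y0 :: toroidal where "y0 = e_loop (- 1) 0"

definition label :: "(toroidal \<Rightarrow> complex) \<Rightarrow> toroidal \<Rightarrow> nat" where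
  "label lam x = (THE n. lam x = of_nat n)"

definition weyl_submodule :: "(toroidal \<Rightarrow> complex) \<Rightarrow> verma_elem set" where
  "weyl_submodule lam =
     {(env_incl a \<otimes>\<^bsub>UT\<^esub> env_of y0 [^]\<^bsub>UT\<^esub> (label lam coroot0 + 1)) \<odot>\<^bsub>verma lam\<^esub> verma_vec lam
        \<oplus>\<^bsub>verma lam\<^esub>
      (env_incl b \<otimes>\<^bsub>UT\<^esub> env_of y1 [^]\<^bsub>UT\<^esub> (label lam coroot1 + 1)) \<odot>\<^bsub>verma lam\<^esub> verma_vec lam
      | a b. a \<in> carrier (env toroidal_neg) \<and> b \<in> carrier (env toroidal_neg)}"

definition weyl_module :: "(toroidal \<Rightarrow> complex) \<Rightarrow> (free_alg set, verma_elem set) module" where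
  "weyl_module lam = quot_module (verma lam) (weyl_submodule lam)"

end

theory Submission imports Defs "HOL-Library.Countable" begin

text \<open>
  Modulo left ideals, \<open>M(\<lambda>)\<close> and \<open>W(\<lambda>)\<close> are quotients of \<open>U(T)\<close>, and irreducibility of \<open>W(\<lambda>) = U/K\<close>
  means that every \<open>p \<notin> K\<close> satisfies \<open>1 \<in> U p + K\<close>. Grade by the degree in \<open>t\<^sub>2\<close>. Write \<open>p\<close> as a sum of
  \<open>w v\<^sub>w\<close>, where the words \<open>w\<close> consist of letters of negative \<open>t\<^sub>2\<close>-degree and the \<open>v\<^sub>w\<close> lie in the top
  component \<open>V\<close>, and let \<open>x(-M, n)\<close> with \<open>n > 0\<close> and \<open>M\<close> large act on it. By the Poincare-Birkhoff-Witt theorem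
  the coefficient of a word that is shorter by one letter is, up to multiplicities,
  \<open>\<Sum> [x, y](s - M, 0) v\<close>. If all of these vanish, then applying \<open>b(M - s, 0)\<close> and comparing \<open>M\<close> with
  \<open>M + 1\<close> isolates \<open>k\<^sub>1 v\<close>, so that \<open>v = 0\<close> because \<open>k\<^sub>1 \<noteq> 0\<close>. Hence some \<open>x(-M, n) p\<close> is nonzero, and
  repeating this reaches \<open>V\<close>. There \<open>y\<^sub>0\<close> and \<open>y\<^sub>1\<close> act locally nilpotently, so the weight of a singular vector
  is dominant, and comparing the eigenvalues of the affine Casimir operator shows that it is \<open>\<lambda>\<close>.

  The Poincare-Birkhoff-Witt theorem is used in a functional form: a function on sorted words extends to all
  words compatibly with the straightening relation.
\<close>

section \<open>Straightening in enveloping algebras\<close>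

text \<open>The obstacle is that \<open>W(\<lambda>)\<close> has no visible basis: its top component
  is infinite-dimensional and given by generators and relations only, so coefficients of PBW
  monomials must make sense modulo \<open>K\<close> without a description of \<open>K\<close>. They
  do because \<open>K\<close> is generated, as a left ideal, by elements of nonnegative t2-degree.
  Over the subalgebra of nonnegative t2-degree, \<open>U\<close> is a free right module on the
  monomials in the letters of negative t2-degree. A coefficient map for this structure is right
  linear, so it sends \<open>u * g\<close>, with \<open>g\<close> a generator of \<open>K\<close>,
  to another left multiple of \<open>g\<close>, and therefore preserves \<open>K\<close>. This
  dictates the form of the straightening function: its values lie in an arbitrary vector space on
  which the letters outside a chosen set act from the right. With values in \<open>U\<close> it
  yields the coefficient maps; with complex values and the action through \<lambda> it shows that
  the Verma module is nonzero. The property \<open>1 \<in> U p + K\<close> also settles the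
  uniqueness of the maximal submodule, since a left ideal strictly above \<open>K\<close> must then
  be everything.\<close>

locale cspace = vector_space scale for scale :: "complex \<Rightarrow> 'v::ab_group_add \<Rightarrow> 'v"
begin

definition lin :: "('k \<Rightarrow> 'v) \<Rightarrow> ('k \<Rightarrow>\<^sub>0 complex) \<Rightarrow> 'v"
  where "lin f x = (\<Sum>b\<in>Poly_Mapping.keys x. scale (Poly_Mapping.lookup x b) (f b))"

lemma lin_superset:
  assumes "finite A" "Poly_Mapping.keys x \<subseteq> A"
  shows "lin f x = (\<Sum>b\<in>A. scale (Poly_Mapping.lookup x b) (f b))"
  unfolding lin_def using assms
  by (intro sum.mono_neutral_left) (auto simp: in_keys_iff)

lemma lin_zero [simp]: "lin f 0 = 0"
  by (simp add: lin_def)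

lemma lin_add: "lin f (x + y) = lin f x + lin f y"
proof -
  let ?A = "Poly_Mapping.keys x \<union> Poly_Mapping.keys y"
  have "Poly_Mapping.keys (x + y) \<subseteq> ?A" by (rule Poly_Mapping.keys_add)
  then show ?thesis
    by (simp add: lin_superset[where A = ?A] lookup_add scale_left_distrib sum.distrib)
qed

lemma lin_scl: "lin f (scl c x) = scale c (lin f x)"
proof -
  have "Poly_Mapping.keys (scl c x) \<subseteq> Poly_Mapping.keys x" by (auto simp: in_keys_iff)
  then show ?thesis
    by (simp add: lin_superset[where A = "Poly_Mapping.keys x"] scale_sum_right)
qed

lemma lin_uminus: "lin f (- x) = - lin f x"
  using lin_add[of f x "- x"] by (simp add: minus_unique)

lemma lin_diff: "lin f (x - y) = lin f x - lin f y"
  using lin_add[of f x "- y"] by (simp add: lin_uminus)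

lemma lin_bas [simp]: "lin f (bas b) = f b"
  by (simp add: lin_def)

lemma lin_sum: "lin f (sum g A) = (\<Sum>i\<in>A. lin f (g i))"
  by (induction A rule: infinite_finite_induct) (auto simp: lin_add)

lemma lin_fun_add: "lin (\<lambda>b. f b + g b) x = lin f x + lin g x"
  by (simp add: lin_def scale_right_distrib sum.distrib)

lemma lin_fun_zero [simp]: "lin (\<lambda>b. 0) x = 0"
  by (simp add: lin_def)

lemma lin_fun_scale: "lin (\<lambda>b. scale c (f b)) x = scale c (lin f x)"
  by (simp add: lin_def scale_sum_right mult.commute)

lemma lin_swap: "lin (\<lambda>a. lin (\<lambda>b. f a b) y) x = lin (\<lambda>b. lin (\<lambda>a. f a b) x) y"
  unfolding lin_def scale_sum_right by (subst sum.swap) (simp add: mult.commute)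

lemma lin_eq_0: "(\<And>b. b \<in> Poly_Mapping.keys x \<Longrightarrow> f b = 0) \<Longrightarrow> lin f x = 0"
  by (simp add: lin_def)

lemma lin_cong: "(\<And>b. b \<in> Poly_Mapping.keys x \<Longrightarrow> f b = g b) \<Longrightarrow> lin f x = lin g x"
  by (simp add: lin_def)

end

global_interpretation pm: cspace scl
  by unfold_locales

lemma pm_lin_bas: "pm.lin bas x = x"
  by (rule poly_mapping_eqI) (auto simp: pm.lin_def lookup_sum lookup_single when_def if_distrib sum.delta in_keys_iff cong: if_cong)

lemma (in cspace) lin_lin: "lin f (pm.lin g x) = lin (\<lambda>c. lin f (g c)) x"
  unfolding pm.lin_def[of g] lin_sum lin_scl by (simp add: lin_def)

lemma lin_induct [case_names zero add]:
  fixes x :: "'k \<Rightarrow>\<^sub>0 complex"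
  assumes "P 0" "\<And>x c b. P x \<Longrightarrow> P (x + scl c (bas b))"
  shows "P x"
proof -
  have "P (\<Sum>b\<in>A. scl (Poly_Mapping.lookup x b) (bas b))" if "finite A" for A
    using that
  proof induction
    case (insert b A)
    then show ?case
      using assms(2)[OF insert.IH, of "Poly_Mapping.lookup x b" b] by (simp add: add.commute)
  qed (simp add: assms)
  from this[of "Poly_Mapping.keys x"] show ?thesis
    using pm_lin_bas[of x] by (simp add: pm.lin_def)
qed

section \<open>Inversions and the leftmost descent of a word\<close>

fun inversions :: "int list \<Rightarrow> nat" where
  "inversions [] = 0"
| "inversions (x # xs) = length (filter (\<lambda>y. y < x) xs) + inversions xs"

lemma inversions_swap:
  "b < a \<Longrightarrow> inversions (u @ b # a # v) < inversions (u @ a # b # v)"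
  by (induction u) auto

text \<open>Sortedness of \<open>u @ [a]\<close> forces the descent to be the leftmost one, on which
  the case distinction in \<open>straighten_step\<close> depends. In the induction a descent of the
  tail stays leftmost only if the new head does not exceed the letters before it; otherwise the head
  itself starts a descent.\<close>

lemma first_descent:
  fixes xs :: "'a list" and key :: "'a \<Rightarrow> int"
  assumes "\<not> sorted (map key xs)"
  shows "\<exists>u a b v. xs = u @ a # b # v \<and> key b < key a \<and> sorted (map key (u @ [a]))"
  using assms
proof (induction xs)
  case (Cons x xs)
  show ?case
  proof (cases "sorted (map key xs)")
    case True
    with Cons.prems obtain b v where xs: "xs = b # v" by (cases xs) auto
    from True Cons.prems xs have "key b < key x" by auto
    with xs show ?thesis by (intro exI[of _ "[]"]) auto
  next
    case False
    then obtain u a b v where 1: "xs = u @ a # b # v" "key b < key a" "sorted (map key (u @ [a]))"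
      using Cons.IH by blast
    show ?thesis
    proof (cases "\<forall>z\<in>set (u @ [a]). key x \<le> key z")
      case True
      with 1 show ?thesis by (intro exI[of _ "x # u"]) auto
    next
      case F: False
      obtain y w where w: "xs = y # w" using 1 by (cases u) auto
      have "key y < key x"
      proof (cases u)
        case Nil
        with F w 1 show ?thesis by auto
      next
        case (Cons c cs)
        with F w 1 show ?thesis by (auto simp: not_le)
      qed
      with w show ?thesis by (intro exI[of _ "[]"]) auto
    qed
  qed
qed auto

text \<open>The conditions determine \<open>u\<close> as the prefix before the leftmost descent, so
  \<open>SOME\<close> has no freedom.\<close>

definition descent :: "('b \<Rightarrow> int) \<Rightarrow> 'b list \<Rightarrow> 'b list \<times> 'b \<times> 'b \<times> 'b list" where
  "descent key xs = (SOME (u, a, b, v). xs = u @ a # b # v \<and> key b < key a \<and> sorted (map key (u @ [a])))"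

lemma descent:
  assumes "\<not> sorted (map key xs)" "descent key xs = (u, a, b, v)"
  shows "xs = u @ a # b # v \<and> key b < key a \<and> sorted (map key (u @ [a]))"
proof -
  have "case descent key xs of (u, a, b, v) \<Rightarrow>
      xs = u @ a # b # v \<and> key b < key a \<and> sorted (map key (u @ [a]))"
    unfolding descent_def by (rule someI_ex) (use first_descent[OF assms(1)] in auto)
  with assms(2) show ?thesis by auto
qed

lemma descent_measure:
  assumes "\<not> sorted (map key w)" "descent key w = (u, a, b, v)"
  shows "w = u @ a # b # v \<and> inversions (map key (u @ b # a # v)) < inversions (map key w)"
  using descent[OF assms] inversions_swap[of "key b" "key a" "map key u" "map key v"] by auto

section \<open>Confluence of straightening for a Lie bracket on an ordered basis\<close>

locale lie_basis =
  fixes key :: "'b \<Rightarrow> int" and br :: "'b \<Rightarrow> 'b \<Rightarrow> ('b \<Rightarrow>\<^sub>0 complex)"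
  assumes key_inj: "inj key"
    and br_self: "br a a = 0"
    and br_anti: "br b a = - br a b"
    and jacobi: "pm.lin (\<lambda>d. br d c) (br a b) + pm.lin (\<lambda>d. br d a) (br b c)
                 + pm.lin (\<lambda>d. br d b) (br c a) = 0"

locale pbw = lie_basis key br + cspace scale
  for key :: "'b \<Rightarrow> int" and br and scale :: "complex \<Rightarrow> 'v::ab_group_add \<Rightarrow> 'v" +
  fixes \<psi> :: "'b list \<Rightarrow> 'v"
begin

text \<open>Rewriting with a fixed strategy: only the leftmost descent is resolved, and
  \<open>\<psi>\<close> is consulted on sorted words alone. The swapped word has the same length and
  fewer inversions, the words from the bracket are shorter. That every other exchange of neighbours
  is compatible with the value is the actual theorem, \<open>straighten_swap\<close>.\<close>

function straighten :: "'b list \<Rightarrow> 'v" where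
  "straighten w = (if sorted (map key w) then \<psi> w else
     (case descent key w of (u, a, b, v) \<Rightarrow>
        straighten (u @ b # a # v) + lin (\<lambda>c. straighten (u @ c # v)) (br a b)))"
  by auto
termination
  by (relation "measures [length, \<lambda>w. inversions (map key w)]") (auto dest!: descent_measure[OF _ sym])

declare straighten.simps [simp del]

lemma straighten_sorted: "sorted (map key w) \<Longrightarrow> straighten w = \<psi> w"
  by (simp add: straighten.simps)

text \<open>Induction hypothesis for confluence. It is not restricted to descending pairs, hence
  both the word and its swap have to lie below the bound \<open>k\<close>. Shorter words carry no
  such bound, because a bracket letter can stand anywhere in the order.\<close>

definition small :: "nat \<Rightarrow> nat \<Rightarrow> bool" where
  "small n k \<longleftrightarrow> (\<forall>u a b v. length (u @ a # b # v) < n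
     \<or> length (u @ a # b # v) = n \<and> inversions (map key (u @ a # b # v)) < k
       \<and> inversions (map key (u @ b # a # v)) < k \<longrightarrow>
     straighten (u @ a # b # v) = straighten (u @ b # a # v) + lin (\<lambda>c. straighten (u @ c # v)) (br a b))"

lemma smallD:
  assumes "small n k"
    and "length (u @ a # b # v) < n
     \<or> length (u @ a # b # v) = n \<and> inversions (map key (u @ a # b # v)) < k \<and> inversions (map key (u @ b # a # v)) < k"
  shows "straighten (u @ a # b # v) = straighten (u @ b # a # v) + lin (\<lambda>c. straighten (u @ c # v)) (br a b)"
  using assms unfolding small_def by blast

lemma straighten_descent:
  assumes "\<not> sorted (map key w)" "descent key w = (u, a, b, v)"
  shows "straighten w = straighten (u @ b # a # v) + lin (\<lambda>c. straighten (u @ c # v)) (br a b)"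
  using assms by (subst straighten.simps) auto

text \<open>The three cases of the confluence argument: the descent at hand and the leftmost one coincide,
  overlap (where the Jacobi identity enters) or are disjoint.\<close>

lemma straighten_step:
  assumes ih: "small (length (u @ a # b # v)) (inversions (map key (u @ a # b # v)))"
    and ba: "key b < key a"
  shows "straighten (u @ a # b # v)
         = straighten (u @ b # a # v) + lin (\<lambda>c. straighten (u @ c # v)) (br a b)"
proof -
  define w where "w = u @ a # b # v"
  have ns: "\<not> sorted (map key w)" using ba by (auto simp: w_def sorted_append)
  obtain u' a' b' v' where d: "descent key w = (u', a', b', v')" by (metis prod_cases4)
  from descent[OF ns d] have w': "w = u' @ a' # b' # v'" and ba': "key b' < key a'"
    and so: "sorted (map key (u' @ [a']))" by auto
  note st = straighten_descent[OF ns d]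
  \<comment> \<open>The prefix ending in \<open>b\<close> already contains a descent, so the
    leftmost descent cannot start to the right of \<open>u\<close>.\<close>
  have "\<not> sorted (map key (take (Suc (Suc (length u))) w))"
    using ba by (auto simp: w_def sorted_append)
  then have "\<not> length u < length u'"
  proof (rule contrapos_nn)
    assume l: "length u < length u'"
    have "take (Suc (length u')) w = u' @ [a']" by (simp add: w')
    then have "take (Suc (Suc (length u))) w = take (Suc (Suc (length u))) (u' @ [a'])"
      using l by (metis Suc_leI Suc_le_mono min.absorb1 take_take)
    then show "sorted (map key (take (Suc (Suc (length u))) w))"
      using so by (metis sorted_wrt_take take_map)
  qed
  then consider "length u = length u'" | "length u = Suc (length u')" | "length u > Suc (length u')"
    by linarith
  then show ?thesis
  proof cases
    case 1
    with w' have "u = u' \<and> a = a' \<and> b = b' \<and> v = v'" by (auto simp: w_def)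
    with st show ?thesis by (auto simp: w_def)
  next
    case 2
    have "u = u' @ [a'] \<and> b' = a \<and> v' = b # v"
    proof -
      have "u = take (Suc (length u')) w" using 2 by (simp add: w_def)
      then have "u = u' @ [a']" by (simp add: w')
      with w' show ?thesis by (auto simp: w_def)
    qed
    then have u: "u = u' @ [a']" and b': "b' = a" and v': "v' = b # v" by auto
    \<comment> \<open>Overlap \<open>x y z\<close> with decreasing keys. Starting with either pair
      leads to \<open>z y x\<close>; \<open>e0\<close> to \<open>e4\<close> record the steps of the
      two paths, whose bracket terms remain to be compared.\<close>
    let ?S = "\<lambda>xs. straighten (u' @ xs @ v)"
    let ?x = a' and ?y = a and ?z = b
    have xyz: "key ?z < key ?y" "key ?y < key ?x" "key ?z < key ?x" using ba ba' b' by auto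
    have len: "length (u @ a # b # v) = length u' + 3 + length v" by (simp add: u)
    have invw: "inversions (map key (u @ a # b # v)) = inversions (map key (u' @ [?x, ?y, ?z] @ v))"
      by (simp add: u)
    have i1: "inversions (map key (u' @ [?y, ?x, ?z] @ v)) < inversions (map key (u' @ [?x, ?y, ?z] @ v))"
      using inversions_swap[of "key ?y" "key ?x" "map key u'" "map key (?z # v)"] xyz by simp
    have i2: "inversions (map key (u' @ [?y, ?z, ?x] @ v)) < inversions (map key (u' @ [?y, ?x, ?z] @ v))"
      using inversions_swap[of "key ?z" "key ?x" "map key (u' @ [?y])" "map key v"] xyz by simp
    have i3: "inversions (map key (u' @ [?z, ?y, ?x] @ v)) < inversions (map key (u' @ [?y, ?z, ?x] @ v))"
      using inversions_swap[of "key ?z" "key ?y" "map key u'" "map key (?x # v)"] xyz by simp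
    have i4: "inversions (map key (u' @ [?x, ?z, ?y] @ v)) < inversions (map key (u' @ [?x, ?y, ?z] @ v))"
      using inversions_swap[of "key ?z" "key ?y" "map key (u' @ [?x])" "map key v"] xyz by simp
    have i5: "inversions (map key (u' @ [?z, ?x, ?y] @ v)) < inversions (map key (u' @ [?x, ?z, ?y] @ v))"
      using inversions_swap[of "key ?z" "key ?x" "map key u'" "map key (?y # v)"] xyz by simp
    have i6: "inversions (map key (u' @ [?z, ?y, ?x] @ v)) < inversions (map key (u' @ [?z, ?x, ?y] @ v))"
      using inversions_swap[of "key ?y" "key ?x" "map key (u' @ [?z])" "map key v"] xyz by simp
    have e0: "?S [?x, ?y, ?z] = ?S [?y, ?x, ?z] + lin (\<lambda>c. ?S [c, ?z]) (br ?x ?y)"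
      using st by (simp add: w' b' v')
    have e1: "?S [?y, ?x, ?z] = ?S [?y, ?z, ?x] + lin (\<lambda>c. ?S [?y, c]) (br ?x ?z)"
      using smallD[OF ih, of "u' @ [?y]" ?x ?z v] i1 i2 len invw by simp
    have e2: "?S [?y, ?z, ?x] = ?S [?z, ?y, ?x] + lin (\<lambda>c. ?S [c, ?x]) (br ?y ?z)"
      using smallD[OF ih, of u' ?y ?z "?x # v"] i1 i2 i3 len invw by simp
    have e3: "?S [?x, ?z, ?y] = ?S [?z, ?x, ?y] + lin (\<lambda>c. ?S [c, ?y]) (br ?x ?z)"
      using smallD[OF ih, of u' ?x ?z "?y # v"] i4 i5 len invw by simp
    have e4: "?S [?z, ?x, ?y] = ?S [?z, ?y, ?x] + lin (\<lambda>c. ?S [?z, c]) (br ?x ?y)"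
      using smallD[OF ih, of "u' @ [?z]" ?x ?y v] i4 i5 i6 len invw by simp
    have sw: "?S [c, d] = ?S [d, c] + lin (\<lambda>e. ?S [e]) (br c d)" for c d
      using smallD[OF ih, of u' c d v] len by simp
    \<comment> \<open>Moving a bracket letter across \<open>z\<close> costs a double bracket. The
      terms with one bracket then match on both paths, and what remains is the Jacobi expression
      \<open>jac\<close>.\<close>
    have f1: "lin (\<lambda>c. ?S [c, z]) q = lin (\<lambda>c. ?S [z, c]) q + lin (\<lambda>e. ?S [e]) (pm.lin (\<lambda>c. br c z) q)"
      for z q
      by (subst sw) (simp add: lin_fun_add lin_lin)
    have jac: "lin (\<lambda>e. ?S [e]) (pm.lin (\<lambda>c. br c ?z) (br ?x ?y))
        + lin (\<lambda>e. ?S [e]) (pm.lin (\<lambda>c. br c ?x) (br ?y ?z))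
        - lin (\<lambda>e. ?S [e]) (pm.lin (\<lambda>c. br c ?y) (br ?x ?z)) = 0"
    proof -
      have "pm.lin (\<lambda>c. br c ?y) (br ?x ?z) = - pm.lin (\<lambda>c. br c ?y) (br ?z ?x)"
        by (subst br_anti) (simp add: pm.lin_uminus)
      then show ?thesis using jacobi[of ?z ?x ?y] 
        by (simp add: lin_uminus lin_add[symmetric])
    qed
    have "?S [?x, ?y, ?z] = ?S [?x, ?z, ?y] + lin (\<lambda>c. ?S [?x, c]) (br ?y ?z)"
      unfolding e0 e1 e2 e3 e4 f1[of ?z] f1[of ?y] f1[of ?x]
      using jac by (simp add: algebra_simps)
    then show ?thesis by (simp add: u)
  next
    case 3
    have "\<exists>m. u = u' @ a' # b' # m \<and> v' = m @ a # b # v"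
    proof -
      have t: "take (Suc (Suc (length u'))) u = u' @ [a', b']"
      proof -
        have "take (Suc (Suc (length u'))) u = take (Suc (Suc (length u'))) w"
          using 3 by (simp add: w_def)
        then show ?thesis by (simp add: w')
      qed
      then have "u = u' @ [a', b'] @ drop (Suc (Suc (length u'))) u"
        by (metis append_assoc append_take_drop_id)
      moreover from this w' have "v' = drop (Suc (Suc (length u'))) u @ a # b # v"
        unfolding w_def by (metis append_assoc append_Cons append_Nil same_append_eq list.inject)
      ultimately show ?thesis by auto
    qed
    then obtain m where u: "u = u' @ a' # b' # m" and v': "v' = m @ a # b # v" by auto
    \<comment> \<open>Disjoint descents: the two reductions act at different places and agree after
      exchanging the two linear extensions by \<open>lin_swap\<close>.\<close>
    let ?S = "\<lambda>p q. straighten (u' @ p @ m @ q @ v)"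
    have len: "length (u @ a # b # v) = length u' + length m + 4 + length v" by (simp add: u)
    have invw: "inversions (map key (u @ a # b # v)) = inversions (map key (u' @ a' # b' # m @ a # b # v))"
      by (simp add: u)
    have i1: "inversions (map key (u' @ b' # a' # m @ a # b # v)) < inversions (map key (u' @ a' # b' # m @ a # b # v))"
      using inversions_swap[of "key b'" "key a'" "map key u'" "map key (m @ a # b # v)"] ba' by simp
    have i2: "inversions (map key (u' @ b' # a' # m @ b # a # v)) < inversions (map key (u' @ b' # a' # m @ a # b # v))"
      using inversions_swap[of "key b" "key a" "map key (u' @ b' # a' # m)" "map key v"] ba by simp
    have i3: "inversions (map key (u' @ a' # b' # m @ b # a # v)) < inversions (map key (u' @ a' # b' # m @ a # b # v))"
      using inversions_swap[of "key b" "key a" "map key (u' @ a' # b' # m)" "map key v"] ba by simp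
    have e0: "?S [a', b'] [a, b] = ?S [b', a'] [a, b] + lin (\<lambda>c. ?S [c] [a, b]) (br a' b')"
      using st by (simp add: w' v')
    have e1: "?S [b', a'] [a, b] = ?S [b', a'] [b, a] + lin (\<lambda>d. ?S [b', a'] [d]) (br a b)"
      using smallD[OF ih, of "u' @ b' # a' # m" a b v] i1 i2 len invw by simp
    have e2: "?S [c] [a, b] = ?S [c] [b, a] + lin (\<lambda>d. ?S [c] [d]) (br a b)" for c
      using smallD[OF ih, of "u' @ c # m" a b v] len by simp
    have e3: "?S [a', b'] [b, a] = ?S [b', a'] [b, a] + lin (\<lambda>c. ?S [c] [b, a]) (br a' b')"
      using smallD[OF ih, of u' a' b' "m @ b # a # v"] i1 i2 i3 len invw by simp
    have e4: "?S [a', b'] [d] = ?S [b', a'] [d] + lin (\<lambda>c. ?S [c] [d]) (br a' b')" for d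
      using smallD[OF ih, of u' a' b' "m @ d # v"] len by simp
    have "?S [a', b'] [a, b] = ?S [a', b'] [b, a] + lin (\<lambda>d. ?S [a', b'] [d]) (br a b)"
      unfolding e0 e1 e2 e3 e4 by (simp add: lin_fun_add algebra_simps lin_swap[of _ "br a b" "br a' b'"])
    then show ?thesis by (simp add: u)
  qed
qed

text \<open>The relation is antisymmetric in \<open>a\<close> and \<open>b\<close>: an ascending
  pair is the descending case read backwards, and an equal pair only needs
  \<open>br_self\<close>.\<close>

lemma straighten_swap:
  "straighten (u @ a # b # v) = straighten (u @ b # a # v) + lin (\<lambda>c. straighten (u @ c # v)) (br a b)"
proof -
  have "small n k" for n k
  proof (induction "(n, k)" arbitrary: n k rule: wf_induct_rule[OF wf_lex_prod[OF wf_less_than wf_less_than]])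
    case (1 n k)
    show ?case unfolding small_def
    proof (intro allI impI)
      fix u a b v
      assume as: "length (u @ a # b # v) < n
        \<or> length (u @ a # b # v) = n \<and> inversions (map key (u @ a # b # v)) < k
       \<and> inversions (map key (u @ b # a # v)) < k"
      have s1: "small (length (u @ a # b # v)) (inversions (map key (u @ a # b # v)))"
        using as 1 by auto
      have s2: "small (length (u @ b # a # v)) (inversions (map key (u @ b # a # v)))"
        using as 1 by auto
      consider "key b < key a" | "key a < key b" | "a = b" using key_inj by (meson injD linorder_neqE_linordered_idom)
      then show "straighten (u @ a # b # v)
          = straighten (u @ b # a # v) + lin (\<lambda>c. straighten (u @ c # v)) (br a b)"
      proof cases
        case 1 then show ?thesis using straighten_step[OF s1] by simp
      next
        case 2 then show ?thesis using straighten_step[OF s2] by (simp add: br_anti[of b a] lin_uminus)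
      next
        case 3 then show ?thesis by (simp add: br_self)
      qed
    qed
  qed
  \<comment> \<open>A length bound one above the word makes the first alternative of
    \<open>small\<close> apply, so the inversion bound can be 0.\<close>
  from smallD[OF this[of "Suc (length (u @ a # b # v))" 0], of u a b v] show ?thesis by simp
qed

end

text \<open>A model of linear maps out of the enveloping algebra that respect right multiplication.
  The letters outside \<open>N\<close> span a subalgebra, \<open>R\<close> is a right action of it
  (\<open>R_br\<close> is the law x a b = x b a + x [a,b]), and \<open>N_key\<close> makes every
  sorted word a word in \<open>N\<close> followed by a word outside \<open>N\<close>. The values
  \<open>\<psi>0\<close> on sorted words in \<open>N\<close> can be prescribed freely.\<close>

locale pbw_right = lie_basis key br + cspace scale
  for key :: "'b \<Rightarrow> int" and br and scale :: "complex \<Rightarrow> 'v::ab_group_add \<Rightarrow> 'v" +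
  fixes N :: "'b \<Rightarrow> bool" and R :: "'b \<Rightarrow> 'v \<Rightarrow> 'v" and \<psi>0 :: "'b list \<Rightarrow> 'v"
  assumes N_key: "N a \<Longrightarrow> \<not> N b \<Longrightarrow> key a < key b"
    and not_N_br: "\<not> N a \<Longrightarrow> \<not> N b \<Longrightarrow> c \<in> Poly_Mapping.keys (br a b) \<Longrightarrow> \<not> N c"
    and R_add: "\<not> N b \<Longrightarrow> R b (x + y) = R b x + R b y"
    and R_scale: "\<not> N b \<Longrightarrow> R b (scale r x) = scale r (R b x)"
    and R_br: "\<not> N a \<Longrightarrow> \<not> N b \<Longrightarrow> R b (R a x) = R a (R b x) + lin (\<lambda>c. R c x) (br a b)"
begin

definition \<psi> :: "'b list \<Rightarrow> 'v" where
  "\<psi> w = foldl (\<lambda>x b. R b x) (\<psi>0 (takeWhile N w)) (dropWhile N w)"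

sublocale pbw key br scale \<psi> ..

lemma R_zero: "\<not> N b \<Longrightarrow> R b 0 = 0"
  using R_add[of b 0 0] by simp

lemma R_sum: "\<not> N b \<Longrightarrow> R b (sum f A) = (\<Sum>i\<in>A. R b (f i))"
  by (induction A rule: infinite_finite_induct) (auto simp: R_zero R_add)

lemma R_lin: "\<not> N b \<Longrightarrow> R b (lin f x) = lin (\<lambda>c. R b (f c)) x"
  by (simp add: lin_def R_sum R_scale)

text \<open>A descent is resolved either inside \<open>w\<close>, where the induction hypothesis
  meets fewer inversions or fewer letters, or at the last position, where \<open>R_br\<close>
  mirrors the swap.\<close>

lemma straighten_right: "\<not> N b \<Longrightarrow> straighten (w @ [b]) = R b (straighten w)"
proof (induction "(length w, inversions (map key (w @ [b])))" arbitrary: w b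
       rule: wf_induct_rule[OF wf_lex_prod[OF wf_less_than wf_less_than]])
  case (1 w b)
  have IH: "straighten (w' @ [b']) = R b' (straighten w')"
    if "\<not> N b'" "length w' < length w \<or> length w' = length w \<and>
      inversions (map key (w' @ [b'])) < inversions (map key (w @ [b]))" for w' b'
    using 1(1)[of w' b'] that by auto
  show ?case
  proof (cases "sorted (map key w)")
    case False
    then obtain u x y v where w: "w = u @ x # y # v" and xy: "key y < key x"
      using first_descent by blast
    have i: "inversions (map key (u @ y # x # v @ [b])) < inversions (map key (u @ x # y # v @ [b]))"
      using inversions_swap[of "key y" "key x" "map key u" "map key (v @ [b])"] xy by simp
    have "straighten (w @ [b]) = straighten (u @ y # x # (v @ [b])) +
        lin (\<lambda>c. straighten (u @ c # (v @ [b]))) (br x y)"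
      unfolding w using straighten_swap[of u x y "v @ [b]"] by simp
    also have "straighten (u @ y # x # (v @ [b])) = R b (straighten (u @ y # x # v))"
      using IH[of b "u @ y # x # v"] 1(2) i w by simp
    also have "(\<lambda>c. straighten (u @ c # (v @ [b]))) = (\<lambda>c. R b (straighten (u @ c # v)))"
      using IH[of b "u @ _ # v"] 1(2) w by simp
    finally show ?thesis
      using straighten_swap[of u x y v] 1(2) by (simp add: w R_add R_lin)
  next
    case so: True
    show ?thesis
    proof (cases "sorted (map key (w @ [b]))")
      case True
      have "\<psi> (w @ [b]) = R b (\<psi> w)"
      proof (cases "\<forall>x\<in>set w. N x")
        case True
        then have t: "takeWhile N w = w" "dropWhile N w = []" by auto
        have "takeWhile N (w @ [b]) = w" "dropWhile N (w @ [b]) = [b]" using True 1(2) by auto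
        then show ?thesis unfolding \<psi>_def t by simp
      next
        case False
        then obtain x where "x \<in> set w" "\<not> N x" by auto
        then show ?thesis by (simp add: \<psi>_def)
      qed
      then show ?thesis using True so by (simp add: straighten_sorted)
    next
      case False
      then have "w \<noteq> []" by auto
      then obtain w' l where w: "w = w' @ [l]" by (cases w rule: rev_cases) auto
      have lb: "key b < key l"
      proof (rule ccontr)
        assume "\<not> key b < key l"
        with so have "\<forall>x\<in>set w. key x \<le> key b" by (force simp: w sorted_append)
        with so False show False by (simp add: sorted_append)
      qed
      \<comment> \<open>Letters in \<open>N\<close> have keys below all others, so a letter above
        \<open>b\<close> is outside \<open>N\<close> as well and acts through
        \<open>R\<close>.\<close>
      have nl: "\<not> N l" using N_key[of l b] 1(2) lb by auto
      have "inversions (map key (w' @ [b, l])) < inversions (map key (w' @ [l, b]))"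
        using inversions_swap[of "key b" "key l" "map key w'" "[]"] lb by simp
      then have "straighten (w' @ [b] @ [l]) = R l (straighten (w' @ [b]))"
        using IH[of l "w' @ [b]"] nl w by simp
      moreover have "straighten (w' @ [b]) = R b (straighten w')" "straighten (w' @ [l]) = R l (straighten w')"
        using IH[of _ w'] 1(2) nl w by auto
      moreover have "lin (\<lambda>c. straighten (w' @ [c])) (br l b) = lin (\<lambda>c. R c (straighten w')) (br l b)"
        using IH[of _ w'] not_N_br[OF nl 1(2)] w by (intro lin_cong) auto
      ultimately show ?thesis
        using straighten_swap[of w' l b "[]"] R_br[OF nl 1(2)] by (simp add: w)
    qed
  qed
qed

end

text \<open>On sorted words in \<open>N\<close> the prescribed value is nonzero at most at
  \<open>J\<close>. The resulting map reads off the coefficient of the monomial \<open>J\<close>;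
  this coefficient is an element of the right module, not a number. Here \<open>N\<close> spans a
  subalgebra too, graded by \<open>deg\<close>.\<close>

locale pbw_coeff = pbw_right key br scale N R "\<lambda>w. if w = J then v0 else 0"
  for key :: "'b \<Rightarrow> int" and br and scale :: "complex \<Rightarrow> 'v::ab_group_add \<Rightarrow> 'v" and N R J v0 +
  fixes deg :: "'b \<Rightarrow> int"
  assumes N_br: "N a \<Longrightarrow> N b \<Longrightarrow> c \<in> Poly_Mapping.keys (br a b) \<Longrightarrow> N c \<and> deg c = deg a + deg b"
    and J_N: "\<forall>a\<in>set J. N a" and J_sorted: "sorted (map key J)"
begin

text \<open>A common induction for the three statements below. Words in \<open>N\<close> stay in
  \<open>N\<close> under straightening, so the action \<open>R\<close> does not enter.\<close>

lemma straighten_N_induct: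
  assumes "\<forall>a\<in>set w. N a"
    and sorted: "\<And>w. \<forall>a\<in>set w. N a \<Longrightarrow> sorted (map key w) \<Longrightarrow> P w (if w = J then v0 else 0)"
    and step: "\<And>u a b v. \<forall>c\<in>set (u @ a # b # v). N c \<Longrightarrow>
       P (u @ b # a # v) (straighten (u @ b # a # v)) \<Longrightarrow>
       (\<And>c. c \<in> Poly_Mapping.keys (br a b) \<Longrightarrow> N c \<Longrightarrow> deg c = deg a + deg b \<Longrightarrow> P (u @ c # v) (straighten (u @ c # v))) \<Longrightarrow>
       P (u @ a # b # v) (straighten (u @ b # a # v) + lin (\<lambda>c. straighten (u @ c # v)) (br a b))"
  shows "P w (straighten w)"
  using assms(1)
proof (induction "(length w, inversions (map key w))" arbitrary: w
       rule: wf_induct_rule[OF wf_lex_prod[OF wf_less_than wf_less_than]])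
  case (1 w)
  show ?case
  proof (cases "sorted (map key w)")
    case True
    have t: "takeWhile N w = w" "dropWhile N w = []" using 1(2) by auto
    have "straighten w = (if w = J then v0 else 0)"
      unfolding straighten_sorted[OF True] \<psi>_def t by simp
    with sorted[OF 1(2) True] show ?thesis by simp
  next
    case False
    then obtain u x y v where w: "w = u @ x # y # v" and xy: "key y < key x"
      using first_descent by blast
    have i: "inversions (map key (u @ y # x # v)) < inversions (map key w)"
      using inversions_swap[of "key y" "key x" "map key u" "map key v"] xy w by simp
    have "P (u @ y # x # v) (straighten (u @ y # x # v))"
      using 1(1)[of "u @ y # x # v"] 1(2) i w by auto
    moreover have "P (u @ c # v) (straighten (u @ c # v))" if "N c" for c
      using 1(1)[of "u @ c # v"] 1(2) that w by auto
    ultimately have "P (u @ x # y # v) (straighten (u @ y # x # v) + lin (\<lambda>c. straighten (u @ c # v)) (br x y))"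
      using step[of u x y v] 1(2) w by auto
    then show ?thesis using straighten_swap[of u x y v] w by simp
  qed
qed

lemma straighten_short:
  assumes "\<forall>a\<in>set w. N a" "length w < length J"
  shows "straighten w = 0"
proof -
  have "length w < length J \<longrightarrow> straighten w = 0"
  proof (rule straighten_N_induct[OF assms(1), where P = "\<lambda>w x. length w < length J \<longrightarrow> x = 0"], goal_cases)
    case (2 u a b v)
    have "lin (\<lambda>c. straighten (u @ c # v)) (br a b) = 0" if "length (u @ a # b # v) < length J"
      using 2 that N_br[of a b] by (intro lin_eq_0) simp
    with 2 show ?case by simp
  qed auto
  with assms show ?thesis by simp
qed

text \<open>At the length of \<open>J\<close> the bracket terms are too short to contribute, so
  letters commute freely and the value depends on the multiset only; injectivity of
  \<open>key\<close> makes \<open>J\<close> the only sorted word with its multiset.\<close>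

lemma straighten_length_eq:
  assumes "\<forall>a\<in>set w. N a" "length w = length J"
  shows "straighten w = (if mset w = mset J then v0 else 0)"
proof -
  have "length w = length J \<longrightarrow> straighten w = (if mset w = mset J then v0 else 0)"
  proof (rule straighten_N_induct[OF assms(1), where P = "\<lambda>w x. length w = length J \<longrightarrow> x = (if mset w = mset J then v0 else 0)"],
      goal_cases)
    case (1 w)
    have "w = J" if "mset w = mset J"
    proof -
      have "mset (map key w) = mset (map key J)" using that by simp
      then have "map key w = map key J" using 1 J_sorted by (metis properties_for_sort sorted_sort_id)
      then show ?thesis using key_inj by (simp add: inj_map_eq_map)
    qed
    then show ?case by auto
  next
    case (2 u a b v)
    have "lin (\<lambda>c. straighten (u @ c # v)) (br a b) = 0" if "length (u @ a # b # v) = length J"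
    proof -
      have "lin (\<lambda>c. straighten (u @ c # v)) (br a b) = lin (\<lambda>c. 0) (br a b)"
        using 2 that N_br[of a b] by (intro lin_cong straighten_short) auto
      then show ?thesis by simp
    qed
    with 2 show ?case by (auto simp: add_mset_commute)
  qed
  with assms show ?thesis by simp
qed

lemma straighten_deg:
  assumes "\<forall>a\<in>set w. N a" "sum_list (map deg w) \<noteq> sum_list (map deg J)"
  shows "straighten w = 0"
proof -
  have "sum_list (map deg w) \<noteq> sum_list (map deg J) \<longrightarrow> straighten w = 0"
  proof (rule straighten_N_induct[OF assms(1), where P = "\<lambda>w x. sum_list (map deg w) \<noteq> sum_list (map deg J) \<longrightarrow> x = 0"], goal_cases)
    case (2 u a b v)
    have "lin (\<lambda>c. straighten (u @ c # v)) (br a b) = 0"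
      if "sum_list (map deg (u @ a # b # v)) \<noteq> sum_list (map deg J)"
      using 2 that N_br[of a b] by (intro lin_eq_0) (simp add: ac_simps)
    with 2 show ?case by (simp add: ac_simps)
  qed auto
  with assms show ?thesis by simp
qed

end

section \<open>The top component as a module over the affine algebra\<close>

text \<open>In the basis e, f, h each bracket is a multiple of a single basis vector:
  \<open>sl2_coeff\<close> is the factor and \<open>sl2_prod\<close> the vector. Where the factor is
  zero, \<open>sl2_prod\<close> falls back to \<open>BH\<close>.\<close>

fun sl2_coeff :: "sl2_basis \<Rightarrow> sl2_basis \<Rightarrow> complex" where
  "sl2_coeff BE BF = 1"
| "sl2_coeff BF BE = - 1"
| "sl2_coeff BH BE = 2"
| "sl2_coeff BE BH = - 2"
| "sl2_coeff BH BF = - 2"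
| "sl2_coeff BF BH = 2"
| "sl2_coeff _ _ = 0"

fun sl2_prod :: "sl2_basis \<Rightarrow> sl2_basis \<Rightarrow> sl2_basis" where
  "sl2_prod BE BH = BE"
| "sl2_prod BH BE = BE"
| "sl2_prod BF BH = BF"
| "sl2_prod BH BF = BF"
| "sl2_prod _ _ = BH"

lemma loop_lin: "loop x m n = pm.lin (\<lambda>b. bas (Loop b m n)) x"
  by (simp add: loop_def pm.lin_def)

lemma loop_bas [simp]: "loop (bas b) m n = bas (Loop b m n)"
  by (simp add: loop_lin)

lemma toroidal_basis_bracket_Loop:
  "toroidal_basis_bracket (Loop a r1 r2) (Loop b s1 s2) =
     scl (sl2_coeff a b) (bas (Loop (sl2_prod a b) (r1 + s1) (r2 + s2))) +
     (if r1 = - s1 \<and> r2 = - s2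
      then scl (sl2_basis_form a b) (scl (of_int r1) (bas C1) + scl (of_int r2) (bas C2)) else 0)"
proof -
  have "loop (sl2_basis_bracket a b) m n = scl (sl2_coeff a b) (bas (Loop (sl2_prod a b) m n))" for m n
    by (cases a; cases b) (auto simp: loop_lin pm.lin_uminus pm.lin_scl pm.scale_minus_left)
  then show ?thesis by simp
qed

section \<open>Modules as quotients of the enveloping algebra by left ideals\<close>

locale left_ideal =
  fixes K :: "'u::ring_1 set"
  assumes zero_mem [simp, intro]: "0 \<in> K"
    and add_mem: "x \<in> K \<Longrightarrow> y \<in> K \<Longrightarrow> x + y \<in> K"
    and mult_mem: "x \<in> K \<Longrightarrow> u * x \<in> K"
begin

lemma uminus_mem: "x \<in> K \<Longrightarrow> - x \<in> K"
  using mult_mem[of x "- 1"] by simp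

lemma diff_mem: "x \<in> K \<Longrightarrow> y \<in> K \<Longrightarrow> x - y \<in> K"
  using add_mem[of x "- y"] uminus_mem by simp

lemma sum_mem: "(\<And>i. i \<in> A \<Longrightarrow> f i \<in> K) \<Longrightarrow> sum f A \<in> K"
  by (induction A rule: infinite_finite_induct) (auto intro: add_mem)

lemma mem_cong: "p - q \<in> K \<Longrightarrow> p \<in> K \<longleftrightarrow> q \<in> K"
  using add_mem[of "p - q" q] diff_mem[of p "p - q"] by auto

end

text \<open>An algebra whose generators satisfy the relations of the enveloping algebra, without
  universality. Freeness enters later only through the properness of \<open>K\<close> and the
  existence of coefficient maps; \<open>generated\<close> is an induction principle in place of a
  basis.\<close>

locale toroidal_alg =
  fixes \<iota> :: "toroidal_basis \<Rightarrow> 'u::ring_1" and sc :: "complex \<Rightarrow> 'u"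
  assumes sc_add: "sc (c + d) = sc c + sc d"
    and sc_mult: "sc (c * d) = sc c * sc d"
    and sc_1 [simp]: "sc 1 = 1"
    and sc_comm: "u * sc c = sc c * u"
    and bracket: "\<iota> a * \<iota> b = \<iota> b * \<iota> a + cspace.lin (\<lambda>c u. sc c * u) \<iota> (toroidal_basis_bracket a b)"
    and generated: "1 \<in> S \<Longrightarrow> (\<And>x y. x \<in> S \<Longrightarrow> y \<in> S \<Longrightarrow> x + y \<in> S) \<Longrightarrow>
       (\<And>c x. x \<in> S \<Longrightarrow> sc c * x \<in> S) \<Longrightarrow> (\<And>b x. x \<in> S \<Longrightarrow> \<iota> b * x \<in> S) \<Longrightarrow> u \<in> S"
begin

sublocale cspace "\<lambda>c u. sc c * u"
  by unfold_locales (auto simp: sc_add sc_mult algebra_simps)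

lemma sc_0 [simp]: "sc 0 = 0"
  using sc_add[of 0 0] by simp

lemma sc_uminus: "sc (- c) = - sc c"
  using sc_add[of c "- c"] by (simp add: minus_unique)

lemma sc_diff: "sc (c - d) = sc c - sc d"
  using sc_add[of c "- d"] by (simp add: sc_uminus)

lemma sc_of_nat [simp]: "sc (of_nat n) = of_nat n"
  by (induction n) (auto simp: sc_add)

lemma sc_of_int [simp]: "sc (of_int n) = of_int n"
  by (cases n rule: int_cases2) (auto simp: sc_uminus)

lemma sc_numeral [simp]: "sc (numeral n) = numeral n"
  using sc_of_nat[of "numeral n"] by simp

lemma sc_left_comm: "u * (sc c * v) = sc c * (u * v)"
  by (metis mult.assoc sc_comm)

lemma sc_inverse_cancel: "c \<noteq> 0 \<Longrightarrow> sc (inverse c) * (sc c * u) = u"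
  by (simp add: mult.assoc[symmetric] sc_mult[symmetric])

lemma Loop_comm:
  "\<iota> (Loop a r1 r2) * \<iota> (Loop b s1 s2) = \<iota> (Loop b s1 s2) * \<iota> (Loop a r1 r2)
     + sc (sl2_coeff a b) * \<iota> (Loop (sl2_prod a b) (r1 + s1) (r2 + s2))
     + (if r1 = - s1 \<and> r2 = - s2
        then sc (sl2_basis_form a b) * (of_int r1 * \<iota> C1 + of_int r2 * \<iota> C2) else 0)"
  unfolding bracket[of "Loop a r1 r2"] toroidal_basis_bracket_Loop
  by (simp add: lin_add lin_diff lin_uminus lin_scl add.assoc del: toroidal_basis_bracket.simps)

lemma central:
  "\<iota> C1 * \<iota> b = \<iota> b * \<iota> C1" "\<iota> C2 * \<iota> b = \<iota> b * \<iota> C2"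
  by (subst bracket, cases b; simp)+

lemma D_comm:
  "\<iota> D1 * \<iota> (Loop b m n) = \<iota> (Loop b m n) * \<iota> D1 + of_int m * \<iota> (Loop b m n)"
  "\<iota> D2 * \<iota> (Loop b m n) = \<iota> (Loop b m n) * \<iota> D2 + of_int n * \<iota> (Loop b m n)"
  by (subst bracket, simp add: lin_scl)+

abbreviation E where "E m \<equiv> \<iota> (Loop BE m 0)"
abbreviation F where "F m \<equiv> \<iota> (Loop BF m 0)"
abbreviation H where "H m \<equiv> \<iota> (Loop BH m 0)"

lemma affine_comm:
  "E m * F n = F n * E m + H (m + n) + (if m = - n then of_int m * \<iota> C1 else 0)"
  "F m * E n = E n * F m - H (m + n) + (if m = - n then of_int m * \<iota> C1 else 0)"
  "H m * E n = E n * H m + 2 * E (m + n)"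
  "E m * H n = H n * E m - 2 * E (m + n)"
  "H m * F n = F n * H m - 2 * F (m + n)"
  "F m * H n = H n * F m + 2 * F (m + n)"
  "H m * H n = H n * H m + (if m = - n then 2 * of_int m * \<iota> C1 else 0)"
  "E m * E n = E n * E m"
  "F m * F n = F n * F m"
  by (subst Loop_comm; simp add: sc_uminus mult.assoc)+

text \<open>Modules are written as \<open>U\<close> modulo \<open>K\<close>, so an eigenvector
  equation is a membership in \<open>K\<close>. As \<open>K\<close> is a left ideal, such equations
  may be multiplied from the left but not from the right.\<close>

definition eigen :: "'u set \<Rightarrow> 'u \<Rightarrow> complex \<Rightarrow> 'u \<Rightarrow> bool" where
  "eigen K D \<mu> q \<longleftrightarrow> D * q - sc \<mu> * q \<in> K"

end

locale toroidal_ideal = toroidal_alg \<iota> sc + left_ideal K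
  for \<iota> :: "toroidal_basis \<Rightarrow> 'u::ring_1" and sc and K :: "'u set"
begin

lemma sc_mem_iff: "c \<noteq> 0 \<Longrightarrow> sc c * x \<in> K \<longleftrightarrow> x \<in> K"
  using mult_mem[of "sc c * x" "sc (inverse c)"] mult_mem[of x "sc c"] sc_inverse_cancel[of c x] by auto

lemma eigen_add: "eigen K D \<mu> p \<Longrightarrow> eigen K D \<mu> q \<Longrightarrow> eigen K D \<mu> (p + q)"
  unfolding eigen_def using add_mem[of "D * p - sc \<mu> * p" "D * q - sc \<mu> * q"] by (simp add: algebra_simps)

lemma eigen_sc: "eigen K D \<mu> p \<Longrightarrow> eigen K D \<mu> (sc c * p)"
  unfolding eigen_def using mult_mem[of "D * p - sc \<mu> * p" "sc c"]
  by (simp add: right_diff_distrib sc_left_comm[of D] mult.commute)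

lemma eigen_mem: "p \<in> K \<Longrightarrow> eigen K D \<mu> p"
  unfolding eigen_def by (simp add: diff_mem mult_mem)

lemma eigen_mult:
  assumes "D * x = x * D + sc \<nu> * x" "eigen K D \<mu> p"
  shows "eigen K D (\<mu> + \<nu>) (x * p)"
proof -
  have "D * (x * p) - sc (\<mu> + \<nu>) * (x * p) = x * (D * p - sc \<mu> * p)"
    by (simp add: mult.assoc[symmetric] assms(1)) (simp add: algebra_simps sc_add sc_left_comm[of x])
  with assms(2) show ?thesis by (simp add: eigen_def mult_mem)
qed

lemma comm_mem:
  assumes "x * y = y * x + sc c * z" "c \<noteq> 0" "x * q \<in> K" "y * q \<in> K"
  shows "z * q \<in> K"
proof -
  have "sc c * (z * q) = x * (y * q) - y * (x * q)"
    using assms(1) by (simp add: mult.assoc[symmetric]) (simp add: algebra_simps)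
  then have "sc c * (z * q) \<in> K" using assms by (simp add: diff_mem mult_mem)
  with assms(2) show ?thesis by (simp add: sc_mem_iff)
qed

text \<open>\<open>E 0\<close> and \<open>F 1\<close> generate the positive part of the affine algebra.\<close>

lemma affine_pos_mem:
  assumes "E 0 * q \<in> K" "F 1 * q \<in> K"
  shows "m \<ge> 0 \<Longrightarrow> E m * q \<in> K" "m \<ge> 1 \<Longrightarrow> F m * q \<in> K" "m \<ge> 1 \<Longrightarrow> H m * q \<in> K"
proof -
  have H1: "H 1 * q \<in> K"
    by (rule comm_mem[OF _ _ assms, where c = 1]) (simp_all add: affine_comm(1))
  have E: "E (int n) * q \<in> K" for n
  proof (induction n)
    case (Suc n)
    show ?case
      by (rule comm_mem[OF _ _ H1 Suc, where c = 2]) (simp_all add: affine_comm(3))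
  qed (simp add: assms)
  have F: "F (int n + 1) * q \<in> K" for n
  proof (induction n)
    case (Suc n)
    show ?case
      by (rule comm_mem[OF _ _ H1 Suc, where c = "-2"]) (simp_all add: affine_comm(5) sc_uminus add.commute)
  qed (simp add: assms)
  have H: "H (int n + 1) * q \<in> K" for n
    by (rule comm_mem[OF _ _ E[of n] assms(2), where c = 1]) (simp_all add: affine_comm(1))
  show "m \<ge> 0 \<Longrightarrow> E m * q \<in> K" using E[of "nat m"] by simp
  show "m \<ge> 1 \<Longrightarrow> F m * q \<in> K" using F[of "nat (m - 1)"] by simp
  show "m \<ge> 1 \<Longrightarrow> H m * q \<in> K" using H[of "nat (m - 1)"] by simp
qed

text \<open>The hypotheses say that three applications of \<open>ad y\<close> kill \<open>b\<close>.
  Hence \<open>y ^ (n + 2) * b\<close> lies in \<open>U * y ^ n\<close>: the surplus 2 is the number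
  of iterated commutators that can be nonzero, and the same argument with surplus 1 serves
  \<open>a1\<close>.\<close>

lemma nilpotent_step:
  assumes "y * b = b * y + a1" "y * a1 = a1 * y + a2" "y * a2 = a2 * y" "y ^ n * q \<in> K"
  shows "y ^ (n + 2) * (b * q) \<in> K"
proof -
  have 2: "y ^ n * a2 = a2 * y ^ n" for n
    by (induction n) (use assms(3) in \<open>simp_all add: power_commutes mult.assoc\<close>, metis mult.assoc)
  have 1: "\<exists>A. y ^ (n + 1) * a1 = A * y ^ n" for n
  proof (induction n)
    case (Suc n)
    then obtain A where A: "y ^ (n + 1) * a1 = A * y ^ n" ..
    have "y ^ (Suc n + 1) * a1 = y ^ (n + 1) * (y * a1)" by (simp only: Suc_eq_plus1[symmetric] power_Suc2[of y "Suc n"] mult.assoc)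
    also have "\<dots> = (y ^ (n + 1) * a1) * y + y ^ (n + 1) * a2" by (simp add: assms(2) distrib_left mult.assoc)
    also have "\<dots> = (A + a2) * y ^ Suc n"
      unfolding A by (subst 2) (simp add: distrib_right mult.assoc power_commutes)
    finally show ?case ..
  qed auto
  have "\<exists>A. y ^ (n + 2) * b = A * y ^ n"
  proof (induction n)
    case (Suc n)
    then obtain A where A: "y ^ (n + 2) * b = A * y ^ n" ..
    obtain B where B: "y ^ (Suc n + 1) * a1 = B * y ^ Suc n" using 1 by blast
    have "y ^ (Suc n + 2) * b = y ^ (n + 2) * (y * b)" by (simp only: add_2_eq_Suc' power_Suc2[of y "Suc (Suc n)"] mult.assoc)
    also have "\<dots> = (y ^ (n + 2) * b) * y + y ^ (Suc n + 1) * a1" by (simp add: assms(1) distrib_left mult.assoc)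
    also have "\<dots> = (A + B) * y ^ Suc n"
      unfolding A B by (simp add: distrib_right mult.assoc power_commutes)
    finally show ?case ..
  qed auto
  then obtain A where "y ^ (n + 2) * b = A * y ^ n" ..
  then have "y ^ (n + 2) * (b * q) = A * (y ^ n * q)" by (metis mult.assoc)
  with assms(4) show ?thesis by (simp add: mult_mem)
qed

lemma power_mem_mono: "y ^ n * q \<in> K \<Longrightarrow> n \<le> m \<Longrightarrow> y ^ m * q \<in> K"
  using mult_mem[of "y ^ n * q" "y ^ (m - n)"] by (simp add: mult.assoc[symmetric] power_add[symmetric])

text \<open>Nilpotency spreads from the cyclic vector 1 to the whole module because \<open>y\<close>
  is ad-nilpotent on the generators; the exponent grows with the length of the word.\<close>

lemma locally_nilpotent:
  assumes "\<And>b. \<exists>a1 a2. y * \<iota> b = \<iota> b * y + a1 \<and> y * a1 = a1 * y + a2 \<and> y * a2 = a2 * y"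
    and "y ^ n \<in> K"
  shows "\<exists>n. y ^ n * p \<in> K"
proof -
  have "p \<in> {p. \<exists>n. y ^ n * p \<in> K}"
  proof (rule generated)
    show "1 \<in> {p. \<exists>n. y ^ n * p \<in> K}" using assms(2) by auto
  next
    fix p q assume "p \<in> {p. \<exists>n. y ^ n * p \<in> K}" "q \<in> {p. \<exists>n. y ^ n * p \<in> K}"
    then obtain n m where "y ^ n * p \<in> K" "y ^ m * q \<in> K" by auto
    then have "y ^ (max n m) * (p + q) \<in> K"
      by (auto simp: distrib_left intro!: add_mem power_mem_mono[of y _ _ "max n m"])
    then show "p + q \<in> {p. \<exists>n. y ^ n * p \<in> K}" by auto
  next
    fix c p assume "p \<in> {p. \<exists>n. y ^ n * p \<in> K}"
    then show "sc c * p \<in> {p. \<exists>n. y ^ n * p \<in> K}" by (auto simp: sc_left_comm[of "y ^ n" for n] intro: mult_mem)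
  next
    fix b p assume "p \<in> {p. \<exists>n. y ^ n * p \<in> K}"
    then obtain n where "y ^ n * p \<in> K" by auto
    with assms(1)[of b] show "\<iota> b * p \<in> {p. \<exists>n. y ^ n * p \<in> K}" using nilpotent_step by blast
  qed
  then show ?thesis by simp
qed

text \<open>The standard sl2 computation. It is used for both simple roots of the affine algebra and
  for two purposes: to bound the weight of a singular vector and, at \<open>\<mu> = j\<close>, to
  see that the generators of the Weyl submodule are singular.\<close>

lemma sl2_string:
  assumes ef: "e * f = f * e + h" and hf: "h * f = f * h - 2 * f"
    and hq: "eigen K h \<mu> q" and eq: "e * q \<in> K"
  shows "e * (f ^ Suc j * q) - sc (of_nat (Suc j) * (\<mu> - of_nat j)) * (f ^ j * q) \<in> K"
proof -
  have h: "eigen K h (\<mu> - 2 * of_nat j) (f ^ j * q)" for j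
  proof (induction j)
    case (Suc j)
    have "eigen K h (\<mu> - 2 * of_nat j + (- 2)) (f * (f ^ j * q))"
      by (rule eigen_mult[OF _ Suc]) (simp add: hf sc_uminus)
    then show ?case by (simp add: algebra_simps)
  qed (simp add: hq)
  show ?thesis
  proof (induction j)
    case 0
    have "e * (f * q) - sc \<mu> * q = f * (e * q) + (h * q - sc \<mu> * q)"
      by (simp add: mult.assoc[symmetric] ef) (simp add: algebra_simps)
    then have "e * (f * q) - sc \<mu> * q \<in> K" using hq eq by (simp only: eigen_def add_mem mult_mem)
    then show ?case by simp
  next
    case (Suc j)
    let ?p = "f ^ Suc j * q"
    have c: "of_nat (Suc (Suc j)) * (\<mu> - of_nat (Suc j)) =
        of_nat (Suc j) * (\<mu> - of_nat j) + (\<mu> - 2 * of_nat (Suc j))"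
      by (simp add: algebra_simps)
    have "e * (f ^ Suc (Suc j) * q) - sc (of_nat (Suc (Suc j)) * (\<mu> - of_nat (Suc j))) * ?p
        = f * (e * ?p - sc (of_nat (Suc j) * (\<mu> - of_nat j)) * (f ^ j * q))
          + (h * ?p - sc (\<mu> - 2 * of_nat (Suc j)) * ?p)"
      unfolding c sc_add
      by (simp only: power_Suc[of f "Suc j"] mult.assoc, simp only: mult.assoc[symmetric, of e f] ef)
        (simp add: distrib_right distrib_left right_diff_distrib sc_left_comm[of f] mult.assoc)
    then show ?case using Suc h[of "Suc j"] by (auto simp: eigen_def intro!: add_mem mult_mem)
  qed
qed

text \<open>At the least exponent \<open>j + 1\<close> with which \<open>f\<close> kills
  \<open>q\<close>, the string coefficient \<open>(j + 1) * (\<mu> - j)\<close> has to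
  vanish.\<close>

lemma sl2_dominant:
  assumes ef: "e * f = f * e + h" and hf: "h * f = f * h - 2 * f"
    and hq: "eigen K h \<mu> q" and eq: "e * q \<in> K" and nil: "f ^ n * q \<in> K" and "q \<notin> K"
  shows "\<exists>j. \<mu> = of_nat j"
proof -
  define N where "N = (LEAST n. f ^ n * q \<in> K)"
  have N: "f ^ N * q \<in> K" unfolding N_def using nil by (rule LeastI)
  then obtain j where j: "N = Suc j" using assms(6) by (cases N) auto
  have nj: "f ^ j * q \<notin> K" using not_less_Least[of j "\<lambda>n. f ^ n * q \<in> K"] j by (auto simp: N_def)
  have "sc (of_nat (Suc j) * (\<mu> - of_nat j)) * (f ^ j * q) \<in> K"
    using sl2_string[OF ef hf hq eq, of j] N j mem_cong mult_mem by blast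
  with nj have "of_nat (Suc j) * (\<mu> - of_nat j) = 0" using sc_mem_iff by blast
  then have "\<mu> = of_nat j" using of_nat_eq_0_iff[of "Suc j", where 'a = complex] by auto
  then show ?thesis ..
qed

end

section \<open>Separation of eigenvectors and the affine Casimir operator\<close>

context toroidal_ideal
begin

lemma eigen_op_mult: "eigen K A \<alpha> r \<Longrightarrow> eigen K B \<beta> r \<Longrightarrow> eigen K (A * B) (\<alpha> * \<beta>) r"
proof -
  assume a: "eigen K A \<alpha> r" and b: "eigen K B \<beta> r"
  have "A * B * r - sc (\<alpha> * \<beta>) * r = A * (B * r - sc \<beta> * r) + sc \<beta> * (A * r - sc \<alpha> * r)"
    by (simp add: right_diff_distrib mult.assoc sc_left_comm[of A] mult.commute[of \<alpha>])
  with a b show ?thesis unfolding eigen_def by (simp only: add_mem mult_mem)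
qed

lemma eigen_op_add: "eigen K A \<alpha> r \<Longrightarrow> eigen K B \<beta> r \<Longrightarrow> eigen K (A + B) (\<alpha> + \<beta>) r"
  unfolding eigen_def using add_mem[of "A * r - sc \<alpha> * r" "B * r - sc \<beta> * r"]
  by (simp add: algebra_simps sc_add)

lemma eigen_op_sc: "eigen K (sc c) c r"
  by (simp add: eigen_def)

lemma eigen_op_zero: "A * r \<in> K \<Longrightarrow> eigen K A 0 r"
  by (simp add: eigen_def)

lemma eigen_op_sum: "(\<And>i. i \<in> I \<Longrightarrow> A i * r \<in> K) \<Longrightarrow> eigen K (sum A I) 0 r"
  by (simp add: eigen_def sum_distrib_right sum_mem)

lemma eigen_unique: "eigen K A \<alpha> r \<Longrightarrow> eigen K A \<beta> r \<Longrightarrow> r \<notin> K \<Longrightarrow> \<alpha> = \<beta>"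
proof (rule ccontr)
  assume a: "eigen K A \<alpha> r" "eigen K A \<beta> r" "r \<notin> K" "\<alpha> \<noteq> \<beta>"
  then have "(A * r - sc \<beta> * r) - (A * r - sc \<alpha> * r) \<in> K" unfolding eigen_def by (simp only: diff_mem)
  then have "sc (\<alpha> - \<beta>) * r \<in> K" by (simp add: sc_diff left_diff_distrib)
  with a show False by (simp add: sc_mem_iff)
qed

text \<open>The element \<open>u\<close> is a product of factors
  \<open>D d - sc (\<nu> i d)\<close>, one for each \<open>i\<close>: it kills \<open>p i\<close>
  and multiplies \<open>p i0\<close> by a nonzero scalar. No commutation between the operators is
  used, since every factor meets eigenvectors modulo \<open>K\<close> and left multiplication
  preserves \<open>K\<close>.\<close>

lemma eigen_separate:
  fixes D :: "'d \<Rightarrow> 'u" and \<nu> :: "'i \<Rightarrow> 'd \<Rightarrow> complex" and p :: "'i \<Rightarrow> 'u"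
  assumes "finite I" "\<And>i d. i \<in> insert i0 I \<Longrightarrow> eigen K (D d) (\<nu> i d) (p i)"
    "\<And>i. i \<in> I \<Longrightarrow> \<exists>d. \<nu> i0 d \<noteq> \<nu> i d"
  shows "\<exists>u c. c \<noteq> 0 \<and> u * p i0 - sc c * p i0 \<in> K \<and> (\<forall>i\<in>I. u * p i \<in> K)"
  using assms
proof (induction I)
  case empty
  show ?case by (intro exI[of _ 1] exI[of _ "1 :: complex"]) simp
next
  case (insert i I)
  then obtain u c where u: "c \<noteq> 0" "u * p i0 - sc c * p i0 \<in> K" "\<forall>j\<in>I. u * p j \<in> K"
    by (metis insert_iff)
  obtain d where d: "\<nu> i0 d \<noteq> \<nu> i d" using insert.prems(2)[of i] by auto
  let ?u = "u * (D d - sc (\<nu> i d))"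
  have e: "?u * p j - sc (\<nu> j d - \<nu> i d) * (u * p j) \<in> K" if "j \<in> insert i0 (insert i I)" for j
  proof -
    have "?u * p j - sc (\<nu> j d - \<nu> i d) * (u * p j) = u * (D d * p j - sc (\<nu> j d) * p j)"
      by (simp add: right_diff_distrib left_diff_distrib mult.assoc sc_diff sc_left_comm[of u])
    with insert.prems(1)[OF that, of d] show ?thesis unfolding eigen_def by (simp only: mult_mem)
  qed
  have "?u * p i0 - sc ((\<nu> i0 d - \<nu> i d) * c) * p i0 \<in> K"
  proof -
    have "sc (\<nu> i0 d - \<nu> i d) * (u * p i0 - sc c * p i0) \<in> K" using u by (simp add: mult_mem)
    from add_mem[OF e[of i0] this] show ?thesis by (simp add: right_diff_distrib mult.assoc)
  qed
  moreover have "?u * p j \<in> K" if "j \<in> insert i I" for j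
  proof -
    have "sc (\<nu> j d - \<nu> i d) * (u * p j) \<in> K"
      using that u by (cases "j = i") (auto intro: mult_mem)
    with e[of j] that show ?thesis using mem_cong by auto
  qed
  ultimately show ?case using u d by (intro exI[of _ ?u] exI[of _ "(\<nu> i0 d - \<nu> i d) * c"]) auto
qed

text \<open>Leibniz rule for the commutator with \<open>y\<close>, in the shape
  \<open>u * y = y * u + u'\<close>. With it and its companions the commutator of a long operator is
  assembled through \<open>OF\<close> instead of by rewriting noncommuting products.\<close>

lemma mult_comm2:
  assumes "u * y = y * u + u'" "v * y = y * v + (v' :: 'u)"
  shows "(u * v) * y = y * (u * v) + (u' * v + u * v')"
proof -
  have "(u * v) * y = (u * y) * v + u * v'" by (simp add: mult.assoc assms(2) distrib_left)
  then show ?thesis by (simp add: assms(1) distrib_right mult.assoc add.assoc)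
qed

lemma sc_comm2: "u * y = y * u + u' \<Longrightarrow> (sc c * u) * y = y * (sc c * u) + sc c * u'"
  by (simp add: mult.assoc distrib_left sc_left_comm[of y])

lemma add_comm2: "u * y = y * u + u' \<Longrightarrow> v * y = y * v + v' \<Longrightarrow> (u + v) * y = y * (u + v) + (u' + (v' :: 'u))"
  by (simp add: algebra_simps)

lemma sum_comm2: "(\<And>i. i \<in> I \<Longrightarrow> u i * y = y * u i + u' i) \<Longrightarrow> sum u I * y = y * sum u I + (sum u' I :: 'u)"
  by (simp add: sum_distrib_left sum_distrib_right sum.distrib)

lemma mult_4: "4 * x = x + x + x + (x :: 'u)"
proof -
  have "4 * x = (1 + 1 + 1 + 1) * x" by simp
  then show ?thesis by (simp only: distrib_right mult_1_left)
qed

text \<open>These are the blocks of \<open>casimir n\<close>, which is twice the affine Casimir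
  operator 2(c + 2)d + h^2/2 + h + 2fe + 2 \<Sum> (e(-k)f(k) + f(-k)e(k) + h(-k)h(k)/2); the factor
  2 clears denominators and the shift of c by 2 is the dual Coxeter number. The infinite sum is not
  an element of \<open>U\<close>, so it is cut off after \<open>n\<close> blocks.\<close>

definition casimir_term where
  "casimir_term k = sc 4 * (E (- k) * F k) + sc 4 * (F (- k) * E k) + sc 2 * (H (- k) * H k)"

definition casimir where
  "casimir n = sc 4 * ((\<iota> C1 + sc 2) * \<iota> D1) + (H 0 * H 0 + sc 2 * H 0 + sc 4 * (F 0 * E 0))
     + (\<Sum>k<n. casimir_term (int k + 1))"

text \<open>The error of the cut-off: commutators of the blocks with \<open>E (- 1)\<close>
  telescope and the last difference survives. Its right factors are \<open>H k\<close> and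
  \<open>E k\<close>, so it kills any vector that is killed by the high modes.\<close>

definition casimir_tail where
  "casimir_tail k = sc 4 * (E (- k - 1) * H k) - sc 4 * (H (- k - 1) * E k)"

lemma casimir_term_F: "k \<ge> 1 \<Longrightarrow> casimir_term k * F 0 = F 0 * casimir_term k + 0"
proof -
  assume k: "k \<ge> 1"
  have 1: "E (- k) * F 0 = F 0 * E (- k) + H (- k)" "E k * F 0 = F 0 * E k + H k"
    "F k * F 0 = F 0 * F k + 0" "F (- k) * F 0 = F 0 * F (- k) + 0"
    "H k * F 0 = F 0 * H k + - (2 * F k)" "H (- k) * F 0 = F 0 * H (- k) + - (2 * F (- k))"
    using k by (simp_all add: affine_comm(1,5) affine_comm(9)[of _ 0])
  note e = mult_comm2[OF 1(1) 1(3)] and f = mult_comm2[OF 1(4) 1(2)] and h = mult_comm2[OF 1(6) 1(5)]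
  show ?thesis
    unfolding casimir_term_def
    by (subst add_comm2[OF add_comm2[OF sc_comm2[OF e] sc_comm2[OF f]] sc_comm2[OF h]])
      (simp add: algebra_simps mult_2 mult_4)
qed

text \<open>The extra summand at \<open>k = 1\<close> is the central term of the commutator of
  \<open>F 1\<close> with \<open>E (- 1)\<close>.\<close>

lemma casimir_term_E:
  "k \<ge> 1 \<Longrightarrow> casimir_term k * E (- 1) = E (- 1) * casimir_term k
     + (casimir_tail k - casimir_tail (k - 1) + (if k = 1 then sc 4 * (E (- 1) * \<iota> C1) else 0))"
proof -
  assume k: "k \<ge> 1"
  have 1: "E k * E (- 1) = E (- 1) * E k + 0" "E (- k) * E (- 1) = E (- 1) * E (- k) + 0"
    "F k * E (- 1) = E (- 1) * F k + (- H (k - 1) + (if k = 1 then \<iota> C1 else 0))"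
    "F (- k) * E (- 1) = E (- 1) * F (- k) + - H (- k - 1)"
    "H k * E (- 1) = E (- 1) * H k + 2 * E (k - 1)" "H (- k) * E (- 1) = E (- 1) * H (- k) + 2 * E (- k - 1)"
    using k by (simp_all add: affine_comm(2,3) affine_comm(8)[of _ "- 1"])
  note e = mult_comm2[OF 1(2) 1(3)] and f = mult_comm2[OF 1(4) 1(1)] and h = mult_comm2[OF 1(6) 1(5)]
  show ?thesis
    unfolding casimir_term_def casimir_tail_def
    by (subst add_comm2[OF add_comm2[OF sc_comm2[OF e] sc_comm2[OF f]] sc_comm2[OF h]])
      (auto simp: algebra_simps mult_2 mult_4)
qed

lemma casimir_F: "casimir n * F 0 = F 0 * casimir n"
proof -
  have 1: "\<iota> C1 * F 0 = F 0 * \<iota> C1 + 0" "\<iota> D1 * F 0 = F 0 * \<iota> D1 + 0" "sc c * F 0 = F 0 * sc c + 0"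
    "H 0 * F 0 = F 0 * H 0 + - (2 * F 0)" "F 0 * F 0 = F 0 * F 0 + 0" "E 0 * F 0 = F 0 * E 0 + H 0" for c
    by (simp_all add: central D_comm affine_comm(1,5) sc_comm)
  have S: "(\<Sum>k<n. casimir_term (int k + 1)) * F 0 = F 0 * (\<Sum>k<n. casimir_term (int k + 1)) + (\<Sum>k<n. 0)"
    by (intro sum_comm2 casimir_term_F) simp
  have "casimir n * F 0 = F 0 * casimir n + 0"
    unfolding casimir_def
    by (subst add_comm2[OF add_comm2[OF sc_comm2[OF mult_comm2[OF add_comm2[OF 1(1) 1(3)] 1(2)]]
        add_comm2[OF add_comm2[OF mult_comm2[OF 1(4) 1(4)] sc_comm2[OF 1(4)]] sc_comm2[OF mult_comm2[OF 1(5) 1(6)]]]] S])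
      (simp add: algebra_simps mult_2 mult_4 affine_comm(5)[of 0 0])
  then show ?thesis by simp
qed

lemma casimir_E:
  assumes "n \<ge> 1"
  shows "casimir n * E (- 1) = E (- 1) * casimir n + casimir_tail (int n)"
proof -
  have 1: "\<iota> C1 * E (- 1) = E (- 1) * \<iota> C1 + 0" "\<iota> D1 * E (- 1) = E (- 1) * \<iota> D1 + - E (- 1)"
    "sc c * E (- 1) = E (- 1) * sc c + 0"
    "H 0 * E (- 1) = E (- 1) * H 0 + 2 * E (- 1)" "E 0 * E (- 1) = E (- 1) * E 0 + 0"
    "F 0 * E (- 1) = E (- 1) * F 0 + - H (- 1)" for c
    by (simp_all add: central D_comm affine_comm(2,3) affine_comm(8)[of 0] sc_comm)
  have S: "(\<Sum>k<n. casimir_term (int k + 1)) * E (- 1) = E (- 1) * (\<Sum>k<n. casimir_term (int k + 1))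
    + (\<Sum>k<n. (casimir_tail (int k + 1) - casimir_tail (int k + 1 - 1)
       + (if int k + 1 = 1 then sc 4 * (E (- 1) * \<iota> C1) else 0)))"
    by (intro sum_comm2 casimir_term_E) simp
  \<comment> \<open>After telescoping, \<open>casimir_tail 0\<close> cancels against the degree zero
    part of the operator and the central term against the commutator with \<open>\<iota> D1\<close>.
    The multiples of \<open>E (- 1)\<close> left over cancel thanks to the shift of
    \<open>\<iota> C1\<close> by 2.\<close>
  have t: "(\<Sum>k<n. (casimir_tail (int k + 1) - casimir_tail (int k + 1 - 1)
       + (if int k + 1 = 1 then sc 4 * (E (- 1) * \<iota> C1) else 0)))
     = casimir_tail (int n) - casimir_tail 0 + sc 4 * (E (- 1) * \<iota> C1)"
  proof -
    have "(\<Sum>k<n. (casimir_tail (int k + 1) - casimir_tail (int k + 1 - 1))) = casimir_tail (int n) - casimir_tail 0"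
      using sum_lessThan_telescope[of "\<lambda>k. casimir_tail (int k)" n] by (simp add: add.commute)
    with assms show ?thesis by (simp add: sum.distrib sum.delta)
  qed
  show ?thesis
    unfolding casimir_def
    by (subst add_comm2[OF add_comm2[OF sc_comm2[OF mult_comm2[OF add_comm2[OF 1(1) 1(3)] 1(2)]]
        add_comm2[OF add_comm2[OF mult_comm2[OF 1(4) 1(4)] sc_comm2[OF 1(4)]] sc_comm2[OF mult_comm2[OF 1(6) 1(5)]]]] S[unfolded t]])
      (simp add: casimir_tail_def algebra_simps mult_2 mult_4 affine_comm(3)[of 0 "- 1"] central)
qed

lemma casimir_eigen:
  assumes "eigen K (\<iota> C1) \<kappa> r" "eigen K (\<iota> D1) \<delta> r" "eigen K (H 0) \<mu> r"
    and "E 0 * r \<in> K" and "\<And>k. k \<ge> 1 \<Longrightarrow> E k * r \<in> K \<and> F k * r \<in> K \<and> H k * r \<in> K"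
  shows "eigen K (casimir n) (4 * (\<kappa> + 2) * \<delta> + \<mu> * \<mu> + 2 * \<mu>) r"
proof -
  have z: "casimir_term (int k + 1) * r \<in> K" for k
    unfolding casimir_term_def distrib_right mult.assoc
    using assms(5)[of "int k + 1"] by (simp add: add_mem mult_mem)
  have "eigen K (casimir n) (4 * ((\<kappa> + 2) * \<delta>) + (\<mu> * \<mu> + 2 * \<mu> + 4 * (0 * 0)) + 0) r"
    unfolding casimir_def
    by (rule eigen_op_add[OF eigen_op_add[OF eigen_op_mult[OF eigen_op_sc
         eigen_op_mult[OF eigen_op_add[OF assms(1) eigen_op_sc] assms(2)]]
         eigen_op_add[OF eigen_op_add[OF eigen_op_mult[OF assms(3,3)] eigen_op_mult[OF eigen_op_sc assms(3)]]
          ]] eigen_op_sum])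
       (auto simp: z eigen_def mult.assoc intro!: mult_mem assms(4))
  then show ?thesis by (simp add: algebra_simps)
qed

end

section \<open>Weight spaces of the top component\<close>

locale weyl_ideal = toroidal_ideal \<iota> sc K
  for \<iota> :: "toroidal_basis \<Rightarrow> 'u::ring_1" and sc and K :: "'u set" +
  fixes n0 n1 :: nat and l1 l2 :: complex
  assumes proper: "1 \<notin> K"
    and E_mem: "m \<ge> 0 \<Longrightarrow> E m \<in> K" and F_mem: "m \<ge> 1 \<Longrightarrow> F m \<in> K" and H_mem: "m \<ge> 1 \<Longrightarrow> H m \<in> K"
    and pos_mem: "n \<ge> 1 \<Longrightarrow> \<iota> (Loop b m n) \<in> K"
    and eigen_1: "eigen K (H 0) (of_nat n1) 1" "eigen K (\<iota> C1) (of_nat (n0 + n1)) 1"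
      "eigen K (\<iota> C2) 0 1" "eigen K (\<iota> D1) l1 1" "eigen K (\<iota> D2) l2 1"
    and power_y0: "E (- 1) ^ Suc n0 \<in> K" and power_y1: "F 0 ^ Suc n1 \<in> K"
begin

text \<open>The space of weight \<lambda> - a\<alpha>_0 - b\<alpha>_1 in the top component, with
  \<open>K\<close> added to make it a condition on elements of \<open>U\<close>. Only the two simple
  lowering operators occur; stability under the rest of the affine algebra is derived from
  this.\<close>

inductive Wt :: "nat \<Rightarrow> nat \<Rightarrow> 'u \<Rightarrow> bool" where
  Wt_mem: "q \<in> K \<Longrightarrow> Wt a b q"
| Wt_1: "Wt 0 0 1"
| Wt_y0: "Wt a b q \<Longrightarrow> Wt (Suc a) b (E (- 1) * q)"
| Wt_y1: "Wt a b q \<Longrightarrow> Wt a (Suc b) (F 0 * q)"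
| Wt_add: "Wt a b p \<Longrightarrow> Wt a b q \<Longrightarrow> Wt a b (p + q)"
| Wt_sc: "Wt a b q \<Longrightarrow> Wt a b (sc c * q)"

lemma Wt_eigen:
  assumes "Wt a b q"
  shows "eigen K (H 0) (of_nat n1 + 2 * of_nat a - 2 * of_nat b) q"
    "eigen K (\<iota> D1) (l1 - of_nat a) q"
    "eigen K (\<iota> C1) (of_nat (n0 + n1)) q" "eigen K (\<iota> C2) 0 q" "eigen K (\<iota> D2) l2 q"
  using assms
proof induction
  case (Wt_y0 a b q)
  { case 1
    have "eigen K (H 0) (of_nat n1 + 2 * of_nat a - 2 * of_nat b + 2) (E (- 1) * q)"
      by (rule eigen_mult[OF _ Wt_y0(2)]) (simp add: affine_comm(3))
    then show ?case by (simp add: algebra_simps)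
  next
    case 2
    have "eigen K (\<iota> D1) (l1 - of_nat a + (- 1)) (E (- 1) * q)"
      by (rule eigen_mult[OF _ Wt_y0(3)]) (simp add: D_comm sc_uminus)
    then show ?case by (simp add: algebra_simps)
  next
    case 3
    have "eigen K (\<iota> C1) (of_nat (n0 + n1) + 0) (E (- 1) * q)"
      by (rule eigen_mult[OF _ Wt_y0(4)]) (simp add: central)
    then show ?case by simp
  next
    case 4
    have "eigen K (\<iota> C2) (0 + 0) (E (- 1) * q)"
      by (rule eigen_mult[OF _ Wt_y0(5)]) (simp add: central)
    then show ?case by simp
  next
    case 5
    have "eigen K (\<iota> D2) (l2 + 0) (E (- 1) * q)"
      by (rule eigen_mult[OF _ Wt_y0(6)]) (simp add: D_comm)
    then show ?case by simp
  }
next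
  case (Wt_y1 a b q)
  { case 1
    have "eigen K (H 0) (of_nat n1 + 2 * of_nat a - 2 * of_nat b + (- 2)) (F 0 * q)"
      by (rule eigen_mult[OF _ Wt_y1(2)]) (simp add: affine_comm(5) sc_uminus)
    then show ?case by (simp add: algebra_simps)
  next
    case 2
    have "eigen K (\<iota> D1) (l1 - of_nat a + 0) (F 0 * q)"
      by (rule eigen_mult[OF _ Wt_y1(3)]) (simp add: D_comm)
    then show ?case by simp
  next
    case 3
    have "eigen K (\<iota> C1) (of_nat (n0 + n1) + 0) (F 0 * q)"
      by (rule eigen_mult[OF _ Wt_y1(4)]) (simp add: central)
    then show ?case by simp
  next
    case 4
    have "eigen K (\<iota> C2) (0 + 0) (F 0 * q)"
      by (rule eigen_mult[OF _ Wt_y1(5)]) (simp add: central)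
    then show ?case by simp
  next
    case 5
    have "eigen K (\<iota> D2) (l2 + 0) (F 0 * q)"
      by (rule eigen_mult[OF _ Wt_y1(6)]) (simp add: D_comm)
    then show ?case by simp
  }
qed (auto intro: eigen_mem eigen_add eigen_sc eigen_1[simplified] eigen_1)

lemma Wt_eigen_mult: "Wt a b q \<Longrightarrow> eigen K A \<alpha> q \<Longrightarrow> Wt a b (A * q)"
  using Wt_add[OF Wt_mem[of "A * q - sc \<alpha> * q"] Wt_sc[of a b q \<alpha>]] by (simp add: eigen_def)

lemma Wt_uminus: "Wt a b q \<Longrightarrow> Wt a b (- q)"
  using Wt_sc[of a b q "- 1"] by (simp add: sc_uminus)

text \<open>The lowering steps: \<open>E 0\<close> undoes \<open>F 0\<close> and \<open>F 1\<close> undoes \<open>E (- 1)\<close>.\<close>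

lemma Wt_E0:
  assumes "Wt a b q"
  shows "(b = 0 \<longrightarrow> E 0 * q \<in> K) \<and> (\<forall>b'. b = Suc b' \<longrightarrow> Wt a b' (E 0 * q))"
  using assms
proof induction
  case (Wt_y0 a b q)
  have "E 0 * (E (- 1) * q) = E (- 1) * (E 0 * q)"
    by (metis affine_comm(8) mult.assoc)
  with Wt_y0.IH show ?case by (simp add: mult_mem Wt.Wt_y0)
next
  case (Wt_y1 a b q)
  have "E 0 * (F 0 * q) = F 0 * (E 0 * q) + H 0 * q"
    by (simp add: mult.assoc[symmetric] affine_comm(1)) (simp add: algebra_simps)
  moreover have "Wt a b (H 0 * q)" by (rule Wt_eigen_mult[OF Wt_y1(1) Wt_eigen(1)[OF Wt_y1(1)]])
  moreover have "Wt a b (F 0 * (E 0 * q))"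
  proof (cases b)
    case 0
    with Wt_y1 show ?thesis by (simp add: Wt_mem mult_mem)
  next
    case (Suc b')
    with Wt_y1 show ?thesis by (simp add: Wt.Wt_y1)
  qed
  ultimately show ?case by (simp add: Wt_add)
next
  case (Wt_mem q a b)
  then show ?case by (simp add: mult_mem Wt.Wt_mem)
next
  case Wt_1
  show ?case by (simp add: E_mem)
next
  case (Wt_add a b p q)
  then show ?case by (simp add: distrib_left add_mem Wt.Wt_add)
next
  case (Wt_sc a b q c)
  then show ?case by (simp add: sc_left_comm[of "E 0"] mult_mem Wt.Wt_sc)
qed

lemma Wt_F1:
  assumes "Wt a b q"
  shows "(a = 0 \<longrightarrow> F 1 * q \<in> K) \<and> (\<forall>a'. a = Suc a' \<longrightarrow> Wt a' b (F 1 * q))"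
  using assms
proof induction
  case (Wt_y1 a b q)
  have "F 1 * (F 0 * q) = F 0 * (F 1 * q)"
    by (metis affine_comm(9) mult.assoc)
  with Wt_y1.IH show ?case by (simp add: mult_mem Wt.Wt_y1)
next
  case (Wt_y0 a b q)
  have "F 1 * (E (- 1) * q) = E (- 1) * (F 1 * q) + (- (H 0 * q) + \<iota> C1 * q)"
    by (simp add: mult.assoc[symmetric] affine_comm(2)) (simp add: algebra_simps)
  moreover have "Wt a b (- (H 0 * q) + \<iota> C1 * q)"
    by (rule Wt_add[OF Wt_uminus[OF Wt_eigen_mult[OF Wt_y0(1) Wt_eigen(1)[OF Wt_y0(1)]]]
          Wt_eigen_mult[OF Wt_y0(1) Wt_eigen(3)[OF Wt_y0(1)]]])
  moreover have "Wt a b (E (- 1) * (F 1 * q))"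
  proof (cases a)
    case 0
    with Wt_y0 show ?thesis by (simp add: Wt_mem mult_mem)
  next
    case (Suc b')
    with Wt_y0 show ?thesis by (simp add: Wt.Wt_y0)
  qed
  ultimately show ?case by (simp add: Wt_add)
next
  case (Wt_mem q a b)
  then show ?case by (simp add: mult_mem Wt.Wt_mem)
next
  case Wt_1
  show ?case by (simp add: F_mem)
next
  case (Wt_add a b p q)
  then show ?case by (simp add: distrib_left add_mem Wt.Wt_add)
next
  case (Wt_sc a b q c)
  then show ?case by (simp add: sc_left_comm[of "F 1"] mult_mem Wt.Wt_sc)
qed

text \<open>\<open>V\<close> is the submodule over the affine algebra generated by the highest weight vector.\<close>

inductive V :: "'u \<Rightarrow> bool" where
  V_Wt: "Wt a b q \<Longrightarrow> V q"
| V_add: "V p \<Longrightarrow> V q \<Longrightarrow> V (p + q)"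

lemma V_mem: "q \<in> K \<Longrightarrow> V q"
  by (rule V_Wt[of 0 0]) (rule Wt_mem)

lemma V_1: "V 1"
  by (rule V_Wt[OF Wt_1])

lemma V_sc: "V q \<Longrightarrow> V (sc c * q)"
  by (induction rule: V.induct) (auto intro: V.intros Wt_sc simp: distrib_left)

lemma V_uminus: "V q \<Longrightarrow> V (- q)"
  using V_sc[of q "- 1"] by (simp add: sc_uminus)

lemma V_diff: "V p \<Longrightarrow> V q \<Longrightarrow> V (p - q)"
  using V_add[of p "- q"] by (simp add: V_uminus)

lemma V_mult_generators:
  assumes "V q"
  shows "V (E 0 * q)" "V (F 1 * q)" "V (E (- 1) * q)" "V (F 0 * q)" "V (H 0 * q)"
    "V (\<iota> C1 * q)" "V (\<iota> C2 * q)" "V (\<iota> D1 * q)" "V (\<iota> D2 * q)"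
  using assms
proof induction
  case (V_Wt a b q)
  { case 1 show ?case using Wt_E0[OF V_Wt] by (cases b) (auto intro: V_mem V.V_Wt)
  next
    case 2 show ?case using Wt_F1[OF V_Wt] by (cases a) (auto intro: V_mem V.V_Wt)
  next
    case 3 show ?case using V_Wt by (auto intro: V.V_Wt Wt_y0)
  next
    case 4 show ?case using V_Wt by (auto intro: V.V_Wt Wt_y1)
  }
  show "V (H 0 * q)" "V (\<iota> C1 * q)" "V (\<iota> C2 * q)" "V (\<iota> D1 * q)" "V (\<iota> D2 * q)"
    by (rule V.V_Wt[OF Wt_eigen_mult[OF V_Wt Wt_eigen(1)[OF V_Wt]]]
        V.V_Wt[OF Wt_eigen_mult[OF V_Wt Wt_eigen(2)[OF V_Wt]]]
        V.V_Wt[OF Wt_eigen_mult[OF V_Wt Wt_eigen(3)[OF V_Wt]]]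
        V.V_Wt[OF Wt_eigen_mult[OF V_Wt Wt_eigen(4)[OF V_Wt]]]
        V.V_Wt[OF Wt_eigen_mult[OF V_Wt Wt_eigen(5)[OF V_Wt]]])+
qed (simp_all add: distrib_left V_add)

lemma V_comm:
  assumes "x * y = y * x + sc c * z" "c \<noteq> 0" "\<And>q. V q \<Longrightarrow> V (x * q)" "\<And>q. V q \<Longrightarrow> V (y * q)" "V q"
  shows "V (z * q)"
proof -
  have "sc c * (z * q) = x * (y * q) - y * (x * q)"
    using assms(1) by (simp add: mult.assoc[symmetric]) (simp add: algebra_simps)
  then have "V (sc c * (z * q))" using assms(3-5) by (simp add: V_diff)
  then have "V (sc (inverse c) * (sc c * (z * q)))" by (rule V_sc)
  then show ?thesis by (simp only: sc_inverse_cancel[OF assms(2)])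
qed

text \<open>All modes are brackets of the generators: \<open>H 1\<close> shifts the mode of
  \<open>E\<close> and \<open>F\<close> up by one, and the modes of \<open>H\<close> are brackets of
  those of \<open>E\<close> with \<open>F 1\<close>.\<close>

lemma V_mult_pos:
  assumes "V q"
  shows "V (E (int n) * q)" "V (F (int n) * q)" "V (H (int n) * q)"
proof -
  have H1: "V (H 1 * q)" if "V q" for q
    by (rule V_comm[of "E 0" "F 1" 1, OF _ _ V_mult_generators(1,2) that]) (simp_all add: affine_comm(1))
  have E: "V (E (int n) * q)" if "V q" for n q
    using that
  proof (induction n arbitrary: q)
    case (Suc n)
    show ?case
      by (rule V_comm[of "H 1" "E (int n)" 2, OF _ _ H1 Suc.IH Suc.prems]) (simp_all add: affine_comm(3))
  qed (simp add: V_mult_generators)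
  have F: "V (F (int n) * q)" if "V q" for n q
    using that
  proof (induction n arbitrary: q)
    case (Suc n)
    show ?case
      by (rule V_comm[of "H 1" "F (int n)" "- 2", OF _ _ H1 Suc.IH Suc.prems])
        (simp_all add: affine_comm(5) sc_uminus)
  qed (simp add: V_mult_generators)
  have H: "V (H (int n + 1) * q)" if "V q" for n q
    by (rule V_comm[of "E (int n)" "F 1" 1, OF _ _ E V_mult_generators(2) that]) (simp_all add: affine_comm(1))
  show "V (E (int n) * q)" "V (F (int n) * q)" using assms E F by auto
  show "V (H (int n) * q)" using H[of q "n - 1"] assms V_mult_generators(5) by (cases n) (auto simp: add.commute)
qed

lemma V_mult_neg:
  assumes "V q"
  shows "V (E (- int n) * q)" "V (F (- int n) * q)" "V (H (- int n) * q)"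
proof -
  have H1: "V (H (- 1) * q)" if "V q" for q
    by (rule V_comm[of "E (- 1)" "F 0" 1, OF _ _ V_mult_generators(3,4) that]) (simp_all add: affine_comm(1))
  have E: "V (E (- int n) * q)" if "V q" for n q
    using that
  proof (induction n arbitrary: q)
    case (Suc n)
    show ?case
      by (rule V_comm[of "H (- 1)" "E (- int n)" 2, OF _ _ H1 Suc.IH Suc.prems]) (simp_all add: affine_comm(3))
  qed (simp add: V_mult_generators)
  have F: "V (F (- int n) * q)" if "V q" for n q
    using that
  proof (induction n arbitrary: q)
    case (Suc n)
    show ?case
      by (rule V_comm[of "H (- 1)" "F (- int n)" "- 2", OF _ _ H1 Suc.IH Suc.prems])
        (simp_all add: affine_comm(5) sc_uminus)
  qed (simp add: V_mult_generators)
  have H: "V (H (- int n - 1) * q)" if "V q" for n q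
    by (rule V_comm[of "E (- 1)" "F (- int n)" 1, OF _ _ V_mult_generators(3) F that])
      (simp_all add: affine_comm(1) minus_diff_commute)
  show "V (E (- int n) * q)" "V (F (- int n) * q)" using assms E F by auto
  show "V (H (- int n) * q)"
    using H[of q "n - 1"] assms V_mult_generators(5) by (cases n) (auto simp: minus_diff_commute)
qed

lemma V_mult: "V q \<Longrightarrow> V (\<iota> (Loop b m 0) * q)"
  using V_mult_pos[of q "nat m"] V_mult_neg[of q "nat (- m)"] by (cases b; cases "m \<ge> 0") auto

text \<open>Moving a mode past \<open>E (- 1)\<close> lowers it by one, so the bound rises with each
  such letter. It depends on the vector, which is why later statements about large modes all begin
  with the existence of a bound.\<close>

lemma Wt_annihilated:
  assumes "Wt a b q"
  shows "\<exists>M. \<forall>m\<ge>M. \<forall>x. \<iota> (Loop x m 0) * q \<in> K"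
  using assms
proof induction
  case (Wt_mem q a b)
  then show ?case by (auto intro: mult_mem)
next
  case Wt_1
  have "\<iota> (Loop x m 0) * 1 \<in> K" if "m \<ge> 1" for x m
    using that E_mem[of m] F_mem[of m] H_mem[of m] by (cases x) auto
  then show ?case by blast
next
  case (Wt_y0 a b q)
  then obtain M where M: "\<And>m x. m \<ge> M \<Longrightarrow> \<iota> (Loop x m 0) * q \<in> K" by blast
  \<comment> \<open>The bound 2 keeps \<open>m\<close> away from 1, where the commutator with
    \<open>E (- 1)\<close> has a central term.\<close>
  have "\<iota> (Loop x m 0) * (E (- 1) * q) \<in> K" if "m \<ge> max 2 (M + 1)" for m x
  proof -
    have "\<iota> (Loop x m 0) * (E (- 1) * q) =
        E (- 1) * (\<iota> (Loop x m 0) * q) + sc (sl2_coeff x BE) * (\<iota> (Loop (sl2_prod x BE) (m - 1) 0) * q)"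
      using that by (simp add: mult.assoc[symmetric] Loop_comm[of x m 0 BE]) (simp add: algebra_simps)
    then show ?thesis using M that by (simp add: add_mem mult_mem)
  qed
  then show ?case by blast
next
  case (Wt_y1 a b q)
  then obtain M where M: "\<And>m x. m \<ge> M \<Longrightarrow> \<iota> (Loop x m 0) * q \<in> K" by blast
  have "\<iota> (Loop x m 0) * (F 0 * q) \<in> K" if "m \<ge> max 2 (M + 1)" for m x
  proof -
    have "\<iota> (Loop x m 0) * (F 0 * q) =
        F 0 * (\<iota> (Loop x m 0) * q) + sc (sl2_coeff x BF) * (\<iota> (Loop (sl2_prod x BF) m 0) * q)"
      using that by (simp add: mult.assoc[symmetric] Loop_comm[of x m 0 BF]) (simp add: algebra_simps)
    then show ?thesis using M that by (simp add: add_mem mult_mem)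
  qed
  then show ?case by blast
next
  case (Wt_add a b p q)
  then obtain M1 M2 where "\<And>m x. m \<ge> M1 \<Longrightarrow> \<iota> (Loop x m 0) * p \<in> K"
    "\<And>m x. m \<ge> M2 \<Longrightarrow> \<iota> (Loop x m 0) * q \<in> K" by blast
  then have "\<forall>m\<ge>max M1 M2. \<forall>x. \<iota> (Loop x m 0) * (p + q) \<in> K"
    by (simp add: distrib_left add_mem)
  then show ?case by blast
next
  case (Wt_sc a b q c)
  then show ?case by (auto simp: sc_left_comm[of "\<iota> _"] intro: mult_mem)
qed

lemma V_annihilated:
  assumes "V q"
  shows "\<exists>M. \<forall>m\<ge>M. \<forall>x. \<iota> (Loop x m 0) * q \<in> K"
  using assms
proof induction
  case (V_add p q)
  then obtain M1 M2 where "\<And>m x. m \<ge> M1 \<Longrightarrow> \<iota> (Loop x m 0) * p \<in> K"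
    "\<And>m x. m \<ge> M2 \<Longrightarrow> \<iota> (Loop x m 0) * q \<in> K" by blast
  then have "\<forall>m\<ge>max M1 M2. \<forall>x. \<iota> (Loop x m 0) * (p + q) \<in> K"
    by (simp add: distrib_left add_mem)
  then show ?case by blast
qed (rule Wt_annihilated)

definition casimir_value :: complex where
  "casimir_value = 4 * (of_nat (n0 + n1) + 2) * l1 + of_nat n1 * of_nat n1 + 2 * of_nat n1"

text \<open>The cut-off operators stabilise on each vector: once \<open>n\<close> passes the bound
  of \<open>Wt_annihilated\<close>, the tail acts by zero and \<open>casimir n\<close> commutes past
  \<open>E (- 1)\<close> on it.\<close>

lemma Wt_casimir:
  assumes "Wt a b q"
  shows "\<exists>N. \<forall>n\<ge>N. eigen K (casimir n) casimir_value q"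
  using assms
proof induction
  case (Wt_mem q a b)
  then show ?case by (auto intro: eigen_mem)
next
  case Wt_1
  have "eigen K (casimir n) casimir_value 1" for n
    unfolding casimir_value_def
    by (rule casimir_eigen) (use eigen_1 E_mem F_mem H_mem in auto)
  then show ?case by blast
next
  case (Wt_y0 a b q)
  obtain M where M: "\<And>m x. m \<ge> M \<Longrightarrow> \<iota> (Loop x m 0) * q \<in> K" using Wt_annihilated[OF Wt_y0(1)] by blast
  obtain N where N: "\<And>n. n \<ge> N \<Longrightarrow> eigen K (casimir n) casimir_value q" using Wt_y0 by blast
  have "eigen K (casimir n) casimir_value (E (- 1) * q)" if n: "n \<ge> max 1 (max N (nat M))" for n
  proof -
    have "casimir n * (E (- 1) * q) - sc casimir_value * (E (- 1) * q) =
        E (- 1) * (casimir n * q - sc casimir_value * q) + casimir_tail (int n) * q"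
      using n casimir_E[of n]
      by (simp add: mult.assoc[symmetric]) (simp add: algebra_simps sc_left_comm[of "E (- 1)"])
    moreover have "casimir_tail (int n) * q \<in> K"
      using M[of "int n"] n by (simp add: nat_le_iff casimir_tail_def left_diff_distrib mult.assoc diff_mem mult_mem)
    ultimately show ?thesis using N[of n] n unfolding eigen_def by (auto intro!: add_mem mult_mem)
  qed
  then show ?case by blast
next
  case (Wt_y1 a b q)
  obtain N where N: "\<And>n. n \<ge> N \<Longrightarrow> eigen K (casimir n) casimir_value q" using Wt_y1 by blast
  have "eigen K (casimir n) (casimir_value + 0) (F 0 * q)" if n: "n \<ge> N" for n
    by (rule eigen_mult[OF _ N[OF n]]) (simp add: casimir_F)
  then show ?case by auto
next
  case (Wt_add a b p q)
  then obtain N1 N2 where "\<And>n. n \<ge> N1 \<Longrightarrow> eigen K (casimir n) casimir_value p"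
    "\<And>n. n \<ge> N2 \<Longrightarrow> eigen K (casimir n) casimir_value q" by blast
  then have "\<forall>n\<ge>max N1 N2. eigen K (casimir n) casimir_value (p + q)" by (simp add: eigen_add)
  then show ?case by blast
next
  case (Wt_sc a b q c)
  then show ?case by (auto intro: eigen_sc)
qed

lemma Wt_0_0: 
  assumes "Wt a b q" "a = 0" "b = 0"
  shows "\<exists>c. q - sc c \<in> K"
  using assms
proof induction
  case (Wt_mem q a b)
  then show ?case by (intro exI[of _ 0]) simp
next
  case Wt_1
  show ?case by (intro exI[of _ 1]) simp
next
  case (Wt_add a b p q)
  then obtain c d where "p - sc c \<in> K" "q - sc d \<in> K" by auto
  then have "(p + q) - sc (c + d) \<in> K" using add_mem by (force simp: sc_add algebra_simps)
  then show ?case ..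
next
  case (Wt_sc a b q c)
  then obtain d where "q - sc d \<in> K" by auto
  then have "sc c * (q - sc d) \<in> K" by (rule mult_mem)
  then have "sc c * q - sc (c * d) \<in> K" by (simp add: right_diff_distrib sc_mult)
  then show ?case ..
qed auto

text \<open>\<open>E (- 1)\<close> belongs to a real root, so the cube of its adjoint action is
  zero: loop elements go from f to h to e, and central terms are killed at the next step. The
  starting point on the cyclic vector is \<open>power_y0\<close>.\<close>

lemma y0_nilpotent: "\<exists>n. E (- 1) ^ n * p \<in> K"
proof (rule locally_nilpotent[OF _ power_y0])
  fix b
  show "\<exists>a1 a2. E (- 1) * \<iota> b = \<iota> b * E (- 1) + a1 \<and> E (- 1) * a1 = a1 * E (- 1) + a2 \<and> E (- 1) * a2 = a2 * E (- 1)"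
  proof (cases b)
    case (Loop x m n)
    let ?E = "\<iota> (Loop BE (m - 1) n)" and ?E2 = "\<iota> (Loop BE (m - 2) n)" and ?H = "\<iota> (Loop BH (m - 1) n)"
    have c: "E (- 1) * ?E = ?E * E (- 1)" "E (- 1) * ?E2 = ?E2 * E (- 1)"
      by (subst Loop_comm; simp)+
    show ?thesis
    proof (cases x)
      case BE
      then show ?thesis using Loop by (intro exI[of _ 0]) (simp add: Loop_comm[of BE "- 1" 0 BE m n])
    next
      case BH
      have "E (- 1) * \<iota> (Loop BH m n) = \<iota> (Loop BH m n) * E (- 1) + - (2 * ?E)"
        by (simp add: Loop_comm[of BE _ _ BH] sc_uminus)
      moreover have "E (- 1) * - (2 * ?E) = - (2 * ?E) * E (- 1) + 0" "E (- 1) * 0 = 0 * E (- 1)"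
        using c by (simp_all add: mult_2 distrib_left distrib_right left_diff_distrib right_diff_distrib)
      ultimately show ?thesis unfolding Loop BH by blast
    next
      case BF
      let ?c = "if - 1 = - m \<and> 0 = - n then - \<iota> C1 else 0"
      have "E (- 1) * ?c = ?c * E (- 1)" by (simp add: central)
      moreover have "E (- 1) * ?H = ?H * E (- 1) + - (2 * ?E2)"
        by (simp add: Loop_comm[of BE _ _ BH] sc_uminus)
      moreover have "E (- 1) * (- (2 * ?E2)) = - (2 * ?E2) * E (- 1)"
        using c by (simp add: mult_2 distrib_left distrib_right left_diff_distrib right_diff_distrib)
      moreover have "E (- 1) * \<iota> (Loop BF m n) = \<iota> (Loop BF m n) * E (- 1) + (?H + ?c)"
        by (simp add: Loop_comm[of BE _ _ BF] add.assoc)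
      ultimately have "E (- 1) * \<iota> (Loop BF m n) = \<iota> (Loop BF m n) * E (- 1) + (?H + ?c) \<and>
          E (- 1) * (?H + ?c) = (?H + ?c) * E (- 1) + - (2 * ?E2) \<and>
          E (- 1) * - (2 * ?E2) = - (2 * ?E2) * E (- 1)"
        by (simp only: distrib_left distrib_right add_ac)
      then show ?thesis unfolding Loop BF by blast
    qed
  next
    case C1 then show ?thesis by (intro exI[of _ 0]) (simp add: central)
  next
    case C2 then show ?thesis by (intro exI[of _ 0]) (simp add: central)
  next
    case D1
    have "E (- 1) * \<iota> D1 = \<iota> D1 * E (- 1) + E (- 1)" by (simp add: D_comm)
    moreover have "E (- 1) * E (- 1) = E (- 1) * E (- 1) + 0" "E (- 1) * 0 = 0 * E (- 1)" by simp_all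
    ultimately show ?thesis unfolding D1 by blast
  next
    case D2 then show ?thesis by (intro exI[of _ 0]) (simp add: D_comm)
  qed
qed

lemma y1_nilpotent: "\<exists>n. F 0 ^ n * p \<in> K"
proof (rule locally_nilpotent[OF _ power_y1])
  fix b
  show "\<exists>a1 a2. F 0 * \<iota> b = \<iota> b * F 0 + a1 \<and> F 0 * a1 = a1 * F 0 + a2 \<and> F 0 * a2 = a2 * F 0"
  proof (cases b)
    case (Loop x m n)
    let ?F = "\<iota> (Loop BF m n)" and ?H = "\<iota> (Loop BH m n)"
    have c: "F 0 * ?F = ?F * F 0" by (subst Loop_comm; simp)
    have cH: "F 0 * ?H = ?H * F 0 + 2 * ?F" by (simp add: Loop_comm[of BF _ _ BH])
    show ?thesis
    proof (cases x)
      case BF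
      then show ?thesis using Loop c by (intro exI[of _ 0]) simp
    next
      case BH
      have "F 0 * (2 * ?F) = (2 * ?F) * F 0 + 0" "F 0 * 0 = 0 * F 0"
        using c by (simp_all add: mult_2 distrib_left distrib_right left_diff_distrib right_diff_distrib)
      with cH show ?thesis unfolding Loop BH by blast
    next
      case BE
      have "F 0 * \<iota> (Loop BE m n) = \<iota> (Loop BE m n) * F 0 + - ?H"
        by (simp add: Loop_comm[of BF _ _ BE] sc_uminus)
      moreover have "F 0 * - ?H = - ?H * F 0 + - (2 * ?F)" using cH by simp
      moreover have "F 0 * - (2 * ?F) = - (2 * ?F) * F 0"
        using c by (simp add: mult_2 distrib_left distrib_right left_diff_distrib right_diff_distrib)
      ultimately show ?thesis unfolding Loop BE by blast
    qed
  next
    case C1 then show ?thesis by (intro exI[of _ 0]) (simp add: central)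
  next
    case C2 then show ?thesis by (intro exI[of _ 0]) (simp add: central)
  next
    case D1 then show ?thesis by (intro exI[of _ 0]) (simp add: D_comm)
  next
    case D2 then show ?thesis by (intro exI[of _ 0]) (simp add: D_comm)
  qed
qed

text \<open>With \<nu> the weight of \<open>q\<close>, equality of the Casimir eigenvalues reads
  (\<lambda> - \<nu> | \<lambda> + \<nu> + 2\<rho>) = 0. Since \<lambda> - \<nu> = a\<alpha>_0 +
  b\<alpha>_1 and local nilpotency makes \<nu> dominant with labels \<open>i\<close> and
  \<open>j\<close>, this is the vanishing of \<open>a * (i + n0 + 2) + b * (j + n1 + 2)\<close>, a
  sum of nonnegative terms.\<close>

lemma singular_weight:
  assumes q: "Wt a b q" "q \<notin> K" and sing: "E 0 * q \<in> K" "F 1 * q \<in> K"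
  shows "a = 0 \<and> b = 0"
proof -
  let ?k = "of_nat (n0 + n1) :: complex"
  define \<mu> where "\<mu> = (of_nat n1 + 2 * of_nat a - 2 * of_nat b :: complex)"
  have H: "eigen K (H 0) \<mu> q" using Wt_eigen(1)[OF q(1)] by (simp add: \<mu>_def)
  have D: "eigen K (\<iota> D1) (l1 - of_nat a) q" and C: "eigen K (\<iota> C1) ?k q"
    using Wt_eigen[OF q(1)] by auto
  obtain j where j: "\<mu> = of_nat j"
    using sl2_dominant[of "E 0" "F 0" "H 0", OF _ _ H sing(1) _ q(2)] y1_nilpotent[of q]
    by (force simp: affine_comm(1,5))
  have "eigen K (- H 0 + \<iota> C1) (- \<mu> + ?k) q"
    using eigen_op_add[OF eigen_op_mult[OF eigen_op_sc[of "- 1"] H] C] by (simp add: sc_uminus)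
  moreover have "F 1 * E (- 1) = E (- 1) * F 1 + (- H 0 + \<iota> C1)"
    by (simp add: affine_comm(2))
  moreover have "(- H 0 + \<iota> C1) * E (- 1) = E (- 1) * (- H 0 + \<iota> C1) - 2 * E (- 1)"
    by (simp add: left_diff_distrib right_diff_distrib affine_comm(3) central)
  ultimately obtain i where i: "- \<mu> + ?k = of_nat i"
    using sl2_dominant[of "F 1" "E (- 1)" "- H 0 + \<iota> C1", OF _ _ _ sing(2) _ q(2)] y0_nilpotent[of q] by blast
  obtain N where N: "\<forall>n\<ge>N. eigen K (casimir n) casimir_value q" using Wt_casimir[OF q(1)] by blast
  have "eigen K (casimir N) (4 * (?k + 2) * (l1 - of_nat a) + \<mu> * \<mu> + 2 * \<mu>) q"
    by (rule casimir_eigen[OF C D H sing(1)]) (use affine_pos_mem[OF sing] in auto)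
  with N have eq: "4 * (?k + 2) * (l1 - of_nat a) + \<mu> * \<mu> + 2 * \<mu> = casimir_value"
    using eigen_unique q(2) by blast
  have sum: "?k = of_nat i + of_nat j" using i j by (simp add: algebra_simps)
  have sum': "n0 + n1 = i + j" using sum by (metis of_nat_add of_nat_eq_iff)
  have wt: "int j = int n1 + 2 * int a - 2 * int b"
  proof -
    have "(of_int (int j) :: complex) = of_int (int n1 + 2 * int a - 2 * int b)" using j by (simp add: \<mu>_def)
    then show ?thesis by (simp only: of_int_eq_iff)
  qed
  have "of_int (int a * (int i + int n0 + 2) + int b * (int j + int n1 + 2)) = (0 :: complex)"
  proof -
    have k: "(of_nat n0 :: complex) = of_nat i + of_nat j - of_nat n1" using sum by (simp add: algebra_simps)
    have b: "2 * (of_nat b :: complex) = of_nat n1 + 2 * of_nat a - of_nat j" using j by (simp add: \<mu>_def algebra_simps)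
    have "4 * of_nat a * (?k + 2) = (of_nat j * of_nat j + 2 * of_nat j - (of_nat n1 * of_nat n1 + 2 * of_nat n1) :: complex)"
      using eq unfolding casimir_value_def j by (simp add: algebra_simps)
    then have e2: "4 * of_nat a * (of_nat i + of_nat j + 2) = (of_nat j - of_nat n1) * (of_nat j + of_nat n1 + 2 :: complex)"
      unfolding sum by (simp add: algebra_simps)
    have "2 * (of_nat a * (of_nat i + of_nat n0 + 2) + of_nat b * (of_nat j + of_nat n1 + 2))
       = 2 * of_nat a * (of_nat i + of_nat n0 + 2) + (2 * of_nat b) * (of_nat j + of_nat n1 + 2 :: complex)"
      by (simp add: algebra_simps)
    also have "\<dots> = 4 * of_nat a * (of_nat i + of_nat j + 2) - (of_nat j - of_nat n1) * (of_nat j + of_nat n1 + 2)"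
      unfolding b k by (simp add: algebra_simps)
    also have "\<dots> = 0" using e2 by simp
    finally have "of_nat a * (of_nat i + of_nat n0 + 2) + of_nat b * (of_nat j + of_nat n1 + 2) = (0 :: complex)"
      by (simp only: mult_eq_0_iff zero_neq_numeral[symmetric]) simp
    then show ?thesis by simp
  qed
  then have "int a * (int i + int n0 + 2) + int b * (int j + int n1 + 2) = 0"
    by (simp only: of_int_eq_0_iff)
  then have "int a * (int i + int n0 + 2) = 0" "int b * (int j + int n1 + 2) = 0"
    by (smt (verit) mult_nonneg_nonneg of_nat_0_le_iff)+
  then show ?thesis by auto
qed

lemma V_decompose:
  assumes "V q"
  shows "\<exists>I f. finite I \<and> (\<forall>a b. Wt a b (f (a, b))) \<and> (\<forall>i. i \<notin> I \<longrightarrow> f i = 0) \<and> q = sum f I"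
  using assms
proof induction
  case (V_Wt a b q)
  show ?case
    by (rule exI[of _ "{(a, b)}"], rule exI[of _ "\<lambda>i. if i = (a, b) then q else 0"])
      (use V_Wt in \<open>auto intro: Wt_mem\<close>)
next
  case (V_add p q)
  then obtain I f J g where
    f: "finite I" "\<And>a b. Wt a b (f (a, b))" "\<And>i. i \<notin> I \<Longrightarrow> f i = 0" "p = sum f I" and
    g: "finite J" "\<And>a b. Wt a b (g (a, b))" "\<And>i. i \<notin> J \<Longrightarrow> g i = 0" "q = sum g J" by blast
  have "p = sum f (I \<union> J)" "q = sum g (I \<union> J)"
    unfolding f(4) g(4) using f(1,3) g(1,3) by (auto intro!: sum.mono_neutral_left)
  with f g show ?case
    by (intro exI[of _ "I \<union> J"] exI[of _ "\<lambda>i. f i + g i"]) (auto simp: sum.distrib intro: Wt.Wt_add)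
qed

section \<open>Irreducibility of the top component\<close>

definition submod where "submod q = {p. \<exists>u. p - u * q \<in> K}"

lemma left_ideal_submod: "left_ideal (submod q)"
proof
  show "0 \<in> submod q" by (auto simp: submod_def intro: exI[of _ 0])
next
  fix x y assume "x \<in> submod q" "y \<in> submod q"
  then obtain u v where "x - u * q \<in> K" "y - v * q \<in> K" by (auto simp: submod_def)
  then have "(x + y) - (u + v) * q \<in> K" using add_mem[of "x - u * q" "y - v * q"] by (simp add: algebra_simps)
  then show "x + y \<in> submod q" by (auto simp: submod_def)
next
  fix x u assume "x \<in> submod q"
  then obtain v where "x - v * q \<in> K" by (auto simp: submod_def)
  then have "u * x - (u * v) * q \<in> K" using mult_mem[of "x - v * q" u] by (simp add: algebra_simps)
  then show "u * x \<in> submod q" by (auto simp: submod_def)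
qed

lemma submod_K: "p \<in> K \<Longrightarrow> p \<in> submod q"
  unfolding submod_def by (auto intro: exI[of _ 0])

text \<open>A submodule contains the weight components of its elements. The eigenvalue of
  \<open>\<iota> D1\<close> determines \<open>a\<close>, and that of \<open>H 0\<close> then
  determines \<open>b\<close>, so these two operators separate the weights.\<close>

lemma submod_Wt:
  assumes "V q" "q \<notin> K"
  shows "\<exists>a b r. Wt a b r \<and> r \<in> submod q \<and> r \<notin> K"
proof -
  obtain I f where I: "finite I" and wt: "\<forall>a b. Wt a b (f (a, b))" and q: "q = sum f I"
    using V_decompose[OF assms(1)] by (elim exE conjE) (rule that)
  have "\<exists>i\<in>I. f i \<notin> K"
  proof (rule ccontr)
    assume "\<not> (\<exists>i\<in>I. f i \<notin> K)"
    then have "sum f I \<in> K" by (simp add: sum_mem)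
    with q assms(2) show False by simp
  qed
  then obtain i where i: "i \<in> I" "f i \<notin> K" by (elim bexE)
  define D where "D d = (if d then H 0 else \<iota> D1)" for d
  define \<nu> where "\<nu> i d = (if d then of_nat n1 + 2 * of_nat (fst i) - 2 * of_nat (snd i) else l1 - of_nat (fst i))"
    for i :: "nat \<times> nat" and d
  have e: "eigen K (D d) (\<nu> j d) (f j)" for j d
    using Wt_eigen(1,2)[OF wt[rule_format, of "fst j" "snd j"]] by (simp add: D_def \<nu>_def)
  have "\<exists>d. \<nu> i d \<noteq> \<nu> j d" if "j \<in> I - {i}" for j
  proof (rule ccontr)
    assume "\<nexists>d. \<nu> i d \<noteq> \<nu> j d"
    then have "\<nu> i True = \<nu> j True" "\<nu> i False = \<nu> j False" by simp_all
    then have "fst i = fst j" "snd i = snd j" by (simp_all add: \<nu>_def)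
    with that show False by (auto simp: prod_eq_iff)
  qed
  then have "\<exists>u c. c \<noteq> 0 \<and> u * f i - sc c * f i \<in> K \<and> (\<forall>j\<in>I - {i}. u * f j \<in> K)"
    by (intro eigen_separate[where D = D and \<nu> = \<nu>] e finite_Diff I)
  then obtain u c where u: "c \<noteq> 0" "u * f i - sc c * f i \<in> K" "\<forall>j\<in>I - {i}. u * f j \<in> K"
    by (elim exE conjE)
  have "u * q - sc c * f i = (u * f i - sc c * f i) + (\<Sum>j\<in>I - {i}. u * f j)"
    unfolding q sum.remove[OF I i(1)] by (simp add: distrib_left sum_distrib_left)
  moreover have "(\<Sum>j\<in>I - {i}. u * f j) \<in> K" using u(3) by (intro sum_mem) simp
  ultimately have "u * q - sc c * f i \<in> K" using u(2) by (simp only: add_mem)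
  then have "- (u * q - sc c * f i) \<in> K" by (rule uminus_mem)
  then have "sc (inverse c) * (sc c * f i - u * q) \<in> K" by (intro mult_mem) simp
  then have "f i - sc (inverse c) * u * q \<in> K"
    using sc_inverse_cancel[OF u(1), of "f i"] by (simp only: right_diff_distrib mult.assoc)
  then have "f i \<in> submod q" by (auto simp: submod_def)
  moreover have "Wt (fst i) (snd i) (f i)" using wt[rule_format, of "fst i" "snd i"] by simp
  ultimately show ?thesis using i(2) by (intro exI conjI)
qed

text \<open>Among the weight vectors of \<open>U q + K\<close> outside \<open>K\<close>, one of
  least depth \<open>a + b\<close> is singular, because \<open>E 0\<close> and \<open>F 1\<close>
  reduce the depth by one. A singular vector lies in the top weight space, which is spanned by 1
  modulo \<open>K\<close>.\<close>

theorem V_irreducible: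
  assumes "V q" "q \<notin> K"
  shows "\<exists>u. u * q - 1 \<in> K"
proof -
  interpret L: left_ideal "submod q" by (rule left_ideal_submod)
  define P where "P n \<longleftrightarrow> (\<exists>a b r. a + b = n \<and> Wt a b r \<and> r \<in> submod q \<and> r \<notin> K)" for n
  define m where "m = (LEAST n. P n)"
  obtain a b r where "Wt a b r" "r \<in> submod q" "r \<notin> K" using submod_Wt[OF assms] by (elim exE conjE)
  then have "P (a + b)" unfolding P_def by (intro exI conjI) (rule refl)
  then have "\<exists>n. P n" ..
  then have "P m" unfolding m_def by (rule LeastI_ex)
  then obtain a b r where r: "a + b = m" "Wt a b r" "r \<in> submod q" "r \<notin> K" by (auto simp: P_def)
  have min: "p \<in> K" if "Wt a' b' p" "p \<in> submod q" "a' + b' < m" for a' b' p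
  proof (rule ccontr)
    assume "p \<notin> K"
    with that have "P (a' + b')" unfolding P_def by (intro exI conjI) (rule refl)
    with that show False using not_less_Least[of "a' + b'" P] by (simp add: m_def)
  qed
  have "E 0 * r \<in> K"
  proof (cases b)
    case (Suc b')
    then have "Wt a b' (E 0 * r)" using Wt_E0[OF r(2)] by simp
    then show ?thesis by (rule min) (use r(1) Suc L.mult_mem[OF r(3)] in simp_all)
  qed (use Wt_E0[OF r(2)] in simp)
  moreover have "F 1 * r \<in> K"
  proof (cases a)
    case (Suc a')
    then have "Wt a' b (F 1 * r)" using Wt_F1[OF r(2)] by simp
    then show ?thesis by (rule min) (use r(1) Suc L.mult_mem[OF r(3)] in simp_all)
  qed (use Wt_F1[OF r(2)] in simp)
  ultimately have "a = 0 \<and> b = 0" by (rule singular_weight[OF r(2,4)])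
  then obtain c where c: "r - sc c \<in> K" using Wt_0_0[OF r(2)] by blast
  have "c \<noteq> 0" using c r(4) by auto
  have "sc c \<in> submod q" using L.diff_mem[OF r(3) submod_K[OF c]] by simp
  then have "sc (inverse c) * (sc c * 1) \<in> submod q" using L.mult_mem by simp
  then have "1 \<in> submod q" by (simp only: sc_inverse_cancel[OF \<open>c \<noteq> 0\<close>])
  then obtain u where "1 - u * q \<in> K" by (auto simp: submod_def)
  then have "- (1 - u * q) \<in> K" by (rule uminus_mem)
  then show ?thesis by auto
qed

end

section \<open>Elements of negative degree in the second variable\<close>

text \<open>For central elements and derivations \<open>BH\<close> is an arbitrary default;
  \<open>sl2_part\<close> is meant for letters of nonzero t2-degree, which are loops by
  \<open>Loop_parts\<close>. The value 0 of \<open>deg1\<close> and \<open>deg2\<close> there is the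
  true degree.\<close>

fun sl2_part :: "toroidal_basis \<Rightarrow> sl2_basis" where
  "sl2_part (Loop b m n) = b" | "sl2_part _ = BH"

fun deg1 :: "toroidal_basis \<Rightarrow> int" where
  "deg1 (Loop b m n) = m" | "deg1 _ = 0"

fun deg2 :: "toroidal_basis \<Rightarrow> int" where
  "deg2 (Loop b m n) = n" | "deg2 _ = 0"

lemma Loop_parts: "deg2 a \<noteq> 0 \<Longrightarrow> a = Loop (sl2_part a) (deg1 a) (deg2 a)"
  by (cases a) auto

definition low :: "toroidal_basis list \<Rightarrow> bool" where
  "low w \<longleftrightarrow> (\<forall>a\<in>set w. deg2 a < 0)"

lemma low_simps [simp]: "low []" "low (a # w) \<longleftrightarrow> deg2 a < 0 \<and> low w" "low (u @ w) \<longleftrightarrow> low u \<and> low w"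
  by (auto simp: low_def)

lemma low_mset: "mset u = mset w \<Longrightarrow> low u \<longleftrightarrow> low w"
  unfolding low_def by (metis set_mset_mset)

lemma low_deg2: "low w \<Longrightarrow> sum_list (map deg2 w) \<le> 0"
  by (induction w) auto

lemma finite_uniform_bound:
  fixes P :: "'w \<Rightarrow> int \<Rightarrow> bool"
  assumes "finite S" "\<And>w. w \<in> S \<Longrightarrow> \<exists>M0. \<forall>M\<ge>M0. P w M"
  shows "\<exists>M0. \<forall>M\<ge>M0. \<forall>w\<in>S. P w M"
  using assms
proof (induction S)
  case (insert w S)
  then obtain M1 M2 where "\<forall>M\<ge>M1. P w M" "\<forall>M\<ge>M2. \<forall>w\<in>S. P w M" by blast
  then have "\<forall>M\<ge>max M1 M2. \<forall>w\<in>insert w S. P w M" by simp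
  then show ?case ..
qed auto

context toroidal_alg
begin

definition word where "word w = prod_list (map \<iota> w)"

lemma word_simps [simp]:
  "word [] = 1" "word (a # w) = \<iota> a * word w" "word (u @ w) = word u * word w"
  by (simp_all add: word_def)

lemma word_snoc: "word u * (\<iota> a * p) = word (u @ [a]) * p"
  by (simp add: mult.assoc)

lemma Loop_comm_mult:
  "\<iota> (Loop a r1 r2) * (\<iota> (Loop b s1 s2) * q) = \<iota> (Loop b s1 s2) * (\<iota> (Loop a r1 r2) * q)
     + sc (sl2_coeff a b) * (\<iota> (Loop (sl2_prod a b) (r1 + s1) (r2 + s2)) * q)
     + (if r1 = - s1 \<and> r2 = - s2
        then sc (sl2_basis_form a b * of_int r1) * (\<iota> C1 * q) + sc (sl2_basis_form a b * of_int r2) * (\<iota> C2 * q)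
        else 0)"
proof -
  have "\<iota> (Loop a r1 r2) * (\<iota> (Loop b s1 s2) * q) = (\<iota> (Loop a r1 r2) * \<iota> (Loop b s1 s2)) * q"
    by (simp only: mult.assoc)
  also have "\<dots> = \<iota> (Loop b s1 s2) * (\<iota> (Loop a r1 r2) * q)
     + sc (sl2_coeff a b) * (\<iota> (Loop (sl2_prod a b) (r1 + s1) (r2 + s2)) * q)
     + (if r1 = - s1 \<and> r2 = - s2
        then sc (sl2_basis_form a b) * (sc (of_int r1) * \<iota> C1 + sc (of_int r2) * \<iota> C2) else 0) * q"
    unfolding Loop_comm[of a r1 r2] sc_of_int by (simp only: distrib_right mult.assoc)
  also have "(if r1 = - s1 \<and> r2 = - s2
        then sc (sl2_basis_form a b) * (sc (of_int r1) * \<iota> C1 + sc (of_int r2) * \<iota> C2) else 0) * q =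
     (if r1 = - s1 \<and> r2 = - s2
        then sc (sl2_basis_form a b * of_int r1) * (\<iota> C1 * q) + sc (sl2_basis_form a b * of_int r2) * (\<iota> C2 * q)
        else 0)"
    by (simp only: distrib_left distrib_right mult.assoc sc_mult if_distrib[of "\<lambda>x. x * q"] mult_zero_left)
  finally show ?thesis .
qed

lemma Loop_comm_low:
  assumes "deg2 a < 0" "deg2 b < 0"
  shows "\<iota> a * (\<iota> b * q) = \<iota> b * (\<iota> a * q) + sc (sl2_coeff (sl2_part a) (sl2_part b)) *
     (\<iota> (Loop (sl2_prod (sl2_part a) (sl2_part b)) (deg1 a + deg1 b) (deg2 a + deg2 b)) * q)"
  using assms Loop_comm_mult[of "sl2_part a" "deg1 a" "deg2 a" "sl2_part b" "deg1 b" "deg2 b" q]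
    Loop_parts[of a] Loop_parts[of b] by simp

lemma word_central:
  "\<iota> C1 * (word w * q) = word w * (\<iota> C1 * q)" "\<iota> C2 * (word w * q) = word w * (\<iota> C2 * q)"
proof -
  have "c * word w = word w * c" if "\<And>b. c * \<iota> b = \<iota> b * c" for c
    by (induction w) (simp, metis that mult.assoc word_simps(2))
  from this[of "\<iota> C1"] this[of "\<iota> C2"]
  have "\<iota> C1 * word w = word w * \<iota> C1" "\<iota> C2 * word w = word w * \<iota> C2"
    using central by simp_all
  then show "\<iota> C1 * (word w * q) = word w * (\<iota> C1 * q)" "\<iota> C2 * (word w * q) = word w * (\<iota> C2 * q)"
    by (simp_all only: mult.assoc[symmetric])
qed

lemma word_D:
  assumes "low w"
  shows "\<iota> D1 * (word w * q) = word w * (\<iota> D1 * q) + sc (of_int (sum_list (map deg1 w))) * (word w * q)"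
    "\<iota> D2 * (word w * q) = word w * (\<iota> D2 * q) + sc (of_int (sum_list (map deg2 w))) * (word w * q)"
proof -
  have D: "\<iota> D1 * \<iota> a = \<iota> a * \<iota> D1 + of_int (deg1 a) * \<iota> a" "\<iota> D2 * \<iota> a = \<iota> a * \<iota> D2 + of_int (deg2 a) * \<iota> a"
    if "deg2 a < 0" for a
    using D_comm[of "sl2_part a" "deg1 a" "deg2 a"] Loop_parts[of a] that by simp_all
  have i: "x * (of_int k * y) = of_int k * (x * y)" for x y :: 'u and k
    using sc_left_comm[of x "of_int k" y] by simp
  have "\<iota> D1 * word w = word w * \<iota> D1 + of_int (sum_list (map deg1 w)) * word w"
    using assms
  proof (induction w)
    case (Cons a w)
    have "\<iota> D1 * word (a # w) = \<iota> a * (\<iota> D1 * word w) + of_int (deg1 a) * word (a # w)"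
      using Cons.prems D(1)[of a] by (simp add: mult.assoc[symmetric] distrib_right)
    also have "\<dots> = word (a # w) * \<iota> D1 + of_int (sum_list (map deg1 (a # w))) * word (a # w)"
      using Cons by (simp add: distrib_left distrib_right mult.assoc i[of "\<iota> a"] add_ac)
    finally show ?case .
  qed simp
  then show "\<iota> D1 * (word w * q) = word w * (\<iota> D1 * q) + sc (of_int (sum_list (map deg1 w))) * (word w * q)"
    by (simp only: mult.assoc[symmetric] sc_of_int distrib_right)
  have "\<iota> D2 * word w = word w * \<iota> D2 + of_int (sum_list (map deg2 w)) * word w"
    using assms
  proof (induction w)
    case (Cons a w)
    have "\<iota> D2 * word (a # w) = \<iota> a * (\<iota> D2 * word w) + of_int (deg2 a) * word (a # w)"
      using Cons.prems D(2)[of a] by (simp add: mult.assoc[symmetric] distrib_right)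
    also have "\<dots> = word (a # w) * \<iota> D2 + of_int (sum_list (map deg2 (a # w))) * word (a # w)"
      using Cons by (simp add: distrib_left distrib_right mult.assoc i[of "\<iota> a"] add_ac)
    finally show ?case .
  qed simp
  then show "\<iota> D2 * (word w * q) = word w * (\<iota> D2 * q) + sc (of_int (sum_list (map deg2 w))) * (word w * q)"
    by (simp only: mult.assoc[symmetric] sc_of_int distrib_right)
qed

end

section \<open>The filtration by number and total degree of negative letters\<close>

context weyl_ideal
begin

lemma V_eigen_C:
  assumes "V q"
  shows "eigen K (\<iota> C1) (of_nat (n0 + n1)) q" "eigen K (\<iota> C2) 0 q"
  using assms by (induction) (simp_all only: Wt_eigen eigen_add)

text \<open>Commuting with letters of t2-degree zero leaves the degree positive, and no central term
  arises.\<close>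

lemma Wt_pos:
  assumes "Wt a b q" "n \<ge> 1"
  shows "\<iota> (Loop x m n) * q \<in> K"
  using assms
proof (induction arbitrary: x m)
  case (Wt_mem q a b)
  then show ?case by (simp add: mult_mem)
next
  case Wt_1
  then show ?case by (simp add: pos_mem)
next
  case (Wt_y0 a b q)
  then show ?case unfolding Loop_comm_mult[of x m n] by (simp add: add_mem mult_mem)
next
  case (Wt_y1 a b q)
  then show ?case unfolding Loop_comm_mult[of x m n] by (simp add: add_mem mult_mem)
next
  case (Wt_add a b p q)
  then show ?case by (simp add: distrib_left add_mem)
next
  case (Wt_sc a b q c)
  then show ?case by (simp add: sc_left_comm[of "\<iota> _"] mult_mem)
qed

lemma V_pos:
  assumes "V q" "n \<ge> 1"
  shows "\<iota> (Loop x m n) * q \<in> K"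
  using assms by induction (simp_all add: Wt_pos distrib_left add_mem)

text \<open>\<open>Fil l d\<close>: at most \<open>l\<close> factors of negative degree in \<open>t\<^sub>2\<close>, of total degree at least \<open>- d\<close>.\<close>

inductive Fil :: "nat \<Rightarrow> int \<Rightarrow> 'u \<Rightarrow> bool" where
  Fil_mem: "p \<in> K \<Longrightarrow> Fil l d p"
| Fil_word: "V q \<Longrightarrow> low w \<Longrightarrow> length w \<le> l \<Longrightarrow> - sum_list (map deg2 w) \<le> d \<Longrightarrow> Fil l d (word w * q)"
| Fil_add: "Fil l d p \<Longrightarrow> Fil l d q \<Longrightarrow> Fil l d (p + q)"

lemma Fil_0: "Fil l d 0"
  by (rule Fil_mem) simp

lemma Fil_sc: "Fil l d p \<Longrightarrow> Fil l d (sc c * p)"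
proof (induction rule: Fil.induct)
  case (Fil_word q w l d)
  then show ?case using Fil.Fil_word[OF V_sc[OF Fil_word(1), of c] Fil_word(2-4)]
    by (simp only: sc_left_comm[of "word w"])
qed (simp_all only: Fil_mem Fil_add distrib_left mult_mem)

lemma Fil_mono: "Fil l d p \<Longrightarrow> l \<le> l' \<Longrightarrow> d \<le> d' \<Longrightarrow> Fil l' d' p"
proof (induction rule: Fil.induct)
  case (Fil_word q w l d)
  show ?case by (rule Fil.Fil_word) (use Fil_word in simp_all)
qed (simp_all add: Fil_mem Fil_add)

lemma Fil_sum: "(\<And>i. i \<in> I \<Longrightarrow> Fil l d (f i)) \<Longrightarrow> Fil l d (sum f I)"
  by (induction I rule: infinite_finite_induct) (simp_all add: Fil_0 Fil_add)

lemma Fil_low: "Fil l d p \<Longrightarrow> deg2 a < 0 \<Longrightarrow> Fil (Suc l) (d - deg2 a) (\<iota> a * p)"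
proof (induction rule: Fil.induct)
  case (Fil_word q w l d)
  have "Fil (Suc l) (d - deg2 a) (word (a # w) * q)"
    by (rule Fil.Fil_word) (use Fil_word in simp_all)
  then show ?case by (simp add: mult.assoc)
qed (simp_all add: Fil_mem Fil_add distrib_left mult_mem)

text \<open>On meeting a negative letter, a letter of degree \<open>n \<ge> 0\<close> moves on,
  merges with it, or cancels it to a central element. The number of negative letters never grows,
  and the total degree rises by \<open>n\<close>. At the right end the letter acts within
  \<open>V\<close> or kills it.\<close>

lemma Fil_nonneg_word:
  assumes "V q" "low w" "n \<ge> 0"
  shows "Fil (length w) (- sum_list (map deg2 w) - n) (\<iota> (Loop x m n) * (word w * q))"
  using assms(2,3)
proof (induction w arbitrary: x m n)
  case Nil
  show ?case
  proof (cases "n = 0")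
    case True
    have "Fil 0 0 (word [] * (\<iota> (Loop x m 0) * q))" by (rule Fil_word) (simp_all add: V_mult assms(1))
    with True show ?thesis by simp
  next
    case False
    with Nil show ?thesis using V_pos[OF assms(1), of n] by (simp add: Fil_mem)
  qed
next
  case (Cons a w)
  let ?P = "word w * q" and ?d = "- sum_list (map deg2 (a # w)) - n"
  let ?z = "\<iota> (Loop x m n)" and ?y = "sl2_part a"
  have a: "a = Loop ?y (deg1 a) (deg2 a)" "deg2 a < 0" "low w"
    using Cons.prems Loop_parts[of a] by auto
  have "Fil (Suc (length w)) (- sum_list (map deg2 w) - n - deg2 a) (\<iota> a * (?z * ?P))"
    by (rule Fil_low[OF Cons.IH[OF a(3) Cons.prems(2)] a(2)])
  then have 1: "Fil (length (a # w)) ?d (\<iota> a * (?z * ?P))" by (rule Fil_mono) simp_all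
  let ?l = "Loop (sl2_prod x ?y) (m + deg1 a) (n + deg2 a)"
  have 2: "Fil (length (a # w)) ?d (sc (sl2_coeff x ?y) * (\<iota> ?l * ?P))"
  \<comment> \<open>A merged letter of nonnegative degree continues to the right; one of negative
    degree takes the place of \<open>a\<close>.\<close>
  proof (rule Fil_sc, cases "n + deg2 a \<ge> 0")
    case True
    from Cons.IH[OF a(3) this] show "Fil (length (a # w)) ?d (\<iota> ?l * ?P)"
      by (rule Fil_mono) simp_all
  next
    case False
    have "Fil (length (a # w)) ?d (word (?l # w) * q)"
      by (rule Fil_word) (use a False assms(1) in simp_all)
    then show "Fil (length (a # w)) ?d (\<iota> ?l * ?P)" by (simp add: mult.assoc)
  qed
  have 3: "Fil (length (a # w)) ?d (sc c * (\<iota> C1 * ?P) + sc c' * (\<iota> C2 * ?P))"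
    if "n = - deg2 a" for c c'
    unfolding word_central
    by (intro Fil_add Fil_sc Fil_word V_mult_generators assms(1) a(3)) (use that in simp_all)
  have "?z * (word (a # w) * q) = \<iota> a * (?z * ?P) + sc (sl2_coeff x ?y) * (\<iota> ?l * ?P)
     + (if m = - deg1 a \<and> n = - deg2 a
        then sc (sl2_basis_form x ?y * of_int m) * (\<iota> C1 * ?P) + sc (sl2_basis_form x ?y * of_int n) * (\<iota> C2 * ?P)
        else 0)"
    using Loop_comm_mult[of x m n ?y "deg1 a" "deg2 a" ?P] a(1) by (simp add: mult.assoc)
  also have "Fil (length (a # w)) ?d \<dots>"
  proof (rule Fil_add[OF Fil_add[OF 1 2]])
    show "Fil (length (a # w)) ?d (if m = - deg1 a \<and> n = - deg2 a
        then sc (sl2_basis_form x ?y * of_int m) * (\<iota> C1 * ?P) + sc (sl2_basis_form x ?y * of_int n) * (\<iota> C2 * ?P)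
        else 0)"
    proof (cases "m = - deg1 a \<and> n = - deg2 a")
      case True
      then have "n = - deg2 a" by simp
      from 3[OF this] show ?thesis unfolding if_P[OF True] .
    next
      case False
      show ?thesis unfolding if_not_P[OF False] by (rule Fil_0)
    qed
  qed
  finally show ?case .
qed

lemma Fil_nonneg:
  assumes "Fil l d p" "n \<ge> 0"
  shows "Fil l (d - n) (\<iota> (Loop x m n) * p)"
  using assms
proof (induction rule: Fil.induct)
  case (Fil_word q w l d)
  then show ?case using Fil_mono[OF Fil_nonneg_word[OF Fil_word(1,2), of n x m]] by simp
qed (simp_all add: Fil_mem Fil_add distrib_left mult_mem)

lemma Fil_CD:
  assumes "Fil l d p" "b \<in> {C1, C2, D1, D2}"
  shows "Fil l d (\<iota> b * p)"
  using assms
proof (induction rule: Fil.induct)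
  case (Fil_word q w l d)
  have "Fil l d (word w * (\<iota> b * q))"
    by (rule Fil.Fil_word) (use Fil_word V_mult_generators[OF Fil_word(1)] in auto)
  moreover have "Fil l d (sc c * (word w * q))" for c
    by (rule Fil_sc, rule Fil.Fil_word) (use Fil_word in auto)
  ultimately have "Fil l d (word w * (\<iota> b * q))" "Fil l d (word w * (\<iota> b * q) + sc c * (word w * q))" for c
    by (simp_all only: Fil_add)
  then show ?case using Fil_word(5) by (auto simp only: word_central word_D[OF Fil_word(2)])
qed (simp_all add: Fil_mem Fil_add distrib_left mult_mem)

lemma Fil_exhaust: "\<exists>l d. Fil l d p"
proof -
  have "p \<in> {p. \<exists>l d. Fil l d p}"
  proof (rule generated)
    have "Fil 0 0 (word [] * 1)" by (rule Fil_word) (simp_all add: V_1)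
    then show "1 \<in> {p. \<exists>l d. Fil l d p}" by auto
  next
    fix p q assume "p \<in> {p. \<exists>l d. Fil l d p}" "q \<in> {p. \<exists>l d. Fil l d p}"
    then obtain l d l' d' where "Fil l d p" "Fil l' d' q" by auto
    then have "Fil (max l l') (max d d') (p + q)"
      by (intro Fil_add) (auto elim: Fil_mono)
    then show "p + q \<in> {p. \<exists>l d. Fil l d p}" by auto
  next
    fix c p assume "p \<in> {p. \<exists>l d. Fil l d p}"
    then obtain l d where "Fil l d p" by auto
    from Fil_sc[OF this] show "sc c * p \<in> {p. \<exists>l d. Fil l d p}" by blast
  next
    fix b p assume "p \<in> {p. \<exists>l d. Fil l d p}"
    then obtain l d where *: "Fil l d p" by auto
    consider x m n where "b = Loop x m n" "n \<ge> 0" | "deg2 b < 0" | "b \<in> {C1, C2, D1, D2}"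
      by (cases b) force+
    then have "\<exists>l d. Fil l d (\<iota> b * p)"
    proof cases
      case 1 then show ?thesis using Fil_nonneg[OF *] by blast
    next
      case 2 then show ?thesis using Fil_low[OF *] by blast
    next
      case 3 then show ?thesis using Fil_CD[OF *] by blast
    qed
    then show "\<iota> b * p \<in> {p. \<exists>l d. Fil l d p}" by auto
  qed
  then show ?thesis by simp
qed

text \<open>Words of negative letters have total degree at most zero, so a negative bound leaves
  only elements of \<open>K\<close>. This is what ends the descent in
  \<open>irreducible\<close>.\<close>

lemma Fil_neg: "Fil l d p \<Longrightarrow> d < 0 \<Longrightarrow> p \<in> K"
proof (induction rule: Fil.induct)
  case (Fil_word q w l d)
  then show ?case using low_deg2[of w] by simp
qed (simp_all add: add_mem)

lemma Fil_V: "Fil l d p \<Longrightarrow> l = 0 \<Longrightarrow> V p"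
  by (induction rule: Fil.induct) (simp_all add: V_mem V_add)

lemma Fil_move:
  assumes "V q"
  shows "low (a # x @ y) \<Longrightarrow>
    Fil (length x + length y) (- sum_list (map deg2 (a # x @ y))) (word (a # x @ y) * q - word (x @ a # y) * q)"
proof (induction x)
  case Nil
  show ?case by (simp add: Fil_0)
next
  case (Cons b x)
  let ?P = "word (x @ y) * q"
  let ?l = "Loop (sl2_prod (sl2_part a) (sl2_part b)) (deg1 a + deg1 b) (deg2 a + deg2 b)"
  have l: "deg2 a < 0" "deg2 b < 0" "low (a # x @ y)" "low (x @ y)" using Cons.prems by simp_all
  have "Fil (Suc (length x + length y)) (- sum_list (map deg2 (a # x @ y)) - deg2 b)
      (\<iota> b * (word (a # x @ y) * q - word (x @ a # y) * q))"
    by (rule Fil_low[OF Cons.IH[OF l(3)] l(2)])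
  then have 1: "Fil (length (b # x) + length y) (- sum_list (map deg2 (a # (b # x) @ y)))
      (\<iota> b * (word (a # x @ y) * q - word (x @ a # y) * q))" by (rule Fil_mono) simp_all
  have "Fil (length (b # x) + length y) (- sum_list (map deg2 (a # (b # x) @ y))) (word (?l # x @ y) * q)"
    by (rule Fil_word) (use l assms in simp_all)
  then have 2: "Fil (length (b # x) + length y) (- sum_list (map deg2 (a # (b # x) @ y)))
      (sc (sl2_coeff (sl2_part a) (sl2_part b)) * (\<iota> ?l * ?P))"
    by (intro Fil_sc) (simp add: mult.assoc)
  have "word (a # (b # x) @ y) * q - word ((b # x) @ a # y) * q =
     \<iota> b * (word (a # x @ y) * q - word (x @ a # y) * q) + sc (sl2_coeff (sl2_part a) (sl2_part b)) * (\<iota> ?l * ?P)"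
    using Loop_comm_low[OF l(1,2), of ?P] by (simp add: mult.assoc right_diff_distrib)
  then show ?case using Fil_add[OF 1 2] by simp
qed

text \<open>Exchanging neighbours merges two letters into one of the same total degree, so
  reordering is free up to shorter words within the same degree bound. Hence only the multiset of a
  longest word matters.\<close>

lemma Fil_perm:
  assumes "V q" "low w" "mset w = mset w'"
  shows "Fil (length w - 1) (- sum_list (map deg2 w)) (word w * q - word w' * q)"
  using assms(2,3)
proof (induction w arbitrary: w')
  case Nil
  then show ?case by (simp add: Fil_0)
next
  case (Cons a w)
  then have "a \<in> set w'" by (metis list.set_intros(1) set_mset_mset)
  then obtain x y where w': "w' = x @ a # y" by (metis split_list)
  with Cons.prems have m: "mset w = mset (x @ y)" by simp
  have len: "length w = length x + length y" using mset_eq_length[OF m] by simp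
  have deg: "sum_list (map deg2 w) = sum_list (map deg2 (x @ y))"
    by (metis m mset_map sum_mset_sum_list)
  have lw: "low w" "deg2 a < 0" "low (a # x @ y)" using Cons.prems low_mset[OF m] by simp_all
  have 1: "Fil (length (a # w) - 1) (- sum_list (map deg2 (a # w))) (\<iota> a * (word w * q - word (x @ y) * q))"
  proof (cases "w = []")
    case True
    with m show ?thesis by (simp add: Fil_0)
  next
    case False
    have "Fil (Suc (length w - 1)) (- sum_list (map deg2 w) - deg2 a) (\<iota> a * (word w * q - word (x @ y) * q))"
      by (rule Fil_low[OF Cons.IH[OF lw(1) m] lw(2)])
    then show ?thesis by (rule Fil_mono) (use False in simp_all)
  qed
  have 2: "Fil (length (a # w) - 1) (- sum_list (map deg2 (a # w))) (word (a # x @ y) * q - word (x @ a # y) * q)"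
    using Fil_move[OF assms(1) lw(3)] len deg by simp
  have "word (a # w) * q - word w' * q =
      \<iota> a * (word w * q - word (x @ y) * q) + (word (a # x @ y) * q - word (x @ a # y) * q)"
    by (simp add: w' mult.assoc right_diff_distrib)
  then show ?case using Fil_add[OF 1 2] by simp
qed

text \<open>The coefficient function is total and zero off \<open>S\<close>, which lets two
  decompositions be added over the union of their supports.\<close>

lemma Fil_decompose:
  assumes "Fil l d p"
  shows "\<exists>S v. finite S \<and> (\<forall>w\<in>S. low w \<and> length w \<le> l \<and> - sum_list (map deg2 w) \<le> d) \<and>
    (\<forall>w. V (v w)) \<and> (\<forall>w. w \<notin> S \<longrightarrow> v w = 0) \<and> p - (\<Sum>w\<in>S. word w * v w) \<in> K"
  using assms
proof induction
  case (Fil_mem p l d)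
  then show ?case by (intro exI[of _ "{}"] exI[of _ "\<lambda>_. 0"]) (simp add: V_mem)
next
  case (Fil_word q w l d)
  show ?case
    by (rule exI[of _ "{w}"], rule exI[of _ "\<lambda>u. if u = w then q else 0"])
      (use Fil_word in \<open>simp add: V_mem\<close>)
next
  case (Fil_add l d p q)
  obtain S v where S: "finite S" "\<forall>w\<in>S. low w \<and> length w \<le> l \<and> - sum_list (map deg2 w) \<le> d"
    and v: "\<forall>w. V (v w)" "\<forall>w. w \<notin> S \<longrightarrow> v w = 0" and p: "p - (\<Sum>w\<in>S. word w * v w) \<in> K"
    using Fil_add.IH(1) by (elim exE conjE) (rule that)
  obtain T u where T: "finite T" "\<forall>w\<in>T. low w \<and> length w \<le> l \<and> - sum_list (map deg2 w) \<le> d"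
    and u: "\<forall>w. V (u w)" "\<forall>w. w \<notin> T \<longrightarrow> u w = 0" and q: "q - (\<Sum>w\<in>T. word w * u w) \<in> K"
    using Fil_add.IH(2) by (elim exE conjE) (rule that)
  have "(\<Sum>w\<in>S. word w * v w) = (\<Sum>w\<in>S \<union> T. word w * v w)"
    using S(1) T(1) v(2) by (intro sum.mono_neutral_left) auto
  moreover have "(\<Sum>w\<in>T. word w * u w) = (\<Sum>w\<in>S \<union> T. word w * u w)"
    using S(1) T(1) u(2) by (intro sum.mono_neutral_left) auto
  ultimately have "(p + q) - (\<Sum>w\<in>S \<union> T. word w * (v w + u w)) =
      (p - (\<Sum>w\<in>S. word w * v w)) + (q - (\<Sum>w\<in>T. word w * u w))"
    by (simp add: distrib_left sum.distrib)
  then have "(p + q) - (\<Sum>w\<in>S \<union> T. word w * (v w + u w)) \<in> K" using add_mem[OF p q] by (simp only:)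
  moreover have "\<forall>w. V (v w + u w)" using v u V_add by simp
  moreover have "\<forall>w. w \<notin> S \<union> T \<longrightarrow> v w + u w = 0" using v u by simp
  moreover have "\<forall>w\<in>S \<union> T. low w \<and> length w \<le> l \<and> - sum_list (map deg2 w) \<le> d" using S T by blast
  ultimately show ?case using S(1) T(1) by (intro exI[of _ "S \<union> T"] exI[of _ "\<lambda>w. v w + u w"]) simp
qed

end

text \<open>By invariance of the form the expression is the pairing of [b,x] with y'. It isolates
  \<open>y\<close> when [b,x] is a multiple of the basis vector dual to \<open>y\<close>: as (b,x)
  the pairs (h,f), (h,e) and (e,f) serve e, f and h.\<close>

lemma sl2_separate:
  "\<exists>x b. \<forall>y'. (sl2_coeff x y' * sl2_basis_form b (sl2_prod x y') \<noteq> 0) = (y' = y)"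
proof -
  have "\<forall>y'. (sl2_coeff BF y' * sl2_basis_form BH (sl2_prod BF y') \<noteq> 0) = (y' = BE)"
    "\<forall>y'. (sl2_coeff BE y' * sl2_basis_form BH (sl2_prod BE y') \<noteq> 0) = (y' = BF)"
    "\<forall>y'. (sl2_coeff BF y' * sl2_basis_form BE (sl2_prod BF y') \<noteq> 0) = (y' = BH)"
    by (rule allI, case_tac y'; simp)+
  then show ?thesis by (cases y) blast+
qed

lemma sum_nth_eq_count:
  fixes c :: "'u::ring_1"
  shows "(\<Sum>i<length w. if w ! i = a then c else 0) = of_nat (count (mset w) a) * c"
  by (induction w) (simp_all add: sum.lessThan_Suc_shift distrib_right add.commute del: sum.lessThan_Suc)

lemma mset_remove_nth: "i < length w \<Longrightarrow> mset w = add_mset (w ! i) (mset (take i w @ drop (Suc i) w))"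
  by (metis id_take_nth_drop mset_append mset.simps(2) union_mset_add_mset_right)

text \<open>\<open>\<Phi>\<close> plays the role of the coefficient of the monomial
  \<open>J\<close>. On words longer than \<open>J\<close> it is controlled only through the
  t1-degree; this suffices because the longer words that have to be discarded contain a letter of
  very negative t1-degree.\<close>

locale weyl_coeff = weyl_ideal +
  fixes J :: "toroidal_basis list" and \<Phi> :: "'a \<Rightarrow> 'a"
  assumes \<Phi>_add: "\<Phi> (x + y) = \<Phi> x + \<Phi> y"
    and \<Phi>_sc: "\<Phi> (sc c * x) = sc c * \<Phi> x"
    and \<Phi>_mem: "x \<in> K \<Longrightarrow> \<Phi> x \<in> K"
    and \<Phi>_right: "deg2 b \<ge> 0 \<Longrightarrow> \<Phi> (x * \<iota> b) = \<Phi> x * \<iota> b"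
    and \<Phi>_short: "low w \<Longrightarrow> length w < length J \<Longrightarrow> \<Phi> (word w) = 0"
    and \<Phi>_eq: "low w \<Longrightarrow> length w = length J \<Longrightarrow> \<Phi> (word w) = (if mset w = mset J then 1 else 0)"
    and \<Phi>_deg: "low w \<Longrightarrow> sum_list (map deg1 w) \<noteq> sum_list (map deg1 J) \<Longrightarrow> \<Phi> (word w) = 0"
begin

lemma \<Phi>_0: "\<Phi> 0 = 0"
  using \<Phi>_add[of 0 0] by simp

lemma \<Phi>_diff: "\<Phi> (x - y) = \<Phi> x - \<Phi> y"
  using \<Phi>_add[of "x - y" y] by simp

lemma \<Phi>_sum: "\<Phi> (sum f I) = (\<Sum>i\<in>I. \<Phi> (f i))"
  by (induction I rule: infinite_finite_induct) (simp_all add: \<Phi>_0 \<Phi>_add)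

text \<open>Elements of the top component come from words in \<open>E (- 1)\<close> and
  \<open>F 0\<close>, both of t2-degree zero, so right linearity lets \<open>\<Phi>\<close> pass
  over them.\<close>

lemma \<Phi>_Wt: "Wt a b q \<Longrightarrow> \<Phi> (u * q) - \<Phi> u * q \<in> K"
proof (induction arbitrary: u rule: Wt.induct)
  case (Wt_mem q a b)
  then show ?case by (simp add: diff_mem mult_mem \<Phi>_mem)
next
  case (Wt_y0 a b q)
  from Wt_y0.IH[of "u * E (- 1)"] show ?case by (simp add: \<Phi>_right mult.assoc)
next
  case (Wt_y1 a b q)
  from Wt_y1.IH[of "u * F 0"] show ?case by (simp add: \<Phi>_right mult.assoc)
next
  case (Wt_add a b p q)
  have "\<Phi> (u * (p + q)) - \<Phi> u * (p + q) = (\<Phi> (u * p) - \<Phi> u * p) + (\<Phi> (u * q) - \<Phi> u * q)"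
    by (simp add: distrib_left \<Phi>_add)
  then show ?case by (simp only: add_mem[OF Wt_add.IH])
next
  case (Wt_sc a b q c)
  have "\<Phi> (u * (sc c * q)) - \<Phi> u * (sc c * q) = sc c * (\<Phi> (u * q) - \<Phi> u * q)"
    by (simp add: sc_left_comm[of u] sc_left_comm[of "\<Phi> u"] \<Phi>_sc right_diff_distrib)
  then show ?case by (simp only: mult_mem[OF Wt_sc.IH])
qed simp

lemma \<Phi>_V: "V q \<Longrightarrow> \<Phi> (u * q) - \<Phi> u * q \<in> K"
proof (induction rule: V.induct)
  case (V_add p q)
  have "\<Phi> (u * (p + q)) - \<Phi> u * (p + q) = (\<Phi> (u * p) - \<Phi> u * p) + (\<Phi> (u * q) - \<Phi> u * q)"
    by (simp add: distrib_left \<Phi>_add)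
  then show ?case by (simp only: add_mem[OF V_add.IH])
qed (rule \<Phi>_Wt)

lemma word_short: "V q \<Longrightarrow> low w \<Longrightarrow> length w < length J \<Longrightarrow> \<Phi> (word w * q) \<in> K"
  using \<Phi>_V[of q "word w"] by (simp add: \<Phi>_short)

lemma word_length_le:
  "V q \<Longrightarrow> low w \<Longrightarrow> length w \<le> length J \<Longrightarrow> \<Phi> (word w * q) - (if mset w = mset J then q else 0) \<in> K"
  using \<Phi>_V[of q "word w"] mset_eq_length[of w J]
  by (cases "length w = length J") (auto simp: \<Phi>_eq \<Phi>_short)

lemma word_deg: "V q \<Longrightarrow> low w \<Longrightarrow> sum_list (map deg1 w) \<noteq> sum_list (map deg1 J) \<Longrightarrow> \<Phi> (word w * q) \<in> K"
  using \<Phi>_V[of q "word w"] by (simp add: \<Phi>_deg)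

text \<open>In the next three lemmas an element whose \<open>t\<^sub>1\<close>-degree is very negative is moved to the right
  through a word. The commutators that remain in the word do not contribute, because they change
  the total \<open>t\<^sub>1\<close>-degree of the word.\<close>

lemma \<Phi>_affine:
  assumes "V q"
  shows "low u \<Longrightarrow> low w \<Longrightarrow> \<exists>M0. \<forall>M\<ge>M0. \<forall>x.
    \<Phi> (word u * (\<iota> (Loop x (t - M) 0) * (word w * q))) - \<Phi> (word (u @ w) * (\<iota> (Loop x (t - M) 0) * q)) \<in> K"
proof (induction w arbitrary: u)
  case Nil
  show ?case by simp
next
  case (Cons a w)
  have a: "deg2 a < 0" "low w" "low (u @ [a])" using Cons.prems by simp_all
  obtain M1 where M1: "\<forall>M\<ge>M1. \<forall>x. \<Phi> (word (u @ [a]) * (\<iota> (Loop x (t - M) 0) * (word w * q)))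
      - \<Phi> (word ((u @ [a]) @ w) * (\<iota> (Loop x (t - M) 0) * q)) \<in> K"
    using Cons.IH[OF a(3,2)] by (elim exE)
  \<comment> \<open>From this bound on, the word with the merged letter has t1-degree strictly below
    that of \<open>J\<close>.\<close>
  define M2 where "M2 = sum_list (map deg1 u) + t + deg1 a + sum_list (map deg1 w) - sum_list (map deg1 J) + 1"
  have "\<Phi> (word u * (\<iota> (Loop x (t - M) 0) * (word (a # w) * q)))
      - \<Phi> (word (u @ a # w) * (\<iota> (Loop x (t - M) 0) * q)) \<in> K" if M: "M \<ge> max M1 M2" for M x
  proof -
    let ?z = "\<iota> (Loop x (t - M) 0)" and ?l = "Loop (sl2_prod x (sl2_part a)) (t - M + deg1 a) (deg2 a)"
    have "?z * (word (a # w) * q) = \<iota> a * (?z * (word w * q)) + sc (sl2_coeff x (sl2_part a)) * (\<iota> ?l * (word w * q))"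
      using Loop_comm_mult[of x "t - M" 0 "sl2_part a" "deg1 a" "deg2 a" "word w * q"] Loop_parts[of a] a(1)
      by (simp add: mult.assoc)
    then have eq: "\<Phi> (word u * (?z * (word (a # w) * q))) = \<Phi> (word (u @ [a]) * (?z * (word w * q)))
        + sc (sl2_coeff x (sl2_part a)) * \<Phi> (word (u @ ?l # w) * q)"
      by (simp add: distrib_left \<Phi>_add sc_left_comm[of "word u"] \<Phi>_sc mult.assoc)
    have "\<Phi> (word (u @ ?l # w) * q) \<in> K"
      by (rule word_deg[OF assms]) (use Cons.prems M in \<open>auto simp: M2_def\<close>)
    then have "sc (sl2_coeff x (sl2_part a)) * \<Phi> (word (u @ ?l # w) * q) \<in> K" by (rule mult_mem)
    moreover have "\<Phi> (word (u @ [a]) * (?z * (word w * q))) - \<Phi> (word (u @ a # w) * (?z * q)) \<in> K"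
      using M1 M by simp
    ultimately show ?thesis unfolding eq using add_mem by (fastforce simp: algebra_simps)
  qed
  then show ?case by blast
qed

lemma \<Phi>_pos_short:
  assumes "V q"
  shows "low u \<Longrightarrow> low w \<Longrightarrow> n \<ge> 1 \<Longrightarrow> length u + length w \<le> length J \<Longrightarrow> \<exists>M0. \<forall>M\<ge>M0. \<forall>x.
    \<Phi> (word u * (\<iota> (Loop x (t - M) n) * (word w * q))) \<in> K"
proof (induction w arbitrary: u t n)
  case Nil
  then show ?case using V_pos[OF assms, of n] by (simp add: \<Phi>_mem mult_mem)
next
  case (Cons a w)
  have a: "deg2 a < 0" "low w" "low (u @ [a])" "length (u @ [a]) + length w \<le> length J"
    "length u + length w \<le> length J" "length (u @ w) < length J" "low u" "low (u @ w)"
    using Cons.prems by simp_all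
  obtain M1 where M1: "\<forall>M\<ge>M1. \<forall>x. \<Phi> (word (u @ [a]) * (\<iota> (Loop x (t - M) n) * (word w * q))) \<in> K"
    using Cons.IH[OF a(3,2) Cons.prems(3) a(4), of t] by (elim exE)
  let ?l = "\<lambda>x M. Loop (sl2_prod x (sl2_part a)) (t + deg1 a - M) (n + deg2 a)"
  have "\<exists>M2. \<forall>M\<ge>M2. \<forall>x. \<Phi> (word u * (\<iota> (?l x M) * (word w * q))) \<in> K"
  \<comment> \<open>The merged letter still has positive degree, has become affine, or is negative
    and stays in the word. The cases use the induction hypothesis, the lack of letters compared with
    \<open>J\<close>, and the t1-degree, respectively.\<close>
  proof (cases "n + deg2 a" "0 :: int" rule: linorder_cases)
    case greater
    then have "\<exists>M0. \<forall>M\<ge>M0. \<forall>x. \<Phi> (word u * (\<iota> (Loop x (t + deg1 a - M) (n + deg2 a)) * (word w * q))) \<in> K"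
      by (intro Cons.IH a) simp
    then show ?thesis by blast
  next
    case equal
    obtain M2 where M2: "\<forall>M\<ge>M2. \<forall>x. \<Phi> (word u * (\<iota> (Loop x (t + deg1 a - M) 0) * (word w * q)))
       - \<Phi> (word (u @ w) * (\<iota> (Loop x (t + deg1 a - M) 0) * q)) \<in> K"
      using \<Phi>_affine[OF assms a(7,2)] by blast
    have "\<Phi> (word u * (\<iota> (?l x M) * (word w * q))) \<in> K" if "M \<ge> M2" for M x
      using M2[rule_format, OF that, of "sl2_prod x (sl2_part a)"] equal
        word_short[OF V_mult[OF assms] a(8,6), of "sl2_prod x (sl2_part a)" "t + deg1 a - M"] mem_cong
      by simp
    then show ?thesis by blast
  next
    case less
    define M2 where "M2 = sum_list (map deg1 u) + t + deg1 a + sum_list (map deg1 w) - sum_list (map deg1 J) + 1"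
    have "\<Phi> (word (u @ ?l x M # w) * q) \<in> K" if "M \<ge> M2" for M x
      by (rule word_deg[OF assms]) (use a less that in \<open>auto simp: M2_def\<close>)
    then show ?thesis by (auto simp: mult.assoc)
  qed
  then obtain M2 where M2: "\<forall>M\<ge>M2. \<forall>x. \<Phi> (word u * (\<iota> (?l x M) * (word w * q))) \<in> K" by (elim exE)
  \<comment> \<open>The third bound makes \<open>t - M + deg1 a\<close> negative, so the commutator
    with \<open>a\<close> has no central term.\<close>
  have "\<Phi> (word u * (\<iota> (Loop x (t - M) n) * (word (a # w) * q))) \<in> K"
    if M: "M \<ge> max (max M1 M2) (t + deg1 a + 1)" for M x
  proof -
    let ?z = "\<iota> (Loop x (t - M) n)"
    have "?z * (word (a # w) * q) = \<iota> a * (?z * (word w * q)) + sc (sl2_coeff x (sl2_part a)) * (\<iota> (?l x M) * (word w * q))"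
      using Loop_comm_mult[of x "t - M" n "sl2_part a" "deg1 a" "deg2 a" "word w * q"] Loop_parts[of a] a(1) M
      by (simp add: mult.assoc add_diff_eq diff_add_eq)
    then have eq: "\<Phi> (word u * (?z * (word (a # w) * q))) = \<Phi> (word (u @ [a]) * (?z * (word w * q)))
        + sc (sl2_coeff x (sl2_part a)) * \<Phi> (word u * (\<iota> (?l x M) * (word w * q)))"
      by (simp add: distrib_left \<Phi>_add sc_left_comm[of "word u"] \<Phi>_sc mult.assoc)
    show ?thesis unfolding eq
      by (intro add_mem mult_mem M1[rule_format] M2[rule_format]) (use M in simp_all)
  qed
  then show ?case by blast
qed

text \<open>The contribution of one letter \<open>a\<close> to the coefficient of \<open>J\<close>:
  its commutator with \<open>x(k,n)\<close> has t2-degree zero and becomes an affine operator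
  applied to \<open>q\<close>, while the other letters \<open>u\<close> must form \<open>J\<close>
  up to order.\<close>

definition \<Phi>_term :: "int \<Rightarrow> int \<Rightarrow> sl2_basis \<Rightarrow> toroidal_basis list \<Rightarrow> toroidal_basis \<Rightarrow> 'a \<Rightarrow> 'a" where
  "\<Phi>_term n k x u a q =
     (if deg2 a = - n \<and> mset u = mset J
      then sc (sl2_coeff x (sl2_part a)) * (\<iota> (Loop (sl2_prod x (sl2_part a)) (k + deg1 a) 0) * q) else 0)"

lemma \<Phi>_pos:
  assumes "V q" "n \<ge> 1"
  shows "low u \<Longrightarrow> low w \<Longrightarrow> length u + length w \<le> Suc (length J) \<Longrightarrow> \<exists>M0. \<forall>M\<ge>M0. \<forall>x.
    \<Phi> (word u * (\<iota> (Loop x (t - M) n) * (word w * q)))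
      - (\<Sum>i<length w. \<Phi>_term n (t - M) x (u @ take i w @ drop (Suc i) w) (w ! i) q) \<in> K"
proof (induction w arbitrary: u)
  case Nil
  then show ?case using V_pos[OF assms] by (simp add: \<Phi>_mem mult_mem)
next
  case (Cons a w)
  have a: "deg2 a < 0" "low w" "low (u @ [a])" "length (u @ [a]) + length w \<le> Suc (length J)"
    "length u + length w \<le> length J" "length (u @ w) \<le> length J" "low u" "low (u @ w)"
    using Cons.prems by simp_all
  let ?S = "\<lambda>M x. (\<Sum>i<length w. \<Phi>_term n (t - M) x ((u @ [a]) @ take i w @ drop (Suc i) w) (w ! i) q)"
  obtain M1 where M1: "\<forall>M\<ge>M1. \<forall>x. \<Phi> (word (u @ [a]) * (\<iota> (Loop x (t - M) n) * (word w * q))) - ?S M x \<in> K"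
    using Cons.IH[OF a(3,2) a(4)] by (elim exE)
  let ?l = "\<lambda>x M. Loop (sl2_prod x (sl2_part a)) (t + deg1 a - M) (n + deg2 a)"
  have "\<exists>M2. \<forall>M\<ge>M2. \<forall>x. sc (sl2_coeff x (sl2_part a)) * \<Phi> (word u * (\<iota> (?l x M) * (word w * q)))
     - \<Phi>_term n (t - M) x (u @ w) a q \<in> K"
  \<comment> \<open>Only the affine case contributes: there the remaining word \<open>u @ w\<close>
    is no longer than \<open>J\<close>, so its coefficient is decided by its multiset. In the other
    two cases \<open>\<Phi>_term\<close> is zero.\<close>
  proof (cases "n + deg2 a" "0 :: int" rule: linorder_cases)
    case greater
    then have "\<exists>M0. \<forall>M\<ge>M0. \<forall>x. \<Phi> (word u * (\<iota> (Loop x (t + deg1 a - M) (n + deg2 a)) * (word w * q))) \<in> K"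
      by (intro \<Phi>_pos_short assms(1) a) simp
    then show ?thesis using greater by (auto simp: \<Phi>_term_def intro: mult_mem)
  next
    case equal
    obtain M2 where M2: "\<forall>M\<ge>M2. \<forall>x. \<Phi> (word u * (\<iota> (Loop x (t + deg1 a - M) 0) * (word w * q)))
       - \<Phi> (word (u @ w) * (\<iota> (Loop x (t + deg1 a - M) 0) * q)) \<in> K"
      using \<Phi>_affine[OF assms(1) a(7,2)] by blast
    have "sc (sl2_coeff x (sl2_part a)) * \<Phi> (word u * (\<iota> (?l x M) * (word w * q)))
     - \<Phi>_term n (t - M) x (u @ w) a q \<in> K" if M: "M \<ge> M2" for M x
    proof -
      let ?z = "\<iota> (Loop (sl2_prod x (sl2_part a)) (t + deg1 a - M) 0)"
      have 1: "\<Phi> (word u * (?z * (word w * q))) - \<Phi> (word (u @ w) * (?z * q)) \<in> K"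
        using M2 M by simp
      have 2: "\<Phi> (word (u @ w) * (?z * q)) - (if mset (u @ w) = mset J then ?z * q else 0) \<in> K"
        by (rule word_length_le[OF V_mult[OF assms(1)] a(8,6)])
      have "\<Phi> (word u * (?z * (word w * q))) - (if mset (u @ w) = mset J then ?z * q else 0) \<in> K"
        using add_mem[OF 1 2] by simp
      then have 3: "sc (sl2_coeff x (sl2_part a)) * (\<Phi> (word u * (?z * (word w * q))) - (if mset (u @ w) = mset J then ?z * q else 0)) \<in> K"
        by (rule mult_mem)
      have e: "deg2 a = - n" "t - M + deg1 a = t + deg1 a - M" using equal by simp_all
      have "\<Phi>_term n (t - M) x (u @ w) a q = sc (sl2_coeff x (sl2_part a)) * (if mset (u @ w) = mset J then ?z * q else 0)"
        unfolding \<Phi>_term_def e by simp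
      with 3 show ?thesis using equal by (simp only: right_diff_distrib)
    qed
    then show ?thesis by blast
  next
    case less
    define M2 where "M2 = sum_list (map deg1 u) + t + deg1 a + sum_list (map deg1 w) - sum_list (map deg1 J) + 1"
    have "\<Phi> (word (u @ ?l x M # w) * q) \<in> K" if "M \<ge> M2" for M x
      by (rule word_deg[OF assms(1)]) (use a less that in \<open>auto simp: M2_def\<close>)
    then show ?thesis using less by (auto simp: mult.assoc \<Phi>_term_def intro: mult_mem)
  qed
  then obtain M2 where M2: "\<forall>M\<ge>M2. \<forall>x. sc (sl2_coeff x (sl2_part a)) * \<Phi> (word u * (\<iota> (?l x M) * (word w * q)))
     - \<Phi>_term n (t - M) x (u @ w) a q \<in> K" by (elim exE)
  have "\<Phi> (word u * (\<iota> (Loop x (t - M) n) * (word (a # w) * q)))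
      - (\<Sum>i<length (a # w). \<Phi>_term n (t - M) x (u @ take i (a # w) @ drop (Suc i) (a # w)) ((a # w) ! i) q) \<in> K"
    if M: "M \<ge> max (max M1 M2) (t + deg1 a + 1)" for M x
  proof -
    let ?z = "\<iota> (Loop x (t - M) n)"
    have "?z * (word (a # w) * q) = \<iota> a * (?z * (word w * q)) + sc (sl2_coeff x (sl2_part a)) * (\<iota> (?l x M) * (word w * q))"
      using Loop_comm_mult[of x "t - M" n "sl2_part a" "deg1 a" "deg2 a" "word w * q"] Loop_parts[of a] a(1) M
      by (simp add: mult.assoc add_diff_eq diff_add_eq)
    then have eq: "\<Phi> (word u * (?z * (word (a # w) * q))) = \<Phi> (word (u @ [a]) * (?z * (word w * q)))
        + sc (sl2_coeff x (sl2_part a)) * \<Phi> (word u * (\<iota> (?l x M) * (word w * q)))"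
      by (simp add: distrib_left \<Phi>_add sc_left_comm[of "word u"] \<Phi>_sc mult.assoc)
    have S: "(\<Sum>i<length (a # w). \<Phi>_term n (t - M) x (u @ take i (a # w) @ drop (Suc i) (a # w)) ((a # w) ! i) q)
      = \<Phi>_term n (t - M) x (u @ w) a q + ?S M x"
      by (simp add: sum.lessThan_Suc_shift del: sum.lessThan_Suc)
    have "\<Phi> (word (u @ [a]) * (?z * (word w * q))) - ?S M x \<in> K"
      "sc (sl2_coeff x (sl2_part a)) * \<Phi> (word u * (\<iota> (?l x M) * (word w * q))) - \<Phi>_term n (t - M) x (u @ w) a q \<in> K"
      using M1 M2 M by simp_all
    from add_mem[OF this] show ?thesis unfolding eq S by (simp add: algebra_simps)
  qed
  then show ?case by blast
qed

end

section \<open>Vanishing of the leading coefficients of a singular vector\<close>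

context weyl_ideal
begin

text \<open>For large \<open>M\<close> the operator \<open>b(M - s)\<close> kills \<open>q\<close>,
  so only the commutator remains. Its bracket part depends on \<open>s' - s\<close> alone, while the
  central part, present for \<open>s' = s\<close>, grows linearly in \<open>M\<close>; this contrast
  is exploited in \<open>top_coefficient\<close>.\<close>

lemma heisenberg:
  assumes "V q"
  shows "\<exists>M0. \<forall>M\<ge>M0. \<forall>b x s'. \<iota> (Loop b (M - s) 0) * (\<iota> (Loop x (s' - M) 0) * q) -
     (sc (sl2_coeff b x) * (\<iota> (Loop (sl2_prod b x) (s' - s) 0) * q) +
      (if s' = s then sc (sl2_basis_form b x * of_int (M - s) * of_nat (n0 + n1)) * q else 0)) \<in> K"
proof -
  obtain N where N: "\<forall>m\<ge>N. \<forall>x. \<iota> (Loop x m 0) * q \<in> K" using V_annihilated[OF assms] by (elim exE)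
  have "\<iota> (Loop b (M - s) 0) * (\<iota> (Loop x (s' - M) 0) * q) -
     (sc (sl2_coeff b x) * (\<iota> (Loop (sl2_prod b x) (s' - s) 0) * q) +
      (if s' = s then sc (sl2_basis_form b x * of_int (M - s) * of_nat (n0 + n1)) * q else 0)) \<in> K"
    if "M \<ge> N + s" for M b x s'
  proof -
    let ?f = "sl2_basis_form b x * of_int (M - s)"
    have 1: "\<iota> (Loop x (s' - M) 0) * (\<iota> (Loop b (M - s) 0) * q) \<in> K"
      using N that by (simp add: mult_mem)
    have 2: "sc ?f * (\<iota> C1 * q - sc (of_nat (n0 + n1)) * q) \<in> K"
      using V_eigen_C(1)[OF assms] unfolding eigen_def by (rule mult_mem)
    have e: "M - s + (s' - M) = s' - s" "(M - s = - (s' - M)) = (s' = s)" by auto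
    have L: "\<iota> (Loop b (M - s) 0) * (\<iota> (Loop x (s' - M) 0) * q) =
       \<iota> (Loop x (s' - M) 0) * (\<iota> (Loop b (M - s) 0) * q) +
       sc (sl2_coeff b x) * (\<iota> (Loop (sl2_prod b x) (s' - s) 0) * q) +
       (if s' = s then sc ?f * (\<iota> C1 * q) else 0)"
      unfolding Loop_comm_mult[of b "M - s"] e by simp
    show ?thesis
    proof (cases "s' = s")
      case True
      have "sc ?f * (\<iota> C1 * q - sc (of_nat (n0 + n1)) * q) = sc ?f * (\<iota> C1 * q) - sc (?f * of_nat (n0 + n1)) * q"
        by (simp only: right_diff_distrib sc_mult mult.assoc)
      moreover have "A + B + C - (B + D) = A + (C - D)" for A B C D :: 'u by simp
      ultimately show ?thesis unfolding L if_P[OF True] using add_mem[OF 1 2] by (simp only:)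
    next
      case False
      with 1 show ?thesis unfolding L by simp
    qed
  qed
  then show ?thesis by blast
qed

text \<open>Dropping one letter \<open>L\<close> of \<open>w0\<close> leaves \<open>J\<close>. Every
  word that becomes \<open>J\<close> up to order when a letter of degree \<open>- n\<close> is
  dropped contributes to the coefficient; in the part linear in \<open>M\<close>, the choice of
  \<open>x\<close>, \<open>b\<close> and \<open>s\<close> admits only \<open>L\<close> as the
  dropped letter, hence only words with the multiset of \<open>w0\<close>. The conclusion concerns
  their sum, because words with equal multisets agree to leading order.\<close>

lemma top_coefficient:
  assumes level: "n0 + n1 > 0"
    and coeff: "\<And>J. low J \<Longrightarrow> \<exists>\<Phi>. weyl_coeff \<iota> sc K n0 n1 l1 l2 J \<Phi>"
    and S: "finite S" "\<And>w. w \<in> S \<Longrightarrow> low w \<and> length w \<le> Suc l" and v: "\<And>w. V (v w)"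
    and sing: "\<And>b m n. n \<ge> 1 \<Longrightarrow> \<iota> (Loop b m n) * (\<Sum>w\<in>S. word w * v w) \<in> K"
    and w0: "w0 \<in> S" "length w0 = Suc l"
  shows "(\<Sum>w\<in>{w\<in>S. mset w = mset w0}. v w) \<in> K"
proof -
  obtain L J where w0': "w0 = L # J" using w0(2) by (cases w0) auto
  have J: "low J" "length J = l" and L: "deg2 L < 0" using S(2)[OF w0(1)] w0(2) w0' by auto
  define n where "n = - deg2 L"
  have n: "n \<ge> 1" using L by (simp add: n_def)
  define s where "s = deg1 L"
  obtain \<Phi> where "weyl_coeff \<iota> sc K n0 n1 l1 l2 J \<Phi>" using coeff[OF J(1)] by (elim exE)
  then interpret weyl_coeff \<iota> sc K n0 n1 l1 l2 J \<Phi> .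
  obtain x b where xb: "\<forall>y'. (sl2_coeff x y' * sl2_basis_form b (sl2_prod x y') \<noteq> 0) = (y' = sl2_part L)"
    using sl2_separate by blast
  let ?k = "of_nat (n0 + n1) :: complex"
  let ?w = "\<lambda>w i. take i w @ drop (Suc i) w"
  let ?c = "\<lambda>a. sl2_coeff x (sl2_part a)" and ?p = "\<lambda>a. sl2_prod x (sl2_part a)"
  define R where "R w M = (\<Sum>i<length w. \<Phi>_term n (0 - M) x (?w w i) (w ! i) (v w))" for w M
  define cond where "cond w i \<longleftrightarrow> deg2 (w ! i) = - n \<and> mset (?w w i) = mset J" for w i
  \<comment> \<open>\<open>G\<close> collects the contributions independent of \<open>M\<close>, and
    \<open>B\<close> the coefficients of \<open>M - s\<close>.\<close>
  define G where "G w i = (if cond w i then sc (?c (w ! i)) *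
      (sc (sl2_coeff b (?p (w ! i))) * (\<iota> (Loop (sl2_prod b (?p (w ! i))) (deg1 (w ! i) - s) 0) * v w)) else 0)" for w i
  define B where "B w i = (if cond w i \<and> deg1 (w ! i) = s then sc (?c (w ! i) * sl2_basis_form b (?p (w ! i)) * ?k) * v w else 0)" for w i
  have R: "\<exists>M0. \<forall>M\<ge>M0. \<Phi> (\<iota> (Loop x (0 - M) n) * (word w * v w)) - R w M \<in> K" if "w \<in> S" for w
  proof -
    have "\<exists>M0. \<forall>M\<ge>M0. \<forall>x. \<Phi> (word [] * (\<iota> (Loop x (0 - M) n) * (word w * v w)))
      - (\<Sum>i<length w. \<Phi>_term n (0 - M) x ([] @ take i w @ drop (Suc i) w) (w ! i) (v w)) \<in> K"
      by (rule \<Phi>_pos[OF v n]) (use S(2)[OF that] J(2) in simp_all)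
    then show ?thesis unfolding R_def by auto
  qed
  have hei: "\<exists>M0. \<forall>M\<ge>M0. \<iota> (Loop b (M - s) 0) * R w M - (\<Sum>i<length w. G w i + of_int (M - s) * B w i) \<in> K" for w
  proof -
    obtain M0 where M0: "\<forall>M\<ge>M0. \<forall>b x s'. \<iota> (Loop b (M - s) 0) * (\<iota> (Loop x (s' - M) 0) * v w) -
     (sc (sl2_coeff b x) * (\<iota> (Loop (sl2_prod b x) (s' - s) 0) * v w) +
      (if s' = s then sc (sl2_basis_form b x * of_int (M - s) * ?k) * v w else 0)) \<in> K"
      using heisenberg[OF v, of s w] by (elim exE)
    have "\<iota> (Loop b (M - s) 0) * R w M - (\<Sum>i<length w. G w i + of_int (M - s) * B w i) \<in> K" if M: "M \<ge> M0" for M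
    proof -
      have "\<iota> (Loop b (M - s) 0) * \<Phi>_term n (0 - M) x (?w w i) (w ! i) (v w) - (G w i + of_int (M - s) * B w i) \<in> K" for i
      proof (cases "cond w i")
        case True
        let ?a = "w ! i"
        have t: "\<Phi>_term n (0 - M) x (?w w i) ?a (v w) = sc (?c ?a) * (\<iota> (Loop (?p ?a) (deg1 ?a - M) 0) * v w)"
          using True by (simp add: \<Phi>_term_def cond_def)
        have B: "of_int (M - s) * B w i = sc (?c ?a) * (if deg1 ?a = s then sc (sl2_basis_form b (?p ?a) * of_int (M - s) * ?k) * v w else 0)"
        proof -
          have "of_int (M - s) * (sc c * q) = sc (of_int (M - s) * c) * q" for c q
            by (simp only: sc_mult sc_of_int mult.assoc)
          then show ?thesis using True by (simp add: B_def mult_ac)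
        qed
        have "sc (?c ?a) * (\<iota> (Loop b (M - s) 0) * (\<iota> (Loop (?p ?a) (deg1 ?a - M) 0) * v w) -
          (sc (sl2_coeff b (?p ?a)) * (\<iota> (Loop (sl2_prod b (?p ?a)) (deg1 ?a - s) 0) * v w) +
          (if deg1 ?a = s then sc (sl2_basis_form b (?p ?a) * of_int (M - s) * ?k) * v w else 0))) \<in> K"
          by (intro mult_mem M0[rule_format] M)
        moreover have "G w i = sc (?c ?a) * (sc (sl2_coeff b (?p ?a)) * (\<iota> (Loop (sl2_prod b (?p ?a)) (deg1 ?a - s) 0) * v w))"
          unfolding G_def if_P[OF True] ..
        ultimately show ?thesis unfolding t B
          by (simp only: sc_left_comm[of "\<iota> (Loop b (M - s) 0)"] right_diff_distrib distrib_left)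
      next
        case False
        then have "\<Phi>_term n (0 - M) x (?w w i) (w ! i) (v w) = 0" "G w i = 0" "B w i = 0"
          by (auto simp: \<Phi>_term_def cond_def G_def B_def)
        then show ?thesis by simp
      qed
      then have "(\<Sum>i<length w. \<iota> (Loop b (M - s) 0) * \<Phi>_term n (0 - M) x (?w w i) (w ! i) (v w) - (G w i + of_int (M - s) * B w i)) \<in> K"
        by (intro sum_mem)
      then show ?thesis by (simp only: R_def sum_distrib_left sum_subtractf)
    qed
    then show ?thesis by blast
  qed
  obtain M1 where M1: "\<forall>M\<ge>M1. \<forall>w\<in>S. \<Phi> (\<iota> (Loop x (0 - M) n) * (word w * v w)) - R w M \<in> K"
    using finite_uniform_bound[OF S(1), where P = "\<lambda>w M. \<Phi> (\<iota> (Loop x (0 - M) n) * (word w * v w)) - R w M \<in> K"] R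
    by blast
  obtain M2 where M2: "\<forall>M\<ge>M2. \<forall>w\<in>S. \<iota> (Loop b (M - s) 0) * R w M - (\<Sum>i<length w. G w i + of_int (M - s) * B w i) \<in> K"
    using finite_uniform_bound[OF S(1), where P = "\<lambda>w M. \<iota> (Loop b (M - s) 0) * R w M - (\<Sum>i<length w. G w i + of_int (M - s) * B w i) \<in> K"] hei
    by blast
  define A where "A = (\<Sum>w\<in>S. \<Sum>i<length w. G w i)"
  define C where "C = (\<Sum>w\<in>S. \<Sum>i<length w. B w i)"
  have AC: "A + of_int (M - s) * C \<in> K" if M: "M \<ge> max M1 M2" for M
  proof -
    have "\<Phi> (\<iota> (Loop x (0 - M) n) * (\<Sum>w\<in>S. word w * v w)) \<in> K" by (rule \<Phi>_mem[OF sing[OF n]])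
    then have 1: "(\<Sum>w\<in>S. \<Phi> (\<iota> (Loop x (0 - M) n) * (word w * v w))) \<in> K"
      by (simp only: sum_distrib_left \<Phi>_sum)
    have "(\<Sum>w\<in>S. \<Phi> (\<iota> (Loop x (0 - M) n) * (word w * v w)) - R w M) \<in> K"
      by (rule sum_mem) (use M1 M in simp)
    from diff_mem[OF 1 this] have "(\<Sum>w\<in>S. R w M) \<in> K" by (simp add: sum_subtractf)
    then have 2: "\<iota> (Loop b (M - s) 0) * (\<Sum>w\<in>S. R w M) \<in> K" by (rule mult_mem)
    have 3: "(\<Sum>w\<in>S. \<iota> (Loop b (M - s) 0) * R w M - (\<Sum>i<length w. G w i + of_int (M - s) * B w i)) \<in> K"
      by (rule sum_mem) (use M2 M in simp)
    have "(\<Sum>w\<in>S. \<iota> (Loop b (M - s) 0) * R w M - (\<Sum>i<length w. G w i + of_int (M - s) * B w i)) =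
      \<iota> (Loop b (M - s) 0) * (\<Sum>w\<in>S. R w M) - (A + of_int (M - s) * C)"
      by (simp only: sum_subtractf sum_distrib_left sum.distrib A_def C_def)
    with diff_mem[OF 2 3] show ?thesis by (simp add: add.commute)
  qed
  have "C \<in> K"
  proof -
    let ?M = "max M1 M2"
    have "(A + of_int (?M + 1 - s) * C) - (A + of_int (?M - s) * C) \<in> K"
      by (rule diff_mem) (rule AC, simp)+
    moreover have "(A + of_int (?M + 1 - s) * C) - (A + of_int (?M - s) * C) = C"
    proof -
      have "of_int (?M + 1 - s) = of_int (?M - s) + (1 :: 'u)" by (metis add_diff_eq diff_add_eq of_int_1 of_int_add add.commute)
      then show ?thesis by (simp only: distrib_right mult_1_left add_diff_cancel_left add_diff_cancel_left')
    qed
    ultimately show ?thesis by simp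
  qed
  \<comment> \<open>The level \<open>n0 + n1\<close> enters here as a factor; the other factors are
    nonzero by the choice of \<open>x\<close> and \<open>b\<close>.\<close>
  define \<kappa> where "\<kappa> = ?c L * sl2_basis_form b (?p L) * ?k"
  have \<kappa>: "\<kappa> \<noteq> 0" using xb level by (auto simp: \<kappa>_def simp flip: of_nat_add)
  have Bi: "B w i = (if w ! i = L then if mset w = mset w0 then sc \<kappa> * v w else 0 else 0)"
    if w: "w \<in> S" "i < length w" for w i
  proof -
    have m: "mset w = add_mset (w ! i) (mset (?w w i))" using mset_remove_nth[OF w(2)] .
    have d: "deg2 (w ! i) < 0" using S(2)[OF w(1)] w(2) by (auto simp: low_def)
    show ?thesis
    proof (cases "w ! i = L")
      case True
      then have "cond w i \<longleftrightarrow> mset w = mset w0" using m by (simp add: cond_def n_def w0')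
      then show ?thesis using True by (simp add: B_def s_def \<kappa>_def)
    next
      case False
      have "B w i = 0"
      proof (cases "cond w i \<and> deg1 (w ! i) = s")
        case True
        then have "deg1 (w ! i) = deg1 L" "deg2 (w ! i) = deg2 L" by (auto simp: cond_def n_def s_def)
        with False have "sl2_part (w ! i) \<noteq> sl2_part L"
          using L by (cases L; cases "w ! i") auto
        then have "?c (w ! i) * sl2_basis_form b (?p (w ! i)) = 0" using xb by blast
        then show ?thesis by (simp add: B_def)
      next
        case False
        then show ?thesis unfolding B_def by (rule if_not_P)
      qed
      with False show ?thesis by simp
    qed
  qed
  \<comment> \<open>Each occurrence of \<open>L\<close> in \<open>w\<close> contributes once, which
    produces the multiplicity of \<open>L\<close> in \<open>w0\<close>, a positive integer.\<close>
  have "C = (\<Sum>w\<in>S. of_nat (count (mset w) L) * (if mset w = mset w0 then sc \<kappa> * v w else 0))"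
    unfolding C_def by (intro sum.cong refl) (simp add: Bi sum_nth_eq_count)
  also have "\<dots> = (\<Sum>w\<in>S. if mset w = mset w0 then sc (of_nat (count (mset w0) L) * \<kappa>) * v w else 0)"
    by (intro sum.cong refl) (simp add: sc_mult mult.assoc del: scale_scale)
  also have "\<dots> = (\<Sum>w\<in>{w\<in>S. mset w = mset w0}. sc (of_nat (count (mset w0) L) * \<kappa>) * v w)"
    using S(1) by (simp add: sum.inter_filter)
  also have "\<dots> = sc (of_nat (count (mset w0) L) * \<kappa>) * (\<Sum>w\<in>{w\<in>S. mset w = mset w0}. v w)"
    by (simp only: sum_distrib_left)
  finally have "sc (of_nat (count (mset w0) L) * \<kappa>) * (\<Sum>w\<in>{w\<in>S. mset w = mset w0}. v w) \<in> K"
    using \<open>C \<in> K\<close> by simp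
  moreover have "of_nat (count (mset w0) L) * \<kappa> \<noteq> 0" using \<kappa> by (simp add: w0' del: of_nat_Suc)
  ultimately show ?thesis using sc_mem_iff by blast
qed

text \<open>Words of full length are grouped by multiset and rewritten to one representative per
  group: the sums of coefficients vanish by \<open>top_coefficient\<close>, and reordering costs
  only shorter words by \<open>Fil_perm\<close>.\<close>

lemma Fil_singular_step:
  assumes level: "n0 + n1 > 0"
    and coeff: "\<And>J. low J \<Longrightarrow> \<exists>\<Phi>. weyl_coeff \<iota> sc K n0 n1 l1 l2 J \<Phi>"
    and p: "Fil (Suc l) d p" and sing: "\<And>b m n. n \<ge> 1 \<Longrightarrow> \<iota> (Loop b m n) * p \<in> K"
  shows "Fil l d p"
proof -
  obtain S v where S: "finite S" "\<forall>w\<in>S. low w \<and> length w \<le> Suc l \<and> - sum_list (map deg2 w) \<le> d"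
    and v: "\<forall>w. V (v w)" and pS: "p - (\<Sum>w\<in>S. word w * v w) \<in> K"
    using Fil_decompose[OF p] by (elim exE conjE) (rule that)
  have sing': "\<iota> (Loop b m n) * (\<Sum>w\<in>S. word w * v w) \<in> K" if "n \<ge> 1" for b m n
  proof -
    have "\<iota> (Loop b m n) * p - \<iota> (Loop b m n) * (p - (\<Sum>w\<in>S. word w * v w)) \<in> K"
      by (intro diff_mem sing[OF that] mult_mem pS)
    then show ?thesis by (simp add: right_diff_distrib)
  qed
  let ?T = "{w\<in>S. length w = Suc l}" and ?c = "\<lambda>I. SOME w. mset w = (I :: toroidal_basis multiset)"
  have c: "mset (?c I) = I" for I by (rule someI_ex) (rule ex_mset)
  have "(\<Sum>w\<in>?T. word (?c (mset w)) * v w) = (\<Sum>I\<in>mset ` ?T. \<Sum>w\<in>{w\<in>?T. mset w = I}. word (?c (mset w)) * v w)"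
    using S(1) by (intro sum.group[symmetric]) auto
  also have "\<dots> \<in> K"
  proof (rule sum_mem)
    fix I assume "I \<in> mset ` ?T"
    then obtain w0 where w0: "w0 \<in> S" "length w0 = Suc l" "I = mset w0" by auto
    have "{w\<in>?T. mset w = I} = {w\<in>S. mset w = mset w0}"
      using w0 by (auto dest: mset_eq_length)
    moreover have "(\<Sum>w\<in>{w\<in>S. mset w = mset w0}. v w) \<in> K"
      by (rule top_coefficient[OF level coeff S(1) _ _ sing' w0(1,2)]) (use S v in auto)
    ultimately have "word (?c I) * (\<Sum>w\<in>{w\<in>?T. mset w = I}. v w) \<in> K" by (simp add: mult_mem)
    then show "(\<Sum>w\<in>{w\<in>?T. mset w = I}. word (?c (mset w)) * v w) \<in> K"
      by (simp add: sum_distrib_left)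
  qed
  finally have 1: "Fil l d (\<Sum>w\<in>?T. word (?c (mset w)) * v w)" by (rule Fil_mem)
  have 2: "Fil l d (\<Sum>w\<in>?T. word w * v w - word (?c (mset w)) * v w)"
  proof (rule Fil_sum)
    fix w assume w: "w \<in> ?T"
    have "Fil (length w - 1) (- sum_list (map deg2 w)) (word w * v w - word (?c (mset w)) * v w)"
      by (rule Fil_perm) (use w S v c in auto)
    then show "Fil l d (word w * v w - word (?c (mset w)) * v w)"
      by (rule Fil_mono) (use w S in auto)
  qed
  have 3: "Fil l d (\<Sum>w\<in>S - ?T. word w * v w)"
    by (rule Fil_sum, rule Fil_word) (use S v in auto)
  have "(\<Sum>w\<in>S. word w * v w) = (\<Sum>w\<in>S - ?T. word w * v w) + (\<Sum>w\<in>?T. word w * v w)"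
    using S(1) by (intro sum.subset_diff) auto
  also have "\<dots> = (\<Sum>w\<in>S - ?T. word w * v w) + ((\<Sum>w\<in>?T. word w * v w - word (?c (mset w)) * v w)
      + (\<Sum>w\<in>?T. word (?c (mset w)) * v w))"
    by (simp add: sum_subtractf)
  finally have "Fil l d (\<Sum>w\<in>S. word w * v w)" using Fil_add[OF 3 Fil_add[OF 2 1]] by simp
  from Fil_add[OF Fil_mem[OF pS] this] show ?thesis by simp
qed

lemma Fil_singular:
  assumes level: "n0 + n1 > 0"
    and coeff: "\<And>J. low J \<Longrightarrow> \<exists>\<Phi>. weyl_coeff \<iota> sc K n0 n1 l1 l2 J \<Phi>"
    and sing: "\<And>b m n. n \<ge> 1 \<Longrightarrow> \<iota> (Loop b m n) * p \<in> K"
  shows "Fil l d p \<Longrightarrow> V p"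
proof (induction l)
  case 0
  then show ?case by (rule Fil_V) simp
next
  case (Suc l)
  show ?case by (rule Suc.IH, rule Fil_singular_step[OF level coeff Suc.prems sing])
qed

theorem irreducible:
  assumes level: "n0 + n1 > 0"
    and coeff: "\<And>J. low J \<Longrightarrow> \<exists>\<Phi>. weyl_coeff \<iota> sc K n0 n1 l1 l2 J \<Phi>"
    and p: "p \<notin> K"
  shows "\<exists>u. u * p - 1 \<in> K"
proof -
  obtain l d where "Fil l d p" using Fil_exhaust[of p] by (elim exE)
  then show ?thesis using p
  \<comment> \<open>The measure is the degree bound: it drops by \<open>n\<close>, and
    \<open>Fil_neg\<close> keeps it nonnegative as long as the vector is outside
    \<open>K\<close>.\<close>
  proof (induction "nat d" arbitrary: p d rule: less_induct)
    case (less d p)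
    show ?case
    proof (cases "V p")
      case True
      then show ?thesis using V_irreducible less.prems(2) by simp
    next
      case False
      then obtain b m n where n: "n \<ge> 1" and zp: "\<iota> (Loop b m n) * p \<notin> K"
        using Fil_singular[OF level coeff _ less.prems(1)] by meson
      have F: "Fil l (d - n) (\<iota> (Loop b m n) * p)" by (rule Fil_nonneg[OF less.prems(1)]) (use n in simp)
      have "d - n \<ge> 0" using Fil_neg[OF F] zp by force
      then have "nat (d - n) < nat d" using n by simp
      from less.hyps[OF this F zp] obtain u where "u * (\<iota> (Loop b m n) * p) - 1 \<in> K" by (elim exE)
      then have "(u * \<iota> (Loop b m n)) * p - 1 \<in> K" by (simp only: mult.assoc)
      then show ?thesis by (intro exI)
    qed
  qed
qed

end

section \<open>The enveloping algebra of the toroidal Lie algebra\<close>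

lemma scl_single: "scl c (Poly_Mapping.single b d) = Poly_Mapping.single b (c * d)"
  by (rule poly_mapping_eqI) (simp add: lookup_single when_def)

lemma scl_mult_left: "scl c p * q = scl c (p * q)" for p q :: "'k::monoid_add \<Rightarrow>\<^sub>0 complex"
proof -
  have l: "Poly_Mapping.single 0 c * r = scl c r" for r :: "'k \<Rightarrow>\<^sub>0 complex"
  proof (induction r rule: lin_induct)
    case (add r d b)
    then show ?case by (simp add: distrib_left pm.scale_right_distrib scl_single mult_single mult.commute)
  qed simp
  show ?thesis by (simp flip: l add: mult.assoc)
qed

lemma single_0_mult: "Poly_Mapping.single 0 c * r = scl c r" for r :: "'k::monoid_add \<Rightarrow>\<^sub>0 complex"
  using scl_mult_left[of c 1 r] scl_single[of c "0 :: 'k" 1] by (simp add: single_one)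

lemma scl_mult_right: "p * scl c q = scl c (p * q)" for p q :: "'k::monoid_add \<Rightarrow>\<^sub>0 complex"
proof (induction p rule: lin_induct)
  case (add p d b)
  have "bas b * scl c q = scl c (bas b * q)"
  proof (induction q rule: lin_induct)
    case (add q e b')
    then show ?case by (simp add: distrib_left pm.scale_right_distrib scl_single mult_single mult.commute)
  qed simp
  with add show ?case
    by (simp only: distrib_right pm.scale_right_distrib scl_mult_left pm.scale_left_commute)
qed simp

section \<open>The toroidal bracket on an ordered basis\<close>

instance sl2_basis :: countable
  by countable_datatype

instance toroidal_basis :: countable
  by countable_datatype

text \<open>An injective key that puts the letters satisfying \<open>N\<close> before all others;
  the offset 1 keeps code 0 apart on the two sides. It serves two choices of \<open>N\<close>: the
  basis of the negative part and the letters of negative t2-degree.\<close>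

definition split_key :: "('b::countable \<Rightarrow> bool) \<Rightarrow> 'b \<Rightarrow> int" where
  "split_key N b = (if N b then - int (to_nat b) - 1 else int (to_nat b))"

lemma inj_split_key: "inj (split_key N)"
  by (rule injI) (auto simp: split_key_def split: if_splits)

lemma split_key_less: "N a \<Longrightarrow> \<not> N b \<Longrightarrow> split_key N a < split_key N b"
  by (simp add: split_key_def)

lemma toroidal_basis_bracket_self: "toroidal_basis_bracket a a = 0"
proof (cases a)
  case (Loop b m n)
  then show ?thesis by (cases b) (auto simp: toroidal_basis_bracket_Loop simp del: toroidal_basis_bracket.simps(1))
qed auto

lemma toroidal_basis_bracket_anti: "toroidal_basis_bracket b a = - toroidal_basis_bracket a b"
proof (cases a; cases b)
  fix x y r1 r2 s1 s2
  assume ab: "a = Loop x r1 r2" "b = Loop y s1 s2"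
  have "sl2_coeff y x = - sl2_coeff x y" "sl2_prod y x = sl2_prod x y" "sl2_basis_form y x = sl2_basis_form x y"
    by (cases x; cases y; simp)+
  then show ?thesis
    by (auto simp: ab toroidal_basis_bracket_Loop add.commute pm.scale_minus_left pm.scale_minus_right
        pm.scale_right_distrib pm.scale_right_diff_distrib simp del: toroidal_basis_bracket.simps(1))
qed auto

text \<open>The three basis vectors may differ when coefficients vanish, so the identity is stated
  for vectors and not for coefficients.\<close>

lemma sl2_jacobi:
  "scl (sl2_coeff a b * sl2_coeff (sl2_prod a b) c) (bas (Loop (sl2_prod (sl2_prod a b) c) m n))
   + scl (sl2_coeff b c * sl2_coeff (sl2_prod b c) a) (bas (Loop (sl2_prod (sl2_prod b c) a) m n))
   + scl (sl2_coeff c a * sl2_coeff (sl2_prod c a) b) (bas (Loop (sl2_prod (sl2_prod c a) b) m n)) = 0"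
  by (cases a; cases b; cases c; simp)

text \<open>Invariance of the form. It gives the three central terms of the Jacobi identity a common
  factor, after which they cancel because the degrees add up to zero.\<close>

lemma sl2_form_cyclic:
  "sl2_coeff b c * sl2_basis_form (sl2_prod b c) a = sl2_coeff a b * sl2_basis_form (sl2_prod a b) c"
  by (cases a; cases b; cases c; simp)

lemma toroidal_basis_bracket_central [simp]:
  "toroidal_basis_bracket d C1 = 0" "toroidal_basis_bracket d C2 = 0"
  "toroidal_basis_bracket C1 d = 0" "toroidal_basis_bracket C2 d = 0"
  by (cases d; simp)+

lemma toroidal_jacobi_D:
  assumes "a = Loop x r1 r2" "b = Loop y s1 s2" "c = D1 \<or> c = D2"
  shows "pm.lin (\<lambda>d. toroidal_basis_bracket d c) (toroidal_basis_bracket a b)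
   + pm.lin (\<lambda>d. toroidal_basis_bracket d a) (toroidal_basis_bracket b c)
   + pm.lin (\<lambda>d. toroidal_basis_bracket d b) (toroidal_basis_bracket c a) = 0"
proof -
  have sw: "sl2_coeff y x = - sl2_coeff x y" "sl2_prod y x = sl2_prod x y" "sl2_basis_form y x = sl2_basis_form x y"
    by (cases x; cases y; simp)+
  have l: "pm.lin f (if P then g else 0) = (if P then pm.lin f g else 0)" for f g P by simp
  have "scl (- p - q) z + scl p z + scl q z = 0" for p q and z :: toroidal
    by (simp flip: pm.scale_left_distrib)
  from this[of "sl2_coeff x y * of_int s1" "sl2_coeff x y * of_int r1"]
    this[of "sl2_coeff x y * of_int s2" "sl2_coeff x y * of_int r2"]
  show ?thesis using assms(3)
    by (auto simp: assms(1,2) sw toroidal_basis_bracket_Loop pm.lin_uminus pm.lin_add pm.lin_scl pm.lin_diff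
        algebra_simps pm.scale_minus_left pm.scale_minus_right simp del: toroidal_basis_bracket.simps(1))
qed

lemma toroidal_jacobi:
  "pm.lin (\<lambda>d. toroidal_basis_bracket d c) (toroidal_basis_bracket a b)
   + pm.lin (\<lambda>d. toroidal_basis_bracket d a) (toroidal_basis_bracket b c)
   + pm.lin (\<lambda>d. toroidal_basis_bracket d b) (toroidal_basis_bracket c a) = 0"
proof (cases a; cases b; cases c)
  fix x y z r1 r2 s1 s2 t1 t2
  assume abc: "a = Loop x r1 r2" "b = Loop y s1 s2" "c = Loop z t1 t2"
  have L: "pm.lin (\<lambda>d. toroidal_basis_bracket d (Loop z t1 t2)) (toroidal_basis_bracket (Loop x r1 r2) (Loop y s1 s2)) =
    scl (sl2_coeff x y * sl2_coeff (sl2_prod x y) z) (bas (Loop (sl2_prod (sl2_prod x y) z) (r1 + s1 + t1) (r2 + s2 + t2)))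
    + (if r1 + s1 = - t1 \<and> r2 + s2 = - t2
       then scl (sl2_coeff x y * sl2_basis_form (sl2_prod x y) z) (scl (of_int (r1 + s1)) (bas C1) + scl (of_int (r2 + s2)) (bas C2)) else 0)"
    for x y z r1 r2 s1 s2 t1 t2
  proof -
    \<comment> \<open>The central part of the inner bracket is killed by the outer bracket.\<close>
    let ?C = "if r1 = - s1 \<and> r2 = - s2
      then scl (sl2_basis_form x y) (scl (of_int r1) (bas C1) + scl (of_int r2) (bas C2)) else 0"
    have "pm.lin (\<lambda>d. toroidal_basis_bracket d (Loop z t1 t2)) ?C = 0"
      by (simp add: pm.lin_add pm.lin_scl pm.lin_diff pm.lin_uminus)
    then show ?thesis
      unfolding toroidal_basis_bracket_Loop[of x r1] pm.lin_add pm.lin_scl pm.lin_bas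
      unfolding toroidal_basis_bracket_Loop pm.scale_right_distrib
      by (simp only: pm.scale_scale if_distrib[of "scl _"] pm.scale_right_distrib pm.scale_zero_right mult.assoc add_0_right)
  qed
  let ?f = "sl2_coeff x y * sl2_basis_form (sl2_prod x y) z"
  let ?Z = "\<lambda>p q. scl ?f (scl (of_int p) (bas C1) + scl (of_int q) (bas C2))"
  have Z: "?Z (r1 + s1) (r2 + s2) + ?Z (s1 + t1) (s2 + t2) + ?Z (t1 + r1) (t2 + r2) = 0"
    if "r1 + s1 + t1 = 0" "r2 + s2 + t2 = 0"
  proof -
    have t: "t1 = - r1 - s1" "t2 = - r2 - s2" using that by auto
    show ?thesis unfolding t by (rule poly_mapping_eqI) (simp add: lookup_add algebra_simps)
  qed
  have idx: "s1 + t1 + r1 = r1 + s1 + t1" "s2 + t2 + r2 = r2 + s2 + t2"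
    "t1 + r1 + s1 = r1 + s1 + t1" "t2 + r2 + s2 = r2 + s2 + t2" by simp_all
  have c: "s1 + t1 = - r1 \<and> s2 + t2 = - r2 \<longleftrightarrow> r1 + s1 = - t1 \<and> r2 + s2 = - t2"
    "t1 + r1 = - s1 \<and> t2 + r2 = - s2 \<longleftrightarrow> r1 + s1 = - t1 \<and> r2 + s2 = - t2" by auto
  have g: "(A + Z1) + (B + Z2) + (C + Z3) = (A + B + C) + (Z1 + Z2 + Z3)" for A B C Z1 Z2 Z3 :: toroidal
    by (simp add: add_ac)
  show ?thesis
    unfolding abc L idx c g sl2_jacobi sl2_form_cyclic[of y z x] sl2_form_cyclic[of z x y]
  proof (cases "r1 + s1 = - t1 \<and> r2 + s2 = - t2")
    case True
    then have "r1 + s1 + t1 = 0" "r2 + s2 + t2 = 0" by simp_all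
    from Z[OF this] show "0 + ((if r1 + s1 = - t1 \<and> r2 + s2 = - t2 then ?Z (r1 + s1) (r2 + s2) else 0)
        + (if r1 + s1 = - t1 \<and> r2 + s2 = - t2 then ?Z (s1 + t1) (s2 + t2) else 0)
        + (if r1 + s1 = - t1 \<and> r2 + s2 = - t2 then ?Z (t1 + r1) (t2 + r2) else 0)) = 0"
      unfolding if_P[OF True] by (simp only: add_0_left)
  next
    case False
    show "0 + ((if r1 + s1 = - t1 \<and> r2 + s2 = - t2 then ?Z (r1 + s1) (r2 + s2) else 0)
        + (if r1 + s1 = - t1 \<and> r2 + s2 = - t2 then ?Z (s1 + t1) (s2 + t2) else 0)
        + (if r1 + s1 = - t1 \<and> r2 + s2 = - t2 then ?Z (t1 + r1) (t2 + r2) else 0)) = 0"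
      unfolding if_not_P[OF False] by (simp only: add_0_left)
  qed
\<comment> \<open>With exactly one derivation and two loops the cyclic sum is rotated until the
  derivation stands last; in the remaining cases the terms vanish or cancel directly.\<close>
qed ((rule toroidal_jacobi_D, assumption, assumption, (rule disjI1, assumption | rule disjI2, assumption)) |
    (subst add.commute, subst add.assoc[symmetric], rule toroidal_jacobi_D, assumption, assumption,
      (rule disjI1, assumption | rule disjI2, assumption)) |
    (subst add.assoc, subst add.commute, rule toroidal_jacobi_D, assumption, assumption,
      (rule disjI1, assumption | rule disjI2, assumption)) |
    (simp add: pm.lin_uminus pm.lin_scl))+

lemma lie_basis_toroidal: "lie_basis (split_key N) toroidal_basis_bracket"
  by unfold_locales
    (rule inj_split_key toroidal_basis_bracket_self toroidal_basis_bracket_anti toroidal_jacobi)+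

section \<open>The enveloping algebra as a quotient type\<close>

lemma free_algebra_UNIV: "free_algebra UNIV = ring_of_type_algebra"
  by (simp add: free_algebra_def ring_of_type_algebra_def)

lemma ring_free_algebra_UNIV: "ring (free_algebra UNIV)"
proof -
  have "\<exists>y. x + y = 0" for x :: free_alg using add.right_inverse by blast
  then show ?thesis
    unfolding free_algebra_UNIV ring_of_type_algebra_def
    using add.right_inverse by unfold_locales (auto simp: algebra_simps Units_def)
qed

interpretation FA: ring "free_algebra UNIV"
  by (rule ring_free_algebra_UNIV)

lemma FA_simps [simp]:
  "carrier (free_algebra UNIV) = UNIV" "x \<oplus>\<^bsub>free_algebra UNIV\<^esub> y = x + y"
  "x \<otimes>\<^bsub>free_algebra UNIV\<^esub> y = x * y" "\<zero>\<^bsub>free_algebra UNIV\<^esub> = 0" "\<one>\<^bsub>free_algebra UNIV\<^esub> = 1"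
  by (simp_all add: free_algebra_UNIV ring_of_type_algebra_def)

abbreviation EI where "EI \<equiv> env_ideal UNIV"

lemma ideal_EI: "ideal EI (free_algebra UNIV)"
  unfolding env_ideal_def by (rule FA.genideal_ideal) simp

lemma EI_closed:
  "0 \<in> EI" "x \<in> EI \<Longrightarrow> y \<in> EI \<Longrightarrow> x + y \<in> EI" "x \<in> EI \<Longrightarrow> p * x \<in> EI" "x \<in> EI \<Longrightarrow> x * p \<in> EI"
  using ideal.I_l_closed[OF ideal_EI] ideal.I_r_closed[OF ideal_EI] additive_subgroup.zero_closed[OF ideal.axioms(1)[OF ideal_EI]]
    additive_subgroup.a_closed[OF ideal.axioms(1)[OF ideal_EI]] by auto

lemma EI_uminus: "x \<in> EI \<Longrightarrow> - x \<in> EI"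
  using EI_closed(3)[of x "- 1"] by simp

lemma EI_relations: "env_relations UNIV \<subseteq> EI"
  unfolding env_ideal_def by (rule FA.genideal_self) simp

text \<open>The generated ideal of the record-based algebra, expressed by type class operations. It
  reduces a property of all of \<open>EI\<close> to the defining relations.\<close>

lemma EI_minimal:
  assumes "env_relations UNIV \<subseteq> S" "0 \<in> S" "\<And>x y. x \<in> S \<Longrightarrow> y \<in> S \<Longrightarrow> x + y \<in> S"
    "\<And>p x. x \<in> S \<Longrightarrow> p * x \<in> S" "\<And>p x. x \<in> S \<Longrightarrow> x * p \<in> S"
  shows "EI \<subseteq> S"
proof -
  have m: "- x \<in> S" if "x \<in> S" for x using assms(4)[OF that, of "- 1"] by simp
  have "subgroup S (add_monoid (free_algebra UNIV))"
  proof
    fix x assume "x \<in> S"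
    have "x \<oplus>\<^bsub>free_algebra UNIV\<^esub> (- x) = \<zero>\<^bsub>free_algebra UNIV\<^esub>" by simp
    then have "\<ominus>\<^bsub>free_algebra UNIV\<^esub> x = - x" by (intro FA.minus_equality) (simp_all add: add.commute)
    then show "inv\<^bsub>add_monoid (free_algebra UNIV)\<^esub> x \<in> S" using m[OF \<open>x \<in> S\<close>] by (simp add: a_inv_def)
  qed (use assms in simp_all)
  then have "ideal S (free_algebra UNIV)"
    by (intro idealI ring_free_algebra_UNIV) (use assms in simp_all)
  then show ?thesis unfolding env_ideal_def by (rule FA.genideal_minimal) (rule assms(1))
qed

interpretation cx: cspace "(*) :: complex \<Rightarrow> complex \<Rightarrow> complex"
  by unfold_locales (simp_all add: algebra_simps)

declare cx.scale_scale [simp del]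

lemma (in cspace) lin_bas_mult: "lin f (bas u * p) = lin (\<lambda>w. f (u + w)) p"
proof (induction p rule: lin_induct)
  case (add p c b)
  have "bas u * (p + scl c (bas b)) = bas u * p + scl c (bas (u + b))"
    by (simp add: distrib_left scl_single mult_single)
  with add show ?case by (simp add: lin_add lin_scl)
qed simp

lemma free_alg_eval_lin: "free_alg_eval \<chi> p = cx.lin (\<lambda>w. prod_list (map \<chi> (letters w))) p"
  by (simp add: free_alg_eval_def cx.lin_def)

lemma free_alg_eval_add: "free_alg_eval \<chi> (p + q) = free_alg_eval \<chi> p + free_alg_eval \<chi> q"
  by (simp add: free_alg_eval_lin cx.lin_add)

lemma free_alg_eval_diff: "free_alg_eval \<chi> (p - q) = free_alg_eval \<chi> p - free_alg_eval \<chi> q"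
  by (simp add: free_alg_eval_lin cx.lin_diff)

lemma free_alg_eval_scl: "free_alg_eval \<chi> (scl c p) = c * free_alg_eval \<chi> p"
  by (simp add: free_alg_eval_lin cx.lin_scl)

lemma free_alg_eval_gen [simp]: "free_alg_eval \<chi> (gen x) = \<chi> x"
  by (simp add: free_alg_eval_lin gen_def)

lemma one_bas: "(1 :: free_alg) = bas (Word [])"
  by (simp add: zero_word_def flip: single_one)

lemma free_alg_eval_one [simp]: "free_alg_eval \<chi> 1 = 1"
  by (simp add: free_alg_eval_lin one_bas)

lemma free_alg_eval_mult: "free_alg_eval \<chi> (p * q) = free_alg_eval \<chi> p * free_alg_eval \<chi> q"
proof (induction p rule: lin_induct)
  case (add p c b)
  have "free_alg_eval \<chi> (bas b * q) = prod_list (map \<chi> (letters b)) * free_alg_eval \<chi> q"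
    by (simp add: free_alg_eval_lin cx.lin_bas_mult plus_word_def cx.lin_fun_scale)
  with add show ?case
    by (simp add: distrib_right scl_mult_left free_alg_eval_add free_alg_eval_scl)
      (simp add: free_alg_eval_lin)
qed (simp add: free_alg_eval_lin)

text \<open>The augmentation, which sends all generators to 0, vanishes on the relations but not on
  1.\<close>

lemma one_notin_EI: "1 \<notin> EI"
proof -
  have "EI \<subseteq> {p. free_alg_eval (\<lambda>_. 0) p = 0}"
    by (rule EI_minimal)
      (auto simp: env_relations_def free_alg_eval_add free_alg_eval_diff free_alg_eval_scl free_alg_eval_mult
        free_alg_eval_lin[of _ 0])
  then show ?thesis by auto
qed

definition env_eq :: "free_alg \<Rightarrow> free_alg \<Rightarrow> bool" where
  "env_eq p q \<longleftrightarrow> p - q \<in> EI"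

lemma env_eqI: "p = q \<Longrightarrow> env_eq p q"
  by (simp add: env_eq_def EI_closed)

\<comment> \<open>The same quotient as \<open>UT\<close>, but as a type, so that the class
  \<open>ring_1\<close> and the locales above apply. The map \<open>coset_of\<close> translates back
  to the record.\<close>
quotient_type uea = free_alg / env_eq
proof (rule equivpI)
  show "reflp env_eq" by (rule reflpI) (simp add: env_eq_def EI_closed)
  show "symp env_eq"
  proof (rule sympI)
    fix p q assume "env_eq p q"
    then have "- (p - q) \<in> EI" unfolding env_eq_def by (rule EI_uminus)
    then show "env_eq q p" by (simp add: env_eq_def)
  qed
  show "transp env_eq"
  proof (rule transpI)
    fix p q r assume "env_eq p q" "env_eq q r"
    then have "(p - q) + (q - r) \<in> EI" unfolding env_eq_def by (rule EI_closed(2))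
    then show "env_eq p r" by (simp add: env_eq_def)
  qed
qed

instantiation uea :: ring_1
begin

lift_definition zero_uea :: uea is 0 .
lift_definition one_uea :: uea is 1 .
lift_definition plus_uea :: "uea \<Rightarrow> uea \<Rightarrow> uea" is "(+)"
proof -
  fix a b c d assume "env_eq a b" "env_eq c d"
  then have "(a - b) + (c - d) \<in> EI" unfolding env_eq_def by (rule EI_closed(2))
  then show "env_eq (a + c) (b + d)" by (simp add: env_eq_def add_diff_add)
qed
lift_definition uminus_uea :: "uea \<Rightarrow> uea" is uminus
proof -
  fix a b assume "env_eq a b"
  then have "- (a - b) \<in> EI" unfolding env_eq_def by (rule EI_uminus)
  then show "env_eq (- a) (- b)" by (simp add: env_eq_def)
qed
lift_definition minus_uea :: "uea \<Rightarrow> uea \<Rightarrow> uea" is "(-)"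
proof -
  fix a b c d assume "env_eq a b" "env_eq c d"
  then have "(a - b) + - (c - d) \<in> EI" unfolding env_eq_def by (intro EI_closed(2) EI_uminus)
  moreover have "(a - b) + - (c - d) = a - c - (b - d)" by simp
  ultimately show "env_eq (a - c) (b - d)" unfolding env_eq_def by (simp only:)
qed
lift_definition times_uea :: "uea \<Rightarrow> uea \<Rightarrow> uea" is "(*)"
proof -
  fix a b c d assume "env_eq a b" "env_eq c d"
  then have "(a - b) * c + b * (c - d) \<in> EI" unfolding env_eq_def by (intro EI_closed)
  moreover have "(a - b) * c + b * (c - d) = a * c - b * d" by (simp add: algebra_simps)
  ultimately show "env_eq (a * c) (b * d)" unfolding env_eq_def by simp
qed

instance
proof
  have "\<not> env_eq 0 1" using EI_uminus[of "0 - 1"] one_notin_EI by (auto simp: env_eq_def)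
  then show "(0 :: uea) \<noteq> 1" by transfer
qed (transfer, rule env_eqI, simp add: algebra_simps)+

end

definition uea_sc :: "complex \<Rightarrow> uea" where "uea_sc c = abs_uea (Poly_Mapping.single 0 c)"

definition uea_gen :: "toroidal_basis \<Rightarrow> uea" where "uea_gen b = abs_uea (gen (bas b))"

lemma abs_uea_simps:
  "abs_uea (p + q) = abs_uea p + abs_uea q" "abs_uea (p - q) = abs_uea p - abs_uea q"
  "abs_uea (p * q) = abs_uea p * abs_uea q" "abs_uea 0 = 0" "abs_uea 1 = 1"
  by (simp_all add: plus_uea.abs_eq minus_uea.abs_eq times_uea.abs_eq zero_uea_def one_uea_def)

lemma abs_uea_scl: "abs_uea (scl c p) = uea_sc c * abs_uea p"
  unfolding uea_sc_def abs_uea_simps(3)[symmetric] by (simp add: single_0_mult)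

lemma abs_uea_eq_iff: "abs_uea p = abs_uea q \<longleftrightarrow> p - q \<in> EI"
  using uea.abs_eq_iff by (simp add: env_eq_def)

lemma abs_uea_surj: "\<exists>p. u = abs_uea p"
  using Quotient_abs_rep[OF Quotient_uea] by metis

lemma abs_uea_gen_relations:
  "abs_uea (gen (x + y)) = abs_uea (gen x) + abs_uea (gen y)"
  "abs_uea (gen (scl c x)) = uea_sc c * abs_uea (gen x)"
  "abs_uea (gen x) * abs_uea (gen y) = abs_uea (gen y) * abs_uea (gen x) + abs_uea (gen (toroidal_bracket x y))"
proof -
  have "gen (x + y) - (gen x + gen y) \<in> EI" "gen (scl c x) - scl c (gen x) \<in> EI"
    "gen x * gen y - gen y * gen x - gen (toroidal_bracket x y) \<in> EI"
    by (rule subsetD[OF EI_relations], unfold env_relations_def, blast)+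
  then show "abs_uea (gen (x + y)) = abs_uea (gen x) + abs_uea (gen y)"
    "abs_uea (gen (scl c x)) = uea_sc c * abs_uea (gen x)"
    "abs_uea (gen x) * abs_uea (gen y) = abs_uea (gen y) * abs_uea (gen x) + abs_uea (gen (toroidal_bracket x y))"
    by (simp_all add: abs_uea_simps(1,3)[symmetric] abs_uea_scl[symmetric] abs_uea_eq_iff algebra_simps)
qed

lemma toroidal_bracket_bas: "toroidal_bracket (bas a) (bas b) = toroidal_basis_bracket a b"
  by (simp add: toroidal_bracket_def)

lemma uea_sc_comm: "u * uea_sc c = uea_sc c * u"
proof -
  obtain p where u: "u = abs_uea p" using abs_uea_surj by blast
  have "p * Poly_Mapping.single 0 c = Poly_Mapping.single 0 c * p"
    using scl_mult_right[of p c 1] scl_single[of c "0 :: toroidal word" 1] by (simp add: single_0_mult single_one)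
  then show ?thesis unfolding u uea_sc_def abs_uea_simps(3)[symmetric] by simp
qed

lemma uea_sc_add: "uea_sc (c + d) = uea_sc c + uea_sc d"
  by (simp add: uea_sc_def single_add abs_uea_simps)

lemma uea_sc_mult: "uea_sc (c * d) = uea_sc c * uea_sc d"
  unfolding uea_sc_def abs_uea_simps(3)[symmetric] by (simp add: mult_single)

lemma uea_sc_1: "uea_sc 1 = 1"
  by (simp add: uea_sc_def single_one abs_uea_simps)

lemma uea_cspace: "cspace (\<lambda>c u. uea_sc c * u)"
  by unfold_locales (simp_all add: uea_sc_add uea_sc_mult uea_sc_1 distrib_left distrib_right mult.assoc)

interpretation uea: cspace "\<lambda>c u. uea_sc c * u"
  by (rule uea_cspace)

text \<open>The free algebra has a letter for every vector of the Lie algebra; the relations of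
  linearity reduce it to the letters of the basis.\<close>

lemma abs_uea_gen: "abs_uea (gen x) = uea.lin uea_gen x"
proof (induction x rule: lin_induct)
  case zero
  have "abs_uea (gen (scl 0 0)) = uea_sc 0 * abs_uea (gen 0)" by (rule abs_uea_gen_relations)
  moreover have "uea_sc 0 = 0" by (simp add: uea_sc_def abs_uea_simps)
  ultimately show ?case by simp
next
  case (add x c b)
  then show ?case by (simp add: abs_uea_gen_relations(1,2) uea.lin_add uea.lin_scl uea_gen_def)
qed

lemma bas_Word_Cons: "bas (Word (x # xs)) = gen x * bas (Word xs)"
  by (simp add: gen_def mult_single plus_word_def)

lemma uea_generated:
  assumes one: "1 \<in> S" and S_add: "\<And>x y. x \<in> S \<Longrightarrow> y \<in> S \<Longrightarrow> x + y \<in> S"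
    and sc: "\<And>c x. x \<in> S \<Longrightarrow> uea_sc c * x \<in> S" and gen: "\<And>b x. x \<in> S \<Longrightarrow> uea_gen b * x \<in> S"
  shows "u \<in> S"
proof -
  have z: "0 \<in> S" using sc[OF one, of 0] by (simp add: uea_sc_def abs_uea_simps)
  have sum: "sum f A \<in> S" if "\<And>i. i \<in> A \<Longrightarrow> f i \<in> S" for f :: "toroidal_basis \<Rightarrow> uea" and A
    using that by (induction A rule: infinite_finite_induct) (auto intro: z S_add)
  have g: "abs_uea (gen x) * s \<in> S" if "s \<in> S" for x s
    unfolding abs_uea_gen uea.lin_def sum_distrib_right mult.assoc by (intro sum sc gen that)
  have w: "abs_uea (bas (Word xs)) \<in> S" for xs
  proof (induction xs)
    case Nil
    then show ?case using one by (simp add: one_bas[symmetric] abs_uea_simps)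
  next
    case (Cons x xs)
    then show ?case unfolding bas_Word_Cons abs_uea_simps by (rule g)
  qed
  obtain p where u: "u = abs_uea p" using abs_uea_surj by blast
  show ?thesis unfolding u
  proof (induction p rule: lin_induct)
    case zero
    then show ?case using z by (simp add: abs_uea_simps)
  next
    case (add p c b)
    have "abs_uea (bas b) \<in> S" using w[of "letters b"] by simp
    with add show ?case unfolding abs_uea_simps abs_uea_scl by (intro S_add sc)
  qed
qed

lemma uea_bracket:
  "uea_gen a * uea_gen b = uea_gen b * uea_gen a + uea.lin uea_gen (toroidal_basis_bracket a b)"
  using abs_uea_gen_relations(3)[of "bas a" "bas b"]
  unfolding toroidal_bracket_bas abs_uea_gen uea.lin_bas .

interpretation uea: toroidal_alg uea_gen uea_sc
  by (rule toroidal_alg.intro[OF uea_sc_add uea_sc_mult uea_sc_1 uea_sc_comm uea_bracket]) (rule uea_generated)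

text \<open>Multilinear extension of a function on words of basis letters; a solution of the straightening
  relation extends to a linear map on the enveloping algebra.\<close>

context cspace
begin

primrec mlin :: "('k \<Rightarrow>\<^sub>0 complex) list \<Rightarrow> ('k list \<Rightarrow> 'v) \<Rightarrow> 'v" where
  "mlin [] f = f []"
| "mlin (x # xs) f = lin (\<lambda>b. mlin xs (\<lambda>w. f (b # w))) x"

lemma mlin_append: "mlin (xs @ ys) f = mlin xs (\<lambda>u. mlin ys (\<lambda>v. f (u @ v)))"
  by (induction xs arbitrary: f) simp_all

lemma mlin_bas: "mlin (map bas w) f = f w"
  by (induction w arbitrary: f) simp_all

lemma mlin_fun_add: "mlin xs (\<lambda>w. f w + g w) = mlin xs f + mlin xs g"
  by (induction xs arbitrary: f g) (simp_all add: lin_fun_add)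

lemma mlin_fun_scale: "mlin xs (\<lambda>w. scale c (f w)) = scale c (mlin xs f)"
  by (induction xs arbitrary: f) (simp_all add: lin_fun_scale)

definition word_ext :: "('k list \<Rightarrow> 'v) \<Rightarrow> (('k \<Rightarrow>\<^sub>0 complex) word \<Rightarrow>\<^sub>0 complex) \<Rightarrow> 'v" where
  "word_ext f p = lin (\<lambda>w. mlin (letters w) f) p"

lemma lin_mult_bas: "lin f (p * bas u) = lin (\<lambda>w. f (w + u)) p"
proof (induction p rule: lin_induct)
  case (add p c b)
  have "(p + scl c (bas b)) * bas u = p * bas u + scl c (bas (b + u))"
    by (simp add: distrib_right scl_single mult_single)
  with add show ?case by (simp add: lin_add lin_scl)
qed simp

lemma word_ext_bas_mult:
  "word_ext f (bas u * p * bas v) = lin (\<lambda>w. mlin (letters u @ letters w @ letters v) f) p"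
  by (simp add: word_ext_def lin_bas_mult lin_mult_bas plus_word_def add.assoc mult.assoc)

text \<open>Sandwiching between words turns the vanishing condition into a two-sided ideal, so only
  the relations have to be checked. Multilinearity settles the relations of linearity, and the
  bilinear extension of \<open>rel\<close> those of the bracket.\<close>

lemma word_ext_vanish:
  assumes rel: "\<And>u a b v. f (u @ a # b # v) = f (u @ b # a # v) + lin (\<lambda>c. f (u @ c # v)) (toroidal_basis_bracket a b)"
    and p: "p \<in> EI"
  shows "word_ext f p = 0"
proof -
  let ?S = "{p. \<forall>u v. word_ext f (bas u * p * bas v) = 0}"
  have ext_add: "word_ext f (x + y) = word_ext f x + word_ext f y"
    and ext_scl: "word_ext f (scl c x) = scale c (word_ext f x)" and ext_zero: "word_ext f 0 = 0" for x y c
    by (simp_all add: word_ext_def lin_add lin_scl)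
  have br: "lin (\<lambda>a. lin (\<lambda>b. g (toroidal_basis_bracket a b)) y) x = g (toroidal_bracket x y)"
    if g: "g = lin h" for g h x y
    unfolding g toroidal_bracket_def lin_sum lin_scl
    by (simp add: lin_def scale_sum_right mult.assoc)
  have "EI \<subseteq> ?S"
  proof (rule EI_minimal)
    show "env_relations UNIV \<subseteq> ?S"
    proof
      fix r assume "r \<in> env_relations UNIV"
      then consider x y where "r = gen (x + y) - (gen x + gen y)" | c x where "r = gen (scl c x) - scl c (gen x)"
        | x y where "r = gen x * gen y - gen y * gen x - gen (toroidal_bracket x y)"
        by (auto simp: env_relations_def)
      then show "r \<in> ?S"
      proof cases
        case 1
        then show ?thesis
          by (simp add: word_ext_bas_mult lin_diff lin_add gen_def mlin_append)
            (simp add: lin_add mlin_fun_add)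
      next
        case 2
        then show ?thesis
          by (simp add: word_ext_bas_mult lin_diff lin_scl gen_def mlin_append mlin_fun_scale)
      next
        case 3
        have g: "gen x * gen y = bas (Word [x, y])" for x y
          by (simp add: gen_def mult_single plus_word_def)
        have m: "mlin [x, y] h = mlin [y, x] h + mlin [toroidal_bracket x y] h"
          if "\<And>a b. h [a, b] = h [b, a] + lin (\<lambda>c. h [c]) (toroidal_basis_bracket a b)" for h
        proof -
          have "mlin [x, y] h = lin (\<lambda>a. lin (\<lambda>b. h [b, a] + lin (\<lambda>c. h [c]) (toroidal_basis_bracket a b)) y) x"
            by (simp add: that[symmetric])
          also have "\<dots> = lin (\<lambda>a. lin (\<lambda>b. h [b, a]) y) x + lin (\<lambda>c. h [c]) (toroidal_bracket x y)"
            by (simp add: lin_fun_add br)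
          also have "lin (\<lambda>a. lin (\<lambda>b. h [b, a]) y) x = mlin [y, x] h" by (simp add: lin_swap[of _ y x])
          finally show ?thesis by simp
        qed
        have "mlin (us @ [x, y] @ vs) f = mlin (us @ [y, x] @ vs) f + mlin (us @ [toroidal_bracket x y] @ vs) f" for us vs
        proof -
          have "mlin [x, y] (\<lambda>ab. mlin vs (\<lambda>v. f (u @ ab @ v))) = mlin [y, x] (\<lambda>ab. mlin vs (\<lambda>v. f (u @ ab @ v)))
             + mlin [toroidal_bracket x y] (\<lambda>ab. mlin vs (\<lambda>v. f (u @ ab @ v)))" for u
          proof (rule m)
            fix a b
            have s: "mlin vs (\<lambda>v. lin (F v) z) = lin (\<lambda>c. mlin vs (\<lambda>v. F v c)) z" for F :: "toroidal_basis list \<Rightarrow> toroidal_basis \<Rightarrow> 'v" and z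
              by (induction vs arbitrary: F) (simp_all add: lin_swap[of _ z])
            show "mlin vs (\<lambda>v. f (u @ [a, b] @ v)) = mlin vs (\<lambda>v. f (u @ [b, a] @ v))
              + lin (\<lambda>c. mlin vs (\<lambda>v. f (u @ [c] @ v))) (toroidal_basis_bracket a b)"
              by (simp add: rel[of u a b] mlin_fun_add s)
          qed
          then show ?thesis unfolding mlin_append by (simp only: mlin_fun_add)
        qed
        then show ?thesis unfolding 3 g by (simp add: word_ext_bas_mult lin_diff) (simp add: gen_def)
      qed
    qed
  next
    show "0 \<in> ?S" by (simp add: ext_zero)
  next
    fix x y assume "x \<in> ?S" "y \<in> ?S"
    then show "x + y \<in> ?S" by (simp add: distrib_left distrib_right ext_add)
  next
    fix q x assume x: "x \<in> ?S"
    have "word_ext f (bas u * (q * x) * bas v) = 0" for u v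
    proof (induction q rule: lin_induct)
      case (add q c b)
      have "bas u * (scl c (bas b) * x) * bas v = scl c (bas (u + b) * x * bas v)"
        by (simp add: scl_mult_left scl_mult_right mult.assoc[symmetric]) (simp add: mult_single)
      with add x show ?case by (simp add: distrib_left distrib_right ext_add ext_scl)
    qed (simp add: ext_zero)
    then show "q * x \<in> ?S" by simp
    have "word_ext f (bas u * (x * q) * bas v) = 0" for u v
    proof (induction q rule: lin_induct)
      case (add q c b)
      have "bas u * (x * scl c (bas b)) * bas v = scl c (bas u * x * bas (b + v))"
        by (simp add: scl_mult_left scl_mult_right mult.assoc) (simp add: mult_single)
      with add x show ?case by (simp add: distrib_left distrib_right ext_add ext_scl)
    qed (simp add: ext_zero)
    then show "x * q \<in> ?S" by simp
  qed
  with p have "word_ext f (bas (Word []) * p * bas (Word [])) = 0" by auto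
  then show ?thesis by (simp add: one_bas[symmetric])
qed

theorem uea_extend:
  fixes f :: "toroidal_basis list \<Rightarrow> 'v"
  assumes rel: "\<And>u a b v. f (u @ a # b # v) = f (u @ b # a # v) + lin (\<lambda>c. f (u @ c # v)) (toroidal_basis_bracket a b)"
  shows "\<exists>g :: uea \<Rightarrow> 'v. (\<forall>x y. g (x + y) = g x + g y) \<and> (\<forall>c x. g (uea_sc c * x) = scale c (g x)) \<and>
    (\<forall>w. g (uea.word w) = f w)"
proof -
  \<comment> \<open>Any representative gives the same value, since \<open>word_ext f\<close>
    vanishes on \<open>EI\<close>.\<close>
  define g where "g u = word_ext f (rep_uea u)" for u
  have ext_add: "word_ext f (x + y) = word_ext f x + word_ext f y"
    and ext_scl: "word_ext f (scl c x) = scale c (word_ext f x)"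
    and ext_diff: "word_ext f (x - y) = word_ext f x - word_ext f y" for x y c
    by (simp_all add: word_ext_def lin_add lin_scl lin_diff)
  have g: "g (abs_uea p) = word_ext f p" for p
  proof -
    have "rep_uea (abs_uea p) - p \<in> EI"
      using Quotient_abs_rep[OF Quotient_uea] abs_uea_eq_iff by metis
    then have "word_ext f (rep_uea (abs_uea p) - p) = 0" by (rule word_ext_vanish[OF rel])
    then show ?thesis by (simp add: g_def ext_diff)
  qed
  have "g (x + y) = g x + g y" for x y
    using abs_uea_surj[of x] abs_uea_surj[of y] by (auto simp: g ext_add simp flip: abs_uea_simps(1))
  moreover have "g (uea_sc c * x) = scale c (g x)" for c x
    using abs_uea_surj[of x] by (auto simp: g ext_scl simp flip: abs_uea_scl)
  moreover have "g (uea.word w) = f w" for w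
  proof -
    have "uea.word w = abs_uea (bas (Word (map bas w)))"
      by (induction w) (simp_all add: bas_Word_Cons abs_uea_simps one_bas[symmetric] flip: uea_gen_def)
    then show ?thesis by (simp add: g word_ext_def mlin_bas)
  qed
  ultimately show ?thesis by blast
qed

end

inductive_set lgen :: "'u::ring_1 set \<Rightarrow> 'u set" for G where
  lgen_0: "0 \<in> lgen G"
| lgen_add: "x \<in> lgen G \<Longrightarrow> g \<in> G \<Longrightarrow> u * g + x \<in> lgen G"

lemma lgen_plus: "x \<in> lgen G \<Longrightarrow> y \<in> lgen G \<Longrightarrow> x + y \<in> lgen G"
  by (induction rule: lgen.induct) (simp_all add: lgen.intros add.assoc)

lemma lgen_mult: "x \<in> lgen G \<Longrightarrow> v * x \<in> lgen G"
proof (induction rule: lgen.induct)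
  case (lgen_add x g u)
  then show ?case using lgen.lgen_add[of "v * x" G g "v * u"] by (simp add: distrib_left mult.assoc)
qed (simp add: lgen_0)

lemma left_ideal_lgen: "left_ideal (lgen G)"
  by unfold_locales (simp_all add: lgen_0 lgen_plus lgen_mult)

lemma lgen_gen: "g \<in> G \<Longrightarrow> g \<in> lgen G"
  using lgen_add[OF lgen_0, of g G 1] by simp

lemma lgen_minimal:
  assumes "left_ideal K" "G \<subseteq> K"
  shows "lgen G \<subseteq> K"
proof
  interpret left_ideal K by fact
  fix x assume "x \<in> lgen G"
  then show "x \<in> K" by induction (use assms(2) in \<open>auto intro: add_mem mult_mem\<close>)
qed

text \<open>The words span \<open>U\<close>. Since \<open>generated\<close> multiplies by letters on
  the left, the invariant has to allow an arbitrary word as a prefix.\<close>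

lemma (in toroidal_alg) word_induct:
  assumes "\<And>w. P (word w)" "\<And>x y. P x \<Longrightarrow> P y \<Longrightarrow> P (x + y)" "\<And>c x. P x \<Longrightarrow> P (sc c * x)"
  shows "P u"
proof -
  have "u \<in> {u. \<forall>w. P (word w * u)}"
  proof (rule generated)
    show "1 \<in> {u. \<forall>w. P (word w * u)}" by (simp add: assms(1))
  next
    fix x y assume "x \<in> {u. \<forall>w. P (word w * u)}" "y \<in> {u. \<forall>w. P (word w * u)}"
    then show "x + y \<in> {u. \<forall>w. P (word w * u)}" by (simp add: distrib_left assms(2))
  next
    fix c x assume "x \<in> {u. \<forall>w. P (word w * u)}"
    then show "sc c * x \<in> {u. \<forall>w. P (word w * u)}"
      using assms(3) by (simp add: sc_left_comm[of "word w" for w])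
  next
    fix b x assume x: "x \<in> {u. \<forall>w. P (word w * u)}"
    have "P (word w * (\<iota> b * x))" for w
    proof -
      have "P (word (w @ [b]) * x)" using x by blast
      then show ?thesis by (simp only: word_snoc)
    qed
    then show "\<iota> b * x \<in> {u. \<forall>w. P (word w * u)}" by simp
  qed
  then have "P (word [] * u)" by blast
  then show ?thesis by simp
qed

lemma (in toroidal_alg) mult_lin: "x * lin f z = lin (\<lambda>c. x * f c) z"
  by (simp add: lin_def sum_distrib_left sc_left_comm[of x])

section \<open>Two applications of straightening\<close>

fun neg_basis :: "toroidal_basis \<Rightarrow> bool" where
  "neg_basis (Loop b m n) \<longleftrightarrow> n < 0 \<or> n = 0 \<and> (m < 0 \<or> m = 0 \<and> b = BF)"
| "neg_basis _ \<longleftrightarrow> False"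

definition cartan_basis :: "toroidal_basis set" where
  "cartan_basis = {Loop BH 0 0, C1, C2, D1, D2}"

text \<open>On the letters of the Borel subalgebra this is the character defined by \<lambda>:
  positive letters are sent to 0.\<close>

definition weight :: "(toroidal \<Rightarrow> complex) \<Rightarrow> toroidal_basis \<Rightarrow> complex" where
  "weight lam b = (if b \<in> cartan_basis then lam (bas b) else 0)"

text \<open>The annihilator of the highest weight vector, so that \<open>U\<close> modulo it is
  \<open>M(\<lambda>)\<close>; the identification is made in \<open>ker_verma\<close>.\<close>

definition verma_ideal :: "(toroidal \<Rightarrow> complex) \<Rightarrow> uea set" where
  "verma_ideal lam = lgen {uea_gen b - uea_sc (weight lam b) | b. \<not> neg_basis b}"

lemma keys_scl_bas: "c \<in> Poly_Mapping.keys (scl r (bas b)) \<Longrightarrow> c = b \<and> r \<noteq> 0"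
  by (auto simp: in_keys_iff lookup_single when_def split: if_splits)

lemma keys_bracket_Loop:
  assumes "c \<in> Poly_Mapping.keys (toroidal_basis_bracket (Loop a r1 r2) (Loop b s1 s2))"
  shows "c = Loop (sl2_prod a b) (r1 + s1) (r2 + s2) \<and> sl2_coeff a b \<noteq> 0
    \<or> (c = C1 \<or> c = C2) \<and> r1 = - s1 \<and> r2 = - s2 \<and> sl2_basis_form a b \<noteq> 0"
proof (rule ccontr)
  assume n: "\<not> (c = Loop (sl2_prod a b) (r1 + s1) (r2 + s2) \<and> sl2_coeff a b \<noteq> 0
    \<or> (c = C1 \<or> c = C2) \<and> r1 = - s1 \<and> r2 = - s2 \<and> sl2_basis_form a b \<noteq> 0)"
  have "Poly_Mapping.lookup (toroidal_basis_bracket (Loop a r1 r2) (Loop b s1 s2)) c = 0"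
    unfolding toroidal_basis_bracket_Loop lookup_add
    using n by (cases c) (auto simp: lookup_add lookup_minus lookup_uminus lookup_single when_def)
  with assms show False by (simp add: in_keys_iff del: toroidal_basis_bracket.simps)
qed

lemma keys_bracket_D:
  assumes "c \<in> Poly_Mapping.keys (toroidal_basis_bracket a b)" "a \<in> {D1, D2}"
  shows "c = b \<and> \<not> (deg1 b = 0 \<and> deg2 b = 0)"
  using assms by (cases b) (auto dest: keys_scl_bas)

lemma keys_bracket_cases:
  assumes "c \<in> Poly_Mapping.keys (toroidal_basis_bracket a b)"
  obtains x r1 r2 y s1 s2 where "a = Loop x r1 r2" "b = Loop y s1 s2"
  | "a \<in> {D1, D2}" "c = b" "\<not> (deg1 b = 0 \<and> deg2 b = 0)"
  | "b \<in> {D1, D2}" "c = a" "\<not> (deg1 a = 0 \<and> deg2 a = 0)"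
proof -
  have sym: "c \<in> Poly_Mapping.keys (toroidal_basis_bracket b a)"
    using assms unfolding toroidal_basis_bracket_anti[of b a] by (simp add: in_keys_iff)
  consider "a \<in> {D1, D2}" | "b \<in> {D1, D2}" | x r1 r2 y s1 s2 where "a = Loop x r1 r2" "b = Loop y s1 s2"
    using assms by (cases a; cases b) auto
  then show ?thesis
  proof cases
    case 1 then show ?thesis using keys_bracket_D[OF assms] that(2) by blast
  next
    case 2 then show ?thesis using keys_bracket_D[OF sym] that(3) by blast
  next
    case 3 then show ?thesis using that(1) by blast
  qed
qed

lemma keys_bracket_borel:
  assumes "\<not> neg_basis a" "\<not> neg_basis b" "c \<in> Poly_Mapping.keys (toroidal_basis_bracket a b)"
  shows "\<not> neg_basis c \<and> (c \<in> cartan_basis \<longrightarrow> c \<in> {C1, C2} \<and> (\<exists>x y. a = Loop x 0 0 \<and> b = Loop y 0 0))"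
  using assms(3)
proof (cases rule: keys_bracket_cases)
  case (1 x r1 r2 y s1 s2)
  from keys_bracket_Loop[OF assms(3)[unfolded 1]] assms(1,2)[unfolded 1] show ?thesis
    unfolding 1 by (cases x; cases y) (auto simp: cartan_basis_def)
next
  case 2
  with assms show ?thesis by (auto simp: cartan_basis_def)
next
  case 3
  with assms show ?thesis by (auto simp: cartan_basis_def)
qed

text \<open>This makes \<open>weight\<close> a character of the Borel subalgebra: brackets have no
  Cartan component, apart from central terms of two letters of degree (0,0), whose coefficients are
  zero.\<close>

lemma bracket_weight:
  assumes "\<not> neg_basis a" "\<not> neg_basis b"
  shows "cx.lin (\<lambda>c. weight lam c * z) (toroidal_basis_bracket a b) = 0"
proof (cases "\<exists>x y. a = Loop x 0 0 \<and> b = Loop y 0 0")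
  case False
  show ?thesis
  proof (rule cx.lin_eq_0)
    fix c assume "c \<in> Poly_Mapping.keys (toroidal_basis_bracket a b)"
    from keys_bracket_borel[OF assms this] False have "c \<notin> cartan_basis" by blast
    then show "weight lam c * z = 0" by (simp add: weight_def)
  qed
next
  case True
  then obtain x y where ab: "a = Loop x 0 0" "b = Loop y 0 0" by blast
  have "x \<noteq> BF" "y \<noteq> BF" using assms ab by auto
  then have "sl2_coeff x y = 0 \<or> sl2_prod x y = BE" by (cases x; cases y) auto
  then show ?thesis unfolding ab toroidal_basis_bracket_Loop
    by (auto simp: cx.lin_add cx.lin_scl weight_def cartan_basis_def)
qed

text \<open>Here \<open>N\<close> is the negative part, the values are complex numbers and the Borel
  letters act by \<open>weight\<close>. The functional obtained is the coefficient of the highest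
  weight vector; it is 1 at the element 1 and kills \<open>verma_ideal\<close>.\<close>

lemma one_notin_verma_ideal: "1 \<notin> verma_ideal lam"
proof -
  interpret pbw_right "split_key neg_basis" toroidal_basis_bracket "(*) :: complex \<Rightarrow> complex \<Rightarrow> complex"
    neg_basis "\<lambda>b z. weight lam b * z" "\<lambda>w. if w = [] then 1 else 0"
  proof (intro pbw_right.intro lie_basis_toroidal cx.cspace_axioms pbw_right_axioms.intro)
    fix a b c assume "\<not> neg_basis a" "\<not> neg_basis b" "c \<in> Poly_Mapping.keys (toroidal_basis_bracket a b)"
    from keys_bracket_borel[OF this] show "\<not> neg_basis c" ..
  next
    fix a b x assume "\<not> neg_basis a" "\<not> neg_basis b"
    then show "weight lam b * (weight lam a * x) = weight lam a * (weight lam b * x)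
        + cx.lin (\<lambda>c. weight lam c * x) (toroidal_basis_bracket a b)"
      by (simp add: bracket_weight mult.left_commute)
  qed (simp_all add: split_key_less algebra_simps)
  obtain g :: "uea \<Rightarrow> complex" where "\<forall>x y. g (x + y) = g x + g y" "\<forall>c x. g (uea_sc c * x) = c * g x"
    "\<forall>w. g (uea.word w) = straighten w"
    using cx.uea_extend[of straighten, OF straighten_swap] by (elim exE conjE)
  then have g: "g (x + y) = g x + g y" "g (uea_sc c * x) = c * g x" "g (uea.word w) = straighten w" for x y c w
    by simp_all
  have right: "g (u * uea_gen b) = weight lam b * g u" if "\<not> neg_basis b" for u b
  proof (rule uea.word_induct[where u = u])
    fix w
    show "g (uea.word w * uea_gen b) = weight lam b * g (uea.word w)"
      using straighten_right[OF that, of w] g(3)[of "w @ [b]"] by (simp add: g(3))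
  qed (simp_all add: distrib_right g(1,2) distrib_left mult.assoc mult.left_commute[of _ "weight lam b"] del: scale_scale)
  have g0: "g 0 = 0" using g(1)[of 0 0] by simp
  have gd: "g (x - y) = g x - g y" for x y using g(1)[of "x - y" y] by simp
  have "g x = 0" if "x \<in> verma_ideal lam" for x
    using that unfolding verma_ideal_def
  proof induction
    case lgen_0
    show ?case by (rule g0)
  next
    case (lgen_add x h u)
    then obtain b where b: "h = uea_gen b - uea_sc (weight lam b)" "\<not> neg_basis b" by blast
    have "g (u * h) = 0"
      unfolding b(1) right_diff_distrib gd uea_sc_comm[of u] g(2) right[OF b(2)] by simp
    with lgen_add show ?case by (simp add: g(1))
  qed
  moreover have "g 1 \<noteq> 0"
    using g(3)[of "[]"] straighten_sorted[of "[]"] by (simp add: \<psi>_def)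
  ultimately show ?thesis by blast
qed

text \<open>Here \<open>N\<close> consists of the letters of negative t2-degree, and the values lie
  in \<open>U\<close> itself with right multiplication as the action.\<close>

lemma ex_coeff_map:
  assumes J: "low J"
  shows "\<exists>\<Phi> :: uea \<Rightarrow> uea. (\<forall>x y. \<Phi> (x + y) = \<Phi> x + \<Phi> y) \<and> (\<forall>c x. \<Phi> (uea_sc c * x) = uea_sc c * \<Phi> x)
    \<and> (\<forall>b x. deg2 b \<ge> 0 \<longrightarrow> \<Phi> (x * uea_gen b) = \<Phi> x * uea_gen b)
    \<and> (\<forall>w. low w \<longrightarrow> length w < length J \<longrightarrow> \<Phi> (uea.word w) = 0)
    \<and> (\<forall>w. low w \<longrightarrow> length w = length J \<longrightarrow> \<Phi> (uea.word w) = (if mset w = mset J then 1 else 0))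
    \<and> (\<forall>w. low w \<longrightarrow> sum_list (map deg1 w) \<noteq> sum_list (map deg1 J) \<longrightarrow> \<Phi> (uea.word w) = 0)"
proof -
  define N where "N b \<longleftrightarrow> deg2 b < 0" for b
  \<comment> \<open>\<open>pbw_coeff\<close> asks for a sorted word; the required properties depend
    only on the multiset of \<open>J\<close>.\<close>
  define J' where "J' = sort_key (split_key N) J"
  have mset: "mset J' = mset J" by (simp add: J'_def)
  have len: "length J' = length J" by (simp add: J'_def)
  have sum: "sum_list (map deg1 J') = sum_list (map deg1 J)"
    by (metis mset mset_map sum_mset_sum_list)
  have low_N: "low w \<longleftrightarrow> (\<forall>a\<in>set w. N a)" for w by (simp add: low_def N_def)
  interpret pbw_coeff "split_key N" toroidal_basis_bracket "\<lambda>c u. uea_sc c * u" N "\<lambda>b u. u * uea_gen b" J' 1 deg1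
  proof (intro pbw_coeff.intro pbw_right.intro lie_basis_toroidal uea_cspace pbw_right_axioms.intro pbw_coeff_axioms.intro)
    fix a b c assume "\<not> N a" "\<not> N b" and c: "c \<in> Poly_Mapping.keys (toroidal_basis_bracket a b)"
    then have ab: "deg2 a \<ge> 0" "deg2 b \<ge> 0" by (simp_all add: N_def)
    show "\<not> N c" using c
    proof (cases rule: keys_bracket_cases)
      case (1 x r1 r2 y s1 s2)
      from keys_bracket_Loop[OF c[unfolded 1]] ab show ?thesis by (auto simp: N_def 1)
    qed (use ab in \<open>auto simp: N_def\<close>)
  next
    fix a b and x :: uea
    have "x * (uea_gen a * uea_gen b) = x * (uea_gen b * uea_gen a) + uea.lin (\<lambda>c. x * uea_gen c) (toroidal_basis_bracket a b)"
      unfolding uea_bracket[of a b] distrib_left uea.mult_lin ..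
    then show "x * uea_gen a * uea_gen b = x * uea_gen b * uea_gen a + uea.lin (\<lambda>c. x * uea_gen c) (toroidal_basis_bracket a b)"
      by (simp only: mult.assoc)
  next
    fix a b c assume "N a" "N b" and c: "c \<in> Poly_Mapping.keys (toroidal_basis_bracket a b)"
    then obtain x r1 r2 y s1 s2 where "a = Loop x r1 r2" "b = Loop y s1 s2" "r2 < 0" "s2 < 0"
      by (cases a; cases b) (auto simp: N_def)
    with keys_bracket_Loop[of c x r1 r2 y s1 s2] c show "N c \<and> deg1 c = deg1 a + deg1 b"
      by (auto simp: N_def)
  next
    show "\<forall>a\<in>set J'. N a" using J low_mset[OF mset] low_N by blast
    show "sorted (map (split_key N) J')" by (simp add: J'_def)
  qed (simp_all add: split_key_less distrib_right mult.assoc)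
  obtain g :: "uea \<Rightarrow> uea" where "\<forall>x y. g (x + y) = g x + g y" "\<forall>c x. g (uea_sc c * x) = uea_sc c * g x"
    "\<forall>w. g (uea.word w) = straighten w"
    using uea.uea_extend[of straighten, OF straighten_swap] by (elim exE conjE)
  then have g: "g (x + y) = g x + g y" "g (uea_sc c * x) = uea_sc c * g x" "g (uea.word w) = straighten w" for x y c w
    by simp_all
  have right: "g (u * uea_gen b) = g u * uea_gen b" if "deg2 b \<ge> 0" for u b
  proof (rule uea.word_induct[where u = u])
    fix w
    show "g (uea.word w * uea_gen b) = g (uea.word w) * uea_gen b"
      using straighten_right[of b w] that g(3)[of "w @ [b]"] by (simp add: g(3) N_def)
  qed (simp_all add: distrib_right g(1,2) mult.assoc)
  show ?thesis
    by (rule exI[of _ g])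
      (use g right straighten_short straighten_length_eq straighten_deg in \<open>simp add: low_N len sum mset\<close>)
qed

section \<open>Weights and the maximal left ideal\<close>

text \<open>The image of \<open>U(T_-)\<close> in \<open>U\<close>, as a span of words without a
  claim of linear independence.\<close>

inductive_set (in toroidal_alg) neg_alg :: "'u set" where
  neg_alg_word: "list_all neg_basis w \<Longrightarrow> word w \<in> neg_alg"
| neg_alg_add: "x \<in> neg_alg \<Longrightarrow> y \<in> neg_alg \<Longrightarrow> x + y \<in> neg_alg"
| neg_alg_sc: "x \<in> neg_alg \<Longrightarrow> sc c * x \<in> neg_alg"

text \<open>The augmentation ideal of the negative part. Adding one word at a time exhibits an
  element as the finite sum that \<open>weight_separate\<close> works with.\<close>

inductive_set (in toroidal_alg) neg_aug :: "'u set" where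
  neg_aug_0: "0 \<in> neg_aug"
| neg_aug_add: "x \<in> neg_aug \<Longrightarrow> list_all neg_basis w \<Longrightarrow> w \<noteq> [] \<Longrightarrow> sc c * word w + x \<in> neg_aug"

context toroidal_alg
begin

lemma neg_alg_gen: "x \<in> neg_alg \<Longrightarrow> neg_basis b \<Longrightarrow> \<iota> b * x \<in> neg_alg"
proof (induction rule: neg_alg.induct)
  case (neg_alg_word w)
  then show ?case using neg_alg.neg_alg_word[of "b # w"] by simp
qed (simp_all add: distrib_left sc_left_comm[of "\<iota> b"] neg_alg_add neg_alg_sc)

lemma neg_alg_0: "0 \<in> neg_alg"
  using neg_alg_sc[OF neg_alg_word[of "[]"], of 0] by simp

lemma neg_aug_plus: "x \<in> neg_aug \<Longrightarrow> y \<in> neg_aug \<Longrightarrow> x + y \<in> neg_aug"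
  by (induction rule: neg_aug.induct) (simp_all add: add.assoc neg_aug.neg_aug_add)

lemma neg_aug_scale: "x \<in> neg_aug \<Longrightarrow> sc c * x \<in> neg_aug"
proof (induction rule: neg_aug.induct)
  case (neg_aug_add x w d)
  then show ?case using neg_aug.neg_aug_add[of "sc c * x" w "c * d"] by (simp add: distrib_left)
qed (simp add: neg_aug_0)

lemma neg_alg_split: "x \<in> neg_alg \<Longrightarrow> \<exists>c. x - sc c \<in> neg_aug"
proof (induction rule: neg_alg.induct)
  case (neg_alg_word w)
  show ?case
  proof (cases w)
    case Nil
    then show ?thesis by (intro exI[of _ 1]) (simp add: neg_aug_0)
  next
    case Cons
    then show ?thesis using neg_aug_add[OF neg_aug_0 neg_alg_word, of 1]
      by (intro exI[of _ 0]) simp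
  qed
next
  case (neg_alg_add x y)
  then obtain c d where "x - sc c \<in> neg_aug" "y - sc d \<in> neg_aug" by (elim exE)
  from neg_aug_plus[OF this] have "(x + y) - sc (c + d) \<in> neg_aug" by (simp add: sc_add algebra_simps)
  then show ?case ..
next
  case (neg_alg_sc x c)
  then obtain d where "x - sc d \<in> neg_aug" by (elim exE)
  from neg_aug_scale[OF this, of c] have "sc c * x - sc (c * d) \<in> neg_aug"
    by (simp add: right_diff_distrib sc_mult)
  then show ?case ..
qed

lemma neg_alg_mult_word:
  assumes "x \<in> neg_alg" "list_all neg_basis w" "w \<noteq> []"
  shows "x * word w \<in> neg_aug"
  using assms(1)
proof (induction rule: neg_alg.induct)
  case (neg_alg_word v)
  then show ?case using neg_aug_add[OF neg_aug_0, of "v @ w" 1] assms(2,3) by simp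
qed (simp_all add: distrib_right mult.assoc neg_aug_plus neg_aug_scale)

fun h_weight :: "toroidal_basis \<Rightarrow> int" where
  "h_weight (Loop BE m n) = 2"
| "h_weight (Loop BF m n) = - 2"
| "h_weight _ = 0"

text \<open>For every negative letter the triple of t2-degree, t1-degree and sl2-weight is
  lexicographically negative, so these triples cannot add up to zero.\<close>

lemma neg_word_weight:
  assumes "list_all neg_basis w" "w \<noteq> []"
  shows "sum_list (map deg2 w) \<noteq> 0 \<or> sum_list (map deg1 w) \<noteq> 0 \<or> sum_list (map h_weight w) \<noteq> 0"
proof -
  have "list_all neg_basis w \<Longrightarrow>
      sum_list (map deg2 w) < 0 \<or> sum_list (map deg2 w) = 0 \<and> (sum_list (map deg1 w) < 0 \<or>
        sum_list (map deg1 w) = 0 \<and> sum_list (map h_weight w) \<le> 0 \<and> (w \<noteq> [] \<longrightarrow> sum_list (map h_weight w) < 0))" for w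
  proof (induction w)
    case (Cons a w)
    then have "neg_basis a" by simp
    then have "deg2 a < 0 \<or> deg2 a = 0 \<and> (deg1 a < 0 \<or> deg1 a = 0 \<and> h_weight a < 0)"
      by (cases a rule: neg_basis.cases) auto
    with Cons show ?case by auto
  qed simp
  from this[OF assms(1)] assms(2) show ?thesis by auto
qed

end

context toroidal_ideal
begin

text \<open>Commuting Borel elements to the right shows that a vector on which the Borel subalgebra acts
  by scalars generates a submodule that is spanned by the words in the negative letters.\<close>

lemma neg_span:
  assumes p: "\<And>b. \<not> neg_basis b \<Longrightarrow> eigen K (\<iota> b) (\<mu> b) p"
  shows "\<exists>a\<in>neg_alg. u * p - a * p \<in> K"
proof -
  define S where "S = {x. \<exists>a\<in>neg_alg. x - a * p \<in> K}"
  have add: "x + y \<in> S" if "x \<in> S" "y \<in> S" for x y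
  proof -
    from that obtain a b where "a \<in> neg_alg" "x - a * p \<in> K" "b \<in> neg_alg" "y - b * p \<in> K"
      unfolding S_def by blast
    moreover from this have "(x + y) - (a + b) * p \<in> K"
      using add_mem[of "x - a * p" "y - b * p"] by (simp add: algebra_simps)
    ultimately show ?thesis unfolding S_def using neg_alg_add by blast
  qed
  have sc: "sc c * x \<in> S" if "x \<in> S" for x c
  proof -
    from that obtain a where a: "a \<in> neg_alg" "x - a * p \<in> K" unfolding S_def by blast
    then have "sc c * x - (sc c * a) * p \<in> K"
      using mult_mem[of "x - a * p" "sc c"] by (simp add: right_diff_distrib mult.assoc)
    then show ?thesis unfolding S_def using neg_alg_sc[OF a(1)] by blast
  qed
  have neg: "\<iota> b * x \<in> S" if "x \<in> S" "neg_basis b" for x b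
  proof -
    from that obtain a where a: "a \<in> neg_alg" "x - a * p \<in> K" unfolding S_def by blast
    then have "\<iota> b * x - (\<iota> b * a) * p \<in> K"
      using mult_mem[of "x - a * p" "\<iota> b"] by (simp add: right_diff_distrib mult.assoc)
    then show ?thesis unfolding S_def using neg_alg_gen[OF a(1) that(2)] by blast
  qed
  have mem: "x \<in> S" if "x \<in> K" for x
    unfolding S_def using that neg_alg_0 by force
  have one: "p \<in> S"
    unfolding S_def using neg_alg_word[of "[]"] by force
  have sum: "sum f A \<in> S" if "\<And>i. i \<in> A \<Longrightarrow> f i \<in> S" for f :: "toroidal_basis \<Rightarrow> 'u" and A
    using that by (induction A rule: infinite_finite_induct) (auto intro: mem add)
  have word: "list_all neg_basis w \<Longrightarrow> \<iota> b * (word w * p) \<in> S" for w b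
  proof (induction w arbitrary: b)
    case Nil
    show ?case
    proof (cases "neg_basis b")
      case True
      then show ?thesis using neg[OF one] by simp
    next
      case False
      have "(\<iota> b * p - sc (\<mu> b) * p) + sc (\<mu> b) * p \<in> S"
        by (intro add mem sc one) (use p[OF False] in \<open>simp add: eigen_def\<close>)
      then show ?thesis by simp
    qed
  next
    case (Cons a w)
    have "\<iota> b * (word (a # w) * p) = (\<iota> b * \<iota> a) * (word w * p)" by (simp add: mult.assoc)
    also have "\<dots> = \<iota> a * (\<iota> b * (word w * p))
        + (\<Sum>c\<in>Poly_Mapping.keys (toroidal_basis_bracket b a).
            sc (Poly_Mapping.lookup (toroidal_basis_bracket b a) c) * (\<iota> c * (word w * p)))"
      by (subst bracket) (simp add: distrib_right mult.assoc lin_def sum_distrib_right)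
    also have "\<dots> \<in> S"
    proof (rule add)
      show "\<iota> a * (\<iota> b * (word w * p)) \<in> S" by (rule neg) (use Cons in simp_all)
      show "(\<Sum>c\<in>Poly_Mapping.keys (toroidal_basis_bracket b a).
            sc (Poly_Mapping.lookup (toroidal_basis_bracket b a) c) * (\<iota> c * (word w * p))) \<in> S"
        by (rule sum, rule sc) (use Cons in simp_all)
    qed
    finally show ?case .
  qed
  have gen: "\<iota> b * x \<in> S" if "x \<in> S" for b x
  proof -
    from that obtain a where a: "a \<in> neg_alg" "x - a * p \<in> K" unfolding S_def by blast
    have "\<iota> b * (a * p) \<in> S"
      using a(1)
    proof (induction rule: neg_alg.induct)
      case (neg_alg_sc x c)
      from sc[OF neg_alg_sc(2), of c] show ?case by (simp only: mult.assoc sc_left_comm[of "\<iota> b"])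
    qed (simp_all add: word distrib_left distrib_right add)
    from add[OF mem[OF mult_mem[OF a(2), of "\<iota> b"]] this] show ?thesis by (simp add: right_diff_distrib)
  qed
  have "u \<in> {u. u * p \<in> S}"
  proof (rule generated)
    fix c x assume "x \<in> {u. u * p \<in> S}"
    then show "sc c * x \<in> {u. u * p \<in> S}" using sc by (simp add: mult.assoc)
  next
    fix b x assume "x \<in> {u. u * p \<in> S}"
    then show "\<iota> b * x \<in> {u. u * p \<in> S}" using gen by (simp add: mult.assoc)
  qed (simp_all add: one add distrib_right)
  then show ?thesis unfolding S_def by simp
qed

lemma word_eigen:
  assumes "list_all neg_basis w" "eigen K (\<iota> D1) l1 p" "eigen K (\<iota> D2) l2 p" "eigen K (H 0) l p"
    "eigen K (\<iota> C1) k1 p" "eigen K (\<iota> C2) k2 p"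
  shows "eigen K (\<iota> D1) (l1 + of_int (sum_list (map deg1 w))) (word w * p)"
    "eigen K (\<iota> D2) (l2 + of_int (sum_list (map deg2 w))) (word w * p)"
    "eigen K (H 0) (l + of_int (sum_list (map h_weight w))) (word w * p)"
    "eigen K (\<iota> C1) k1 (word w * p)" "eigen K (\<iota> C2) k2 (word w * p)"
proof -
  have "list_all neg_basis w \<Longrightarrow> eigen K (\<iota> D1) (l1 + of_int (sum_list (map deg1 w))) (word w * p) \<and>
    eigen K (\<iota> D2) (l2 + of_int (sum_list (map deg2 w))) (word w * p) \<and>
    eigen K (H 0) (l + of_int (sum_list (map h_weight w))) (word w * p) \<and>
    eigen K (\<iota> C1) k1 (word w * p) \<and> eigen K (\<iota> C2) k2 (word w * p)"
  proof (induction w)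
    case Nil
    then show ?case using assms by simp
  next
    case (Cons a w)
    then obtain x m n where a: "a = Loop x m n" by (cases a) auto
    let ?p = "word w * p"
    have ih: "eigen K (\<iota> D1) (l1 + of_int (sum_list (map deg1 w))) ?p"
      "eigen K (\<iota> D2) (l2 + of_int (sum_list (map deg2 w))) ?p"
      "eigen K (H 0) (l + of_int (sum_list (map h_weight w))) ?p"
      "eigen K (\<iota> C1) k1 ?p" "eigen K (\<iota> C2) k2 ?p"
      using Cons by simp_all
    have "H 0 * \<iota> a = \<iota> a * H 0 + sc (of_int (h_weight a)) * \<iota> a"
      unfolding a by (cases x) (simp_all add: Loop_comm[of BH 0 0] sc_uminus)
    note h = eigen_mult[OF this ih(3)]
    have "\<iota> D1 * \<iota> a = \<iota> a * \<iota> D1 + sc (of_int (deg1 a)) * \<iota> a"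
      unfolding a by (simp add: D_comm)
    note d1 = eigen_mult[OF this ih(1)]
    have "\<iota> D2 * \<iota> a = \<iota> a * \<iota> D2 + sc (of_int (deg2 a)) * \<iota> a"
      unfolding a by (simp add: D_comm)
    note d2 = eigen_mult[OF this ih(2)]
    have "\<iota> C1 * \<iota> a = \<iota> a * \<iota> C1 + sc 0 * \<iota> a" "\<iota> C2 * \<iota> a = \<iota> a * \<iota> C2 + sc 0 * \<iota> a"
      by (simp_all add: central)
    note c = eigen_mult[OF this(1) ih(4)] eigen_mult[OF this(2) ih(5)]
    show ?case
      using h d1 d2 c by (simp add: mult.assoc add_ac)
  qed
  with assms(1) show "eigen K (\<iota> D1) (l1 + of_int (sum_list (map deg1 w))) (word w * p)"
    "eigen K (\<iota> D2) (l2 + of_int (sum_list (map deg2 w))) (word w * p)"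
    "eigen K (H 0) (l + of_int (sum_list (map h_weight w))) (word w * p)"
    "eigen K (\<iota> C1) k1 (word w * p)" "eigen K (\<iota> C2) k2 (word w * p)"
    by simp_all
qed

lemma neg_aug_sum:
  "x \<in> neg_aug \<Longrightarrow> \<exists>n c w. (\<forall>i<n. list_all neg_basis (w i) \<and> w i \<noteq> []) \<and> x = (\<Sum>i<(n::nat). sc (c i) * word (w i))"
proof (induction rule: neg_aug.induct)
  case neg_aug_0
  show ?case by (intro exI[of _ 0]) simp
next
  case (neg_aug_add x v d)
  then obtain n c w where x: "\<forall>i<n. list_all neg_basis (w i) \<and> w i \<noteq> []" "x = (\<Sum>i<(n::nat). sc (c i) * word (w i))"
    by (elim exE conjE)
  let ?w = "w(n := v)" and ?c = "c(n := d)"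
  have 1: "\<forall>i<Suc n. list_all neg_basis (?w i) \<and> ?w i \<noteq> []"
    using x(1) neg_aug_add(2,3) by (auto simp: less_Suc_eq)
  have 2: "sc d * word v + x = (\<Sum>i<Suc n. sc (?c i) * word (?w i))"
    unfolding x(2) by (simp add: add.commute)
  show ?case by (rule exI[of _ "Suc n"], rule exI[of _ ?c], rule exI[of _ ?w]) (use 1 2 in blast)
qed

text \<open>Nonempty negative words have weights different from \<lambda>, so a polynomial in the
  Cartan operators kills all those occurring in \<open>x\<close> and keeps the highest weight
  vector.\<close>

lemma weight_separate:
  assumes e: "eigen K (\<iota> D1) l1 1" "eigen K (\<iota> D2) l2 1" "eigen K (H 0) l 1"
    "eigen K (\<iota> C1) k1 1" "eigen K (\<iota> C2) k2 1"
    and x: "x \<in> neg_aug"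
  shows "\<exists>u c. c \<noteq> 0 \<and> u - sc c \<in> K \<and> u * x \<in> K"
proof -
  obtain n c w where w: "\<forall>i<n. list_all neg_basis (w i) \<and> w i \<noteq> []" and x: "x = (\<Sum>i<(n::nat). sc (c i) * word (w i))"
    using neg_aug_sum[OF x] by (elim exE conjE)
  \<comment> \<open>The index \<open>n\<close> stands for the empty word, that is, for the highest
    weight vector.\<close>
  define v where "v i = (if i < n then w i else [])" for i
  define D where "D d = (if d = 0 then \<iota> D1 else if d = 1 then \<iota> D2 else H 0)" for d :: nat
  define \<nu> where "\<nu> i d = (if d = 0 then l1 + of_int (sum_list (map deg1 (v i)))
     else if d = 1 then l2 + of_int (sum_list (map deg2 (v i))) else l + of_int (sum_list (map h_weight (v i))))" for i and d :: nat
  have eig: "eigen K (D d) (\<nu> i d) (word (v i))" for i d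
  proof -
    have "list_all neg_basis (v i)" using w by (simp add: v_def)
    from word_eigen[OF this e] show ?thesis by (simp add: D_def \<nu>_def)
  qed
  have dist: "\<exists>d. \<nu> n d \<noteq> \<nu> i d" if "i \<in> {..<n}" for i
  proof (rule ccontr)
    assume "\<nexists>d. \<nu> n d \<noteq> \<nu> i d"
    then have "\<nu> n 0 = \<nu> i 0" "\<nu> n 1 = \<nu> i 1" "\<nu> n 2 = \<nu> i 2" by simp_all
    then have "sum_list (map deg1 (w i)) = 0" "sum_list (map deg2 (w i)) = 0" "sum_list (map h_weight (w i)) = 0"
      using that by (simp_all add: \<nu>_def v_def)
    with neg_word_weight[of "w i"] w that show False by simp
  qed
  have "\<exists>u c. c \<noteq> 0 \<and> u * word (v n) - sc c * word (v n) \<in> K \<and> (\<forall>i\<in>{..<n}. u * word (v i) \<in> K)"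
    by (rule eigen_separate[where D = D and \<nu> = \<nu>]) (use eig dist in simp_all)
  then obtain u r where u: "r \<noteq> 0" "u * word (v n) - sc r * word (v n) \<in> K" "\<forall>i\<in>{..<n}. u * word (v i) \<in> K"
    by (elim exE conjE)
  have "u * x = (\<Sum>i<n. sc (c i) * (u * word (v i)))"
    unfolding x sum_distrib_left by (intro sum.cong) (simp_all add: v_def sc_left_comm[of u])
  also have "\<dots> \<in> K" by (rule sum_mem, rule mult_mem) (use u(3) in simp)
  finally show ?thesis using u by (intro exI[of _ u] exI[of _ r]) (simp add: v_def)
qed

end

section \<open>The left ideals of the Verma module and of W\<close>

locale weyl_data =
  fixes lam :: "toroidal \<Rightarrow> complex" and n0 n1 :: nat
  assumes lam_C1: "lam (bas C1) = of_nat (n0 + n1)" and lam_C2: "lam (bas C2) = 0"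
    and lam_H: "lam (bas (Loop BH 0 0)) = of_nat n1" and level: "n0 + n1 > 0"
begin

sublocale J: toroidal_ideal uea_gen uea_sc "verma_ideal lam"
  by (intro toroidal_ideal.intro uea.toroidal_alg_axioms) (simp add: verma_ideal_def left_ideal_lgen)

lemma verma_eigen: "\<not> neg_basis b \<Longrightarrow> uea.eigen (verma_ideal lam) (uea_gen b) (weight lam b) 1"
  unfolding uea.eigen_def verma_ideal_def by (rule lgen_gen) auto

lemma verma_mem: "\<not> neg_basis b \<Longrightarrow> b \<notin> cartan_basis \<Longrightarrow> uea_gen b \<in> verma_ideal lam"
  using verma_eigen[of b] by (simp add: uea.eigen_def weight_def)

lemma cartan_eigen:
  "uea.eigen (verma_ideal lam) (uea_gen D1) (lam (bas D1)) 1"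
  "uea.eigen (verma_ideal lam) (uea_gen D2) (lam (bas D2)) 1"
  "uea.eigen (verma_ideal lam) (uea.H 0) (of_nat n1) 1"
  "uea.eigen (verma_ideal lam) (uea_gen C1) (of_nat (n0 + n1)) 1"
  "uea.eigen (verma_ideal lam) (uea_gen C2) 0 1"
  using verma_eigen[of D1] verma_eigen[of D2] verma_eigen[of "Loop BH 0 0"] verma_eigen[of C1] verma_eigen[of C2]
  by (simp_all add: weight_def cartan_basis_def lam_C1 lam_C2 lam_H)

text \<open>The sum of all weight spaces of the Verma module except the highest one, as a subset of
  \<open>U\<close>. Every proper left ideal above \<open>verma_ideal\<close> lies inside it, hence
  so does the sum of two of them.\<close>

definition lower :: "uea set" where
  "lower = {x. \<exists>y\<in>uea.neg_aug. x - y \<in> verma_ideal lam}"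

lemma lower_plus: "x \<in> lower \<Longrightarrow> y \<in> lower \<Longrightarrow> x + y \<in> lower"
  unfolding lower_def
proof safe
  fix a b assume "a \<in> uea.neg_aug" "x - a \<in> verma_ideal lam" "b \<in> uea.neg_aug" "y - b \<in> verma_ideal lam"
  then have "a + b \<in> uea.neg_aug" "x + y - (a + b) \<in> verma_ideal lam"
    using uea.neg_aug_plus J.add_mem[of "x - a" "y - b"] by (simp_all add: algebra_simps)
  then show "\<exists>z\<in>uea.neg_aug. x + y - z \<in> verma_ideal lam" by blast
qed

lemma lower_mem: "x \<in> verma_ideal lam \<Longrightarrow> x \<in> lower"
  unfolding lower_def using uea.neg_aug_0 by force

lemma lower_neg_aug: "x \<in> uea.neg_aug \<Longrightarrow> x \<in> lower"
  unfolding lower_def by force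

lemma scalar_plus_lower: "\<exists>c. u - uea_sc c \<in> lower"
proof -
  obtain a where a: "a \<in> uea.neg_alg" "u * 1 - a * 1 \<in> verma_ideal lam"
    using J.neg_span[of "weight lam" 1 u] verma_eigen by blast
  obtain c where c: "a - uea_sc c \<in> uea.neg_aug" using uea.neg_alg_split[OF a(1)] by (elim exE)
  have "(u - a) + (a - uea_sc c) \<in> lower"
    using a(2) by (intro lower_plus lower_mem lower_neg_aug c) simp
  then show ?thesis by (intro exI[of _ c]) simp
qed

text \<open>The projection of \<open>q\<close> to the highest weight line by
  \<open>weight_separate\<close> produces a nonzero scalar in \<open>L\<close>.\<close>

lemma one_notin_lower_ideal:
  assumes "left_ideal L" "verma_ideal lam \<subseteq> L" "q \<in> L" "q - uea_sc c \<in> lower" "c \<noteq> 0"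
  shows "1 \<in> L"
proof -
  interpret L: left_ideal L by fact
  obtain x where x: "x \<in> uea.neg_aug" "q - uea_sc c - x \<in> verma_ideal lam"
    using assms(4) unfolding lower_def by blast
  obtain u r where u: "r \<noteq> 0" "u - uea_sc r \<in> verma_ideal lam" "u * x \<in> verma_ideal lam"
    using J.weight_separate[OF cartan_eigen x(1)] by blast
  have "u * q - (u * (q - uea_sc c - x) + u * x + uea_sc c * (u - uea_sc r)) \<in> L"
    by (intro L.diff_mem L.add_mem L.mult_mem assms(3) subsetD[OF assms(2)] x(2) u(2,3))
  moreover have "u * q - (u * (q - uea_sc c - x) + u * x + uea_sc c * (u - uea_sc r)) = uea_sc c * (uea_sc r * 1)"
    by (simp add: right_diff_distrib uea_sc_comm[of u])
  ultimately have "uea_sc (inverse r) * (uea_sc (inverse c) * (uea_sc c * (uea_sc r * 1))) \<in> L"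
    by (simp only: L.mult_mem)
  then show ?thesis by (simp only: uea.sc_inverse_cancel[OF assms(5)] uea.sc_inverse_cancel[OF u(1)])
qed

lemma proper_lower:
  assumes "left_ideal L" "verma_ideal lam \<subseteq> L" "1 \<notin> L"
  shows "L \<subseteq> lower"
proof
  fix q assume q: "q \<in> L"
  obtain c where c: "q - uea_sc c \<in> lower" using scalar_plus_lower by blast
  then have "c = 0" using one_notin_lower_ideal[OF assms(1,2) q c] assms(3) by blast
  with c show "q \<in> lower" by simp
qed

lemma one_notin_lower: "1 \<notin> lower"
proof
  assume "1 \<in> lower"
  then obtain y where y: "y \<in> uea.neg_aug" "1 - y \<in> verma_ideal lam" unfolding lower_def by blast
  have "uea_sc (- 1) * y \<in> lower" by (intro lower_neg_aug uea.neg_aug_scale y(1))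
  then have "(1 - y) - uea_sc 1 \<in> lower" by (simp add: uea.sc_uminus)
  from one_notin_lower_ideal[OF J.left_ideal_axioms subset_refl y(2) this] one_notin_verma_ideal
  show False by simp
qed

definition "vec0 = uea.E (- 1) ^ Suc n0"
definition "vec1 = uea.F 0 ^ Suc n1"

lemma power_word: "uea_gen b ^ n = uea.word (replicate n b)"
  by (induction n) simp_all

lemma vec_neg_aug: "a \<in> uea.neg_alg \<Longrightarrow> a * vec0 \<in> uea.neg_aug" "a \<in> uea.neg_alg \<Longrightarrow> a * vec1 \<in> uea.neg_aug"
  unfolding vec0_def vec1_def power_word
  by (rule uea.neg_alg_mult_word; simp add: list_all_iff)+

lemma F_power_mem:
  assumes "n \<ge> 1 \<or> n = 0 \<and> m \<ge> 1"
  shows "uea_gen (Loop b m n) * uea.F 0 ^ N \<in> verma_ideal lam"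
proof (induction N arbitrary: b)
  case 0
  show ?case using assms verma_mem[of "Loop b m n"] by (auto simp: cartan_basis_def)
next
  case (Suc N)
  have "uea_gen (Loop b m n) * uea.F 0 ^ Suc N = uea.F 0 * (uea_gen (Loop b m n) * uea.F 0 ^ N)
      + uea_sc (sl2_coeff b BF) * (uea_gen (Loop (sl2_prod b BF) m n) * uea.F 0 ^ N)"
    unfolding power_Suc uea.Loop_comm_mult[of b m n] using assms by auto
  also have "\<dots> \<in> verma_ideal lam" by (intro J.add_mem J.mult_mem Suc)
  finally show ?case .
qed

text \<open>Commuting with \<open>E (- 1)\<close> lowers \<open>m\<close> by one and turns f into h
  and h into e, so the thresholds 2, 1, 0 are respected. The mode \<open>F 1\<close> is left out:
  its commutator with \<open>E (- 1)\<close> reaches the Cartan subalgebra and is a matter for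
  \<open>sl2_string\<close>.\<close>

lemma E_power_mem:
  assumes "n \<ge> 1 \<or> n = 0 \<and> (case b of BE \<Rightarrow> m \<ge> 0 | BH \<Rightarrow> m \<ge> 1 | BF \<Rightarrow> m \<ge> 2)"
  shows "uea_gen (Loop b m n) * uea.E (- 1) ^ N \<in> verma_ideal lam"
  using assms
proof (induction N arbitrary: b m)
  case 0
  then show ?case using verma_mem[of "Loop b m n"] by (cases b) (auto simp: cartan_basis_def)
next
  case (Suc N)
  have nz: "\<not> (m = - (- 1) \<and> n = - 0 \<and> sl2_basis_form b BE \<noteq> 0)" using Suc.prems by (cases b) auto
  have "uea_gen (Loop b m n) * uea.E (- 1) ^ Suc N = uea.E (- 1) * (uea_gen (Loop b m n) * uea.E (- 1) ^ N)
      + uea_sc (sl2_coeff b BE) * (uea_gen (Loop (sl2_prod b BE) (m + - 1) n) * uea.E (- 1) ^ N)"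
    unfolding power_Suc uea.Loop_comm_mult[of b m n] using nz by auto
  moreover have "uea_sc (sl2_coeff b BE) * (uea_gen (Loop (sl2_prod b BE) (m + - 1) n) * uea.E (- 1) ^ N) \<in> verma_ideal lam"
  proof (cases b)
    case BE
    then show ?thesis by simp
  next
    case BH
    show ?thesis by (rule J.mult_mem, rule Suc.IH) (use Suc.prems BH in auto)
  next
    case BF
    show ?thesis by (rule J.mult_mem, rule Suc.IH) (use Suc.prems BF in auto)
  qed
  ultimately show ?case using Suc.IH[OF Suc.prems] by (simp only: J.add_mem J.mult_mem)
qed

lemma vec_cartan:
  assumes "b \<in> cartan_basis" "\<And>a. a \<in> set w \<Longrightarrow> neg_basis a"
  shows "\<exists>\<mu>. uea.eigen (verma_ideal lam) (uea_gen b) \<mu> (uea.word w)"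
proof -
  have "list_all neg_basis w" using assms(2) by (simp add: list_all_iff)
  from J.word_eigen[OF this cartan_eigen] show ?thesis
    using assms(1) unfolding cartan_basis_def by (auto simp only: mult_1_right)
qed

text \<open>The delicate raising operator is \<open>E 0\<close>: the exponent is one more than the
  label, so its coefficient in \<open>sl2_string\<close> contains the factor
  \<open>n1 - n1\<close>.\<close>

lemma vec1_singular:
  assumes "\<not> neg_basis b"
  shows "\<exists>\<mu>. uea.eigen (verma_ideal lam) (uea_gen b) \<mu> vec1"
proof (cases "b \<in> cartan_basis")
  case True
  show ?thesis unfolding vec1_def power_word by (rule vec_cartan[OF True]) auto
next
  case False
  have "uea_gen b * vec1 \<in> verma_ideal lam"
  proof (cases "b = Loop BE 0 0")
    case True
    have "uea.E 0 * (uea.F 0 ^ Suc n1 * 1) - uea_sc (of_nat (Suc n1) * (of_nat n1 - of_nat n1)) * (uea.F 0 ^ n1 * 1) \<in> verma_ideal lam"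
      by (rule J.sl2_string[OF _ _ cartan_eigen(3)])
        (simp_all add: uea.affine_comm(1,5), rule verma_mem, simp_all add: cartan_basis_def)
    with True show ?thesis by (simp add: vec1_def)
  next
    case ne: False
    with False assms obtain x m n where b: "b = Loop x m n" "n \<ge> 1 \<or> n = 0 \<and> m \<ge> 1"
    proof (cases b)
      case (Loop x m n)
      with assms False ne have "n \<ge> 1 \<or> n = 0 \<and> m \<ge> 1" by (cases x) (auto simp: cartan_basis_def)
      with Loop that show ?thesis by blast
    qed (auto simp: cartan_basis_def)
    then show ?thesis unfolding vec1_def b(1) by (intro F_power_mem)
  qed
  then show ?thesis using J.eigen_op_zero by blast
qed

text \<open>The analogue for \<alpha>_0, with the sl2-triple \<open>F 1\<close>,
  \<open>E (- 1)\<close>, \<open>C1 - H 0\<close>. The last acts on 1 by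
  \<open>(n0 + n1) - n1\<close>, which is \<open>n0\<close>.\<close>

lemma vec0_singular:
  assumes "\<not> neg_basis b"
  shows "\<exists>\<mu>. uea.eigen (verma_ideal lam) (uea_gen b) \<mu> vec0"
proof (cases "b \<in> cartan_basis")
  case True
  show ?thesis unfolding vec0_def power_word by (rule vec_cartan[OF True]) auto
next
  case False
  have "uea_gen b * vec0 \<in> verma_ideal lam"
  proof (cases "b = Loop BF 1 0")
    case True
    have h: "uea.eigen (verma_ideal lam) (- uea.H 0 + uea_gen C1) (of_nat n0) 1"
      using J.eigen_op_add[OF J.eigen_op_mult[OF J.eigen_op_sc[of "- 1"] cartan_eigen(3)] cartan_eigen(4)]
      by (simp add: uea.sc_uminus)
    have "uea.F 1 * (uea.E (- 1) ^ Suc n0 * 1) - uea_sc (of_nat (Suc n0) * (of_nat n0 - of_nat n0)) * (uea.E (- 1) ^ n0 * 1) \<in> verma_ideal lam"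
    proof (rule J.sl2_string[OF _ _ h])
      show "uea.F 1 * uea.E (- 1) = uea.E (- 1) * uea.F 1 + (- uea.H 0 + uea_gen C1)"
        by (simp add: uea.affine_comm(2))
      show "(- uea.H 0 + uea_gen C1) * uea.E (- 1) = uea.E (- 1) * (- uea.H 0 + uea_gen C1) - 2 * uea.E (- 1)"
        by (simp add: left_diff_distrib right_diff_distrib uea.affine_comm(3) uea.central)
      show "uea.F 1 * 1 \<in> verma_ideal lam" by (simp, rule verma_mem) (simp_all add: cartan_basis_def)
    qed
    with True show ?thesis by (simp add: vec0_def)
  next
    case ne: False
    with False assms obtain x m n where b: "b = Loop x m n"
      "n \<ge> 1 \<or> n = 0 \<and> (case x of BE \<Rightarrow> m \<ge> 0 | BH \<Rightarrow> m \<ge> 1 | BF \<Rightarrow> m \<ge> 2)"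
    proof (cases b)
      case (Loop x m n)
      with assms False ne have "n \<ge> 1 \<or> n = 0 \<and> (case x of BE \<Rightarrow> m \<ge> 0 | BH \<Rightarrow> m \<ge> 1 | BF \<Rightarrow> m \<ge> 2)"
        by (cases x) (auto simp: cartan_basis_def)
      with Loop that show ?thesis by blast
    qed (auto simp: cartan_basis_def)
    then show ?thesis unfolding vec0_def b(1) by (intro E_power_mem)
  qed
  then show ?thesis using J.eigen_op_zero by blast
qed

text \<open>The preimage of the Weyl submodule in \<open>U\<close>, with coefficients from the
  negative part only, as in the definition of that submodule.\<close>

definition weyl_set :: "uea set" where
  "weyl_set = {x. \<exists>a\<in>uea.neg_alg. \<exists>b\<in>uea.neg_alg. x - (a * vec0 + b * vec1) \<in> verma_ideal lam}"

lemma mult_vec: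
  "\<exists>a\<in>uea.neg_alg. u * vec0 - a * vec0 \<in> verma_ideal lam" "\<exists>a\<in>uea.neg_alg. u * vec1 - a * vec1 \<in> verma_ideal lam"
proof -
  obtain \<mu> where "\<And>b. \<not> neg_basis b \<Longrightarrow> uea.eigen (verma_ideal lam) (uea_gen b) (\<mu> b) vec0"
    using vec0_singular by metis
  then show "\<exists>a\<in>uea.neg_alg. u * vec0 - a * vec0 \<in> verma_ideal lam" by (rule J.neg_span)
  obtain \<mu> where "\<And>b. \<not> neg_basis b \<Longrightarrow> uea.eigen (verma_ideal lam) (uea_gen b) (\<mu> b) vec1"
    using vec1_singular by metis
  then show "\<exists>a\<in>uea.neg_alg. u * vec1 - a * vec1 \<in> verma_ideal lam" by (rule J.neg_span)
qed

text \<open>That coefficients from the negative part already give a left ideal rests on the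
  singularity of the two vectors: by \<open>neg_span\<close> all of \<open>U * vec0\<close> and
  \<open>U * vec1\<close> is reached by negative words modulo \<open>verma_ideal\<close>.\<close>

lemma weyl_set_eq:
  "weyl_set = lgen ({uea_gen b - uea_sc (weight lam b) | b. \<not> neg_basis b} \<union> {vec0, vec1})"
    (is "_ = lgen (?G \<union> _)")
proof
  interpret L: left_ideal "lgen (?G \<union> {vec0, vec1})" by (rule left_ideal_lgen)
  have J: "verma_ideal lam \<subseteq> lgen (?G \<union> {vec0, vec1})"
    unfolding verma_ideal_def by (rule lgen_minimal[OF left_ideal_lgen]) (blast intro: lgen_gen)
  show "weyl_set \<subseteq> lgen (?G \<union> {vec0, vec1})"
  proof
    fix x assume "x \<in> weyl_set"
    then obtain a b where "x - (a * vec0 + b * vec1) \<in> verma_ideal lam" unfolding weyl_set_def by blast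
    then have "(x - (a * vec0 + b * vec1)) + (a * vec0 + b * vec1) \<in> lgen (?G \<union> {vec0, vec1})"
      by (intro L.add_mem L.mult_mem subsetD[OF J] lgen_gen) simp_all
    then show "x \<in> lgen (?G \<union> {vec0, vec1})" by simp
  qed
  have plus: "x + y \<in> weyl_set" if xy: "x \<in> weyl_set" "y \<in> weyl_set" for x y
  proof -
    obtain a b c d where "a \<in> uea.neg_alg" "b \<in> uea.neg_alg" "x - (a * vec0 + b * vec1) \<in> verma_ideal lam"
      "c \<in> uea.neg_alg" "d \<in> uea.neg_alg" "y - (c * vec0 + d * vec1) \<in> verma_ideal lam"
      using xy unfolding weyl_set_def by blast
    then have "a + c \<in> uea.neg_alg" "b + d \<in> uea.neg_alg" "x + y - ((a + c) * vec0 + (b + d) * vec1) \<in> verma_ideal lam"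
      using uea.neg_alg_add J.add_mem[of "x - (a * vec0 + b * vec1)" "y - (c * vec0 + d * vec1)"]
      by (simp_all add: algebra_simps)
    then show ?thesis unfolding weyl_set_def by blast
  qed
  have mem: "x \<in> weyl_set" if "x \<in> verma_ideal lam" for x
    unfolding weyl_set_def using uea.neg_alg_0 that by force
  have v: "u * vec0 \<in> weyl_set" "u * vec1 \<in> weyl_set" for u
    unfolding weyl_set_def using mult_vec[of u] uea.neg_alg_0 by force+
  show "lgen (?G \<union> {vec0, vec1}) \<subseteq> weyl_set"
  proof
    fix x assume "x \<in> lgen (?G \<union> {vec0, vec1})"
    then show "x \<in> weyl_set"
    proof induction
      case lgen_0
      show ?case by (rule mem) simp
    next
      case (lgen_add x g u)
      have "u * g \<in> weyl_set"
      proof (cases "g \<in> ?G")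
        case True
        then have "g \<in> verma_ideal lam" unfolding verma_ideal_def by (rule lgen_gen)
        then show ?thesis by (intro mem J.mult_mem)
      next
        case False
        with lgen_add(2) v show ?thesis by blast
      qed
      then show ?case using lgen_add(3) by (rule plus)
    qed
  qed
qed

lemma verma_ideal_subset: "verma_ideal lam \<subseteq> weyl_set"
  unfolding weyl_set_def using uea.neg_alg_0 by force

lemma left_ideal_weyl: "left_ideal weyl_set"
  unfolding weyl_set_eq by (rule left_ideal_lgen)

lemma weyl_lower: "weyl_set \<subseteq> lower"
proof
  fix x assume "x \<in> weyl_set"
  then obtain a b where ab: "a \<in> uea.neg_alg" "b \<in> uea.neg_alg" "x - (a * vec0 + b * vec1) \<in> verma_ideal lam"
    unfolding weyl_set_def by blast
  have "(x - (a * vec0 + b * vec1)) + (a * vec0 + b * vec1) \<in> lower"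
    by (intro lower_plus lower_mem[OF ab(3)] lower_neg_aug vec_neg_aug ab(1,2))
  then show "x \<in> lower" by simp
qed

sublocale W: weyl_ideal uea_gen uea_sc weyl_set n0 n1 "lam (bas D1)" "lam (bas D2)"
proof (intro weyl_ideal.intro weyl_ideal_axioms.intro toroidal_ideal.intro uea.toroidal_alg_axioms left_ideal_weyl)
  show "1 \<notin> weyl_set" using weyl_lower one_notin_lower by blast
  show "uea.E (- 1) ^ Suc n0 \<in> weyl_set" "uea.F 0 ^ Suc n1 \<in> weyl_set"
    unfolding weyl_set_eq vec0_def[symmetric] vec1_def[symmetric] by (rule lgen_gen, simp)+
next
  fix m :: int
  show "uea.E m \<in> weyl_set" if "m \<ge> 0"
    by (rule subsetD[OF verma_ideal_subset], rule verma_mem) (use that in \<open>simp_all add: cartan_basis_def\<close>)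
  show "uea.F m \<in> weyl_set" if "m \<ge> 1"
    by (rule subsetD[OF verma_ideal_subset], rule verma_mem) (use that in \<open>simp_all add: cartan_basis_def\<close>)
  show "uea.H m \<in> weyl_set" if "m \<ge> 1"
    by (rule subsetD[OF verma_ideal_subset], rule verma_mem) (use that in \<open>simp_all add: cartan_basis_def\<close>)
next
  fix n m :: int and b
  show "uea_gen (Loop b m n) \<in> weyl_set" if "n \<ge> 1"
    by (rule subsetD[OF verma_ideal_subset], rule verma_mem) (use that in \<open>simp_all add: cartan_basis_def\<close>)
qed (use cartan_eigen verma_ideal_subset in \<open>auto simp only: uea.eigen_def\<close>)

text \<open>All generators of \<open>weyl_set\<close>, including the powers \<open>vec0\<close> and
  \<open>vec1\<close>, are built from letters of t2-degree at least zero and scalars. Right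
  linearity gives \<open>\<Phi> (u * g) = \<Phi> u * g\<close> for them, so the left ideal is
  preserved.\<close>

lemma ex_weyl_coeff:
  assumes "low J"
  shows "\<exists>\<Phi>. weyl_coeff uea_gen uea_sc weyl_set n0 n1 (lam (bas D1)) (lam (bas D2)) J \<Phi>"
proof -
  obtain \<Phi> :: "uea \<Rightarrow> uea" where \<Phi>: "\<forall>x y. \<Phi> (x + y) = \<Phi> x + \<Phi> y" "\<forall>c x. \<Phi> (uea_sc c * x) = uea_sc c * \<Phi> x"
    "\<forall>b x. deg2 b \<ge> 0 \<longrightarrow> \<Phi> (x * uea_gen b) = \<Phi> x * uea_gen b"
    and w: "\<forall>w. low w \<longrightarrow> length w < length J \<longrightarrow> \<Phi> (uea.word w) = 0"
    "\<forall>w. low w \<longrightarrow> length w = length J \<longrightarrow> \<Phi> (uea.word w) = (if mset w = mset J then 1 else 0)"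
    "\<forall>w. low w \<longrightarrow> sum_list (map deg1 w) \<noteq> sum_list (map deg1 J) \<longrightarrow> \<Phi> (uea.word w) = 0"
    using ex_coeff_map[OF assms] by (elim exE conjE) (rule that)
  have pow: "\<Phi> (u * uea_gen b ^ n) = \<Phi> u * uea_gen b ^ n" if "deg2 b \<ge> 0" for u b n
    using that \<Phi>(3) by (induction n) (simp_all only: power_0 mult_1_right power_Suc2 mult.assoc[symmetric] simp_thms)
  have sc: "\<Phi> (u * uea_sc c) = \<Phi> u * uea_sc c" for u c
    using \<Phi>(2) by (simp only: uea_sc_comm)
  have diff: "\<Phi> (x - y) = \<Phi> x - \<Phi> y" for x y
    using \<Phi>(1)[rule_format, of "x - y" y] by (simp add: algebra_simps)
  have "\<Phi> x \<in> weyl_set" if "x \<in> weyl_set" for x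
    using that[unfolded weyl_set_eq]
  proof induction
    case lgen_0
    have "\<Phi> 0 = 0" using \<Phi>(1)[rule_format, of 0 0] by simp
    then show ?case by simp
  next
    case (lgen_add x g u)
    have "\<Phi> (u * g) = \<Phi> u * g"
    proof (cases "g = vec0 \<or> g = vec1")
      case True
      then show ?thesis
        using pow[of "Loop BE (- 1) 0" u "Suc n0"] pow[of "Loop BF 0 0" u "Suc n1"]
        unfolding vec0_def vec1_def by (elim disjE) (simp_all only: deg2.simps order_refl)
    next
      case False
      with lgen_add(2) obtain b where b: "g = uea_gen b - uea_sc (weight lam b)" "\<not> neg_basis b" by blast
      then have "deg2 b \<ge> 0" by (cases b) auto
      with \<Phi>(3) show ?thesis unfolding b(1) by (simp only: right_diff_distrib diff sc simp_thms)
    qed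
    moreover have "g \<in> weyl_set" unfolding weyl_set_eq using lgen_add(2) by (rule lgen_gen)
    ultimately show ?case using lgen_add(3) \<Phi>(1) by (simp only: W.add_mem W.mult_mem)
  qed
  with \<Phi> w show ?thesis
    by (intro exI[of _ \<Phi>] weyl_coeff.intro W.weyl_ideal_axioms weyl_coeff_axioms.intro) blast+
qed

theorem weyl_maximal: "p \<notin> weyl_set \<Longrightarrow> \<exists>u. u * p - 1 \<in> weyl_set"
  by (rule W.irreducible[OF level ex_weyl_coeff])

text \<open>Both \<open>L\<close> and \<open>weyl_set\<close> lie in \<open>lower\<close>, so their
  sum is proper and the maximality of \<open>L\<close> gives \<open>weyl_set \<subseteq> L\<close>;
  \<open>weyl_maximal\<close> excludes strict inclusion.\<close>

theorem maximal_unique: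
  assumes L: "left_ideal L" "verma_ideal lam \<subseteq> L" "1 \<notin> L"
    and max: "\<And>L'. left_ideal L' \<Longrightarrow> L \<subseteq> L' \<Longrightarrow> L' = L \<or> L' = UNIV"
  shows "L = weyl_set"
proof -
  interpret L: left_ideal L by fact
  let ?M = "{x + y | x y. x \<in> L \<and> y \<in> weyl_set}"
  have "left_ideal ?M"
  proof
    show "0 \<in> ?M" by (auto intro!: exI[of _ 0])
  next
    fix a b assume "a \<in> ?M" "b \<in> ?M"
    then obtain x y x' y' where "a = x + y" "b = x' + y'" "x \<in> L" "x' \<in> L" "y \<in> weyl_set" "y' \<in> weyl_set" by blast
    then have "a + b = (x + x') + (y + y')" "x + x' \<in> L" "y + y' \<in> weyl_set"
      by (simp_all only: L.add_mem W.add_mem add_ac)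
    then show "a + b \<in> ?M" by blast
  next
    fix a u assume "a \<in> ?M"
    then obtain x y where "a = x + y" "x \<in> L" "y \<in> weyl_set" by blast
    then have "u * a = u * x + u * y" "u * x \<in> L" "u * y \<in> weyl_set"
      by (simp_all only: L.mult_mem W.mult_mem distrib_left)
    then show "u * a \<in> ?M" by blast
  qed
  moreover have "L \<subseteq> ?M" by (force intro: exI[of _ 0])
  moreover have "?M \<subseteq> lower" using proper_lower[OF L] weyl_lower lower_plus by blast
  then have "?M \<noteq> UNIV" using one_notin_lower by blast
  ultimately have M: "?M = L" using max by blast
  have "weyl_set \<subseteq> ?M" by (force intro: exI[of _ 0])
  then have sub: "weyl_set \<subseteq> L" using M by simp
  show ?thesis
  proof (rule ccontr)
    assume "L \<noteq> weyl_set"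
    with sub obtain p where p: "p \<in> L" "p \<notin> weyl_set" by blast
    from weyl_maximal[OF p(2)] obtain u where "u * p - 1 \<in> weyl_set" by (elim exE)
    then have "u * p - 1 \<in> L" using sub by blast
    from L.diff_mem[OF L.mult_mem[OF p(1)] this] have "u * p - (u * p - 1) \<in> L" .
    with L(3) show False by simp
  qed
qed

end

section \<open>Modules over the enveloping algebra\<close>

definition coset_of :: "uea \<Rightarrow> free_alg set" where
  "coset_of u = abs_uea -` {u}"

lemma r_coset_EI: "EI +>\<^bsub>free_algebra UNIV\<^esub> p = coset_of (abs_uea p)"
proof -
  have "q \<in> EI +>\<^bsub>free_algebra UNIV\<^esub> p \<longleftrightarrow> (\<exists>h\<in>EI. q = h + p)" for q
    unfolding a_r_coset_def' by simp
  moreover have "(\<exists>h\<in>EI. q = h + p) \<longleftrightarrow> q - p \<in> EI" for q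
  proof
    assume "q - p \<in> EI"
    then show "\<exists>h\<in>EI. q = h + p" by (intro bexI[of _ "q - p"]) simp_all
  qed (elim bexE, simp)
  ultimately have "q \<in> EI +>\<^bsub>free_algebra UNIV\<^esub> p \<longleftrightarrow> q - p \<in> EI" for q by blast
  then show ?thesis
    unfolding coset_of_def vimage_def set_eq_iff mem_Collect_eq singleton_iff abs_uea_eq_iff by (rule allI)
qed

lemma coset_of_inject: "coset_of u = coset_of v \<longleftrightarrow> u = v"
proof
  assume eq: "coset_of u = coset_of v"
  obtain p where "u = abs_uea p" using abs_uea_surj by blast
  then have "p \<in> coset_of u" by (simp add: coset_of_def)
  with eq \<open>u = abs_uea p\<close> show "u = v" by (simp add: coset_of_def)
qed simp

lemma carrier_UT: "carrier UT = range coset_of"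
proof -
  have "carrier UT = range (\<lambda>p. EI +>\<^bsub>free_algebra UNIV\<^esub> p)"
    by (auto simp: env_def FactRing_def A_RCOSETS_def')
  also have "\<dots> = range coset_of"
    unfolding r_coset_EI using abs_uea_surj by (auto simp: image_iff) metis
  finally show ?thesis .
qed

lemma UT_mult: "coset_of u \<otimes>\<^bsub>UT\<^esub> coset_of v = coset_of (u * v)"
proof -
  obtain p q where "u = abs_uea p" "v = abs_uea q" using abs_uea_surj by metis
  then show ?thesis
    using ideal.rcoset_mult_add[OF ideal_EI, of p q] by (simp add: env_def FactRing_def r_coset_EI abs_uea_simps)
qed

lemma UT_add: "coset_of u \<oplus>\<^bsub>UT\<^esub> coset_of v = coset_of (u + v)"
proof -
  obtain p q where "u = abs_uea p" "v = abs_uea q" using abs_uea_surj by metis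
  then show ?thesis
    using abelian_subgroup.a_rcos_sum[OF abelian_subgroupI3[OF ideal.axioms(1)[OF ideal_EI] FA.abelian_group_axioms], of p q] by (simp add: env_def FactRing_def r_coset_EI abs_uea_simps)
qed

lemma UT_one: "\<one>\<^bsub>UT\<^esub> = coset_of 1"
  by (simp add: env_def FactRing_def r_coset_EI abs_uea_simps)

lemma UT_pow: "coset_of u [^]\<^bsub>UT\<^esub> (n :: nat) = coset_of (u ^ n)"
proof -
  interpret UT: ring UT unfolding env_def by (rule ideal.quotient_is_ring[OF ideal_EI])
  show ?thesis by (induction n) (simp_all add: UT_one UT_mult power_commutes)
qed

lemma env_of_eq: "env_of x = coset_of (abs_uea (gen x))"
  by (simp add: env_of_def r_coset_EI)

text \<open>A presentation of \<open>M\<close> as \<open>U\<close> modulo a left ideal,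
  \<open>f\<close> being the action on a generator. The group laws follow from those of
  \<open>U\<close>, and submodules correspond to left ideals above \<open>ker\<close>.\<close>

locale cyclic_module =
  fixes f :: "uea \<Rightarrow> 'b" and M :: "(free_alg set, 'b) module"
  assumes carrier: "carrier M = range f"
    and f_add: "f u \<oplus>\<^bsub>M\<^esub> f v = f (u + v)"
    and f_0: "\<zero>\<^bsub>M\<^esub> = f 0"
    and f_smult: "coset_of s \<odot>\<^bsub>M\<^esub> f u = f (s * u)"
begin

definition ker where "ker = {u. f u = \<zero>\<^bsub>M\<^esub>}"

lemma f_eq_iff: "f u = f v \<longleftrightarrow> u - v \<in> ker"
proof
  assume "f u = f v"
  then have "f u \<oplus>\<^bsub>M\<^esub> f (- v) = f v \<oplus>\<^bsub>M\<^esub> f (- v)" by simp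
  then show "u - v \<in> ker" by (simp add: f_add f_0 ker_def)
next
  assume "u - v \<in> ker"
  then have "f (u - v) \<oplus>\<^bsub>M\<^esub> f v = f 0 \<oplus>\<^bsub>M\<^esub> f v" by (simp add: ker_def f_0)
  then show "f u = f v" by (simp add: f_add)
qed

lemma group: "group (add_monoid M)"
proof (rule groupI)
  fix x assume "x \<in> carrier (add_monoid M)"
  then obtain u where "x = f u" by (auto simp: carrier)
  then show "\<exists>y\<in>carrier (add_monoid M). y \<otimes>\<^bsub>add_monoid M\<^esub> x = \<one>\<^bsub>add_monoid M\<^esub>"
    by (intro bexI[of _ "f (- u)"]) (simp_all add: carrier f_add f_0)
qed (auto simp: carrier f_add f_0 add.assoc)

lemma inv: "inv\<^bsub>add_monoid M\<^esub> f u = f (- u)"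
  by (rule group.inv_equality[OF group]) (simp_all add: carrier f_add f_0)

lemma submodule_left_ideal:
  assumes "submodule N UT M"
  shows "left_ideal {u. f u \<in> N}" "N = f ` {u. f u \<in> N}" "ker \<subseteq> {u. f u \<in> N}"
proof -
  interpret submodule N UT M by fact
  have z: "f 0 \<in> N" using one_closed by (simp add: f_0)
  show "left_ideal {u. f u \<in> N}"
  proof
    show "0 \<in> {u. f u \<in> N}" using z by simp
  next
    fix x y assume "x \<in> {u. f u \<in> N}" "y \<in> {u. f u \<in> N}"
    then show "x + y \<in> {u. f u \<in> N}" using m_closed[of "f x" "f y"] by (simp add: f_add)
  next
    fix x s assume "x \<in> {u. f u \<in> N}"
    then show "s * x \<in> {u. f u \<in> N}"
      using smult_closed[of "coset_of s" "f x"] by (simp add: f_smult carrier_UT)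
  qed
  show "N = f ` {u. f u \<in> N}" using subset by (auto simp: carrier)
  show "ker \<subseteq> {u. f u \<in> N}" using z by (auto simp: ker_def f_0)
qed

lemma left_ideal_submodule:
  assumes "left_ideal L"
  shows "submodule (f ` L) UT M"
proof -
  interpret L: left_ideal L by fact
  show ?thesis
  proof (intro submodule.intro subgroup.intro submodule_axioms.intro)
    fix a x assume "a \<in> carrier UT" "x \<in> f ` L"
    then show "a \<odot>\<^bsub>M\<^esub> x \<in> f ` L" by (auto simp: carrier_UT f_smult L.mult_mem)
  next
    show "\<one>\<^bsub>add_monoid M\<^esub> \<in> f ` L" using L.zero_mem by (simp add: f_0)
  next
    fix x assume "x \<in> f ` L"
    then obtain u where "x = f u" "u \<in> L" by blast
    then show "inv\<^bsub>add_monoid M\<^esub> x \<in> f ` L" using inv[of u] L.uminus_mem[of u] by (simp only: image_eqI)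
  qed (auto simp: carrier f_add L.add_mem)
qed

lemma irreducible_iff:
  "irreducible_module UT M \<longleftrightarrow> ker \<noteq> UNIV \<and> (\<forall>L. left_ideal L \<longrightarrow> ker \<subseteq> L \<longrightarrow> L = ker \<or> L = UNIV)"
proof -
  have 1: "carrier M = {\<zero>\<^bsub>M\<^esub>} \<longleftrightarrow> ker = UNIV"
    by (auto simp: carrier ker_def f_0)
  \<comment> \<open>A left ideal above \<open>ker\<close> is the full preimage of its image, so none
    is lost in passing to submodules.\<close>
  have sat: "{u. f u \<in> f ` L} = L" if "left_ideal L" "ker \<subseteq> L" for L
  proof -
    interpret L: left_ideal L by fact
    show ?thesis using that(2) L.mem_cong by (auto simp: f_eq_iff)
  qed
  have "(\<forall>N. submodule N UT M \<longrightarrow> N = {\<zero>\<^bsub>M\<^esub>} \<or> N = carrier M) \<longleftrightarrow>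
     (\<forall>L. left_ideal L \<longrightarrow> ker \<subseteq> L \<longrightarrow> L = ker \<or> L = UNIV)"
  proof (intro iffI allI impI)
    fix L assume N: "\<forall>N. submodule N UT M \<longrightarrow> N = {\<zero>\<^bsub>M\<^esub>} \<or> N = carrier M"
      and L: "left_ideal L" "ker \<subseteq> L"
    from N left_ideal_submodule[OF L(1)] have "f ` L = {\<zero>\<^bsub>M\<^esub>} \<or> f ` L = carrier M" by blast
    then show "L = ker \<or> L = UNIV"
    proof
      assume "f ` L = {\<zero>\<^bsub>M\<^esub>}"
      then have "L \<subseteq> ker" by (auto simp: ker_def)
      with L show ?thesis by blast
    next
      assume "f ` L = carrier M"
      then have "{u. f u \<in> f ` L} = UNIV" by (auto simp: carrier)
      with sat[OF L] show ?thesis by simp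
    qed
  next
    fix N assume L: "\<forall>L. left_ideal L \<longrightarrow> ker \<subseteq> L \<longrightarrow> L = ker \<or> L = UNIV"
      and N: "submodule N UT M"
    show "N = {\<zero>\<^bsub>M\<^esub>} \<or> N = carrier M"
    proof (cases "N = carrier M")
      case False
    note s = submodule_left_ideal[OF N]
    from L s(1,3) have "{u. f u \<in> N} = ker \<or> {u. f u \<in> N} = UNIV" by blast
    moreover have "{u. f u \<in> N} \<noteq> UNIV" using False s(2) by (auto simp: carrier)
    ultimately have "N = f ` ker" using s(2) by simp
    also have "\<dots> = {\<zero>\<^bsub>M\<^esub>}" by (auto simp: ker_def f_0)
    finally show ?thesis by simp
    qed simp
  qed
  with 1 show ?thesis unfolding irreducible_module_def by blast
qed

lemma r_coset_eq:
  assumes "submodule N UT M"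
  shows "N +>\<^bsub>M\<^esub> f u = f ` {v. f (v - u) \<in> N}"
proof -
  have "N +>\<^bsub>M\<^esub> f u = (\<Union>h\<in>f ` {w. f w \<in> N}. {h \<oplus>\<^bsub>M\<^esub> f u})"
    unfolding a_r_coset_def' submodule_left_ideal(2)[OF assms, symmetric] ..
  also have "\<dots> = f ` {v. f (v - u) \<in> N}"
  proof safe
    fix w assume "f w \<in> N"
    then show "f w \<oplus>\<^bsub>M\<^esub> f u \<in> f ` {v. f (v - u) \<in> N}"
      unfolding f_add by (intro imageI) simp
  next
    fix v assume "f (v - u) \<in> N"
    then show "f v \<in> (\<Union>h\<in>f ` {w. f w \<in> N}. {h \<oplus>\<^bsub>M\<^esub> f u})"
      by (intro UN_I[of "f (v - u)"]) (simp_all add: f_add)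
  qed
  finally show ?thesis .
qed

text \<open>A quotient of a cyclic module is again cyclic, presented with a larger kernel; this
  treats \<open>W(\<lambda>)\<close> and all candidates for \<open>L(\<lambda>)\<close> at
  once.\<close>

lemma quotient:
  assumes "submodule N UT M"
  shows "cyclic_module (\<lambda>u. N +>\<^bsub>M\<^esub> f u) (quot_module M N)"
    and "cyclic_module.ker (\<lambda>u. N +>\<^bsub>M\<^esub> f u) (quot_module M N) = {u. f u \<in> N}"
proof -
  define L where "L = {u. f u \<in> N}"
  have N: "N = f ` L" and kL: "ker \<subseteq> L" using submodule_left_ideal(2,3)[OF assms] by (simp_all add: L_def)
  interpret L: left_ideal L unfolding L_def by (rule submodule_left_ideal(1)[OF assms])
  \<comment> \<open>Cosets are described inside \<open>U\<close>, where the left ideal property of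
    \<open>L\<close> makes sum and action independent of representatives.\<close>
  define q where "q u = f ` {v. v - u \<in> L}" for u
  have q: "N +>\<^bsub>M\<^esub> f u = q u" for u
    unfolding r_coset_eq[OF assms] by (simp add: q_def L_def)
  have q_eq: "q u = q v" if "u - v \<in> L" for u v
  proof -
    have "w - u \<in> L \<longleftrightarrow> w - v \<in> L" for w
      using L.add_mem[of "w - u" "u - v"] L.diff_mem[of "w - v" "u - v"] that by auto
    then show ?thesis by (simp add: q_def)
  qed
  show c: "cyclic_module (\<lambda>u. N +>\<^bsub>M\<^esub> f u) (quot_module M N)"
  proof
    show "carrier (quot_module M N) = range (\<lambda>u. N +>\<^bsub>M\<^esub> f u)"
      by (auto simp: quot_module_def A_RCOSETS_def' carrier)
  next
    show "\<zero>\<^bsub>quot_module M N\<^esub> = N +>\<^bsub>M\<^esub> f 0"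
      unfolding q by (simp add: quot_module_def q_def N)
  next
    fix u v
    have "{v'. v' - (u + v) \<in> L} = {a + b | a b. a - u \<in> L \<and> b - v \<in> L}"
    proof safe
      fix w assume "w - (u + v) \<in> L"
      then show "\<exists>a b. w = a + b \<and> a - u \<in> L \<and> b - v \<in> L"
        by (intro exI[of _ "w - v"] exI[of _ v]) (simp add: algebra_simps)
    next
      fix a b assume "a - u \<in> L" "b - v \<in> L"
      then have "(a - u) + (b - v) \<in> L" by (rule L.add_mem)
      then show "a + b - (u + v) \<in> L" by (simp add: algebra_simps)
    qed
    then have "q (u + v) = {x \<oplus>\<^bsub>M\<^esub> y | x y. x \<in> q u \<and> y \<in> q v}"
      unfolding q_def by (auto simp: image_iff f_add) (metis f_add)+
    then show "(N +>\<^bsub>M\<^esub> f u) \<oplus>\<^bsub>quot_module M N\<^esub> (N +>\<^bsub>M\<^esub> f v) = N +>\<^bsub>M\<^esub> f (u + v)"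
      unfolding q by (auto simp: quot_module_def set_add_def')
  next
    fix s u
    have act: "N +>\<^bsub>M\<^esub> (coset_of s \<odot>\<^bsub>M\<^esub> f v) = q (s * u)" if "v - u \<in> L" for v
      unfolding f_smult q by (rule q_eq) (use L.mult_mem[OF that, of s] in \<open>simp add: right_diff_distrib\<close>)
    have "(\<Union>a\<in>q u. N +>\<^bsub>M\<^esub> (coset_of s \<odot>\<^bsub>M\<^esub> a)) = q (s * u)"
    proof (intro Set.set_eqI iffI)
      fix x assume "x \<in> (\<Union>a\<in>q u. N +>\<^bsub>M\<^esub> (coset_of s \<odot>\<^bsub>M\<^esub> a))"
      then obtain a where a: "a \<in> q u" "x \<in> N +>\<^bsub>M\<^esub> (coset_of s \<odot>\<^bsub>M\<^esub> a)" by (rule UN_E)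
      from a(1) obtain v where v: "a = f v" "v - u \<in> L" unfolding q_def by blast
      from a(2) show "x \<in> q (s * u)" unfolding v(1) act[OF v(2)] .
    next
      fix x assume "x \<in> q (s * u)"
      then have "x \<in> N +>\<^bsub>M\<^esub> (coset_of s \<odot>\<^bsub>M\<^esub> f u)" by (subst act) simp_all
      moreover have "f u \<in> q u" unfolding q_def by (rule imageI) simp
      ultimately show "x \<in> (\<Union>a\<in>q u. N +>\<^bsub>M\<^esub> (coset_of s \<odot>\<^bsub>M\<^esub> a))" by (intro UN_I)
    qed
    then show "coset_of s \<odot>\<^bsub>quot_module M N\<^esub> (N +>\<^bsub>M\<^esub> f u) = N +>\<^bsub>M\<^esub> f (s * u)"
      unfolding q by (simp only: quot_module_def module.simps)
  qed
  interpret Q: cyclic_module "\<lambda>u. N +>\<^bsub>M\<^esub> f u" "quot_module M N" by (rule c)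
  have "q u = q 0 \<longleftrightarrow> u \<in> L" for u
  proof
    assume "q u = q 0"
    moreover have "f u \<in> q u" unfolding q_def by (rule imageI) simp
    ultimately have "f u \<in> q 0" by simp
    then obtain v where "f u = f v" "v \<in> L" unfolding q_def diff_0_right by blast
    then have "u - v \<in> L" using kL f_eq_iff by blast
    from L.add_mem[OF this \<open>v \<in> L\<close>] show "u \<in> L" by simp
  next
    assume "u \<in> L"
    then show "q u = q 0" by (intro q_eq) simp
  qed
  moreover have "Q.ker = {u. N +>\<^bsub>M\<^esub> f u = N +>\<^bsub>M\<^esub> f 0}" unfolding Q.ker_def Q.f_0 ..
  ultimately show "Q.ker = {u. f u \<in> N}" unfolding q L_def by simp
qed

end

section \<open>The triangular decomposition in terms of basis letters\<close>

lemma keys_subset_sum: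
  "x = (\<Sum>b\<in>Poly_Mapping.keys x. scl (Poly_Mapping.lookup x b) (bas b))"
  using pm_lin_bas[of x] by (simp add: pm.lin_def)

lemma keys_scl: "Poly_Mapping.keys (scl c x) \<subseteq> Poly_Mapping.keys x"
  by (auto simp: in_keys_iff)

lemma span_bas: "pm.span (bas ` A) = {x. Poly_Mapping.keys x \<subseteq> A}"
proof
  show "pm.span (bas ` A) \<subseteq> {x. Poly_Mapping.keys x \<subseteq> A}"
  proof (rule pm.span_minimal)
    show "pm.subspace {x. Poly_Mapping.keys x \<subseteq> A}"
    proof (rule pm.subspaceI)
      fix x y :: "'a \<Rightarrow>\<^sub>0 complex" assume "x \<in> {x. Poly_Mapping.keys x \<subseteq> A}" "y \<in> {x. Poly_Mapping.keys x \<subseteq> A}"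
      then show "x + y \<in> {x. Poly_Mapping.keys x \<subseteq> A}" using Poly_Mapping.keys_add[of x y] by blast
    next
      fix c and x :: "'a \<Rightarrow>\<^sub>0 complex" assume "x \<in> {x. Poly_Mapping.keys x \<subseteq> A}"
      then show "scl c x \<in> {x. Poly_Mapping.keys x \<subseteq> A}" using keys_scl[of c x] by blast
    qed simp
  qed auto
  show "{x. Poly_Mapping.keys x \<subseteq> A} \<subseteq> pm.span (bas ` A)"
  proof
    fix x :: "'a \<Rightarrow>\<^sub>0 complex" assume "x \<in> {x. Poly_Mapping.keys x \<subseteq> A}"
    then have "(\<Sum>b\<in>Poly_Mapping.keys x. scl (Poly_Mapping.lookup x b) (bas b)) \<in> pm.span (bas ` A)"
      by (intro pm.span_sum pm.span_scale pm.span_base) auto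
    then show "x \<in> pm.span (bas ` A)" by (simp flip: keys_subset_sum)
  qed
qed

lemma loop_in_span:
  assumes "\<And>b. Loop b m n \<in> A"
  shows "loop x m n \<in> pm.span (bas ` A)"
  unfolding loop_def using assms by (intro pm.span_sum pm.span_scale pm.span_base) auto

lemma span_eqI: "G \<subseteq> pm.span B \<Longrightarrow> B \<subseteq> G \<Longrightarrow> pm.span G = pm.span B"
  by (rule subset_antisym) (simp_all add: pm.span_minimal pm.span_mono)

lemma toroidal_pos_eq: "toroidal_pos = pm.span (bas ` {b. \<not> neg_basis b \<and> b \<notin> cartan_basis})"
  unfolding toroidal_pos_def
proof (rule span_eqI)
  let ?P = "{b. \<not> neg_basis b \<and> b \<notin> cartan_basis}"
  show "{e_loop m 0 |m. 0 \<le> m} \<union> {f_loop m 0 |m. 1 \<le> m} \<union> {h_loop m 0 |m. 1 \<le> m} \<union> {loop x m n |x m n. 1 \<le> n}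
    \<subseteq> pm.span (bas ` ?P)"
  proof (intro Un_least subsetI)
    fix y assume "y \<in> {loop x m n |x m n. (1 :: int) \<le> n}"
    then obtain x m n where "y = loop x m n" "n \<ge> 1" by blast
    then show "y \<in> pm.span (bas ` ?P)" by (simp only:) (rule loop_in_span, simp add: cartan_basis_def)
  qed (auto intro!: pm.span_base simp: cartan_basis_def)
  show "bas ` ?P \<subseteq> {e_loop m 0 |m. 0 \<le> m} \<union> {f_loop m 0 |m. 1 \<le> m} \<union> {h_loop m 0 |m. 1 \<le> m} \<union> {loop x m n |x m n. 1 \<le> n}"
  proof
    fix y :: toroidal assume "y \<in> bas ` ?P"
    then obtain a where a: "y = bas a" "\<not> neg_basis a" "a \<notin> cartan_basis" by blast
    then obtain b m n where "a = Loop b m n" by (cases a) (simp_all add: cartan_basis_def)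
    with a have y: "y = loop (bas b) m n" "\<not> neg_basis (Loop b m n)" "Loop b m n \<notin> cartan_basis" by simp_all
    show "y \<in> {e_loop m 0 |m. 0 \<le> m} \<union> {f_loop m 0 |m. 1 \<le> m} \<union> {h_loop m 0 |m. 1 \<le> m} \<union> {loop x m n |x m n. 1 \<le> n}"
    proof (cases "n \<ge> 1")
      case True
      then show ?thesis unfolding y(1) by blast
    next
      case False
      with y(2) have "n = 0" by auto
      with y(2,3) have "b = BE \<and> m \<ge> 0 \<or> b = BF \<and> m \<ge> 1 \<or> b = BH \<and> m \<ge> 1"
        by (cases b) (auto simp: cartan_basis_def)
      then show ?thesis unfolding y(1) \<open>n = 0\<close> by blast
    qed
  qed
qed

lemma toroidal_neg_eq: "toroidal_neg = pm.span (bas ` {b. neg_basis b})"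
  unfolding toroidal_neg_def
proof (rule span_eqI)
  show "{f_loop (- m) 0 |m. 0 \<le> m} \<union> {e_loop (- m) 0 |m. 1 \<le> m} \<union> {h_loop (- m) 0 |m. 1 \<le> m} \<union> {loop x m (- n) |x m n. 1 \<le> n}
    \<subseteq> pm.span (bas ` {b. neg_basis b})"
  proof (intro Un_least subsetI)
    fix y assume "y \<in> {loop x m (- n) |x m n. (1 :: int) \<le> n}"
    then obtain x m n where "y = loop x m (- n)" "n \<ge> 1" by blast
    then show "y \<in> pm.span (bas ` {b. neg_basis b})" by (simp only:) (rule loop_in_span, simp)
  next
    fix y assume "y \<in> {f_loop (- m) 0 |m. 0 \<le> m}"
    then obtain m where "y = bas (Loop BF (- m) 0)" "m \<ge> 0" by auto
    moreover from this have "neg_basis (Loop BF (- m) 0)" by auto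
    ultimately show "y \<in> pm.span (bas ` {b. neg_basis b})" by (simp add: pm.span_base)
  qed (auto intro!: pm.span_base)
  show "bas ` {b. neg_basis b} \<subseteq> {f_loop (- m) 0 |m. 0 \<le> m} \<union> {e_loop (- m) 0 |m. 1 \<le> m} \<union> {h_loop (- m) 0 |m. 1 \<le> m} \<union> {loop x m (- n) |x m n. 1 \<le> n}"
  proof
    fix y :: toroidal assume "y \<in> bas ` {b. neg_basis b}"
    then obtain a where a: "y = bas a" "neg_basis a" by blast
    then obtain b m' n' where "a = Loop b m' n'" by (cases a) simp_all
    moreover define m n where "m = - m'" and "n = - n'"
    ultimately have y: "y = loop (bas b) (- m) (- n)" "neg_basis (Loop b (- m) (- n))" using a by simp_all
    have shift: "loop (bas b) (- m) (- n) = loop (bas b) (- m) 0" if "n = 0" using that by simp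
    show "y \<in> {f_loop (- m) 0 |m. 0 \<le> m} \<union> {e_loop (- m) 0 |m. 1 \<le> m} \<union> {h_loop (- m) 0 |m. 1 \<le> m} \<union> {loop x m (- n) |x m n. 1 \<le> n}"
    proof (cases "n \<ge> 1")
      case True
      then show ?thesis unfolding y(1) by blast
    next
      case False
      with y(2) have "n = 0" by auto
      with y(2) have "b = BF \<and> m \<ge> 0 \<or> b = BE \<and> m \<ge> 1 \<or> b = BH \<and> m \<ge> 1"
        by (cases b) auto
      then show ?thesis unfolding y(1) shift[OF \<open>n = 0\<close>] by blast
    qed
  qed
qed

lemma cartan_eq: "cartan = pm.span (bas ` cartan_basis)"
  by (simp add: cartan_def cartan_basis_def)

lemma borel_span: "borel = pm.span (bas ` {b. \<not> neg_basis b})"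
proof -
  have "borel = pm.span (bas ` {b. \<not> neg_basis b \<and> b \<notin> cartan_basis} \<union> bas ` cartan_basis)"
    unfolding pm.span_Un borel_def toroidal_pos_eq cartan_eq by blast
  also have "bas ` {b. \<not> neg_basis b \<and> b \<notin> cartan_basis} \<union> bas ` cartan_basis = (bas ` {b. \<not> neg_basis b} :: toroidal set)"
    unfolding image_Un[symmetric] by (rule arg_cong[where f = "image bas"]) (auto simp: cartan_basis_def)
  finally show ?thesis .
qed

text \<open>\<open>lam\<close> is known to be linear on the Cartan subalgebra only, so every partial
  sum has to be kept inside it.\<close>

lemma cartan_functional_lin:
  assumes "cartan_functional lam" "h \<in> cartan"
  shows "lam h = cx.lin (weight lam) h"
proof -
  have k: "Poly_Mapping.keys h \<subseteq> cartan_basis" using assms(2) by (simp add: cartan_eq span_bas)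
  have b: "bas b \<in> cartan" if "b \<in> cartan_basis" for b
    using that by (simp add: cartan_eq pm.span_base)
  have cl: "x + y \<in> cartan" "scl c x \<in> cartan" "0 \<in> cartan" if "x \<in> cartan" "y \<in> cartan" for x y c
    using that unfolding cartan_eq by (simp_all add: pm.span_add pm.span_scale pm.span_zero)
  have add: "lam (x + y) = lam x + lam y" if "x \<in> cartan" "y \<in> cartan" for x y
    using assms(1) that by (simp add: cartan_functional_def)
  have scl: "lam (scl c x) = c * lam x" if "x \<in> cartan" for x c
    using assms(1) that by (simp add: cartan_functional_def)
  have z: "(0 :: toroidal) \<in> cartan" unfolding cartan_eq by (rule pm.span_zero)
  have "A \<subseteq> cartan_basis \<Longrightarrow> lam (\<Sum>b\<in>A. scl (c b) (bas b)) = (\<Sum>b\<in>A. c b * lam (bas b))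
      \<and> (\<Sum>b\<in>A. scl (c b) (bas b)) \<in> cartan" if "finite A" for A and c :: "toroidal_basis \<Rightarrow> complex"
    using that
  proof (induction A)
    case empty
    have "lam (scl 0 0) = 0 * lam 0" by (rule scl[OF z])
    then show ?case using z by simp
  next
    case (insert b A)
    then have "scl (c b) (bas b) \<in> cartan" using cl(2)[OF b b, of b b "c b"] by simp
    with insert show ?case using add cl(1) scl[OF b, of b "c b"] by simp
  qed
  from this[of "Poly_Mapping.keys h" "Poly_Mapping.lookup h"] k
  have "lam h = (\<Sum>b\<in>Poly_Mapping.keys h. Poly_Mapping.lookup h b * lam (bas b))"
    by (simp flip: keys_subset_sum)
  then show ?thesis unfolding cx.lin_def using k by (simp add: weight_def subset_iff)
qed

text \<open>The value does not depend on the splitting \<open>x = p + h\<close>, because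
  \<open>weight\<close> vanishes on the positive letters.\<close>

lemma borel_character_lin:
  assumes "cartan_functional lam" "x \<in> borel"
  shows "borel_character lam x = cx.lin (weight lam) x"
proof -
  have *: "lam h = cx.lin (weight lam) x" if "p \<in> toroidal_pos" "h \<in> cartan" "x = p + h" for p h
  proof -
    have "Poly_Mapping.keys p \<subseteq> {b. \<not> neg_basis b \<and> b \<notin> cartan_basis}"
      using that(1) unfolding toroidal_pos_eq span_bas by blast
    then have "cx.lin (weight lam) p = 0" by (intro cx.lin_eq_0) (auto simp: weight_def)
    with that(3) show ?thesis by (simp add: cx.lin_add cartan_functional_lin[OF assms(1) that(2)])
  qed
  obtain p h where ph: "p \<in> toroidal_pos" "h \<in> cartan" "x = p + h" using assms(2) by (auto simp: borel_def)
  show ?thesis unfolding borel_character_def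
  proof (rule the_equality)
    show "\<exists>p\<in>toroidal_pos. \<exists>h\<in>cartan. x = p + h \<and> cx.lin (weight lam) x = lam h"
      using ph *[OF ph] by metis
  qed (use * in metis)
qed

definition basis_subalgebra :: "toroidal_basis set \<Rightarrow> bool" where
  "basis_subalgebra B \<longleftrightarrow> (\<forall>a\<in>B. \<forall>b\<in>B. Poly_Mapping.keys (toroidal_basis_bracket a b) \<subseteq> B)"

lemma basis_subalgebra_borel: "basis_subalgebra {b. \<not> neg_basis b}"
  unfolding basis_subalgebra_def using keys_bracket_borel by blast

lemma basis_subalgebra_neg: "basis_subalgebra {b. neg_basis b}"
  unfolding basis_subalgebra_def
proof safe
  fix a b c assume ab: "neg_basis a" "neg_basis b" and c: "c \<in> Poly_Mapping.keys (toroidal_basis_bracket a b)"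
  obtain x r1 r2 y s1 s2 where l: "a = Loop x r1 r2" "b = Loop y s1 s2"
    using ab by (cases a; cases b) auto
  from keys_bracket_Loop[OF c[unfolded l]] ab show "neg_basis c"
    unfolding l by (cases x; cases y) auto
qed

lemma toroidal_bracket_lin: "toroidal_bracket x y = pm.lin (\<lambda>a. pm.lin (\<lambda>b. toroidal_basis_bracket a b) y) x"
  by (simp add: toroidal_bracket_def pm.lin_def pm.scale_sum_right)

lemma pm_lin_keys: "(\<And>b. b \<in> Poly_Mapping.keys x \<Longrightarrow> Poly_Mapping.keys (f b) \<subseteq> B) \<Longrightarrow> Poly_Mapping.keys (pm.lin f x) \<subseteq> B"
proof -
  assume "\<And>b. b \<in> Poly_Mapping.keys x \<Longrightarrow> Poly_Mapping.keys (f b) \<subseteq> B"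
  then have "pm.lin f x \<in> pm.span (bas ` B)"
    unfolding pm.lin_def by (intro pm.span_sum pm.span_scale) (simp add: span_bas)
  then show ?thesis by (simp add: span_bas)
qed

lemma basis_subalgebra_bracket:
  assumes "basis_subalgebra B" "x \<in> pm.span (bas ` B)" "y \<in> pm.span (bas ` B)"
  shows "toroidal_bracket x y \<in> pm.span (bas ` B)"
proof -
  have "Poly_Mapping.keys (toroidal_bracket x y) \<subseteq> B"
    unfolding toroidal_bracket_lin
  proof (rule pm_lin_keys, rule pm_lin_keys)
    fix a b assume "a \<in> Poly_Mapping.keys x" "b \<in> Poly_Mapping.keys y"
    with assms(2,3) have "a \<in> B" "b \<in> B" unfolding span_bas by blast+
    with assms(1) show "Poly_Mapping.keys (toroidal_basis_bracket a b) \<subseteq> B"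
      unfolding basis_subalgebra_def by blast
  qed
  then show ?thesis unfolding span_bas by simp
qed

section \<open>Enveloping algebras of the Borel and the negative subalgebra\<close>

abbreviation words_over :: "toroidal set \<Rightarrow> free_alg set" where
  "words_over g \<equiv> {p. \<forall>w\<in>Poly_Mapping.keys p. set (letters w) \<subseteq> g}"

lemma words_over_closed:
  "0 \<in> words_over g" "1 \<in> words_over g" "p \<in> words_over g \<Longrightarrow> q \<in> words_over g \<Longrightarrow> p + q \<in> words_over g"
  "p \<in> words_over g \<Longrightarrow> q \<in> words_over g \<Longrightarrow> p * q \<in> words_over g" "p \<in> words_over g \<Longrightarrow> scl c p \<in> words_over g"
  "p \<in> words_over g \<Longrightarrow> - p \<in> words_over g" "x \<in> g \<Longrightarrow> gen x \<in> words_over g"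
proof -
  show "p \<in> words_over g \<Longrightarrow> q \<in> words_over g \<Longrightarrow> p + q \<in> words_over g"
    using Poly_Mapping.keys_add[of p q] by blast
  show "p * q \<in> words_over g" if p: "p \<in> words_over g" and q: "q \<in> words_over g"
  proof
    show "\<forall>w\<in>Poly_Mapping.keys (p * q). set (letters w) \<subseteq> g"
    proof
      fix w assume "w \<in> Poly_Mapping.keys (p * q)"
      then obtain u v where "w = u + v" "u \<in> Poly_Mapping.keys p" "v \<in> Poly_Mapping.keys q"
        using Poly_Mapping.keys_mult[of p q] by blast
      with p q show "set (letters w) \<subseteq> g" by (auto simp: plus_word_def)
    qed
  qed
  show "p \<in> words_over g \<Longrightarrow> scl c p \<in> words_over g" using keys_scl[of c p] by blast
  show "p \<in> words_over g \<Longrightarrow> - p \<in> words_over g" by (simp add: in_keys_iff lookup_uminus)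
qed (auto simp: one_bas gen_def)

lemma free_algebra_simps:
  "carrier (free_algebra g) = words_over g" "x \<oplus>\<^bsub>free_algebra g\<^esub> y = x + y"
  "x \<otimes>\<^bsub>free_algebra g\<^esub> y = x * y" "\<zero>\<^bsub>free_algebra g\<^esub> = 0" "\<one>\<^bsub>free_algebra g\<^esub> = 1"
  by (simp_all add: free_algebra_def ring_of_type_algebra_def)

lemma ring_free_algebra: "ring (free_algebra g)"
proof (rule ringI)
  show "abelian_group (free_algebra g)"
  proof (rule abelian_groupI, unfold free_algebra_simps)
    fix x assume "x \<in> words_over g"
    then show "\<exists>y\<in>words_over g. y + x = 0"
      by (intro bexI[of _ "- x"] words_over_closed(6)) simp_all
  qed (simp_all only: words_over_closed add_0_left add_0_right add_ac)
  show "Group.monoid (free_algebra g)"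
    by (rule monoidI) (simp_all only: free_algebra_simps words_over_closed mult.assoc mult_1_left mult_1_right)
qed (simp_all only: free_algebra_simps distrib_left distrib_right)

text \<open>The intersection with \<open>words_over g\<close> has to be an ideal of the smaller free
  algebra; closure of \<open>g\<close> under sums, scalars and brackets keeps the relations inside
  it.\<close>

lemma env_ideal_minimal:
  assumes g: "\<And>x y. x \<in> g \<Longrightarrow> y \<in> g \<Longrightarrow> x + y \<in> g \<and> toroidal_bracket x y \<in> g" "\<And>c x. x \<in> g \<Longrightarrow> scl c x \<in> g"
    and S: "env_relations g \<subseteq> S" "0 \<in> S" "\<And>x y. x \<in> S \<Longrightarrow> y \<in> S \<Longrightarrow> x + y \<in> S"
    "\<And>p x. p \<in> words_over g \<Longrightarrow> x \<in> S \<Longrightarrow> p * x \<in> S" "\<And>p x. p \<in> words_over g \<Longrightarrow> x \<in> S \<Longrightarrow> x * p \<in> S"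
  shows "env_ideal g \<subseteq> S \<inter> words_over g"
proof -
  let ?I = "S \<inter> words_over g"
  have rel: "env_relations g \<subseteq> words_over g"
  proof -
    have "p - q \<in> words_over g" if "p \<in> words_over g" "q \<in> words_over g" for p q
      using words_over_closed(3)[OF that(1) words_over_closed(6)[OF that(2)]] by simp
    note diff = this
    show ?thesis
    proof
      fix r assume "r \<in> env_relations g"
      then consider x y where "r = gen (x + y) - (gen x + gen y)" "x \<in> g" "y \<in> g"
        | c x where "r = gen (scl c x) - scl c (gen x)" "x \<in> g"
        | x y where "r = gen x * gen y - gen y * gen x - gen (toroidal_bracket x y)" "x \<in> g" "y \<in> g"
        unfolding env_relations_def by blast
      then show "r \<in> words_over g"
      proof cases
        case 1
        show ?thesis unfolding 1(1)
          by (intro diff words_over_closed(3,7) 1(2,3) conjunct1[OF g(1)[OF 1(2,3)]])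
      next
        case 2
        show ?thesis unfolding 2(1)
          by (intro diff words_over_closed(5,7) 2(2) g(2)[OF 2(2)])
      next
        case 3
        show ?thesis unfolding 3(1)
          by (intro diff words_over_closed(4,7) 3(2,3) conjunct2[OF g(1)[OF 3(2,3)]])
      qed
    qed
  qed
  have m: "- x \<in> ?I" if "x \<in> ?I" for x
  proof -
    have "- 1 \<in> words_over g" by (rule words_over_closed(6)[OF words_over_closed(2)])
    then have "(- 1) * x \<in> S" using S(4) that by blast
    then show ?thesis using that words_over_closed(6)[of x g] by simp
  qed
  interpret FG: ring "free_algebra g" by (rule ring_free_algebra)
  have "subgroup ?I (add_monoid (free_algebra g))"
  proof (intro subgroup.intro)
    fix x assume x: "x \<in> ?I"
    have "\<ominus>\<^bsub>free_algebra g\<^esub> x = - x"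
      by (rule FG.minus_equality) (use x m[OF x] in \<open>simp_all only: free_algebra_simps left_minus IntD2\<close>)
    then show "inv\<^bsub>add_monoid (free_algebra g)\<^esub> x \<in> ?I" using m[OF x] unfolding a_inv_def by (simp only:)
  next
    fix x y assume "x \<in> ?I" "y \<in> ?I"
    then show "x \<otimes>\<^bsub>add_monoid (free_algebra g)\<^esub> y \<in> ?I"
      unfolding monoid.simps free_algebra_simps using S(3) words_over_closed(3) by blast
  next
    show "\<one>\<^bsub>add_monoid (free_algebra g)\<^esub> \<in> ?I"
      unfolding monoid.simps free_algebra_simps using S(2) words_over_closed(1) by blast
  next
    show "?I \<subseteq> carrier (add_monoid (free_algebra g))"
      unfolding partial_object.simps free_algebra_simps by blast
  qed
  then have "ideal ?I (free_algebra g)"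
  proof (rule idealI[OF ring_free_algebra])
    fix a x assume "a \<in> ?I" "x \<in> carrier (free_algebra g)"
    then have a: "a \<in> S" "a \<in> words_over g" "x \<in> words_over g" unfolding free_algebra_simps by blast+
    show "x \<otimes>\<^bsub>free_algebra g\<^esub> a \<in> ?I"
      unfolding free_algebra_simps using S(4)[OF a(3,1)] words_over_closed(4)[OF a(3,2)] by (rule IntI)
    show "a \<otimes>\<^bsub>free_algebra g\<^esub> x \<in> ?I"
      unfolding free_algebra_simps using S(5)[OF a(3,1)] words_over_closed(4)[OF a(2,3)] by (rule IntI)
  qed
  then show ?thesis unfolding env_ideal_def
    by (rule FG.genideal_minimal) (use S(1) rel in blast)
qed

lemma env_ideal_0: "0 \<in> env_ideal g"
proof -
  interpret FG: ring "free_algebra g" by (rule ring_free_algebra)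
  have "0 \<in> I" if "ideal I (free_algebra g)" for I
    using additive_subgroup.zero_closed[OF ideal.axioms(1)[OF that]] by (simp only: free_algebra_simps)
  then show ?thesis unfolding env_ideal_def genideal_def by blast
qed

locale span_subalgebra =
  fixes B :: "toroidal_basis set" and g :: "toroidal set"
  assumes B: "basis_subalgebra B" and g: "g = pm.span (bas ` B)"
begin

lemma closed: "x \<in> g \<Longrightarrow> y \<in> g \<Longrightarrow> x + y \<in> g \<and> toroidal_bracket x y \<in> g" "x \<in> g \<Longrightarrow> scl c x \<in> g"
  unfolding g by (simp_all add: pm.span_add pm.span_scale basis_subalgebra_bracket[OF B])

lemma env_ideal_EI: "env_ideal g \<subseteq> EI \<inter> words_over g"
proof (rule env_ideal_minimal[OF closed])
  have "env_relations g \<subseteq> env_relations UNIV" unfolding env_relations_def by blast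
  then show "env_relations g \<subseteq> EI" using EI_relations by blast
qed (use EI_closed in auto)

lemma carrier_env: "carrier (env g) = (\<lambda>p. env_ideal g +>\<^bsub>free_algebra g\<^esub> p) ` words_over g"
  unfolding env_def FactRing_def partial_object.simps A_RCOSETS_def' free_algebra_simps by blast

text \<open>Elements of \<open>env g\<close> are cosets. A representative is chosen here, and
  \<open>env_incl\<close> is seen to be independent of it because \<open>env_ideal g\<close> lies in
  \<open>EI\<close>.\<close>

lemma env_elem:
  assumes "a \<in> carrier (env g)"
  obtains p where "p \<in> words_over g" "p \<in> a" "\<And>q. q \<in> a \<Longrightarrow> q - p \<in> env_ideal g"
    "\<And>q. q \<in> a \<Longrightarrow> q \<in> words_over g" "env_incl a = coset_of (abs_uea p)"
proof -
  obtain p where p: "p \<in> words_over g" "a = env_ideal g +>\<^bsub>free_algebra g\<^esub> p"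
    using assms unfolding carrier_env by blast
  have a: "a = {h + p | h. h \<in> env_ideal g}"
    unfolding p(2) a_r_coset_def' free_algebra_simps by blast
  have "0 + p \<in> a" unfolding a using env_ideal_0[of g] by blast
  then have pa: "p \<in> a" by simp
  have q: "q - p \<in> env_ideal g" if "q \<in> a" for q
  proof -
    from that obtain h where "q = h + p" "h \<in> env_ideal g" unfolding a by blast
    then show ?thesis by simp
  qed
  have w: "q \<in> words_over g" if "q \<in> a" for q
  proof -
    from that obtain h where "q = h + p" "h \<in> env_ideal g" unfolding a by blast
    then show ?thesis using env_ideal_EI words_over_closed(3)[OF _ p(1), of h] by blast
  qed
  have eq: "abs_uea q = abs_uea p" if "q \<in> a" for q
    unfolding abs_uea_eq_iff using q[OF that] env_ideal_EI by blast
  have "env_incl a = (\<Union>q\<in>a. coset_of (abs_uea p))"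
    unfolding env_incl_def r_coset_EI by (intro SUP_cong refl) (simp only: eq)
  also have "\<dots> = coset_of (abs_uea p)" using pa by blast
  finally have fin: "env_incl a = coset_of (abs_uea p)" .
  show ?thesis by (rule that) (fact p(1), fact pa, erule q, erule w, fact fin)
qed

lemma env_incl_image: "env_incl ` carrier (env g) = coset_of ` abs_uea ` words_over g"
proof
  show "env_incl ` carrier (env g) \<subseteq> coset_of ` abs_uea ` words_over g"
  proof
    fix x assume "x \<in> env_incl ` carrier (env g)"
    then obtain a where a: "x = env_incl a" "a \<in> carrier (env g)" by blast
    from a(2) show "x \<in> coset_of ` abs_uea ` words_over g" unfolding a(1) by (rule env_elem) blast
  qed
  show "coset_of ` abs_uea ` words_over g \<subseteq> env_incl ` carrier (env g)"
  proof
    fix x assume "x \<in> coset_of ` abs_uea ` words_over g"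
    then obtain p where p: "x = coset_of (abs_uea p)" "p \<in> words_over g" by blast
    let ?a = "env_ideal g +>\<^bsub>free_algebra g\<^esub> p"
    have a: "?a \<in> carrier (env g)"
      unfolding carrier_env using p(2) by (rule imageI)
    have "0 + p \<in> ?a"
      unfolding a_r_coset_def' free_algebra_simps using env_ideal_0[of g] by blast
    then have pa: "p \<in> ?a" by simp
    from a show "x \<in> env_incl ` carrier (env g)"
    proof (rule env_elem)
      fix q assume q: "env_incl ?a = coset_of (abs_uea q)" "\<And>r. r \<in> ?a \<Longrightarrow> r - q \<in> env_ideal g"
      have "abs_uea p = abs_uea q" unfolding abs_uea_eq_iff using q(2)[OF pa] env_ideal_EI by blast
      then have "x = env_incl ?a" unfolding p(1) q(1) by simp
      then show ?thesis using a by (rule image_eqI)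
    qed
  qed
qed

end

interpretation borel: span_subalgebra "{b. \<not> neg_basis b}" borel
  by unfold_locales (rule basis_subalgebra_borel borel_span)+

interpretation neg: span_subalgebra "{b. neg_basis b}" toroidal_neg
  by unfold_locales (rule basis_subalgebra_neg toroidal_neg_eq)+

text \<open>Connects the coefficients in the definition of the Weyl submodule with the span of
  negative words.\<close>

lemma abs_uea_words_neg: "abs_uea ` words_over toroidal_neg = uea.neg_alg"
proof
  have sum: "sum f A \<in> uea.neg_alg" if "\<And>i. i \<in> A \<Longrightarrow> f i \<in> uea.neg_alg" for f and A :: "'i set"
    using that by (induction A rule: infinite_finite_induct) (simp_all add: uea.neg_alg_0 uea.neg_alg_add)
  have gen: "abs_uea (gen x) * a \<in> uea.neg_alg" if "x \<in> toroidal_neg" "a \<in> uea.neg_alg" for x a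
  proof -
    have k: "Poly_Mapping.keys x \<subseteq> {b. neg_basis b}" using that(1) unfolding toroidal_neg_eq span_bas by blast
    show ?thesis unfolding abs_uea_gen uea.lin_def sum_distrib_right mult.assoc
      by (rule sum, rule uea.neg_alg_sc, rule uea.neg_alg_gen[OF that(2)]) (use k in blast)
  qed
  have w: "set xs \<subseteq> toroidal_neg \<Longrightarrow> abs_uea (bas (Word xs)) \<in> uea.neg_alg" for xs
  proof (induction xs)
    case Nil
    show ?case using uea.neg_alg_word[of "[]"] by (simp add: one_bas[symmetric] abs_uea_simps)
  next
    case (Cons x xs)
    then show ?case unfolding bas_Word_Cons abs_uea_simps by (intro gen) simp_all
  qed
  show "abs_uea ` words_over toroidal_neg \<subseteq> uea.neg_alg"
  proof
    fix x assume "x \<in> abs_uea ` words_over toroidal_neg"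
    then obtain p where p: "x = abs_uea p" "p \<in> words_over toroidal_neg" by blast
    have "finite A \<Longrightarrow> A \<subseteq> Poly_Mapping.keys p \<Longrightarrow>
        abs_uea (\<Sum>w\<in>A. scl (Poly_Mapping.lookup p w) (bas w)) \<in> uea.neg_alg" for A
    proof (induction A rule: finite_induct)
      case empty
      show ?case by (simp add: abs_uea_simps uea.neg_alg_0)
    next
      case (insert v A)
      have "abs_uea (bas v) \<in> uea.neg_alg" using w[of "letters v"] p(2) insert.prems by simp
      then have "abs_uea (scl (Poly_Mapping.lookup p v) (bas v)) \<in> uea.neg_alg"
        unfolding abs_uea_scl by (rule uea.neg_alg_sc)
      with insert show ?case by (simp add: abs_uea_simps uea.neg_alg_add)
    qed
    from this[of "Poly_Mapping.keys p"] show "x \<in> uea.neg_alg"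
      unfolding p(1) by (simp flip: keys_subset_sum)
  qed
  show "uea.neg_alg \<subseteq> abs_uea ` words_over toroidal_neg"
  proof
    fix x assume "x \<in> uea.neg_alg"
    then show "x \<in> abs_uea ` words_over toroidal_neg"
    proof induction
      case (neg_alg_word w)
      have "uea.word w = abs_uea (bas (Word (map bas w)))"
        by (induction w) (simp_all add: bas_Word_Cons abs_uea_simps one_bas[symmetric] flip: uea_gen_def)
      moreover have "bas (Word (map bas w)) \<in> words_over toroidal_neg"
        using neg_alg_word by (auto simp: toroidal_neg_eq list_all_iff intro!: pm.span_base)
      ultimately show ?case by (rule image_eqI)
    next
      case (neg_alg_add x y)
      then obtain p q where "x = abs_uea p" "p \<in> words_over toroidal_neg" "y = abs_uea q" "q \<in> words_over toroidal_neg"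
        by blast
      then have "x + y = abs_uea (p + q)" "p + q \<in> words_over toroidal_neg"
        using words_over_closed(3) by (simp_all only: abs_uea_simps)
      then show ?case by (rule image_eqI)
    next
      case (neg_alg_sc x c)
      then obtain p where "x = abs_uea p" "p \<in> words_over toroidal_neg" by blast
      then have "uea_sc c * x = abs_uea (scl c p)" "scl c p \<in> words_over toroidal_neg"
        using words_over_closed(5) by (simp_all only: abs_uea_scl)
      then show ?case by (rule image_eqI)
    qed
  qed
qed

text \<open>Sends the formal tensor of \<open>s\<close> and \<open>z\<close> to \<open>z * s\<close>
  in \<open>U\<close>, and induces the isomorphism of the Verma module with \<open>U\<close> modulo
  \<open>verma_ideal\<close>. The inverse of \<open>coset_of\<close> recovers an element of type
  \<open>uea\<close> from its coset.\<close>

definition frag_eval :: "(free_alg set \<times> complex \<Rightarrow>\<^sub>0 int) \<Rightarrow> uea" where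
  "frag_eval f = (\<Sum>k\<in>Poly_Mapping.keys f. of_int (Poly_Mapping.lookup f k) * (uea_sc (snd k) * inv_into UNIV coset_of (fst k)))"

lemma inv_coset_of [simp]: "inv_into UNIV coset_of (coset_of u) = u"
  by (rule inv_f_f) (simp add: inj_def coset_of_inject)

lemma frag_eval_superset:
  assumes "finite A" "Poly_Mapping.keys f \<subseteq> A"
  shows "frag_eval f = (\<Sum>k\<in>A. of_int (Poly_Mapping.lookup f k) * (uea_sc (snd k) * inv_into UNIV coset_of (fst k)))"
  unfolding frag_eval_def using assms by (intro sum.mono_neutral_left) (auto simp: in_keys_iff)

lemma frag_eval_diff: "frag_eval (f - g) = frag_eval f - frag_eval g"
proof -
  let ?A = "Poly_Mapping.keys f \<union> Poly_Mapping.keys g"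
  have "Poly_Mapping.keys (f - g) \<subseteq> ?A" by (auto simp: in_keys_iff lookup_minus)
  then show ?thesis
    by (simp add: frag_eval_superset[where A = ?A] lookup_minus left_diff_distrib sum_subtractf)
qed

lemma frag_eval_0 [simp]: "frag_eval 0 = 0"
  by (simp add: frag_eval_def)

lemma frag_eval_add: "frag_eval (f + g) = frag_eval f + frag_eval g"
  using frag_eval_diff[of f "0 - g"] frag_eval_diff[of 0 g] by simp

lemma frag_eval_of [simp]: "frag_eval (frag_of (coset_of u, z)) = uea_sc z * u"
  by (simp add: frag_eval_def)

section \<open>The tensor product defining the Verma module\<close>

locale weyl_functional = weyl_data +
  assumes functional: "cartan_functional lam"
begin

abbreviation \<chi> where "\<chi> \<equiv> borel_character lam"

text \<open>Evaluation at the character descends to the enveloping algebra of the Borel subalgebra,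
  which gives \<open>the_elem\<close> in \<open>borel_module\<close> its meaning.\<close>

lemma eval_env_ideal:
  assumes "r \<in> env_ideal borel"
  shows "free_alg_eval \<chi> r = 0"
proof -
  have br: "cx.lin (weight lam) (toroidal_bracket x y) = 0" if "x \<in> borel" "y \<in> borel" for x y
    unfolding toroidal_bracket_lin
  proof (subst cx.lin_lin, rule cx.lin_eq_0)
    fix a assume a: "a \<in> Poly_Mapping.keys x"
    show "cx.lin (weight lam) (pm.lin (toroidal_basis_bracket a) y) = 0"
    proof (subst cx.lin_lin, rule cx.lin_eq_0)
      fix b assume b: "b \<in> Poly_Mapping.keys y"
      have "\<not> neg_basis a" "\<not> neg_basis b" using a b that unfolding borel_span span_bas by blast+
      from bracket_weight[OF this, of lam 1] show "cx.lin (weight lam) (toroidal_basis_bracket a b) = 0" by simp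
    qed
  qed
  have "env_ideal borel \<subseteq> {p. free_alg_eval \<chi> p = 0} \<inter> words_over borel"
  proof (rule env_ideal_minimal[OF borel.closed])
    show "env_relations borel \<subseteq> {p. free_alg_eval \<chi> p = 0}"
    proof
      fix r assume "r \<in> env_relations borel"
      then consider x y where "r = gen (x + y) - (gen x + gen y)" "x \<in> borel" "y \<in> borel"
        | c x where "r = gen (scl c x) - scl c (gen x)" "x \<in> borel"
        | x y where "r = gen x * gen y - gen y * gen x - gen (toroidal_bracket x y)" "x \<in> borel" "y \<in> borel"
        unfolding env_relations_def by blast
      then show "r \<in> {p. free_alg_eval \<chi> p = 0}"
      proof cases
        case 1
        then show ?thesis using borel.closed(1)[OF 1(2,3)]
          by (simp add: free_alg_eval_diff free_alg_eval_add borel_character_lin[OF functional] cx.lin_add)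
      next
        case 2
        then show ?thesis using borel.closed(2)[OF 2(2)]
          by (simp add: free_alg_eval_diff free_alg_eval_scl borel_character_lin[OF functional] cx.lin_scl)
      next
        case 3
        then show ?thesis using borel.closed(1)[OF 3(2,3)]
          by (simp add: free_alg_eval_diff free_alg_eval_mult borel_character_lin[OF functional] br)
      qed
    qed
  qed (simp_all add: free_alg_eval_add free_alg_eval_mult free_alg_eval_lin[of _ 0])
  with assms show ?thesis by blast
qed

lemma borel_elem:
  assumes "p \<in> words_over borel"
  obtains r where "r \<in> carrier (env borel)" "env_incl r = coset_of (abs_uea p)"
    "\<And>z. r \<odot>\<^bsub>borel_module lam\<^esub> z = free_alg_eval \<chi> p * z"
proof -
  let ?r = "env_ideal borel +>\<^bsub>free_algebra borel\<^esub> p"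
  have r: "?r \<in> carrier (env borel)" unfolding borel.carrier_env using assms by (rule imageI)
  have "0 + p \<in> ?r" unfolding a_r_coset_def' free_algebra_simps using env_ideal_0[of borel] by blast
  then have pr: "p \<in> ?r" by simp
  from r show ?thesis
  proof (rule borel.env_elem)
    fix q assume q: "\<And>s. s \<in> ?r \<Longrightarrow> s - q \<in> env_ideal borel" "env_incl ?r = coset_of (abs_uea q)"
    have ev: "free_alg_eval \<chi> s = free_alg_eval \<chi> q" if "s \<in> ?r" for s
      using eval_env_ideal[OF q(1)[OF that]] by (simp add: free_alg_eval_diff)
    have "abs_uea p = abs_uea q" unfolding abs_uea_eq_iff using q(1)[OF pr] borel.env_ideal_EI by blast
    moreover have "free_alg_eval \<chi> ` ?r = {free_alg_eval \<chi> p}"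
    proof (intro subset_antisym subsetI)
      fix y assume "y \<in> free_alg_eval \<chi> ` ?r"
      then show "y \<in> {free_alg_eval \<chi> p}" using ev ev[OF pr] by force
    qed (use pr in simp)
    ultimately show ?thesis using r q(2) that by (simp add: borel_module_def)
  qed
qed

text \<open>In a product \<open>gen x * W\<close> the factor \<open>W\<close> is replaced by a
  scalar first, and the scalar can be moved to the left of \<open>gen x\<close>; in this order a
  left ideal suffices.\<close>

lemma abs_uea_eval:
  assumes "p \<in> words_over borel"
  shows "abs_uea p - uea_sc (free_alg_eval \<chi> p) \<in> verma_ideal lam"
proof -
  have gen: "abs_uea (gen x) - uea_sc (\<chi> x) \<in> verma_ideal lam" if "x \<in> borel" for x
  proof -
    have k: "Poly_Mapping.keys x \<subseteq> {b. \<not> neg_basis b}" using that unfolding borel_span span_bas by blast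
    have s: "uea_sc (sum f A) = (\<Sum>i\<in>A. uea_sc (f i))" for f and A :: "toroidal_basis set"
      by (induction A rule: infinite_finite_induct) (simp_all add: uea_sc_add uea.sc_0)
    have "abs_uea (gen x) - uea_sc (\<chi> x) = (\<Sum>b\<in>Poly_Mapping.keys x. uea_sc (Poly_Mapping.lookup x b) * (uea_gen b - uea_sc (weight lam b)))"
      unfolding abs_uea_gen borel_character_lin[OF functional that] uea.lin_def cx.lin_def s
      by (simp add: right_diff_distrib sum_subtractf uea_sc_mult)
    also have "\<dots> \<in> verma_ideal lam"
    proof (rule J.sum_mem, rule J.mult_mem)
      fix b assume "b \<in> Poly_Mapping.keys x"
      with k have "\<not> neg_basis b" by blast
      then show "uea_gen b - uea_sc (weight lam b) \<in> verma_ideal lam"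
        unfolding verma_ideal_def by (intro lgen_gen) blast
    qed
    finally show ?thesis .
  qed
  have w: "set xs \<subseteq> borel \<Longrightarrow> abs_uea (bas (Word xs)) - uea_sc (prod_list (map \<chi> xs)) \<in> verma_ideal lam" for xs
  proof (induction xs)
    case Nil
    show ?case by (simp add: one_bas[symmetric] abs_uea_simps uea_sc_1)
  next
    case (Cons x xs)
    let ?W = "abs_uea (bas (Word xs))" and ?c = "prod_list (map \<chi> xs)"
    have "abs_uea (bas (Word (x # xs))) - uea_sc (prod_list (map \<chi> (x # xs)))
        = abs_uea (gen x) * (?W - uea_sc ?c) + uea_sc ?c * (abs_uea (gen x) - uea_sc (\<chi> x))"
      unfolding bas_Word_Cons abs_uea_simps
      by (simp add: right_diff_distrib uea_sc_comm[of "abs_uea (gen x)"] uea_sc_mult uea_sc_comm[of "uea_sc ?c"])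
    then show ?case using Cons gen[of x] by (simp only: J.add_mem J.mult_mem list.set insert_subset)
  qed
  have "finite A \<Longrightarrow> A \<subseteq> Poly_Mapping.keys p \<Longrightarrow>
      abs_uea (\<Sum>w\<in>A. scl (Poly_Mapping.lookup p w) (bas w))
        - uea_sc (free_alg_eval \<chi> (\<Sum>w\<in>A. scl (Poly_Mapping.lookup p w) (bas w))) \<in> verma_ideal lam" for A
  proof (induction A rule: finite_induct)
    case empty
    show ?case by (simp add: abs_uea_simps free_alg_eval_lin uea.sc_0)
  next
    case (insert v A)
    let ?S = "\<Sum>w\<in>A. scl (Poly_Mapping.lookup p w) (bas w)" and ?l = "Poly_Mapping.lookup p v"
    have e: "free_alg_eval \<chi> (bas v) = prod_list (map \<chi> (letters v))"
      by (simp add: free_alg_eval_lin)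
    have "abs_uea (bas v) - uea_sc (free_alg_eval \<chi> (bas v)) \<in> verma_ideal lam"
      unfolding e using w[of "letters v"] assms insert.prems by simp
    then have "uea_sc ?l * (abs_uea (bas v) - uea_sc (free_alg_eval \<chi> (bas v))) +
       (abs_uea ?S - uea_sc (free_alg_eval \<chi> ?S)) \<in> verma_ideal lam"
      by (intro J.add_mem J.mult_mem insert.IH) (use insert.prems in simp_all)
    moreover have "abs_uea (scl ?l (bas v) + ?S) - uea_sc (free_alg_eval \<chi> (scl ?l (bas v) + ?S)) =
      uea_sc ?l * (abs_uea (bas v) - uea_sc (free_alg_eval \<chi> (bas v))) +
       (abs_uea ?S - uea_sc (free_alg_eval \<chi> ?S))"
      unfolding abs_uea_simps abs_uea_scl free_alg_eval_add free_alg_eval_scl uea_sc_add uea_sc_mult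
      by (simp add: right_diff_distrib)
    ultimately show ?case using insert.hyps by simp
  qed
  from this[of "Poly_Mapping.keys p"] show ?thesis by (simp flip: keys_subset_sum)
qed

abbreviation "G \<equiv> free_Abelian_group (carrier UT \<times> carrier (borel_module lam))"
abbreviation "T \<equiv> tensor_subgroup (env borel) UT env_incl (borel_module lam)"

lemma carrier_borel_module: "carrier (borel_module lam) = UNIV"
  by (simp add: borel_module_def)

lemma carrier_G: "f \<in> carrier G \<longleftrightarrow> Poly_Mapping.keys f \<subseteq> range coset_of \<times> UNIV"
  by (simp add: carrier_borel_module carrier_UT)

lemma frag_of_G: "frag_of (coset_of u, z) \<in> carrier G"
  by (subst carrier_G) simp

lemma G_closed: "f \<in> carrier G \<Longrightarrow> g \<in> carrier G \<Longrightarrow> f + g \<in> carrier G"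
  "f \<in> carrier G \<Longrightarrow> g \<in> carrier G \<Longrightarrow> f - g \<in> carrier G" "0 \<in> carrier G"
  unfolding carrier_G using Poly_Mapping.keys_add[of f g] keys_diff[of f g] by (blast, blast, simp)

text \<open>The additive relations evaluate to zero. The balancing relation becomes a left multiple
  of \<open>p - \<chi>(p)\<close> for a Borel element \<open>p\<close>, which lies in
  \<open>verma_ideal\<close> by \<open>abs_uea_eval\<close>.\<close>

lemma relations_eval:
  assumes "f \<in> tensor_relations (env borel) UT env_incl (borel_module lam)"
  shows "f \<in> carrier G \<and> frag_eval f \<in> verma_ideal lam"
proof -
  consider u v z where "f = frag_of (coset_of (u + v), z) - (frag_of (coset_of u, z) + frag_of (coset_of v, z))"
    | u z z' where "f = frag_of (coset_of u, z + z') - (frag_of (coset_of u, z) + frag_of (coset_of u, z'))"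
    | u r z where "f = frag_of (coset_of u \<otimes>\<^bsub>UT\<^esub> env_incl r, z) - frag_of (coset_of u, r \<odot>\<^bsub>borel_module lam\<^esub> z)"
        "r \<in> carrier (env borel)"
  proof -
    have add: "z \<oplus>\<^bsub>borel_module lam\<^esub> z' = z + z'" for z z' by (simp add: borel_module_def)
    show ?thesis
      using assms that unfolding tensor_relations_def carrier_UT carrier_borel_module add by (auto simp: UT_add)
  qed
  then show ?thesis
  proof cases
    case 1
    show ?thesis unfolding 1 frag_eval_diff frag_eval_add frag_eval_of
      by (simp only: distrib_left diff_self J.zero_mem simp_thms) (intro G_closed frag_of_G)
  next
    case 2
    show ?thesis unfolding 2 frag_eval_diff frag_eval_add frag_eval_of
      by (simp only: uea_sc_add distrib_right diff_self J.zero_mem simp_thms) (intro G_closed frag_of_G)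
  next
    case 3
    obtain p where p: "p \<in> words_over borel" "p \<in> r" "\<And>q. q \<in> r \<Longrightarrow> q - p \<in> env_ideal borel"
      "env_incl r = coset_of (abs_uea p)"
    proof (rule borel.env_elem[OF 3(2)])
      fix p assume "p \<in> words_over borel" "p \<in> r" "\<And>q. q \<in> r \<Longrightarrow> q - p \<in> env_ideal borel"
        "env_incl r = coset_of (abs_uea p)"
      then show thesis by (rule that)
    qed
    have "free_alg_eval \<chi> ` r = {free_alg_eval \<chi> p}"
    proof (intro subset_antisym subsetI)
      fix y assume "y \<in> free_alg_eval \<chi> ` r"
      then obtain q where q: "q \<in> r" "y = free_alg_eval \<chi> q" by blast
      show "y \<in> {free_alg_eval \<chi> p}"
        using eval_env_ideal[OF p(3)[OF q(1)]] q(2) by (simp add: free_alg_eval_diff)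
    qed (use p(2) in simp)
    then have sm: "r \<odot>\<^bsub>borel_module lam\<^esub> z = free_alg_eval \<chi> p * z" by (simp add: borel_module_def)
    have "uea_sc z * u * uea_sc (free_alg_eval \<chi> p) = uea_sc (free_alg_eval \<chi> p) * (uea_sc z * u)"
      by (rule uea_sc_comm)
    also have "\<dots> = uea_sc (free_alg_eval \<chi> p * z) * u" by (simp only: uea_sc_mult mult.assoc)
    finally have "uea_sc z * (u * abs_uea p) - uea_sc (free_alg_eval \<chi> p * z) * u
       = (uea_sc z * u) * (abs_uea p - uea_sc (free_alg_eval \<chi> p))"
      by (simp only: right_diff_distrib) (simp only: mult.assoc)
    then have "uea_sc z * (u * abs_uea p) - uea_sc (free_alg_eval \<chi> p * z) * u \<in> verma_ideal lam"
      using abs_uea_eval[OF p(1)] by (simp only: J.mult_mem)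
    then show ?thesis unfolding 3(1) p(4) sm UT_mult frag_eval_diff frag_eval_of
      by (intro conjI G_closed frag_of_G)
  qed
qed

lemma T_subgroup: "subgroup T G"
  unfolding tensor_subgroup_def
  by (rule group.generate_is_subgroup[OF group_free_Abelian_group]) (use relations_eval in blast)

lemma T_closed: "0 \<in> T" "f \<in> T \<Longrightarrow> g \<in> T \<Longrightarrow> f + g \<in> T" "f \<in> T \<Longrightarrow> g \<in> T \<Longrightarrow> f - g \<in> T" "f \<in> T \<Longrightarrow> f \<in> carrier G"
proof -
  show c: "f \<in> T \<Longrightarrow> f \<in> carrier G" for f using subgroup.subset[OF T_subgroup] by blast
  show "0 \<in> T" using subgroup.one_closed[OF T_subgroup] by simp
  show p: "f \<in> T \<Longrightarrow> g \<in> T \<Longrightarrow> f + g \<in> T" for f g using subgroup.m_closed[OF T_subgroup] by simp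
  have "- g \<in> T" if "g \<in> T"
    using subgroup.m_inv_closed[OF T_subgroup that] c[OF that] by simp
  then show "f \<in> T \<Longrightarrow> g \<in> T \<Longrightarrow> f - g \<in> T" using p[of f "- g"] by simp
qed

lemma T_eval:
  assumes "f \<in> T"
  shows "frag_eval f \<in> verma_ideal lam"
proof -
  have "f \<in> carrier G \<and> frag_eval f \<in> verma_ideal lam"
    using assms unfolding tensor_subgroup_def
  proof induction
    case one
    show ?case by (simp only: one_free_Abelian_group frag_eval_0 J.zero_mem G_closed(3) simp_thms)
  next
    case (incl h)
    then show ?case by (rule relations_eval)
  next
    case (inv h)
    from relations_eval[OF this] have h: "h \<in> carrier G" "frag_eval h \<in> verma_ideal lam" by simp_all
    have "inv\<^bsub>G\<^esub> h = 0 - h" using h(1) by simp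
    then show ?case using h G_closed(2)[OF G_closed(3) h(1)]
      by (simp only: frag_eval_diff frag_eval_0 J.diff_mem J.zero_mem simp_thms)
  next
    case (eng f g)
    then show ?case by (simp only: mult_free_Abelian_group G_closed(1) frag_eval_add J.add_mem simp_thms)
  qed
  then show ?thesis ..
qed

lemma T_incl: "f \<in> tensor_relations (env borel) UT env_incl (borel_module lam) \<Longrightarrow> f \<in> T"
  unfolding tensor_subgroup_def by (rule generate.incl)

lemma T_add1: "frag_of (coset_of (u + v), z) - (frag_of (coset_of u, z) + frag_of (coset_of v, z)) \<in> T"
  unfolding UT_add[symmetric]
  by (rule T_incl) (unfold tensor_relations_def carrier_UT carrier_borel_module, blast)

lemma T_add2: "frag_of (coset_of u, z + w) - (frag_of (coset_of u, z) + frag_of (coset_of u, w)) \<in> T"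
proof -
  have e: "z + w = z \<oplus>\<^bsub>borel_module lam\<^esub> w" by (simp add: borel_module_def)
  show ?thesis unfolding e
    by (rule T_incl) (unfold tensor_relations_def carrier_UT carrier_borel_module, blast)
qed

lemma T_smult:
  assumes "p \<in> words_over borel"
  shows "frag_of (coset_of (u * abs_uea p), z) - frag_of (coset_of u, free_alg_eval \<chi> p * z) \<in> T"
  using assms
proof (rule borel_elem)
  fix r assume r: "r \<in> carrier (env borel)" "env_incl r = coset_of (abs_uea p)"
    "\<And>z. r \<odot>\<^bsub>borel_module lam\<^esub> z = free_alg_eval \<chi> p * z"
  show ?thesis unfolding UT_mult[symmetric] r(2)[symmetric] r(3)[symmetric]
    by (rule T_incl) (unfold tensor_relations_def carrier_UT carrier_borel_module, use r(1) in blast)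
qed

lemma T_diff: "frag_of (coset_of (u - v), 1) - (frag_of (coset_of u, 1) - frag_of (coset_of v, 1)) \<in> T"
proof -
  have "0 - (frag_of (coset_of (u - v + v), 1) - (frag_of (coset_of (u - v), 1) + frag_of (coset_of v, 1))) \<in> T"
    by (intro T_closed(3) T_closed(1) T_add1)
  then show ?thesis by (simp add: algebra_simps)
qed

lemma single_words_over: "Poly_Mapping.single 0 c \<in> words_over g"
  by (auto simp: zero_word_def)

lemma eval_single: "free_alg_eval \<chi> (Poly_Mapping.single 0 c) = c"
proof -
  have "Poly_Mapping.single 0 c = scl c (1 :: free_alg)" using scl_single[of c "0 :: toroidal word" 1] by (simp add: single_one)
  then show ?thesis by (simp add: free_alg_eval_scl)
qed

text \<open>Every tensor is congruent to a pure one with second entry 1, since multiplication by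
  \<open>z\<close> on the one-dimensional module is the action of a scalar of the enveloping algebra
  of the Borel subalgebra.\<close>

lemma T_normal:
  assumes "f \<in> carrier G"
  shows "f - frag_of (coset_of (frag_eval f), 1) \<in> T"
  using assms[unfolded carrier_G]
proof (induction rule: frag_induction)
  case zero
  show ?case using T_add1[of 0 0 1] by simp
next
  case (one k)
  then obtain u z where k: "k = (coset_of u, z)" by (cases k) auto
  have "frag_of (coset_of (u * abs_uea (Poly_Mapping.single 0 z)), 1) - frag_of (coset_of u, free_alg_eval \<chi> (Poly_Mapping.single 0 z) * 1) \<in> T"
    by (rule T_smult) (rule single_words_over)
  then have "frag_of (coset_of (uea_sc z * u), 1) - frag_of (coset_of u, z) \<in> T"
    unfolding uea_sc_def[symmetric] eval_single uea_sc_comm mult_1_right .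
  then have "0 - (frag_of (coset_of (uea_sc z * u), 1) - frag_of (coset_of u, z)) \<in> T"
    by (rule T_closed(3)[OF T_closed(1)])
  then show ?case unfolding k frag_eval_of by simp
next
  case (diff a b)
  have "((a - frag_of (coset_of (frag_eval a), 1)) - (b - frag_of (coset_of (frag_eval b), 1)))
    - (frag_of (coset_of (frag_eval a - frag_eval b), 1) - (frag_of (coset_of (frag_eval a), 1) - frag_of (coset_of (frag_eval b), 1))) \<in> T"
    by (intro T_closed(3) diff T_diff)
  then show ?case by (simp add: frag_eval_diff)
qed

lemma T_verma_ideal:
  assumes "x \<in> verma_ideal lam"
  shows "frag_of (coset_of x, 1) \<in> T"
  using assms unfolding verma_ideal_def
proof induction
  case lgen_0
  have "0 - (frag_of (coset_of (0 + 0), 1) - (frag_of (coset_of 0, 1) + frag_of (coset_of 0, 1))) \<in> T"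
    by (intro T_closed(3) T_closed(1) T_add1)
  then show ?case by simp
next
  case (lgen_add x g u)
  then obtain b where b: "g = uea_gen b - uea_sc (weight lam b)" "\<not> neg_basis b" by blast
  let ?p = "gen (bas b) - Poly_Mapping.single 0 (weight lam b)"
  have bb: "bas b \<in> borel" unfolding borel_span using b(2) by (intro pm.span_base) simp
  have p: "?p \<in> words_over borel"
    using words_over_closed(3)[OF words_over_closed(7)[OF bb] words_over_closed(6)[OF single_words_over[of "weight lam b"]]]
    by simp
  have ev: "free_alg_eval \<chi> ?p = 0"
    by (simp add: free_alg_eval_diff eval_single borel_character_lin[OF functional bb])
  have "frag_of (coset_of (u * abs_uea ?p), 1) - frag_of (coset_of u, free_alg_eval \<chi> ?p * 1) \<in> T"
    by (rule T_smult[OF p])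
  then have 1: "frag_of (coset_of (u * g), 1) - frag_of (coset_of u, 0) \<in> T"
    unfolding ev abs_uea_simps b(1) uea_gen_def uea_sc_def by simp
  have "0 - (frag_of (coset_of u, 0 + 0) - (frag_of (coset_of u, 0) + frag_of (coset_of u, 0))) \<in> T"
    by (intro T_closed(3) T_closed(1) T_add2)
  then have 2: "frag_of (coset_of u, 0) \<in> T" by simp
  have "(frag_of (coset_of (u * g + x), 1) - (frag_of (coset_of (u * g), 1) + frag_of (coset_of x, 1)))
    + ((frag_of (coset_of (u * g), 1) - frag_of (coset_of u, 0)) + frag_of (coset_of u, 0)) + frag_of (coset_of x, 1) \<in> T"
    by (intro T_closed(2) T_add1 1 2 lgen_add.IH)
  then show ?case by simp
qed

text \<open>The relations of the tensor product are exactly those of \<open>U\<close> modulo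
  \<open>verma_ideal\<close>: one direction evaluates them, the other goes through the normal
  form.\<close>

lemma T_iff:
  assumes "f \<in> carrier G"
  shows "f \<in> T \<longleftrightarrow> frag_eval f \<in> verma_ideal lam"
proof
  assume "frag_eval f \<in> verma_ideal lam"
  then have "(f - frag_of (coset_of (frag_eval f), 1)) + frag_of (coset_of (frag_eval f), 1) \<in> T"
    by (intro T_closed(2) T_normal assms T_verma_ideal)
  then show "f \<in> T" by simp
qed (rule T_eval)

definition m where "m u = T #>\<^bsub>G\<^esub> frag_of (coset_of u, 1)"

lemma coset_eq: "T #>\<^bsub>G\<^esub> f = {g. g - f \<in> T}"
proof -
  have "g \<in> T #>\<^bsub>G\<^esub> f \<longleftrightarrow> (\<exists>h\<in>T. g = h + f)" for g
    unfolding r_coset_def mult_free_Abelian_group by blast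
  moreover have "(\<exists>h\<in>T. g = h + f) \<longleftrightarrow> g - f \<in> T" for g
  proof
    assume "g - f \<in> T"
    then show "\<exists>h\<in>T. g = h + f" by (intro bexI[of _ "g - f"]) simp_all
  qed (elim bexE, simp)
  ultimately show ?thesis by blast
qed

lemma coset_eqI: "f - g \<in> T \<Longrightarrow> T #>\<^bsub>G\<^esub> f = T #>\<^bsub>G\<^esub> g"
proof -
  assume fg: "f - g \<in> T"
  have "h - f \<in> T \<longleftrightarrow> h - g \<in> T" for h
    using T_closed(2)[of "h - f" "f - g"] T_closed(3)[of "h - g" "f - g"] fg by auto
  then show ?thesis unfolding coset_eq by blast
qed

lemma coset_m: "f \<in> carrier G \<Longrightarrow> T #>\<^bsub>G\<^esub> f = m (frag_eval f)"
  unfolding m_def by (rule coset_eqI) (rule T_normal)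

lemma verma_vec_m: "verma_vec lam = m 1"
  by (simp add: verma_vec_def pure_tensor_def m_def UT_one)

lemma coset_mult: "(T #>\<^bsub>G\<^esub> f) <#>\<^bsub>G\<^esub> (T #>\<^bsub>G\<^esub> g) = T #>\<^bsub>G\<^esub> (f + g)"
proof (intro subset_antisym subsetI)
  fix x assume "x \<in> (T #>\<^bsub>G\<^esub> f) <#>\<^bsub>G\<^esub> (T #>\<^bsub>G\<^esub> g)"
  then obtain a b where "x = a + b" "a - f \<in> T" "b - g \<in> T"
    unfolding set_mult_def mult_free_Abelian_group coset_eq by blast
  then show "x \<in> T #>\<^bsub>G\<^esub> (f + g)"
    unfolding coset_eq using T_closed(2)[of "a - f" "b - g"] by (simp add: algebra_simps)
next
  fix x assume "x \<in> T #>\<^bsub>G\<^esub> (f + g)"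
  then have "x - g - f \<in> T" unfolding coset_eq by (simp add: algebra_simps)
  moreover have "g - g \<in> T" using T_closed(1) by simp
  moreover have "x = (x - g) + g" by simp
  ultimately show "x \<in> (T #>\<^bsub>G\<^esub> f) <#>\<^bsub>G\<^esub> (T #>\<^bsub>G\<^esub> g)"
    unfolding set_mult_def mult_free_Abelian_group coset_eq by blast
qed

lemma verma_simps:
  "carrier (verma lam) = carrier (G Mod T)" "x \<oplus>\<^bsub>verma lam\<^esub> y = x <#>\<^bsub>G\<^esub> y" "\<zero>\<^bsub>verma lam\<^esub> = T"
  "s \<odot>\<^bsub>verma lam\<^esub> A = (\<Union>p\<in>A. T #>\<^bsub>G\<^esub> frag_extend (\<lambda>(s', z). frag_of (s \<otimes>\<^bsub>UT\<^esub> s', z)) p)"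
  by (simp_all add: verma_def induced_module_def Let_def FactGroup_def)

lemma frag_act:
  assumes "Poly_Mapping.keys p \<subseteq> range coset_of \<times> UNIV"
  shows "frag_extend (\<lambda>(s', z). frag_of (coset_of s \<otimes>\<^bsub>UT\<^esub> s', z)) p \<in> carrier G
    \<and> frag_eval (frag_extend (\<lambda>(s', z). frag_of (coset_of s \<otimes>\<^bsub>UT\<^esub> s', z)) p) = s * frag_eval p"
  using assms
proof (induction rule: frag_induction)
  case zero
  show ?case by (simp only: frag_extend_0 G_closed(3) frag_eval_0 mult_zero_right simp_thms)
next
  case (one k)
  then obtain u z where k: "k = (coset_of u, z)" by (cases k) auto
  have "uea_sc z * (s * u) = s * (uea_sc z * u)" by (simp only: mult.assoc[symmetric] uea_sc_comm)
  then show ?case unfolding k by (simp only: frag_extend_of prod.case UT_mult frag_of_G frag_eval_of simp_thms)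
next
  case (diff a b)
  then show ?case by (simp only: frag_extend_diff G_closed(2) frag_eval_diff right_diff_distrib simp_thms)
qed

sublocale M: cyclic_module m "verma lam"
proof
  show "carrier (verma lam) = range m"
  proof -
    have "carrier (G Mod T) = (\<lambda>f. T #>\<^bsub>G\<^esub> f) ` carrier G"
      by (auto simp: FactGroup_def RCOSETS_def)
    also have "\<dots> = range m"
    proof (intro subset_antisym subsetI)
      fix x assume "x \<in> range m"
      then show "x \<in> (\<lambda>f. T #>\<^bsub>G\<^esub> f) ` carrier G" unfolding m_def using frag_of_G by blast
    qed (use coset_m in blast)
    finally show ?thesis unfolding verma_simps .
  qed
next
  fix u v
  show "m u \<oplus>\<^bsub>verma lam\<^esub> m v = m (u + v)"
    unfolding verma_simps m_def coset_mult
  proof (rule coset_eqI)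
    have "0 - (frag_of (coset_of (u + v), 1) - (frag_of (coset_of u, 1) + frag_of (coset_of v, 1))) \<in> T"
      by (intro T_closed(3) T_closed(1) T_add1)
    then show "frag_of (coset_of u, 1) + frag_of (coset_of v, 1) - frag_of (coset_of (u + v), 1) \<in> T" by simp
  qed
next
  have "T = T #>\<^bsub>G\<^esub> 0" unfolding coset_eq by simp
  also have "\<dots> = m 0" using coset_m[OF G_closed(3)] by simp
  finally show "\<zero>\<^bsub>verma lam\<^esub> = m 0" unfolding verma_simps .
next
  fix s u
  \<comment> \<open>The action is a union over all representatives \<open>p\<close> of a coset; they
    give the same coset because \<open>verma_ideal\<close> is a left ideal.\<close>
  have act: "T #>\<^bsub>G\<^esub> frag_extend (\<lambda>(s', z). frag_of (coset_of s \<otimes>\<^bsub>UT\<^esub> s', z)) p = m (s * u)" if "p \<in> m u" for p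
  proof -
    have "p - frag_of (coset_of u, 1) \<in> T" using that unfolding m_def coset_eq by simp
    then have p: "p - frag_of (coset_of u, 1) \<in> carrier G" "frag_eval p - u \<in> verma_ideal lam"
      using T_closed(4) T_eval frag_eval_diff frag_eval_of by (blast, fastforce simp: frag_eval_diff uea_sc_1)
    have "(p - frag_of (coset_of u, 1)) + frag_of (coset_of u, 1) \<in> carrier G"
      by (intro G_closed(1) p(1) frag_of_G)
    then have "Poly_Mapping.keys p \<subseteq> range coset_of \<times> UNIV" unfolding carrier_G by simp
    note fa = frag_act[OF this, of s]
    have "T #>\<^bsub>G\<^esub> frag_extend (\<lambda>(s', z). frag_of (coset_of s \<otimes>\<^bsub>UT\<^esub> s', z)) p = m (s * frag_eval p)"
      using coset_m[OF conjunct1[OF fa]] fa by simp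
    also have "\<dots> = m (s * u)"
      unfolding m_def
    proof (rule coset_eqI, subst T_iff)
      show "frag_of (coset_of (s * frag_eval p), 1) - frag_of (coset_of (s * u), 1) \<in> carrier G"
        by (intro G_closed(2) frag_of_G)
      show "frag_eval (frag_of (coset_of (s * frag_eval p), 1) - frag_of (coset_of (s * u), 1)) \<in> verma_ideal lam"
        using J.mult_mem[OF p(2), of s] by (simp add: frag_eval_diff uea_sc_1 right_diff_distrib)
    qed
    finally show ?thesis .
  qed
  have ne: "frag_of (coset_of u, 1) \<in> m u" unfolding m_def coset_eq using T_closed(1) by simp
  have "(\<Union>p\<in>m u. T #>\<^bsub>G\<^esub> frag_extend (\<lambda>(s', z). frag_of (coset_of s \<otimes>\<^bsub>UT\<^esub> s', z)) p) = (\<Union>p\<in>m u. m (s * u))"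
    by (intro SUP_cong refl act)
  also have "\<dots> = m (s * u)" using ne by blast
  finally show "coset_of s \<odot>\<^bsub>verma lam\<^esub> m u = m (s * u)" unfolding verma_simps .
qed

lemma ker_verma: "M.ker = verma_ideal lam"
proof -
  have "m u = m 0 \<longleftrightarrow> u \<in> verma_ideal lam" for u
  proof
    assume "m u = m 0"
    moreover have "frag_of (coset_of u, 1) \<in> m u" unfolding m_def coset_eq using T_closed(1) by simp
    ultimately have "frag_of (coset_of u, 1) - frag_of (coset_of 0, 1) \<in> T" unfolding m_def coset_eq by simp
    from T_eval[OF this] show "u \<in> verma_ideal lam" by (simp add: frag_eval_diff uea_sc_1)
  next
    assume u: "u \<in> verma_ideal lam"
    show "m u = m 0" unfolding m_def
      by (rule coset_eqI) (intro T_closed(3) T_verma_ideal u J.zero_mem)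
  qed
  then show ?thesis unfolding M.ker_def M.f_0 by blast
qed

section \<open>The Weyl submodule and the irreducible quotient\<close>

lemma label_eq: "label lam coroot0 = n0" "label lam coroot1 = n1"
proof -
  have "lam coroot1 = of_nat n1" by (simp add: coroot1_def lam_H)
  then show "label lam coroot1 = n1" unfolding label_def by (intro the_equality) simp_all
  have "bas C1 - bas (Loop BH 0 0) \<in> cartan"
    unfolding cartan_eq by (intro pm.span_diff pm.span_base) (simp_all add: cartan_basis_def)
  from cartan_functional_lin[OF functional this] have "lam coroot0 = of_nat n0"
    by (simp add: coroot0_def cx.lin_diff weight_def cartan_basis_def lam_C1 lam_H)
  then show "label lam coroot0 = n0" unfolding label_def by (intro the_equality) simp_all
qed

lemma weyl_submodule_eq: "weyl_submodule lam = m ` weyl_set"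
proof -
  have y: "env_of y0 [^]\<^bsub>UT\<^esub> (n0 + 1) = coset_of vec0" "env_of y1 [^]\<^bsub>UT\<^esub> (n1 + 1) = coset_of vec1"
    unfolding env_of_eq UT_pow y0_def y1_def loop_bas uea_gen_def[symmetric] vec0_def vec1_def by simp_all
  have "weyl_submodule lam = {(A \<otimes>\<^bsub>UT\<^esub> coset_of vec0) \<odot>\<^bsub>verma lam\<^esub> m 1 \<oplus>\<^bsub>verma lam\<^esub>
        (B \<otimes>\<^bsub>UT\<^esub> coset_of vec1) \<odot>\<^bsub>verma lam\<^esub> m 1 | A B. A \<in> env_incl ` carrier (env toroidal_neg) \<and> B \<in> env_incl ` carrier (env toroidal_neg)}"
    unfolding weyl_submodule_def label_eq y verma_vec_m by blast
  also have "\<dots> = {m (a * vec0 + b * vec1) | a b. a \<in> uea.neg_alg \<and> b \<in> uea.neg_alg}"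
  proof -
    have "(coset_of a \<otimes>\<^bsub>UT\<^esub> coset_of vec0) \<odot>\<^bsub>verma lam\<^esub> m 1 \<oplus>\<^bsub>verma lam\<^esub>
        (coset_of b \<otimes>\<^bsub>UT\<^esub> coset_of vec1) \<odot>\<^bsub>verma lam\<^esub> m 1 = m (a * vec0 + b * vec1)" for a b
      unfolding UT_mult M.f_smult M.f_add by simp
    then show ?thesis unfolding neg.env_incl_image abs_uea_words_neg by blast
  qed
  also have "\<dots> = m ` weyl_set"
  proof (intro subset_antisym subsetI)
    fix x assume "x \<in> {m (a * vec0 + b * vec1) | a b. a \<in> uea.neg_alg \<and> b \<in> uea.neg_alg}"
    then obtain a b where ab: "x = m (a * vec0 + b * vec1)" "a \<in> uea.neg_alg" "b \<in> uea.neg_alg" by blast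
    have "(a * vec0 + b * vec1) - (a * vec0 + b * vec1) \<in> verma_ideal lam" by simp
    with ab(2,3) have "a * vec0 + b * vec1 \<in> weyl_set" unfolding weyl_set_def by blast
    with ab(1) show "x \<in> m ` weyl_set" by (rule image_eqI)
  next
    fix x assume "x \<in> m ` weyl_set"
    then obtain u where u: "x = m u" "u \<in> weyl_set" by blast
    then obtain a b where ab: "a \<in> uea.neg_alg" "b \<in> uea.neg_alg" "u - (a * vec0 + b * vec1) \<in> verma_ideal lam"
      unfolding weyl_set_def by blast
    have "x = m (a * vec0 + b * vec1)" unfolding u(1) M.f_eq_iff ker_verma by (rule ab(3))
    with ab show "x \<in> {m (a * vec0 + b * vec1) | a b. a \<in> uea.neg_alg \<and> b \<in> uea.neg_alg}" by blast
  qed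
  finally show ?thesis .
qed

lemma submodule_weyl: "submodule (weyl_submodule lam) UT (verma lam)"
  unfolding weyl_submodule_eq by (rule M.left_ideal_submodule[OF left_ideal_weyl])

lemma m_mem_weyl: "m u \<in> weyl_submodule lam \<longleftrightarrow> u \<in> weyl_set"
proof
  assume "m u \<in> weyl_submodule lam"
  then obtain v where v: "m u = m v" "v \<in> weyl_set" unfolding weyl_submodule_eq by blast
  then have "u - v \<in> weyl_set" using verma_ideal_subset unfolding M.f_eq_iff ker_verma by blast
  from W.add_mem[OF this v(2)] show "u \<in> weyl_set" by simp
qed (simp add: weyl_submodule_eq)

lemma irreducible_quot_iff:
  assumes "submodule N UT (verma lam)"
  shows "irreducible_module UT (quot_module (verma lam) N) \<longleftrightarrow> {u. m u \<in> N} \<noteq> UNIV \<and>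
    (\<forall>L. left_ideal L \<longrightarrow> {u. m u \<in> N} \<subseteq> L \<longrightarrow> L = {u. m u \<in> N} \<or> L = UNIV)"
  using cyclic_module.irreducible_iff[OF M.quotient(1)[OF assms]] unfolding M.quotient(2)[OF assms] .

text \<open>The definite description is resolved by \<open>weyl_maximal\<close> for existence and
  \<open>maximal_unique\<close> for uniqueness, after which the two quotient modules are literally
  equal.\<close>

lemma irreducible_quotient_eq: "irreducible_quotient lam = weyl_module lam"
proof -
  have "(THE N. submodule N UT (verma lam) \<and> irreducible_module UT (quot_module (verma lam) N)) = weyl_submodule lam"
  proof (rule the_equality, intro conjI)
    show "submodule (weyl_submodule lam) UT (verma lam)" by (rule submodule_weyl)
    show "irreducible_module UT (quot_module (verma lam) (weyl_submodule lam))"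
      unfolding irreducible_quot_iff[OF submodule_weyl] m_mem_weyl Collect_mem_eq
    proof (intro conjI allI impI)
      show "weyl_set \<noteq> UNIV" using W.proper by blast
      fix L assume L: "left_ideal L" "weyl_set \<subseteq> L"
      interpret L: left_ideal L by (rule L(1))
      show "L = weyl_set \<or> L = UNIV"
      proof (cases "L = weyl_set")
        case False
        with L(2) obtain p where p: "p \<in> L" "p \<notin> weyl_set" by blast
        obtain u where "u * p - 1 \<in> weyl_set" using weyl_maximal[OF p(2)] by (elim exE)
        with L(2) have "u * p - 1 \<in> L" by blast
        from L.diff_mem[OF L.mult_mem[OF p(1), of u] this] have "1 \<in> L" by simp
        then have "x \<in> L" for x using L.mult_mem[of 1 x] by simp
        then show ?thesis by blast
      qed simp
    qed
  next
    fix N assume N: "submodule N UT (verma lam) \<and> irreducible_module UT (quot_module (verma lam) N)"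
    then have s: "submodule N UT (verma lam)" and i: "irreducible_module UT (quot_module (verma lam) N)" by simp_all
    let ?L = "{u. m u \<in> N}"
    interpret L: left_ideal ?L by (rule M.submodule_left_ideal(1)[OF s])
    note irr = i[unfolded irreducible_quot_iff[OF s]]
    have "1 \<notin> ?L"
    proof
      assume "1 \<in> ?L"
      then have "x \<in> ?L" for x using L.mult_mem[of 1 x] by simp
      with irr show False by blast
    qed
    then have "?L = weyl_set"
      using irr M.submodule_left_ideal(3)[OF s] unfolding ker_verma
      by (intro maximal_unique L.left_ideal_axioms) blast+
    then show "N = weyl_submodule lam"
      using M.submodule_left_ideal(2)[OF s] unfolding weyl_submodule_eq by simp
  qed
  then show ?thesis unfolding irreducible_quotient_def weyl_module_def by simp
qed

end

lemma module_isomorphic_refl: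
  assumes "\<And>x y. x \<in> carrier M \<Longrightarrow> y \<in> carrier M \<Longrightarrow> x \<oplus>\<^bsub>M\<^esub> y \<in> carrier M"
  shows "module_isomorphic R M M"
  unfolding module_isomorphic_def
  by (rule exI[of _ id]) (auto simp: iso_def hom_def)

theorem corollary4p5:
  fixes lam :: "toroidal \<Rightarrow> complex" and k1 :: real
  assumes "cartan_functional lam"
    and "lam (bas C1) = complex_of_real k1" and "k1 > 0"
    and "lam (bas C2) = 0"
    and "lam coroot0 \<in> \<nat>" and "lam coroot1 \<in> \<nat>"
  shows "module_isomorphic UT (weyl_module lam) (irreducible_quotient lam)"
proof -
  obtain n0 n1 where n: "lam coroot0 = of_nat n0" "lam coroot1 = of_nat n1"
    using assms(5,6) by (auto elim!: Nats_cases)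
  have "bas C1 - bas (Loop BH 0 0) \<in> cartan"
    unfolding cartan_eq by (intro pm.span_diff pm.span_base) (simp_all add: cartan_basis_def)
  \<comment> \<open>The sum of the two coroots is \<open>C1\<close>, so the level is the integer
    \<open>n0 + n1\<close>, and \<open>k1 > 0\<close> becomes positivity of that integer.\<close>
  from cartan_functional_lin[OF assms(1) this]
  have "lam coroot0 = lam (bas C1) - lam coroot1"
    by (simp add: coroot0_def coroot1_def cx.lin_diff weight_def cartan_basis_def)
  with n have C1: "lam (bas C1) = of_nat (n0 + n1)" by (simp add: algebra_simps)
  with assms(2,3) have "n0 + n1 > 0" by (intro gr0I) auto
  then interpret weyl_functional lam n0 n1
    using C1 n(2) assms(1,4) by unfold_locales (simp_all add: coroot1_def)
  interpret W: cyclic_module "\<lambda>u. weyl_submodule lam +>\<^bsub>verma lam\<^esub> m u" "weyl_module lam"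
    unfolding weyl_module_def by (rule M.quotient(1)[OF submodule_weyl])
  \<comment> \<open>The two modules coincide, so the identity is an isomorphism.\<close>
  show ?thesis unfolding irreducible_quotient_eq
    by (rule module_isomorphic_refl) (auto simp: W.carrier W.f_add)
qed

end
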